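(* Let $A$ be a finite dimensional algebra over a field $k$ which is $g$-finite, $n:=|A|$, and $(h_0,\ldots,h_n)$ the $h$-vector of $\Delta(A)$. Then \[{\rm Ehr}_A(x)=\frac{\sum_{i=0}^nh_ix^i}{(1-x)^{n+1}};\] equivalently, for each $\ell\ge0$, $\#\mathrm{2\text{-}psilt}_\oplus^{\le\ell}A=\sum_{j=0}^n\binom{n+\ell-j}{n}h_j$.
   Context: $|X|$: number of isomorphism classes of indecomposable direct summands. A 2-term presilting complex is $T\in\mathsf{K}^{\rm b}(\operatorname{proj}A)$ concentrated in degrees $-1,0$ with $\operatorname{Hom}(T,T[\ell])=0$ for $\ell>0$; it is silting if also its thick closure is the whole category. $A$ is $g$-finite if there are finitely many isomorphism classes of basic 2-term silting complexes. $\mathrm{2\text{-}psilt}^jA$: isomorphism classes of basic 2-term presilting $T$ with $|T|=j$. $\Delta(A)$ is the simplicial complex whose $(j-1)$-simplices are the elements of $\mathrm{2\text{-}psilt}^jA$; $f_{-1}=1$, $f_{j-1}=\#\mathrm{2\text{-}psilt}^jA$, $h_j=\sum_{i=0}^j(-1)^{j-i}\binom{n-i}{j-i}f_{i-1}$. $\mathrm{2\text{-}psilt}_\oplus^{\le\ell}A$ is the set of isomorphism classes of (not necessarily basic) 2-term presilting complexes having at most $\ell$ indecomposable direct summands counted with multiplicity, and ${\rm Ehr}_A(x):=1+\sum_{\ell\ge1}\#(\mathrm{2\text{-}psilt}_\oplus^{\le\ell}A)x^\ell$. *)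

theory Defs
  imports "Jordan_Normal_Form.Matrix"
begin

text \<open>The algebra A is the ambient type 'a (a unital ring), made into a k-algebra
  by a scalar multiplication scale; finite dimensionality = finite spanning set.\<close>

definition fd_algebra :: "('k::field \<Rightarrow> 'a::ring_1 \<Rightarrow> 'a) \<Rightarrow> bool" where
  "fd_algebra scale \<longleftrightarrow>
     (\<forall>c x y. scale c (x + y) = scale c x + scale c y) \<and>
     (\<forall>c d x. scale (c + d) x = scale c x + scale d x) \<and>
     (\<forall>c d x. scale (c * d) x = scale c (scale d x)) \<and>
     (\<forall>x. scale 1 x = x) \<and>
     (\<forall>c x y. scale c (x * y) = scale c x * y) \<and>
     (\<forall>c x y. scale c (x * y) = x * scale c y) \<and>
     (\<exists>B. finite B \<and> (\<forall>x. \<exists>c. x = (\<Sum>b\<in>B. scale (c b) b)))"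

text \<open>A projective object is a pair (m, e) with e an idempotent m x m matrix over A;
  it stands for the module e A^m. Morphisms (m,e) -> (m',e') are matrices f with f = e' f e.\<close>

type_synonym 'a pobj = "nat \<times> 'a mat"

definition proj_obj :: "'a::ring_1 pobj \<Rightarrow> bool" where
  "proj_obj P \<longleftrightarrow> snd P \<in> carrier_mat (fst P) (fst P) \<and> snd P * snd P = snd P"

definition phom :: "'a::ring_1 pobj \<Rightarrow> 'a pobj \<Rightarrow> 'a mat set" where
  "phom P Q = {f. f \<in> carrier_mat (fst Q) (fst P) \<and> snd Q * f * snd P = f}"

type_synonym 'a cplx = "(int \<Rightarrow> 'a pobj) \<times> (int \<Rightarrow> 'a mat)"

definition cobj :: "'a cplx \<Rightarrow> int \<Rightarrow> 'a pobj" where "cobj X = fst X"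
definition cdif :: "'a cplx \<Rightarrow> int \<Rightarrow> 'a mat" where "cdif X = snd X"

definition is_complex :: "'a::ring_1 cplx \<Rightarrow> bool" where
  "is_complex X \<longleftrightarrow>
     (\<forall>i. proj_obj (cobj X i)) \<and>
     (\<forall>i. cdif X i \<in> phom (cobj X i) (cobj X (i + 1))) \<and>
     (\<forall>i. cdif X (i + 1) * cdif X i = 0\<^sub>m (fst (cobj X (i + 2))) (fst (cobj X i))) \<and>
     (\<exists>N::nat. \<forall>i. \<bar>i\<bar> > int N \<longrightarrow> snd (cobj X i) = 0\<^sub>m (fst (cobj X i)) (fst (cobj X i)))"

definition chain_map :: "'a::ring_1 cplx \<Rightarrow> 'a cplx \<Rightarrow> (int \<Rightarrow> 'a mat) \<Rightarrow> bool" where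
  "chain_map X Y f \<longleftrightarrow>
     (\<forall>i. f i \<in> phom (cobj X i) (cobj Y i)) \<and>
     (\<forall>i. cdif Y i * f i = f (i + 1) * cdif X i)"

definition null_homotopic :: "'a::ring_1 cplx \<Rightarrow> 'a cplx \<Rightarrow> (int \<Rightarrow> 'a mat) \<Rightarrow> bool" where
  "null_homotopic X Y f \<longleftrightarrow>
     (\<exists>h. (\<forall>i. h i \<in> phom (cobj X i) (cobj Y (i - 1))) \<and>
          (\<forall>i. f i = cdif Y (i - 1) * h i + h (i + 1) * cdif X i))"

definition id_cmap :: "'a::ring_1 cplx \<Rightarrow> int \<Rightarrow> 'a mat" where
  "id_cmap X i = snd (cobj X i)"

text \<open>Isomorphism in K^b(proj A) = homotopy equivalence.\<close>

definition htpy_equiv :: "'a::ring_1 cplx \<Rightarrow> 'a cplx \<Rightarrow> bool" (infix \<open>\<simeq>\<^sub>K\<close> 50) where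
  "X \<simeq>\<^sub>K Y \<longleftrightarrow> is_complex X \<and> is_complex Y \<and>
     (\<exists>f g. chain_map X Y f \<and> chain_map Y X g \<and>
        null_homotopic X X (\<lambda>i. g i * f i - id_cmap X i) \<and>
        null_homotopic Y Y (\<lambda>i. f i * g i - id_cmap Y i))"

definition zero_cplx :: "'a::ring_1 cplx" where
  "zero_cplx = ((\<lambda>i. (0, 0\<^sub>m 0 0)), (\<lambda>i. 0\<^sub>m 0 0))"

definition pobj_sum :: "'a::ring_1 pobj \<Rightarrow> 'a pobj \<Rightarrow> 'a pobj" where
  "pobj_sum P Q = (fst P + fst Q,
     four_block_mat (snd P) (0\<^sub>m (fst P) (fst Q)) (0\<^sub>m (fst Q) (fst P)) (snd Q))"

definition dsum :: "'a::ring_1 cplx \<Rightarrow> 'a cplx \<Rightarrow> 'a cplx" (infixr \<open>\<oplus>\<^sub>K\<close> 65) where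
  "X \<oplus>\<^sub>K Y = ((\<lambda>i. pobj_sum (cobj X i) (cobj Y i)),
     (\<lambda>i. four_block_mat (cdif X i) (0\<^sub>m (fst (cobj X (i + 1))) (fst (cobj Y i)))
                         (0\<^sub>m (fst (cobj Y (i + 1))) (fst (cobj X i))) (cdif Y i)))"

fun dsum_list :: "'a::ring_1 cplx list \<Rightarrow> 'a cplx" where
  "dsum_list [] = zero_cplx"
| "dsum_list (X # Xs) = X \<oplus>\<^sub>K dsum_list Xs"

definition shift :: "int \<Rightarrow> 'a::ring_1 cplx \<Rightarrow> 'a cplx" where
  "shift k X = ((\<lambda>i. cobj X (i + k)),
     (\<lambda>i. if even k then cdif X (i + k) else - cdif X (i + k)))"

definition cone :: "'a::ring_1 cplx \<Rightarrow> 'a cplx \<Rightarrow> (int \<Rightarrow> 'a mat) \<Rightarrow> 'a cplx" where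
  "cone X Y f = ((\<lambda>i. pobj_sum (cobj X (i + 1)) (cobj Y i)),
     (\<lambda>i. four_block_mat (- cdif X (i + 1)) (0\<^sub>m (fst (cobj X (i + 2))) (fst (cobj Y i)))
                         (f (i + 1)) (cdif Y i)))"

inductive_set thick :: "'a::ring_1 cplx set \<Rightarrow> 'a cplx set" for S where
  base: "X \<in> S \<Longrightarrow> is_complex X \<Longrightarrow> X \<in> thick S"
| zero: "zero_cplx \<in> thick S"
| iso: "X \<in> thick S \<Longrightarrow> X \<simeq>\<^sub>K Y \<Longrightarrow> Y \<in> thick S"
| shft: "X \<in> thick S \<Longrightarrow> shift k X \<in> thick S"
| cne: "X \<in> thick S \<Longrightarrow> Y \<in> thick S \<Longrightarrow> chain_map X Y f \<Longrightarrow> cone X Y f \<in> thick S"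
| summand: "X \<oplus>\<^sub>K Y \<in> thick S \<Longrightarrow> is_complex X \<Longrightarrow> is_complex Y \<Longrightarrow> X \<in> thick S"

definition indec :: "'a::ring_1 cplx \<Rightarrow> bool" where
  "indec X \<longleftrightarrow> is_complex X \<and> \<not> X \<simeq>\<^sub>K zero_cplx \<and>
     (\<forall>Y Z. is_complex Y \<longrightarrow> is_complex Z \<longrightarrow> X \<simeq>\<^sub>K Y \<oplus>\<^sub>K Z \<longrightarrow>
        Y \<simeq>\<^sub>K zero_cplx \<or> Z \<simeq>\<^sub>K zero_cplx)"

definition iso_class :: "'a::ring_1 cplx \<Rightarrow> 'a cplx set" where
  "iso_class X = {Y. Y \<simeq>\<^sub>K X}"

definition num_summands :: "'a::ring_1 cplx \<Rightarrow> nat" where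
  "num_summands X = card (iso_class ` {Y. indec Y \<and> (\<exists>Z. is_complex Z \<and> X \<simeq>\<^sub>K Y \<oplus>\<^sub>K Z)})"

definition basic :: "'a::ring_1 cplx \<Rightarrow> bool" where
  "basic X \<longleftrightarrow> (\<exists>Ts. X \<simeq>\<^sub>K dsum_list Ts \<and> (\<forall>Y\<in>set Ts. indec Y) \<and>
      (\<forall>i j. i < j \<longrightarrow> j < length Ts \<longrightarrow> \<not> Ts ! i \<simeq>\<^sub>K Ts ! j))"

definition two_term :: "'a::ring_1 cplx \<Rightarrow> bool" where
  "two_term X \<longleftrightarrow> is_complex X \<and>
     (\<forall>i. i \<noteq> -1 \<and> i \<noteq> 0 \<longrightarrow> snd (cobj X i) = 0\<^sub>m (fst (cobj X i)) (fst (cobj X i)))"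

definition presilting :: "'a::ring_1 cplx \<Rightarrow> bool" where
  "presilting T \<longleftrightarrow> is_complex T \<and>
     (\<forall>l::nat. l > 0 \<longrightarrow> (\<forall>f. chain_map T (shift (int l) T) f \<longrightarrow>
                               null_homotopic T (shift (int l) T) f))"

definition silting :: "'a::ring_1 cplx \<Rightarrow> bool" where
  "silting T \<longleftrightarrow> presilting T \<and> (\<forall>X. is_complex X \<longrightarrow> X \<in> thick {T})"

definition alg_cplx :: "'a::ring_1 cplx" where
  "alg_cplx = ((\<lambda>i. if i = 0 then (1, 1\<^sub>m 1) else (0, 0\<^sub>m 0 0)),
               (\<lambda>i. if i = 0 then 0\<^sub>m 0 1 else if i = -1 then 0\<^sub>m 1 0 else 0\<^sub>m 0 0))"

definition g_finite :: "'a::ring_1 itself \<Rightarrow> bool" where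
  "g_finite _ \<longleftrightarrow> finite (iso_class ` {T :: 'a cplx. two_term T \<and> silting T \<and> basic T})"

definition psilt_count :: "'a::ring_1 itself \<Rightarrow> nat \<Rightarrow> nat" where
  "psilt_count _ j = card (iso_class `
      {T :: 'a cplx. two_term T \<and> presilting T \<and> basic T \<and> num_summands T = j})"

text \<open>f_(i-1) of Delta(A), with f_(-1) = 1.\<close>

definition fvec :: "'a::ring_1 itself \<Rightarrow> nat \<Rightarrow> int" where
  "fvec a i = (if i = 0 then 1 else int (psilt_count a i))"

definition hvec :: "'a::ring_1 itself \<Rightarrow> nat \<Rightarrow> nat \<Rightarrow> int" where
  "hvec a n j = (\<Sum>i = 0..j. (-1) ^ (j - i) * int ((n - i) choose (j - i)) * fvec a i)"

definition psilt_oplus_le_count :: "'a::ring_1 itself \<Rightarrow> nat \<Rightarrow> nat" where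
  "psilt_oplus_le_count _ l = card (iso_class `
      {T :: 'a cplx. two_term T \<and> presilting T \<and>
         (\<exists>Ts. length Ts \<le> l \<and> (\<forall>Y\<in>set Ts. indec Y) \<and> T \<simeq>\<^sub>K dsum_list Ts)})"

end

theory Submission
  imports Defs "HOL-Library.Multiset"
begin

text \<open>
  By the Krull-Schmidt theorem in the homotopy category, two-term presilting complexes correspond to
  multisets of indecomposable two-term classes whose support is a face of \<open>\<Delta>(A)\<close>. A face with \<open>i\<close>
  vertices supports \<open>l choose i\<close> multisets of size at most \<open>l\<close>, so the counting function is
  \<open>\<Sum>i. f_(i-1) * (l choose i)\<close>, and repeated differences turn the \<open>f\<close>-vector into the \<open>h\<close>-vector.

  Two facts make the sum meaningful. There are finitely many vertices, since the Bongartz completion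
  places every presilting complex inside one of the finitely many silting ones. A face has at most
  \<open>n = |A|\<close> vertices: otherwise there is a linear relation between their \<open>g\<close>-vectors, that is, there
  are \<open>X\<close> and \<open>Y\<close> without common summands whose terms agree after adding contractible complexes, so
  that they are maps \<open>d, d' : P \<rightarrow> Q\<close>. Vanishing of self-extensions says that \<open>Hom(P, Q)\<close> is
  \<open>End(Q) d + d End(P)\<close>, and likewise for \<open>d'\<close>; comparing dimensions, \<open>coker d\<close> is generated by its
  image under endomorphisms of \<open>X\<close> factoring through \<open>Y\<close>. These are radical, hence \<open>d\<close> is a split
  surjection by Nakayama's lemma; likewise \<open>d'\<close>, and cancellation gives \<open>X \<simeq> Y\<close>.
\<close>

section \<open>Idempotents in a ring\<close>

definition idem_hom :: "'a::ring \<Rightarrow> 'a \<Rightarrow> 'a set" where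
  "idem_hom P Q = {x. Q * x = x \<and> x * P = x}"

lemma idem_homD: "x \<in> idem_hom P Q \<Longrightarrow> Q * x = x" "x \<in> idem_hom P Q \<Longrightarrow> x * P = x"
  unfolding idem_hom_def by auto

lemma idem_homI: "Q * x = x \<Longrightarrow> x * P = x \<Longrightarrow> x \<in> idem_hom P Q"
  unfolding idem_hom_def by auto

lemma idem_hom_mult: "y \<in> idem_hom Q R \<Longrightarrow> x \<in> idem_hom P Q \<Longrightarrow> y * x \<in> idem_hom P R"
  unfolding idem_hom_def by (auto simp: mult.assoc) (simp add: mult.assoc[symmetric])

lemma idem_hom_zero: "0 \<in> idem_hom P Q"
  and idem_hom_add: "x \<in> idem_hom P Q \<Longrightarrow> y \<in> idem_hom P Q \<Longrightarrow> x + y \<in> idem_hom P Q"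
  and idem_hom_diff: "x \<in> idem_hom P Q \<Longrightarrow> y \<in> idem_hom P Q \<Longrightarrow> x - y \<in> idem_hom P Q"
  and idem_hom_uminus: "x \<in> idem_hom P Q \<Longrightarrow> - x \<in> idem_hom P Q"
  unfolding idem_hom_def by (auto simp: algebra_simps)

lemma idem_hom_block: "Q * Q = Q \<Longrightarrow> P * P = P \<Longrightarrow> Q * x * P \<in> idem_hom P Q"
  by (intro idem_homI; simp add: mult.assoc; simp add: mult.assoc[symmetric])

lemma idem_hom_orthogonal:
  assumes "x \<in> idem_hom Q R" "y \<in> idem_hom A B" "Q * B = 0" shows "x * y = 0"
proof -
  have "x * y = (x * Q) * (B * y)" using idem_homD(2)[OF assms(1)] idem_homD(1)[OF assms(2)] by simp
  also have "\<dots> = x * (Q * B) * y" by (simp add: mult.assoc)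
  finally show ?thesis using assms(3) by simp
qed

definition idem_iso :: "'a::ring \<Rightarrow> 'a \<Rightarrow> 'a \<Rightarrow> 'a \<Rightarrow> bool" where
  "idem_iso P Q u u' \<longleftrightarrow> u \<in> idem_hom P Q \<and> u' \<in> idem_hom Q P \<and> u' * u = P \<and> u * u' = Q"

lemma idem_isoD:
  assumes "idem_iso P Q u u'"
  shows "u \<in> idem_hom P Q" "u' \<in> idem_hom Q P" "u' * u = P" "u * u' = Q"
  using assms unfolding idem_iso_def by auto

lemma idem_iso_sym: "idem_iso P Q u u' \<Longrightarrow> idem_iso Q P u' u"
  unfolding idem_iso_def by auto

lemma idem_iso_trans:
  assumes "idem_iso P Q u u'" "idem_iso Q R v v'" shows "idem_iso P R (v * u) (u' * v')"
proof -
  note u = idem_isoD[OF assms(1)] and v = idem_isoD[OF assms(2)]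
  have "(u' * v') * (v * u) = u' * ((v' * v) * u)" "(v * u) * (u' * v') = v * ((u * u') * v')"
    by (simp_all add: mult.assoc)
  then show ?thesis
    unfolding idem_iso_def using u v idem_hom_mult[OF v(1) u(1)] idem_hom_mult[OF u(2) v(2)]
      idem_homD(1)[OF u(1)] idem_homD(1)[OF v(2)] by simp
qed

definition idem_biprod :: "'a::ring \<Rightarrow> 'a \<Rightarrow> 'a \<Rightarrow> 'a \<Rightarrow> 'a \<Rightarrow> 'a \<Rightarrow> 'a \<Rightarrow> bool" where
  "idem_biprod B Y Z i1 i2 p1 p2 \<longleftrightarrow>
     i1 \<in> idem_hom Y B \<and> i2 \<in> idem_hom Z B \<and> p1 \<in> idem_hom B Y \<and> p2 \<in> idem_hom B Z \<and>
     p1 * i1 = Y \<and> p2 * i2 = Z \<and> p1 * i2 = 0 \<and> p2 * i1 = 0 \<and> i1 * p1 + i2 * p2 = B"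

lemma idem_biprodD:
  assumes "idem_biprod B Y Z i1 i2 p1 p2"
  shows "i1 \<in> idem_hom Y B" "i2 \<in> idem_hom Z B" "p1 \<in> idem_hom B Y" "p2 \<in> idem_hom B Z"
    "p1 * i1 = Y" "p2 * i2 = Z" "p1 * i2 = 0" "p2 * i1 = 0" "i1 * p1 + i2 * p2 = B"
  using assms unfolding idem_biprod_def by auto

lemma idem_biprodI:
  assumes "i1 * Y = i1" "i2 * Z = i2" "Y * p1 = p1" "Z * p2 = p2"
    and "p1 * i1 = Y" "p2 * i2 = Z" "p1 * i2 = 0" "p2 * i1 = 0" "i1 * p1 + i2 * p2 = B"
  shows "idem_biprod B Y Z i1 i2 p1 p2"
  unfolding idem_biprod_def idem_hom_def assms(9)[symmetric]
  using assms(1-8) by (simp add: distrib_left distrib_right mult.assoc)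
    (simp add: mult.assoc[symmetric])

lemma idem_biprod_complement:
  assumes "e * e = e" "g * g = g" "e * g = g" "g * e = g"
  shows "idem_biprod e g (e - g) g (e - g) g (e - g)"
  by (rule idem_biprodI) (use assms in \<open>simp_all add: left_diff_distrib right_diff_distrib\<close>)

lemma idem_biprod_swap: "idem_biprod B Y Z i1 i2 p1 p2 \<Longrightarrow> idem_biprod B Z Y i2 i1 p2 p1"
  unfolding idem_biprod_def by (auto simp: add.commute)

lemma idem_biprod_comparison:
  assumes "idem_biprod P Y Z i1 i2 p1 p2" "idem_biprod B Y Z j1 j2 q1 q2"
  shows "(i1 * q1 + i2 * q2) * (j1 * p1 + j2 * p2) = P"
proof -
  note p = idem_biprodD[OF assms(1)] and q = idem_biprodD[OF assms(2)]
  have "(i1 * q1 + i2 * q2) * (j1 * p1 + j2 * p2) =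
    i1 * ((q1 * j1) * p1) + i1 * (q1 * j2) * p2 + i2 * (q2 * j1) * p1 + i2 * ((q2 * j2) * p2)"
    by (simp add: algebra_simps)
  then show ?thesis using idem_homD(1)[OF p(3)] idem_homD(1)[OF p(4)] by (simp add: p q)
qed

lemma idem_biprod_unique:
  assumes "idem_biprod P Y Z i1 i2 p1 p2" "idem_biprod B Y Z j1 j2 q1 q2"
  shows "idem_iso P B (j1 * p1 + j2 * p2) (i1 * q1 + i2 * q2)"
  unfolding idem_iso_def
  using idem_biprod_comparison[OF assms] idem_biprod_comparison[OF assms(2,1)]
    idem_biprodD(1-4)[OF assms(1)] idem_biprodD(1-4)[OF assms(2)]
  by (intro conjI idem_hom_add idem_hom_mult)

lemma idem_biprod_iso_left:
  assumes "idem_biprod B Y Z i1 i2 p1 p2" and "idem_iso W Y u u'"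
  shows "idem_biprod B W Z (i1 * u) i2 (u' * p1) p2"
proof -
  note b = idem_biprodD[OF assms(1)] and u = idem_isoD[OF assms(2)]
  have "(u' * p1) * (i1 * u) = u' * ((p1 * i1) * u)" "(u' * p1) * i2 = u' * (p1 * i2)"
    "p2 * (i1 * u) = (p2 * i1) * u" "(i1 * u) * (u' * p1) = i1 * ((u * u') * p1)"
    by (simp_all add: mult.assoc)
  then show ?thesis
    unfolding idem_biprod_def using b u idem_homD(1)[OF u(1)] idem_homD(1)[OF b(3)]
      idem_hom_mult[OF b(1) u(1)] idem_hom_mult[OF u(2) b(3)] by simp
qed

lemma idem_biprod_iso_sum:
  assumes "idem_biprod B Y Z i1 i2 p1 p2" and "idem_iso B C t t'"
  shows "idem_biprod C Y Z (t * i1) (t * i2) (p1 * t') (p2 * t')"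
proof -
  note b = idem_biprodD[OF assms(1)] and t = idem_isoD[OF assms(2)]
  have comp: "(p * t') * (t * i) = p * i" if "i \<in> idem_hom Y B \<or> i \<in> idem_hom Z B" for p i
  proof -
    have "(p * t') * (t * i) = p * ((t' * t) * i)" by (simp add: mult.assoc)
    then show ?thesis using that idem_homD(1) t(3) by metis
  qed
  have "(t * i1) * (p1 * t') + (t * i2) * (p2 * t') = t * ((i1 * p1 + i2 * p2) * t')"
    by (simp add: algebra_simps)
  then have "(t * i1) * (p1 * t') + (t * i2) * (p2 * t') = C"
    using b(9) t(4) idem_homD(1)[OF t(2)] by simp
  then show ?thesis
    unfolding idem_biprod_def using comp b idem_hom_mult[OF t(1)] idem_hom_mult[OF _ t(2)] by simp
qed

inductive_set products :: "'a::ring set \<Rightarrow> 'a set \<Rightarrow> 'a set" for A B where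
  zero: "0 \<in> products A B"
| add: "a \<in> A \<Longrightarrow> b \<in> B \<Longrightarrow> x \<in> products A B \<Longrightarrow> a * b + x \<in> products A B"

lemma productsI: "a \<in> A \<Longrightarrow> b \<in> B \<Longrightarrow> a * b \<in> products A B"
  using products.add[OF _ _ products.zero] by fastforce

lemma products_add: "x \<in> products A B \<Longrightarrow> y \<in> products A B \<Longrightarrow> x + y \<in> products A B"
  by (induction rule: products.induct) (auto simp: add.assoc intro: products.add)

lemma products_sum: "(\<And>i. i \<in> I \<Longrightarrow> f i \<in> A) \<Longrightarrow> (\<And>i. i \<in> I \<Longrightarrow> g i \<in> B) \<Longrightarrow>
  (\<Sum>i\<in>I. f i * g i) \<in> products A B"
  by (induction I rule: infinite_finite_induct) (auto intro: products.intros)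

lemma products_mult_left:
  "x \<in> products A B \<Longrightarrow> (\<And>a. a \<in> A \<Longrightarrow> c * a \<in> A') \<Longrightarrow> c * x \<in> products A' B"
  by (induction rule: products.induct)
    (auto simp: distrib_left mult.assoc[symmetric] intro: products.intros)

lemma products_mult_right:
  "x \<in> products A B \<Longrightarrow> (\<And>b. b \<in> B \<Longrightarrow> b * c \<in> B') \<Longrightarrow> x * c \<in> products A B'"
  by (induction rule: products.induct) (auto simp: distrib_right mult.assoc intro: products.intros)

lemma products_subset:
  assumes "0 \<in> V" "\<And>x y. x \<in> V \<Longrightarrow> y \<in> V \<Longrightarrow> x + y \<in> V" "\<And>a b. a \<in> A \<Longrightarrow> b \<in> B \<Longrightarrow> a * b \<in> V"
  shows "products A B \<subseteq> V"
proof
  fix x assume "x \<in> products A B"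
  then show "x \<in> V" by (induction rule: products.induct) (auto intro: assms)
qed

text \<open>Powers of \<open>x\<close> in the corner with unit \<open>e\<close>; the ambient ring need not have a unit.\<close>

definition corner_power :: "'a::ring \<Rightarrow> 'a \<Rightarrow> nat \<Rightarrow> 'a" where
  "corner_power e x n = ((*) x ^^ n) e"

lemma corner_power_simps [simp]:
  "corner_power e x 0 = e" "corner_power e x (Suc n) = x * corner_power e x n"
  unfolding corner_power_def by simp_all

lemma corner_power_idem_hom:
  "e * e = e \<Longrightarrow> x \<in> idem_hom e e \<Longrightarrow> corner_power e x n \<in> idem_hom e e"
  by (induction n) (auto intro: idem_homI idem_hom_mult)

lemma corner_power_commute:
  "y \<in> idem_hom e e \<Longrightarrow> x * y = y * x \<Longrightarrow> corner_power e x n * y = y * corner_power e x n"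
  by (induction n) (simp_all add: idem_homD mult.assoc, metis mult.assoc)

lemma corner_power_mult:
  assumes e: "e * e = e" and xy: "y \<in> idem_hom e e" "x * y = y * x"
  shows "corner_power e (x * y) n = corner_power e x n * corner_power e y n"
proof (induction n)
  case (Suc n)
  have "corner_power e (x * y) (Suc n) = x * (y * corner_power e x n) * corner_power e y n"
    using Suc by (simp add: mult.assoc)
  also have "y * corner_power e x n = corner_power e x n * y"
    using corner_power_commute[OF xy] by simp
  finally show ?case by (simp add: mult.assoc)
qed (simp add: e)

lemma corner_power_geometric_sum:
  assumes e: "e * e = e" and x: "x \<in> idem_hom e e"
  shows "(e - x) * (\<Sum>i<n. corner_power e x i) = e - corner_power e x n"
proof (induction n)
  case (Suc n)
  then show ?case
    using idem_homD(1)[OF corner_power_idem_hom[OF e x]]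
    by (simp add: distrib_left left_diff_distrib)
qed simp

section \<open>Matrices with finite support\<close>

text \<open>Rows and columns of all matrices occurring in a complex are indexed by pairs of a degree and
  a position. A separate datatype keeps quantifiers over indices from being split.\<close>

datatype idx = Ix (ix_degree: int) (ix_position: nat)

definition index_box :: "int \<Rightarrow> nat \<Rightarrow> idx set" where
  "index_box N n = {u. \<bar>ix_degree u\<bar> \<le> N \<and> ix_position u < n}"

lemma finite_index_box: "finite (index_box N n)"
proof (rule finite_subset)
  show "index_box N n \<subseteq> case_prod Ix ` ({-N..N} \<times> {..<n})"
  proof
    fix u assume "u \<in> index_box N n"
    then show "u \<in> case_prod Ix ` ({-N..N} \<times> {..<n})"
      unfolding index_box_def by (intro image_eqI[of _ _ "(ix_degree u, ix_position u)"]) auto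
  qed
qed simp

lemma finite_index_region:
  "finite {w. \<bar>ix_degree w\<bar> \<le> N \<and> ix_position w < m (ix_degree w)}"
proof (rule finite_subset[OF _ finite_index_box])
  show "{w. \<bar>ix_degree w\<bar> \<le> N \<and> ix_position w < m (ix_degree w)} \<subseteq> index_box N (\<Sum>i\<in>{-N..N}. m i)"
  proof
    fix w assume w: "w \<in> {w. \<bar>ix_degree w\<bar> \<le> N \<and> ix_position w < m (ix_degree w)}"
    then have "m (ix_degree w) \<le> (\<Sum>i\<in>{-N..N}. m i)" by (intro member_le_sum) auto
    then show "w \<in> index_box N (\<Sum>i\<in>{-N..N}. m i)" using w unfolding index_box_def by simp
  qed
qed

lemma finite_subset_index_box: "finite I \<Longrightarrow> \<exists>N n. I \<subseteq> index_box N n"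
proof (intro exI subsetI)
  fix u assume "finite I" "u \<in> I"
  then show "u \<in> index_box (\<Sum>u\<in>I. \<bar>ix_degree u\<bar>) (\<Sum>u\<in>I. Suc (ix_position u))"
    unfolding index_box_def
    using member_le_sum[of u I "\<lambda>u. \<bar>ix_degree u\<bar>"] member_le_sum[of u I "\<lambda>u. Suc (ix_position u)"]
    by simp
qed

definition finite_support :: "(idx \<Rightarrow> idx \<Rightarrow> 'a::zero) \<Rightarrow> bool" where
  "finite_support f \<longleftrightarrow> (\<exists>I. finite I \<and> (\<forall>u v. u \<notin> I \<or> v \<notin> I \<longrightarrow> f u v = 0))"

lemma finite_supportI: "finite I \<Longrightarrow> (\<And>u v. u \<notin> I \<or> v \<notin> I \<Longrightarrow> f u v = 0) \<Longrightarrow> finite_support f"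
  unfolding finite_support_def by blast

typedef (overloaded) 'a gmat = "{f :: idx \<Rightarrow> idx \<Rightarrow> 'a::zero. finite_support f}"
  morphisms entry Abs_gmat
  by (rule exI[of _ "\<lambda>_ _. 0"]) (simp add: finite_supportI[of "{}"])

lemma gmat_eqI: "(\<And>u v. entry x u v = entry y u v) \<Longrightarrow> x = y"
  by (simp add: entry_inject[symmetric] fun_eq_iff)

lemma gmat_eqI_Ix: "(\<And>i a j b. entry x (Ix i a) (Ix j b) = entry y (Ix i a) (Ix j b)) \<Longrightarrow> x = y"
  by (rule gmat_eqI) (metis idx.exhaust)

lemma entry_Abs_gmat: "finite_support f \<Longrightarrow> entry (Abs_gmat f) = f"
  by (simp add: Abs_gmat_inverse)

definition supported_on :: "idx set \<Rightarrow> 'a::zero gmat \<Rightarrow> bool" where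
  "supported_on I x \<longleftrightarrow> (\<forall>u v. u \<notin> I \<or> v \<notin> I \<longrightarrow> entry x u v = 0)"

lemma supported_onD: "supported_on I x \<Longrightarrow> u \<notin> I \<or> v \<notin> I \<Longrightarrow> entry x u v = 0"
  unfolding supported_on_def by blast

lemma supported_on_mono: "supported_on I x \<Longrightarrow> I \<subseteq> J \<Longrightarrow> supported_on J x"
  unfolding supported_on_def by blast

lemma ex_supported_on: "\<exists>I. finite I \<and> supported_on I x"
  using entry[of x] unfolding finite_support_def supported_on_def by simp

lemma ex_common_support: "finite X \<Longrightarrow> \<exists>I. finite I \<and> (\<forall>x\<in>X. supported_on I x)"
proof (induction rule: finite_induct)
  case (insert x X)
  then obtain I J where "finite I" "\<forall>x\<in>X. supported_on I x" "finite J" "supported_on J x"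
    using ex_supported_on[of x] by blast
  then show ?case by (intro exI[of _ "I \<union> J"]) (auto intro: supported_on_mono)
qed auto

lemma ex_supported_on_index_box: "\<exists>N n. supported_on (index_box N n) x"
  using ex_supported_on[of x] finite_subset_index_box supported_on_mono by metis

lemma ex_position_bound: "\<exists>n. \<forall>i a j b. n \<le> a \<or> n \<le> b \<longrightarrow> entry x (Ix i a) (Ix j b) = 0"
  and ex_degree_bound: "\<exists>N. \<forall>i a j b. N < \<bar>i\<bar> \<or> N < \<bar>j\<bar> \<longrightarrow> entry x (Ix i a) (Ix j b) = 0"
  using ex_supported_on_index_box[of x] unfolding supported_on_def index_box_def
  by (metis idx.sel mem_Collect_eq not_less)+

lemma entry_Abs_gmat_map2:
  assumes "h 0 0 = 0"
  shows "entry (Abs_gmat (\<lambda>u v. h (entry x u v) (entry y u v))) u v = h (entry x u v) (entry y u v)"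
proof -
  obtain I J where "finite I" "supported_on I x" "finite J" "supported_on J y"
    using ex_supported_on[of x] ex_supported_on[of y] by blast
  then have "finite_support (\<lambda>u v. h (entry x u v) (entry y u v))"
    using assms by (intro finite_supportI[of "I \<union> J"]) (auto simp: supported_onD)
  then show ?thesis by (simp add: entry_Abs_gmat)
qed

definition elem_gmat :: "idx \<Rightarrow> idx \<Rightarrow> 'a::zero \<Rightarrow> 'a gmat" where
  "elem_gmat u v a = Abs_gmat (\<lambda>u' v'. if u' = u \<and> v' = v then a else 0)"

lemma entry_elem_gmat: "entry (elem_gmat u v a) u' v' = (if u' = u \<and> v' = v then a else 0)"
proof -
  have "finite_support (\<lambda>u' v'. if u' = u \<and> v' = v then a else 0)"
    by (rule finite_supportI[of "{u, v}"]) auto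
  then show ?thesis unfolding elem_gmat_def by (simp add: entry_Abs_gmat)
qed

instantiation gmat :: (ring) ring
begin

definition "0 = Abs_gmat (\<lambda>_ _. 0 :: 'a)"
definition "x + y = Abs_gmat (\<lambda>u v. entry x u v + entry y u v :: 'a)"
definition "- x = Abs_gmat (\<lambda>u v. - entry x u v :: 'a)"
definition "x - y = Abs_gmat (\<lambda>u v. entry x u v - entry y u v :: 'a)"
definition "x * y = Abs_gmat (\<lambda>u v. \<Sum>w | entry x u w \<noteq> 0. entry x u w * entry y w v :: 'a)"

lemma entry_zero [simp]: "entry (0 :: 'a gmat) u v = 0"
  unfolding zero_gmat_def by (simp add: entry_Abs_gmat finite_supportI[of "{}"])

lemma entry_add [simp]: "entry (x + y :: 'a gmat) u v = entry x u v + entry y u v"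
  and entry_uminus [simp]: "entry (- x :: 'a gmat) u v = - entry x u v"
  and entry_diff [simp]: "entry (x - y :: 'a gmat) u v = entry x u v - entry y u v"
  unfolding plus_gmat_def uminus_gmat_def minus_gmat_def
  by (rule entry_Abs_gmat_map2[of "(+)"] entry_Abs_gmat_map2[of "\<lambda>a _. - a" x x]
      entry_Abs_gmat_map2[of "(-)"]; simp)+

lemma entry_mult_def:
  "entry (x * y :: 'a gmat) u v = (\<Sum>w | entry x u w \<noteq> 0. entry x u w * entry y w v)"
proof -
  obtain I where I: "finite I" "supported_on I x" "supported_on I y"
    using ex_common_support[of "{x, y}"] by auto
  have "finite_support (\<lambda>u v. \<Sum>w | entry x u w \<noteq> 0. entry x u w * entry y w v)"
    using supported_onD[OF I(2)] supported_onD[OF I(3)]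
    by (intro finite_supportI[OF I(1)]) (auto intro!: sum.neutral)
  then show ?thesis unfolding times_gmat_def by (simp add: entry_Abs_gmat)
qed

lemma entry_mult:
  assumes I: "finite I" "\<And>w. w \<notin> I \<Longrightarrow> entry x u w = 0 \<or> entry y w v = 0"
  shows "entry (x * y :: 'a gmat) u v = (\<Sum>w\<in>I. entry x u w * entry y w v)"
proof -
  obtain J where J: "finite J" "supported_on J x" using ex_supported_on by blast
  have "{w. entry x u w \<noteq> 0} \<subseteq> J" using supported_onD[OF J(2)] by blast
  then have fin: "finite {w. entry x u w \<noteq> 0}" using J(1) finite_subset by blast
  have "(\<Sum>w | entry x u w \<noteq> 0. entry x u w * entry y w v)
      = (\<Sum>w\<in>{w. entry x u w \<noteq> 0} \<union> I. entry x u w * entry y w v)"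
    by (rule sum.mono_neutral_left) (use fin I in auto)
  also have "\<dots> = (\<Sum>w\<in>I. entry x u w * entry y w v)"
    by (rule sum.mono_neutral_right) (use fin I in fastforce)+
  finally show ?thesis unfolding entry_mult_def .
qed

lemma entry_mult_supported:
  "finite I \<Longrightarrow> supported_on I x \<Longrightarrow> entry (x * y :: 'a gmat) u v = (\<Sum>w\<in>I. entry x u w * entry y w v)"
  by (rule entry_mult) (auto simp: supported_on_def)

lemma entry_mult_nonzero:
  assumes "entry (x * y :: 'a gmat) u v \<noteq> 0" shows "\<exists>w. entry x u w \<noteq> 0 \<and> entry y w v \<noteq> 0"
proof -
  obtain w where "entry x u w * entry y w v \<noteq> 0"
    using assms unfolding entry_mult_def by (meson sum.neutral)
  then show ?thesis by (intro exI[of _ w]) auto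
qed

lemma supported_on_mult:
  assumes "supported_on I x" "supported_on I y" shows "supported_on I (x * y :: 'a gmat)"
  unfolding supported_on_def using assms supported_onD entry_mult_nonzero by metis

instance
proof
  fix x y z :: "'a gmat"
  show "x + y + z = x + (y + z)" "x + y = y + x" "0 + x = x" "- x + x = 0" "x - y = x + - y"
    by (rule gmat_eqI, simp add: algebra_simps)+
  obtain I where I: "finite I" "supported_on I x" "supported_on I y" "supported_on I z"
    using ex_common_support[of "{x, y, z}"] by auto
  have sum: "supported_on I (x + y)"
    unfolding supported_on_def by (simp add: supported_onD[OF I(2)] supported_onD[OF I(3)])
  have prod: "supported_on I (x * y)" using I by (intro supported_on_mult)
  show "(x + y) * z = x * z + y * z"
    by (rule gmat_eqI) (simp add: entry_mult_supported[OF I(1)] I sum distrib_right sum.distrib)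
  show "x * (y + z) = x * y + x * z"
    by (rule gmat_eqI) (simp add: entry_mult_supported[OF I(1)] I distrib_left sum.distrib)
  show "x * y * z = x * (y * z)"
  proof (rule gmat_eqI)
    fix u v
    have "entry (x * y * z) u v = (\<Sum>w\<in>I. \<Sum>w'\<in>I. entry x u w' * entry y w' w * entry z w v)"
      by (simp add: entry_mult_supported[OF I(1)] I prod sum_distrib_right)
    also have "\<dots> = (\<Sum>w'\<in>I. \<Sum>w\<in>I. entry x u w' * entry y w' w * entry z w v)"
      by (rule sum.swap)
    also have "\<dots> = entry (x * (y * z)) u v"
      by (simp add: entry_mult_supported[OF I(1)] I sum_distrib_left mult.assoc)
    finally show "entry (x * y * z) u v = entry (x * (y * z)) u v" .
  qed
qed

end

lemma gmat_mult_zeroI: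
  "(\<And>u w v. entry x u w = 0 \<or> entry y w v = 0) \<Longrightarrow> x * y = (0 :: 'a::ring gmat)"
  by (rule gmat_eqI) (metis entry_mult_nonzero entry_zero)

lemma entry_sum: "entry (sum F A :: 'a::ring gmat) u v = (\<Sum>i\<in>A. entry (F i) u v)"
  by (induction A rule: infinite_finite_induct) auto

lemma elem_gmat_mult: "elem_gmat u v a * elem_gmat v w b = (elem_gmat u w (a * b) :: 'a::ring gmat)"
proof (rule gmat_eqI)
  fix x y
  have "entry (elem_gmat u v a * elem_gmat v w b) x y
      = (\<Sum>z\<in>{v}. entry (elem_gmat u v a) x z * entry (elem_gmat v w b) z y)"
    by (rule entry_mult) (auto simp: entry_elem_gmat)
  then show "entry (elem_gmat u v a * elem_gmat v w b) x y = entry (elem_gmat u w (a * b)) x y"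
    by (auto simp: entry_elem_gmat)
qed

lemma entry_elem_gmat_mult:
  "entry (elem_gmat u v a * x :: 'a::ring gmat) u' w = (if u' = u then a * entry x v w else 0)"
proof -
  have "entry (elem_gmat u v a * x) u' w = (\<Sum>z\<in>{v}. entry (elem_gmat u v a) u' z * entry x z w)"
    by (rule entry_mult) (auto simp: entry_elem_gmat)
  then show ?thesis by (simp add: entry_elem_gmat)
qed

lemma sum_elem_gmat_mult:
  assumes "finite I" "\<And>u v. u \<notin> I \<Longrightarrow> entry x u v = 0"
  shows "(\<Sum>u\<in>I. elem_gmat u u 1 * x) = (x :: 'a::ring_1 gmat)"
proof (rule gmat_eqI)
  fix u v
  have "entry (\<Sum>u\<in>I. elem_gmat u u 1 * x) u v = (\<Sum>w\<in>I. if u = w then entry x w v else 0)"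
    unfolding entry_sum entry_elem_gmat_mult by (intro sum.cong) auto
  then show "entry (\<Sum>u\<in>I. elem_gmat u u 1 * x) u v = entry x u v" using assms by simp
qed

lemma gmat_eq_sum_elem_gmat:
  assumes "finite I" "supported_on I (x :: 'a::ring gmat)"
  shows "x = (\<Sum>u\<in>I. \<Sum>v\<in>I. elem_gmat u v (entry x u v))"
proof (rule gmat_eqI)
  fix u v
  have "(\<Sum>u'\<in>I. \<Sum>v'\<in>I. if u = u' \<and> v = v' then entry x u' v' else 0)
      = (\<Sum>u'\<in>I. if u = u' then (\<Sum>v'\<in>I. if v = v' then entry x u v' else 0) else 0)"
    by (intro sum.cong refl) auto
  also have "\<dots> = entry x u v" using assms(1) supported_onD[OF assms(2), of u v] by simp
  finally show "entry x u v = entry (\<Sum>u\<in>I. \<Sum>v\<in>I. elem_gmat u v (entry x u v)) u v"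
    by (simp add: entry_sum entry_elem_gmat)
qed

definition homog :: "int \<Rightarrow> 'a::zero gmat \<Rightarrow> bool" where
  "homog k x \<longleftrightarrow> (\<forall>i a j b. entry x (Ix i a) (Ix j b) \<noteq> 0 \<longrightarrow> i = j + k)"

lemma homogD: "homog k x \<Longrightarrow> i \<noteq> j + k \<Longrightarrow> entry x (Ix i a) (Ix j b) = 0"
  unfolding homog_def by blast

lemma homog_zero [simp]: "homog k (0 :: 'a::ring gmat)"
  by (simp add: homog_def)

lemma homog_add: "homog k x \<Longrightarrow> homog k y \<Longrightarrow> homog k (x + y :: 'a::ring gmat)"
  unfolding homog_def by (metis add.right_neutral entry_add)

lemma homog_uminus: "homog k x \<Longrightarrow> homog k (- x :: 'a::ring gmat)"
  unfolding homog_def by simp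

lemma homog_diff: "homog k x \<Longrightarrow> homog k y \<Longrightarrow> homog k (x - y :: 'a::ring gmat)"
  using homog_add[of k x "- y"] homog_uminus[of k y] by simp

lemma homog_mult:
  assumes "homog k x" "homog l y" shows "homog (k + l) (x * y :: 'a::ring gmat)"
  unfolding homog_def
proof (intro allI impI)
  fix i a j b assume "entry (x * y) (Ix i a) (Ix j b) \<noteq> 0"
  then obtain w where "entry x (Ix i a) w \<noteq> 0" "entry y w (Ix j b) \<noteq> 0"
    using entry_mult_nonzero by blast
  then show "i = j + (k + l)"
    using assms unfolding homog_def by (cases w) (metis add.assoc add.commute)
qed

lemma homog_mult_0_left: "homog 0 x \<Longrightarrow> homog l y \<Longrightarrow> homog l (x * y :: 'a::ring gmat)"
  and homog_mult_0_right: "homog l x \<Longrightarrow> homog 0 y \<Longrightarrow> homog l (x * y :: 'a::ring gmat)"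
  using homog_mult[of 0 x l y] homog_mult[of l x 0 y] by auto

definition ksign :: "int \<Rightarrow> 'b::ring \<Rightarrow> 'b" where
  "ksign k x = (if even k then x else - x)"

lemma ksign_add: "ksign k (x + y) = ksign k x + ksign k y"
  and ksign_uminus: "ksign k (- x) = - ksign k x"
  and ksign_mult_left: "ksign k x * y = ksign k (x * y)"
  and ksign_mult_right: "x * ksign k y = ksign k (x * y)"
  and ksign_ksign: "ksign k (ksign l x) = ksign (k + l) x"
  and ksign_0 [simp]: "ksign 0 x = x"
  and ksign_1 [simp]: "ksign 1 x = - x"
  and ksign_zero [simp]: "ksign k (0 :: 'b::ring) = 0"
  unfolding ksign_def by auto

lemma homog_ksign: "homog l z \<Longrightarrow> homog l (ksign k z :: 'a::ring gmat)"
  unfolding ksign_def by (simp add: homog_uminus)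

section \<open>Finite dimensional algebras\<close>

definition relation_preimage ::
  "('a \<Rightarrow> 'b) \<Rightarrow> ('c \<Rightarrow> 'b) \<Rightarrow> 'a set \<Rightarrow> 'b::minus set \<Rightarrow> 'c set \<Rightarrow> 'a set" where
  "relation_preimage f g V W K = {x \<in> V. \<exists>y\<in>K. f x - g y \<in> W}"

lemma relation_preimageI: "x \<in> V \<Longrightarrow> y \<in> K \<Longrightarrow> f x - g y \<in> W \<Longrightarrow> x \<in> relation_preimage f g V W K"
  unfolding relation_preimage_def by blast

lemma relation_preimageE:
  assumes "x \<in> relation_preimage f g V W K"
  obtains y where "x \<in> V" "y \<in> K" "f x - g y \<in> W"
  using assms unfolding relation_preimage_def by blast

lemma relation_preimage_mono: "K \<subseteq> K' \<Longrightarrow> relation_preimage f g V W K \<subseteq> relation_preimage f g V W K'"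
  unfolding relation_preimage_def by blast

context vector_space
begin

lemma dim_strict_mono:
  assumes "subspace S" "S \<subset> T" "T \<subseteq> span B" "finite B"
  shows "dim S < dim T"
proof -
  obtain C where C: "C \<subseteq> S" "independent C" "S \<subseteq> span C"
    by (rule basis_exists[of S])
  obtain C' where C': "C \<subseteq> C'" "C' \<subseteq> T" "independent C'" "T \<subseteq> span C'"
    by (rule maximal_independent_subset_extend[of C T]) (use C assms(2) in blast)+
  have "finite C'" using independent_span_bound[OF assms(4) C'(3)] C'(2) assms(3) by blast
  moreover have "C \<noteq> C'"
    using C(1) C'(4) span_minimal[OF C(1) assms(1)] assms(2) by blast
  ultimately have "card C < card C'" using C'(1) by (meson psubsetI psubset_card_mono)
  then show ?thesis
    using basis_card_eq_dim[OF C(1,3,2)] basis_card_eq_dim[OF C'(2,4,3)] by simp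
qed

lemma ascending_chain_stable:
  assumes sub: "\<And>n. subspace (K n)" and mono: "\<And>n. K n \<subseteq> K (Suc n)"
    and fin: "\<And>n. K n \<subseteq> span B" "finite B"
  shows "\<exists>n::nat. K (Suc n) = K n"
proof (rule ccontr)
  assume "\<not> ?thesis"
  then have "K n \<subset> K (Suc n)" for n using mono[of n] by blast
  then have "dim (K n) < dim (K (Suc n))" for n
    by (rule dim_strict_mono[OF sub _ fin(1)[of "Suc n"] fin(2)])
  then have "strict_mono (\<lambda>n. dim (K n))" by (simp add: strict_mono_Suc_iff)
  then have "Suc (card B) \<le> dim (K (Suc (card B)))" by (rule strict_mono_imp_increasing)
  with dim_le_card[OF fin, of "Suc (card B)"] show False by simp
qed

lemma descending_chain_stable:
  assumes sub: "\<And>n. subspace (K n)" and anti: "\<And>n. K (Suc n) \<subseteq> K n"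
    and fin: "K 0 \<subseteq> span B" "finite B"
  shows "\<exists>n::nat. K (Suc n) = K n"
proof (rule ccontr)
  assume neg: "\<not> ?thesis"
  have span: "K n \<subseteq> span B" for n by (induction n) (use anti fin in blast)+
  have "K (Suc n) \<subset> K n" for n using anti[of n] neg by blast
  then have less: "dim (K (Suc n)) < dim (K n)" for n
    by (rule dim_strict_mono[OF sub _ span[of n] fin(2)])
  have "dim (K n) + n \<le> dim (K 0)" for n
  proof (induction n)
    case (Suc n)
    then show ?case using less[of n] by linarith
  qed simp
  from this[of "Suc (dim (K 0))"] show False by linarith
qed

lemma subspace_relation_preimage:
  assumes f: "module_hom scale scale f" and g: "module_hom scale scale g"
    and V: "subspace V" and W: "subspace W" and K: "subspace K"
  shows "subspace (relation_preimage f g V W K)"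
proof (rule subspaceI)
  show "0 \<in> relation_preimage f g V W K"
    by (rule relation_preimageI[of _ _ 0])
       (simp_all add: V W K subspace_0 module_hom.zero[OF f] module_hom.zero[OF g])
next
  fix x x' assume "x \<in> relation_preimage f g V W K" "x' \<in> relation_preimage f g V W K"
  then obtain y y' where y: "x \<in> V" "x' \<in> V" "y \<in> K" "y' \<in> K" "f x - g y \<in> W" "f x' - g y' \<in> W"
    by (elim relation_preimageE)
  have "f (x + x') - g (y + y') = (f x - g y) + (f x' - g y')"
    by (simp add: module_hom.add[OF f] module_hom.add[OF g])
  then have "f (x + x') - g (y + y') \<in> W" using subspace_add[OF W y(5,6)] by simp
  then show "x + x' \<in> relation_preimage f g V W K"
    by (rule relation_preimageI[OF subspace_add[OF V y(1,2)] subspace_add[OF K y(3,4)]])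
next
  fix c x assume "x \<in> relation_preimage f g V W K"
  then obtain y where y: "x \<in> V" "y \<in> K" "f x - g y \<in> W" by (rule relation_preimageE)
  have "f (scale c x) - g (scale c y) = scale c (f x - g y)"
    by (simp add: module_hom.scale[OF f] module_hom.scale[OF g] scale_right_diff_distrib)
  then have "f (scale c x) - g (scale c y) \<in> W" using subspace_scale[OF W y(3)] by simp
  then show "scale c x \<in> relation_preimage f g V W K"
    by (rule relation_preimageI[OF subspace_scale[OF V y(1)] subspace_scale[OF K y(2)]])
qed

lemma relation_preimage_stable_pred:
  assumes sub: "subspace V1" "subspace W2" "subspace K" "W1 \<subseteq> K" "K \<subseteq> V1"
    and g: "module_hom scale scale g"
    and V: "\<And>x. x \<in> V1 \<Longrightarrow> g x \<in> V2"
    and surj: "\<And>y. y \<in> V2 \<Longrightarrow> \<exists>x\<in>V1. y - f x \<in> W2"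
    and inj: "\<And>x. x \<in> V1 \<Longrightarrow> g x \<in> W2 \<Longrightarrow> x \<in> W1"
    and stable: "relation_preimage f g V1 W2 (relation_preimage f g V1 W2 K)
      \<subseteq> relation_preimage f g V1 W2 K"
  shows "relation_preimage f g V1 W2 K \<subseteq> K"
proof
  fix z assume z: "z \<in> relation_preimage f g V1 W2 K"
  then have "z \<in> V1" by (rule relation_preimageE)
  then obtain z' where z': "z' \<in> V1" "g z - f z' \<in> W2" using surj[OF V] by blast
  then have gz: "f z' - g z \<in> W2" using subspace_neg[OF sub(2)] by fastforce
  then have "z' \<in> relation_preimage f g V1 W2 K"
    using stable relation_preimageI[OF z'(1) z] by blast
  then obtain y where y: "y \<in> K" "f z' - g y \<in> W2" by (rule relation_preimageE)
  have "g (z - y) = (f z' - g y) - (f z' - g z)" by (simp add: module_hom.diff[OF g])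
  then have "g (z - y) \<in> W2" using subspace_diff[OF sub(2) y(2) gz] by simp
  moreover have "z - y \<in> V1" using subspace_diff[OF sub(1) \<open>z \<in> V1\<close>] y(1) sub(5) by blast
  ultimately have "z - y \<in> K" using inj sub(4) by blast
  then show "z \<in> K" using subspace_add[OF sub(3) _ y(1), of "z - y"] by simp
qed

text \<open>Both maps induce maps from \<open>V1/W1\<close> to \<open>V2/W2\<close>. If that of \<open>f\<close> is surjective and that of \<open>g\<close>
  injective, then the dimensions agree and \<open>f\<close> is injective as well.\<close>

lemma quotient_surj_inj:
  assumes sub: "subspace V1" "subspace W1" "subspace W2" "W1 \<subseteq> V1"
    and fin: "V1 \<subseteq> span B" "finite B"
    and f: "module_hom scale scale f" and g: "module_hom scale scale g"
    and W: "\<And>x. x \<in> W1 \<Longrightarrow> f x \<in> W2"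
    and V: "\<And>x. x \<in> V1 \<Longrightarrow> g x \<in> V2"
    and surj: "\<And>y. y \<in> V2 \<Longrightarrow> \<exists>x\<in>V1. y - f x \<in> W2"
    and inj: "\<And>x. x \<in> V1 \<Longrightarrow> g x \<in> W2 \<Longrightarrow> x \<in> W1"
    and x: "x \<in> V1" "f x \<in> W2"
  shows "x \<in> W1"
proof -
  define K where "K n = (relation_preimage f g V1 W2 ^^ n) W1" for n
  have K_simps: "K 0 = W1" "K (Suc n) = relation_preimage f g V1 W2 (K n)" for n
    by (simp_all add: K_def)
  have sub_K: "subspace (K n)" for n
    by (induction n) (simp_all add: K_simps sub subspace_relation_preimage[OF f g])
  have K_V: "K n \<subseteq> V1" for n
    by (cases n) (use K_simps sub(4) in \<open>auto elim: relation_preimageE\<close>)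
  have f_K: "y \<in> K (Suc n)" if "y \<in> V1" "f y \<in> W2" for y n
    using relation_preimageI[OF that(1) subspace_0[OF sub_K], of f g] that(2)
    by (simp add: K_simps module_hom.zero[OF g])
  have mono: "K n \<subseteq> K (Suc n)" for n
  proof (induction n)
    case 0
    show ?case using f_K W sub(4) K_simps(1) by blast
  next
    case (Suc n)
    then show ?case unfolding K_simps(2) by (rule relation_preimage_mono)
  qed
  have W1_K: "W1 \<subseteq> K n" for n by (induction n) (use K_simps(1) mono in auto)
  have "\<exists>n. K (Suc n) = K n"
    by (rule ascending_chain_stable[of K B]) (use sub_K mono K_V fin in blast)+
  then obtain n where stable: "K (Suc n) \<subseteq> K n" by blast
  have "K (Suc m) \<subseteq> K m" if "m \<le> n" for m
    using that
  proof (induction rule: inc_induct)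
    case (step m)
    then show ?case
      using relation_preimage_stable_pred[OF sub(1,3) sub_K W1_K K_V g V surj inj]
      by (simp add: K_simps(2))
  qed (rule stable)
  from this[of 0] show ?thesis using f_K[OF x, of 0] K_simps(1) by blast
qed

end

locale finite_dim_algebra =
  fixes scale :: "'k::field \<Rightarrow> 'a::ring_1 \<Rightarrow> 'a"
  assumes fd_algebra: "fd_algebra scale"
begin

lemma scale_simps:
  "scale c (x + y) = scale c x + scale c y" "scale (c + d) x = scale c x + scale d x"
  "scale (c * d) x = scale c (scale d x)" "scale 1 x = x"
  "scale c (x * y) = scale c x * y" "scale c x * y = x * scale c y"
  using fd_algebra unfolding fd_algebra_def by simp_all (metis)

lemma scale_zero [simp]: "scale c 0 = 0"
  using scale_simps(1)[of c 0 0] by simp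

lemma scale_sum: "scale c (sum f A) = (\<Sum>i\<in>A. scale c (f i))"
  by (induction A rule: infinite_finite_induct) (auto simp: scale_simps)

definition gscale :: "'k \<Rightarrow> 'a gmat \<Rightarrow> 'a gmat" where
  "gscale c x = Abs_gmat (\<lambda>u v. scale c (entry x u v))"

lemma entry_gscale [simp]: "entry (gscale c x) u v = scale c (entry x u v)"
  unfolding gscale_def by (rule entry_Abs_gmat_map2[of "\<lambda>a _. scale c a" x x]) simp

sublocale vs: vector_space gscale
  by unfold_locales (rule gmat_eqI, simp add: scale_simps)+

lemma gscale_mult_left: "gscale c x * y = gscale c (x * y)"
  and gscale_mult_right: "x * gscale c y = gscale c (x * y)"
proof -
  obtain I where I: "finite I" "supported_on I x" using ex_supported_on by blast
  have "supported_on I (gscale c x)" using I(2) unfolding supported_on_def by simp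
  then show "gscale c x * y = gscale c (x * y)"
    by (intro gmat_eqI) (simp add: entry_mult_supported[OF I] entry_mult_supported[OF I(1)]
      scale_sum scale_simps(5))
  show "x * gscale c y = gscale c (x * y)"
    by (rule gmat_eqI) (simp add: entry_mult_supported[OF I] scale_sum scale_simps(5,6))
qed

lemma module_hom_mult_left: "module_hom gscale gscale ((*) x)"
  and module_hom_mult_right: "module_hom gscale gscale (\<lambda>y. y * x)"
  unfolding module_hom_iff using vs.module_axioms
  by (auto simp: distrib_left distrib_right gscale_mult_left gscale_mult_right)

lemma homog_gscale: "homog k x \<Longrightarrow> homog k (gscale c x)"
  unfolding homog_def using entry_gscale scale_zero by metis

lemma subspace_idem_hom: "vs.subspace (idem_hom P Q)"
  unfolding idem_hom_def
  by (rule vs.subspaceI) (auto simp: distrib_left distrib_right gscale_mult_left gscale_mult_right)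

lemma finite_span_supported_on:
  assumes "finite I" shows "\<exists>B. finite B \<and> {x. supported_on I x} \<subseteq> vs.span B"
proof -
  obtain B where B: "finite B" "\<And>x. \<exists>c. x = (\<Sum>b\<in>B. scale (c b) b)"
    using fd_algebra unfolding fd_algebra_def by auto
  let ?E = "(\<lambda>(u, v, b). elem_gmat u v b) ` (I \<times> I \<times> B)"
  have elem: "elem_gmat u v a \<in> vs.span ?E" if "u \<in> I" "v \<in> I" for u v a
  proof -
    obtain c where c: "a = (\<Sum>b\<in>B. scale (c b) b)" using B(2) by blast
    have "elem_gmat u v a = (\<Sum>b\<in>B. gscale (c b) (elem_gmat u v b))"
      by (rule gmat_eqI) (auto simp: entry_elem_gmat entry_sum c)
    also have "\<dots> \<in> vs.span ?E"
      using that by (intro vs.span_sum vs.span_scale vs.span_base) force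
    finally show ?thesis .
  qed
  have "x \<in> vs.span ?E" if "supported_on I x" for x
    by (subst gmat_eq_sum_elem_gmat[OF assms that]) (intro vs.span_sum elem)
  then show ?thesis using assms B(1) by (intro exI[of _ ?E]) auto
qed

lemma finite_span_idem_hom: "\<exists>B. finite B \<and> idem_hom P Q \<subseteq> vs.span B"
proof -
  obtain I where I: "finite I" "supported_on I P" "supported_on I Q"
    using ex_common_support[of "{P, Q}"] by auto
  have "supported_on I x" if "x \<in> idem_hom P Q" for x
    unfolding supported_on_def
    using idem_homD[OF that] supported_onD[OF I(2)] supported_onD[OF I(3)] entry_mult_nonzero
    by metis
  then show ?thesis using finite_span_supported_on[OF I(1)] by blast
qed

lemma fitting_stable_power:
  assumes e: "e * e = e" and f: "f \<in> idem_hom e e"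
    and S: "vs.subspace S" "\<And>x y. x \<in> S \<Longrightarrow> y \<in> S \<Longrightarrow> x * y \<in> S" "e \<in> S" "f \<in> S"
  obtains n w where "w \<in> S" "w \<in> idem_hom e e" "f * w = w * f"
    "corner_power e f n = corner_power e f (Suc n) * w"
proof -
  define C where "C = {x \<in> S. x \<in> idem_hom e e \<and> f * x = x * f}"
  have e_id: "e \<in> idem_hom e e" by (rule idem_homI[OF e e])
  have "f * e = e * f" using idem_homD[OF f] by simp
  then have e_C: "e \<in> C" unfolding C_def using S(3) e_id by blast
  have sub_C: "vs.subspace C"
  proof (rule vs.subspaceI)
    show "0 \<in> C" unfolding C_def using vs.subspace_0[OF S(1)] by (simp add: idem_hom_zero)
    show "x + y \<in> C" if "x \<in> C" "y \<in> C" for x y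
      using that vs.subspace_add[OF S(1)] unfolding C_def
      by (simp add: idem_hom_add distrib_left distrib_right)
    show "gscale c x \<in> C" if "x \<in> C" for c x
      using that vs.subspace_scale[OF S(1)] vs.subspace_scale[OF subspace_idem_hom]
      unfolding C_def by (simp add: gscale_mult_left gscale_mult_right)
  qed
  have f_C: "f * x \<in> C" if "x \<in> C" for x
    using that S(2,4) idem_hom_mult[OF f, of x] unfolding C_def by (auto, metis mult.assoc)
  define K where "K n = (*) (corner_power e f n) ` C" for n
  have shift: "corner_power e f (Suc n) * x = corner_power e f n * (f * x)" for n x
    using corner_power_commute[OF f refl, of n] by (simp add: mult.assoc[symmetric])
  obtain B where B: "finite B" "idem_hom e e \<subseteq> vs.span B" using finite_span_idem_hom by blast
  have "\<exists>n. K (Suc n) = K n"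
  proof (rule vs.descending_chain_stable[OF _ _ _ B(1)])
    show "vs.subspace (K n)" for n
      unfolding K_def by (rule module_hom.subspace_image[OF module_hom_mult_left sub_C])
    show "K (Suc n) \<subseteq> K n" for n unfolding K_def using shift f_C by blast
    show "K 0 \<subseteq> vs.span B" unfolding K_def C_def using B(2) by (auto simp: idem_homD)
  qed
  then obtain n where n: "K (Suc n) = K n" by blast
  have "corner_power e f n * e \<in> K n" unfolding K_def using e_C by blast
  then obtain w where "w \<in> C" "corner_power e f n * e = corner_power e f (Suc n) * w"
    using n unfolding K_def by blast
  then show thesis
    using that[of w n] idem_homD(2)[OF corner_power_idem_hom[OF e f]] unfolding C_def by simp
qed

lemma fitting_stable_idempotent:
  assumes e: "e * e = e" and f: "f \<in> idem_hom e e"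
    and S: "vs.subspace S" "\<And>x y. x \<in> S \<Longrightarrow> y \<in> S \<Longrightarrow> x * y \<in> S" "e \<in> S" "f \<in> S"
  obtains n g w where "g \<in> S" "w \<in> S" "g \<in> idem_hom e e" "g * g = g" "f * g = g * f" "f * w = w * f"
    "w * f * g = g" "g * corner_power e f n = corner_power e f n"
proof -
  obtain n w where w: "w \<in> S" "w \<in> idem_hom e e" "f * w = w * f"
    and stable: "corner_power e f n = corner_power e f (Suc n) * w"
    using fitting_stable_power[OF assms] .
  define p where "p = corner_power e f n"
  define y where "y = corner_power e w n"
  have power_S: "corner_power e x i \<in> S" if "x \<in> S" for x i
    using that by (induction i) (use S in auto)
  have py: "p \<in> idem_hom e e" "y \<in> idem_hom e e"
    unfolding p_def y_def using corner_power_idem_hom[OF e] f w(2) by auto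
  have fp: "f * p = p * f" unfolding p_def using corner_power_commute[OF f refl] by simp
  have fy: "f * y = y * f" unfolding y_def using corner_power_commute[OF f] w(3) by simp
  have wp: "w * p = p * w" unfolding p_def using corner_power_commute[OF w(2,3)] by simp
  have yp: "y * p = p * y" unfolding p_def using corner_power_commute[OF py(2) fy] by simp
  have pfw: "p * (f * w) = p"
    using stable fp unfolding p_def[symmetric] corner_power_simps by (simp add: mult.assoc)
  have "p * corner_power e (f * w) i = p" for i
    by (induction i) (simp_all add: idem_homD[OF py(1)], metis pfw mult.assoc)
  then have ppy: "p * (p * y) = p"
    unfolding p_def y_def corner_power_mult[OF e w(2,3)] by (simp add: p_def y_def)
  then have gp: "(p * y) * p = p" using yp by (simp add: mult.assoc)
  have "p * y \<in> S" unfolding p_def y_def using S(2) power_S S(4) w(1) by blast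
  moreover have "(p * y) * (p * y) = p * y" using gp by (simp add: mult.assoc[symmetric])
  moreover have "f * (p * y) = (p * y) * f" using fp fy by (metis mult.assoc)
  moreover have "w * f * (p * y) = p * y" using pfw fp wp w(3) by (metis mult.assoc)
  ultimately show thesis using that[OF _ w(1) idem_hom_mult[OF py]] w(3) gp unfolding p_def by blast
qed

text \<open>Fitting's lemma, in the form of the exchange property: \<open>g\<close> is an idempotent on whose image
  \<open>f\<close> is invertible, and on the complement \<open>e - f\<close> is invertible.\<close>

lemma fitting_idempotent:
  assumes e: "e * e = e" and f: "f \<in> idem_hom e e"
    and S: "vs.subspace S" "\<And>x y. x \<in> S \<Longrightarrow> y \<in> S \<Longrightarrow> x * y \<in> S" "e \<in> S" "f \<in> S"
  obtains g u v where "g \<in> S" "u \<in> S" "v \<in> S" "g * g = g" "f * u = g" "u * f = g"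
    "(e - f) * v = e - g" "v * (e - f) = e - g" "e * g = g" "g * e = g"
proof -
  obtain n g w where S_gw: "g \<in> S" "w \<in> S" and g: "g \<in> idem_hom e e" "g * g = g" "f * g = g * f"
    and w: "f * w = w * f" "w * f * g = g" and gp: "g * corner_power e f n = corner_power e f n"
    using fitting_stable_idempotent[OF assms] .
  define p where "p = corner_power e f n"
  define r where "r = (\<Sum>i<n. corner_power e f i)"
  define v where "v = (e - g) * r"
  have p: "p \<in> idem_hom e e" unfolding p_def by (rule corner_power_idem_hom[OF e f])
  have r: "r \<in> idem_hom e e"
    unfolding r_def by (rule vs.subspace_sum[OF subspace_idem_hom])
      (rule corner_power_idem_hom[OF e f])
  have fr: "f * r = r * f"
    unfolding r_def sum_distrib_left sum_distrib_right using corner_power_commute[OF f refl] by simp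
  have er: "(e - f) * r = e - p" unfolding r_def p_def by (rule corner_power_geometric_sum[OF e f])
  then have re: "r * (e - f) = e - p"
    using fr idem_homD[OF r] by (simp add: left_diff_distrib right_diff_distrib)
  have "v * (e - f) = (e - g) * (e - p)" unfolding v_def using re by (simp add: mult.assoc)
  also have "\<dots> = e - g"
    using e gp[folded p_def] idem_homD[OF g(1)] idem_homD[OF p]
    by (simp add: left_diff_distrib right_diff_distrib)
  finally have ve: "v * (e - f) = e - g" .
  have "(e - f) * (e - g) = (e - g) * (e - f)"
    using g(3) idem_homD[OF f] idem_homD[OF g(1)]
    by (simp add: left_diff_distrib right_diff_distrib)
  then have "(e - f) * v = (e - g) * ((e - f) * r)"
    unfolding v_def by (simp add: mult.assoc[symmetric])
  also have "\<dots> = v * (e - f)" unfolding er re[symmetric] v_def by (simp add: mult.assoc)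
  finally have ev: "(e - f) * v = e - g" unfolding ve .
  have "corner_power e f i \<in> S" for i by (induction i) (use S in auto)
  then have "v \<in> S"
    unfolding v_def r_def
    by (intro S(2) vs.subspace_diff[OF S(1,3) S_gw(1)] vs.subspace_sum[OF S(1)])
  moreover have "w * g \<in> S" using S(2) S_gw by blast
  moreover have "(w * g) * f = g" using w(2) g(3) by (simp add: mult.assoc)
  moreover have "f * (w * g) = g" using w by (simp add: mult.assoc[symmetric])
  ultimately show thesis using that[of g "w * g" v] S_gw(1) g ev ve idem_homD[OF g(1)] by blast
qed

end

section \<open>Complexes as pairs of matrices\<close>

text \<open>The first component is the idempotent cutting out all terms at once, the second one the
  total differential; the degree is recorded in the indices.\<close>

type_synonym 'a total_cplx = "'a gmat \<times> 'a gmat"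

abbreviation ide :: "'a total_cplx \<Rightarrow> 'a::zero gmat" where "ide \<equiv> fst"

abbreviation dif :: "'a total_cplx \<Rightarrow> 'a::zero gmat" where "dif \<equiv> snd"

definition total_complex :: "'a::ring total_cplx \<Rightarrow> bool" where
  "total_complex X \<longleftrightarrow> homog 0 (ide X) \<and> homog 1 (dif X) \<and> ide X * ide X = ide X \<and>
     ide X * dif X = dif X \<and> dif X * ide X = dif X \<and> dif X * dif X = 0"

definition Hom :: "int \<Rightarrow> 'a::ring total_cplx \<Rightarrow> 'a total_cplx \<Rightarrow> 'a gmat set" where
  "Hom k X Y = {f. homog k f \<and> ide Y * f = f \<and> f * ide X = f}"

definition ZHom :: "int \<Rightarrow> 'a::ring total_cplx \<Rightarrow> 'a total_cplx \<Rightarrow> 'a gmat set" where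
  "ZHom k X Y = {f \<in> Hom k X Y. ksign k (dif Y * f) = f * dif X}"

definition BHom :: "int \<Rightarrow> 'a::ring total_cplx \<Rightarrow> 'a total_cplx \<Rightarrow> 'a gmat set" where
  "BHom k X Y = {ksign k (dif Y * h) + h * dif X | h. h \<in> Hom (k - 1) X Y}"

lemma HomD: "f \<in> Hom k X Y \<Longrightarrow> homog k f" "f \<in> Hom k X Y \<Longrightarrow> ide Y * f = f"
  "f \<in> Hom k X Y \<Longrightarrow> f * ide X = f"
  unfolding Hom_def by auto

lemma Hom_idem_hom: "f \<in> Hom k X Y \<Longrightarrow> f \<in> idem_hom (ide X) (ide Y)"
  unfolding Hom_def idem_hom_def by auto

lemma ZHomD: "f \<in> ZHom k X Y \<Longrightarrow> f \<in> Hom k X Y" "f \<in> ZHom k X Y \<Longrightarrow> ksign k (dif Y * f) = f * dif X"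
  unfolding ZHom_def by auto

lemma Hom_zero [simp]: "0 \<in> Hom k X Y" and ZHom_zero [simp]: "0 \<in> ZHom k X Y"
  unfolding Hom_def ZHom_def by auto

lemma BHom_zero [simp]: "0 \<in> BHom k X Y"
  unfolding BHom_def by (auto intro!: exI[of _ 0])

lemma Hom_add: "f \<in> Hom k X Y \<Longrightarrow> g \<in> Hom k X Y \<Longrightarrow> f + g \<in> Hom k X Y"
  and Hom_uminus: "f \<in> Hom k X Y \<Longrightarrow> - f \<in> Hom k X Y"
  unfolding Hom_def by (auto simp: homog_add homog_uminus distrib_left distrib_right)

lemma Hom_ksign: "f \<in> Hom k X Y \<Longrightarrow> ksign l f \<in> Hom k X Y"
  by (simp add: ksign_def Hom_uminus)

lemma Hom_mult: "g \<in> Hom l Y W \<Longrightarrow> f \<in> Hom k X Y \<Longrightarrow> g * f \<in> Hom (k + l) X W"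
  unfolding Hom_def using homog_mult[of l g k f]
  by (auto simp: mult.assoc add.commute) (simp add: mult.assoc[symmetric])

lemma dif_Hom: "total_complex X \<Longrightarrow> dif X \<in> Hom 1 X X"
  unfolding total_complex_def Hom_def by auto

lemma ZHom_add: "f \<in> ZHom k X Y \<Longrightarrow> g \<in> ZHom k X Y \<Longrightarrow> f + g \<in> ZHom k X Y"
  and ZHom_uminus: "f \<in> ZHom k X Y \<Longrightarrow> - f \<in> ZHom k X Y"
  unfolding ZHom_def by (auto simp: Hom_add Hom_uminus distrib_left distrib_right ksign_add
    ksign_uminus)

lemma ZHom_diff: "f \<in> ZHom k X Y \<Longrightarrow> g \<in> ZHom k X Y \<Longrightarrow> f - g \<in> ZHom k X Y"
  using ZHom_add[of f k X Y "- g"] ZHom_uminus[of g k X Y] by simp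

lemma BHomI: "h \<in> Hom (k - 1) X Y \<Longrightarrow> ksign k (dif Y * h) + h * dif X \<in> BHom k X Y"
  unfolding BHom_def by blast

lemma BHom_subset_ZHom:
  assumes X: "total_complex X" and Y: "total_complex Y" shows "BHom k X Y \<subseteq> ZHom k X Y"
proof
  fix f assume "f \<in> BHom k X Y"
  then obtain h where h: "h \<in> Hom (k - 1) X Y" "f = ksign k (dif Y * h) + h * dif X"
    unfolding BHom_def by auto
  have square: "dif Y * (dif Y * z) = 0" "dif X * dif X = 0" for z
    using X Y unfolding total_complex_def by (simp_all add: mult.assoc[symmetric])
  have "f \<in> Hom k X Y"
    using Hom_mult[OF dif_Hom[OF Y] h(1)] Hom_mult[OF h(1) dif_Hom[OF X]] unfolding h(2)
    by (simp add: Hom_add Hom_ksign)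
  moreover have "ksign k (dif Y * f) = f * dif X"
    unfolding h(2) using square
    by (simp add: distrib_left distrib_right ksign_add ksign_mult_left ksign_mult_right mult.assoc)
  ultimately show "f \<in> ZHom k X Y" unfolding ZHom_def by simp
qed

lemma BHom_add: "f \<in> BHom k X Y \<Longrightarrow> g \<in> BHom k X Y \<Longrightarrow> f + g \<in> BHom k X Y"
proof -
  assume "f \<in> BHom k X Y" "g \<in> BHom k X Y"
  then obtain h h' where "h \<in> Hom (k - 1) X Y" "f = ksign k (dif Y * h) + h * dif X"
    "h' \<in> Hom (k - 1) X Y" "g = ksign k (dif Y * h') + h' * dif X"
    unfolding BHom_def by auto
  then show ?thesis
    unfolding BHom_def by (auto intro!: exI[of _ "h + h'"] simp: Hom_add algebra_simps ksign_add)
qed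

lemma BHom_uminus: "f \<in> BHom k X Y \<Longrightarrow> - f \<in> BHom k X Y"
proof -
  assume "f \<in> BHom k X Y"
  then obtain h where h: "h \<in> Hom (k - 1) X Y" "f = ksign k (dif Y * h) + h * dif X"
    unfolding BHom_def by auto
  then have "- f = ksign k (dif Y * - h) + - h * dif X" by (simp add: ksign_uminus)
  then show ?thesis using Hom_uminus[OF h(1)] unfolding BHom_def by blast
qed

lemma BHom_diff: "f \<in> BHom k X Y \<Longrightarrow> g \<in> BHom k X Y \<Longrightarrow> f - g \<in> BHom k X Y"
  using BHom_add[of f k X Y "- g"] BHom_uminus[of g k X Y] by simp

lemma ZHom_mult:
  assumes "g \<in> ZHom l Y W" "f \<in> ZHom k X Y" shows "g * f \<in> ZHom (k + l) X W"
proof -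
  have "ksign (k + l) (dif W * (g * f)) = ksign k (ksign l (dif W * g) * f)"
    by (simp add: ksign_ksign ksign_mult_left mult.assoc)
  also have "\<dots> = g * ksign k (dif Y * f)"
    using assms ZHomD(2)[of g l Y W] by (simp add: ksign_mult_right mult.assoc)
  also have "\<dots> = g * f * dif X" using ZHomD(2)[OF assms(2)] by (simp add: mult.assoc)
  finally show ?thesis using assms ZHomD(1) Hom_mult unfolding ZHom_def by blast
qed

lemma BHom_mult_left:
  assumes "g \<in> ZHom l Y W" "f \<in> BHom k X Y" shows "g * f \<in> BHom (k + l) X W"
proof -
  obtain h where h: "h \<in> Hom (k - 1) X Y" "f = ksign k (dif Y * h) + h * dif X"
    using assms(2) unfolding BHom_def by auto
  have "g * f = ksign k (g * dif Y * h) + g * h * dif X"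
    by (simp add: h distrib_left ksign_mult_right mult.assoc)
  also have "g * dif Y = ksign l (dif W * g)" using ZHomD(2)[OF assms(1)] by simp
  also have "ksign k (ksign l (dif W * g) * h) = ksign (k + l) (dif W * (g * h))"
    by (simp add: ksign_ksign ksign_mult_left mult.assoc)
  finally show ?thesis
    using Hom_mult[OF ZHomD(1)[OF assms(1)] h(1)] unfolding BHom_def
    by (auto intro!: exI[of _ "g * h"] simp: algebra_simps)
qed

lemma BHom_mult_right:
  assumes "g \<in> BHom l Y W" "f \<in> ZHom k X Y" shows "g * f \<in> BHom (k + l) X W"
proof -
  obtain h where h: "h \<in> Hom (l - 1) Y W" "g = ksign l (dif W * h) + h * dif Y"
    using assms(1) unfolding BHom_def by auto
  have "g * f = ksign l (dif W * h * f) + h * (dif Y * f)"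
    by (simp add: h distrib_right ksign_mult_left mult.assoc)
  also have "dif Y * f = ksign k (f * dif X)"
    unfolding ZHomD(2)[OF assms(2), symmetric] by (simp add: ksign_def)
  also have "ksign l (dif W * h * f) + h * ksign k (f * dif X) =
    ksign (k + l) (dif W * ksign k (h * f)) + ksign k (h * f) * dif X"
    by (simp add: ksign_def mult.assoc)
  finally show ?thesis
    using Hom_ksign[OF Hom_mult[OF h(1) ZHomD(1)[OF assms(2)]], of k] unfolding BHom_def
    by (auto intro!: exI[of _ "ksign k (h * f)"] simp: algebra_simps)
qed

lemma ide_ZHom: "total_complex X \<Longrightarrow> ide X \<in> ZHom 0 X X"
  unfolding total_complex_def ZHom_def Hom_def by simp

lemma total_complex_zero_dif: "homog 0 e \<Longrightarrow> e * e = e \<Longrightarrow> total_complex (e, 0)"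
  unfolding total_complex_def by simp

definition htpy_iso :: "'a::ring total_cplx \<Rightarrow> 'a total_cplx \<Rightarrow> bool" where
  "htpy_iso X Y \<longleftrightarrow>
     (\<exists>f\<in>ZHom 0 X Y. \<exists>g\<in>ZHom 0 Y X. g * f - ide X \<in> BHom 0 X X \<and> f * g - ide Y \<in> BHom 0 Y Y)"

definition ext_orthogonal :: "'a::ring total_cplx \<Rightarrow> 'a total_cplx \<Rightarrow> bool" where
  "ext_orthogonal X Y \<longleftrightarrow> (\<forall>l::nat. l > 0 \<longrightarrow> ZHom (int l) X Y \<subseteq> BHom (int l) X Y)"

definition two_term_total :: "'a::ring total_cplx \<Rightarrow> bool" where
  "two_term_total X \<longleftrightarrow> (\<forall>i a j b. i \<noteq> -1 \<longrightarrow> i \<noteq> 0 \<longrightarrow> entry (ide X) (Ix i a) (Ix j b) = 0)"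

subsection \<open>Assembling a family of matrices\<close>

definition bounded_family :: "int \<Rightarrow> (int \<Rightarrow> nat) \<Rightarrow> (int \<Rightarrow> nat) \<Rightarrow> (int \<Rightarrow> 'a::zero mat) \<Rightarrow> bool" where
  "bounded_family k v u f \<longleftrightarrow> (\<forall>i. f i \<in> carrier_mat (v (i + k)) (u i)) \<and>
     (\<exists>N. \<forall>i. \<bar>i\<bar> > N \<longrightarrow> f i = 0\<^sub>m (v (i + k)) (u i))"

definition assemble :: "int \<Rightarrow> (int \<Rightarrow> nat) \<Rightarrow> (int \<Rightarrow> nat) \<Rightarrow> (int \<Rightarrow> 'a::zero mat) \<Rightarrow> 'a gmat" where
  "assemble k v u f = Abs_gmat (\<lambda>x y.
     if ix_degree x = ix_degree y + k \<and> ix_position x < v (ix_degree x) \<and> ix_position y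
       < u (ix_degree y)
     then f (ix_degree y) $$ (ix_position x, ix_position y) else 0)"

lemma bounded_family_carrier: "bounded_family k v u f \<Longrightarrow> f i \<in> carrier_mat (v (i + k)) (u i)"
  unfolding bounded_family_def by blast

lemma bounded_family_zero: "bounded_family k v u (\<lambda>i. 0\<^sub>m (v (i + k)) (u i))"
  unfolding bounded_family_def by auto

lemma entry_assemble:
  assumes "bounded_family k v u f"
  shows "entry (assemble k v u f) (Ix i a) (Ix j b) =
    (if i = j + k \<and> a < v i \<and> b < u j then f j $$ (a, b) else 0)"
proof -
  obtain N where N: "\<And>i. \<bar>i\<bar> > N \<Longrightarrow> f i = 0\<^sub>m (v (i + k)) (u i)"
    using assms unfolding bounded_family_def by blast
  let ?I = "{w. \<bar>ix_degree w\<bar> \<le> \<bar>N\<bar> + \<bar>k\<bar> \<and> ix_position w < v (ix_degree w) + u (ix_degree w)}"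
  have "finite_support (\<lambda>x y.
     if ix_degree x = ix_degree y + k \<and> ix_position x < v (ix_degree x) \<and> ix_position y
       < u (ix_degree y)
     then f (ix_degree y) $$ (ix_position x, ix_position y) else 0)"
  proof (rule finite_supportI[OF finite_index_region[of "\<bar>N\<bar> + \<bar>k\<bar>" "\<lambda>i. v i + u i"]])
    fix x y assume "x \<notin> ?I \<or> y \<notin> ?I"
    then show "(if ix_degree x = ix_degree y + k \<and> ix_position x < v (ix_degree x) \<and> ix_position y
      < u (ix_degree y)
      then f (ix_degree y) $$ (ix_position x, ix_position y) else 0) = 0"
      using N[of "ix_degree y"] by auto
  qed
  then show ?thesis unfolding assemble_def by (simp only: entry_Abs_gmat idx.sel)
qed

lemma homog_assemble: "bounded_family k v u f \<Longrightarrow> homog k (assemble k v u f)"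
  unfolding homog_def by (auto simp: entry_assemble split: if_splits)

lemma assemble_zero: "assemble k v u (\<lambda>i. 0\<^sub>m (v (i + k)) (u i)) = (0 :: 'a::ring_1 gmat)"
  by (rule gmat_eqI_Ix) (auto simp: entry_assemble[OF bounded_family_zero])

lemma assemble_eq_iff:
  assumes f: "bounded_family k v u f" and g: "bounded_family k v u g"
  shows "assemble k v u f = assemble k v u g \<longleftrightarrow> (\<forall>i. f i = g i)"
proof
  assume eq: "assemble k v u f = assemble k v u g"
  show "\<forall>i. f i = g i"
  proof (intro allI eq_matI)
    fix i a b assume "a < dim_row (g i)" "b < dim_col (g i)"
    then have "a < v (i + k)" "b < u i" using bounded_family_carrier[OF g, of i] by auto
    then show "f i $$ (a, b) = g i $$ (a, b)"
      using arg_cong[OF eq, of "\<lambda>x. entry x (Ix (i + k) a) (Ix i b)"]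
      by (simp add: entry_assemble[OF f] entry_assemble[OF g])
  qed (use bounded_family_carrier[OF f] bounded_family_carrier[OF g] in \<open>metis carrier_matD\<close>)+
next
  assume "\<forall>i. f i = g i"
  then have "f = g" by auto
  then show "assemble k v u f = assemble k v u g" by simp
qed

lemma bounded_family_mult:
  fixes f g :: "int \<Rightarrow> 'a::ring_1 mat"
  assumes g: "bounded_family l w v g" and f: "bounded_family k v u f"
  shows "bounded_family (k + l) w u (\<lambda>i. g (i + k) * f i)"
proof -
  have carrier: "g (i + k) \<in> carrier_mat (w (i + (k + l))) (v (i + k))" for i
    using bounded_family_carrier[OF g, of "i + k"] by (simp add: add.assoc)
  obtain N where "\<And>i. \<bar>i\<bar> > N \<Longrightarrow> f i = 0\<^sub>m (v (i + k)) (u i)"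
    using f unfolding bounded_family_def by blast
  then have "g (i + k) * f i = 0\<^sub>m (w (i + (k + l))) (u i)" if "\<bar>i\<bar> > N" for i
    using that carrier[of i] by simp
  then show ?thesis
    unfolding bounded_family_def using carrier bounded_family_carrier[OF f]
    by (meson mult_carrier_mat)
qed

lemma assemble_mult:
  fixes f g :: "int \<Rightarrow> 'a::ring_1 mat"
  assumes g: "bounded_family l w v g" and f: "bounded_family k v u f"
  shows "assemble l w v g * assemble k v u f = assemble (k + l) w u (\<lambda>i. g (i + k) * f i)"
proof (rule gmat_eqI_Ix)
  fix i a j b
  let ?G = "assemble l w v g" and ?F = "assemble k v u f"
  note carrier = bounded_family_carrier[OF g, of "j + k"] bounded_family_carrier[OF f, of j]
  note entries = entry_assemble[OF f] entry_assemble[OF g]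
    entry_assemble[OF bounded_family_mult[OF g f]]
  have "entry (?G * ?F) (Ix i a) (Ix j b) =
    (\<Sum>x\<in>Ix (j + k) ` {0..<v (j + k)}. entry ?G (Ix i a) x * entry ?F x (Ix j b))"
  proof (rule entry_mult)
    fix x assume "x \<notin> Ix (j + k) ` {0..<v (j + k)}"
    then show "entry ?G (Ix i a) x = 0 \<or> entry ?F x (Ix j b) = 0"
      by (cases x) (auto simp: entry_assemble[OF f])
  qed simp
  also have "\<dots> = (\<Sum>c = 0..<v (j + k). entry ?G (Ix i a) (Ix (j + k) c) * entry
    ?F (Ix (j + k) c) (Ix j b))"
    by (subst sum.reindex) (auto simp: inj_on_def)
  also have "\<dots> = entry (assemble (k + l) w u (\<lambda>i. g (i + k) * f i)) (Ix i a) (Ix j b)"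
  proof (cases "i = j + (k + l) \<and> a < w i \<and> b < u j")
    case True
    then have "(g (j + k) * f j) $$ (a, b)
      = (\<Sum>c = 0..<v (j + k). g (j + k) $$ (a, c) * f j $$ (c, b))"
      using carrier by (auto simp: scalar_prod_def add.assoc intro!: sum.cong)
    then show ?thesis using True by (simp add: entries add.assoc)
  next
    case False
    then show ?thesis by (auto simp: entries add.assoc intro!: sum.neutral)
  qed
  finally show "entry (?G * ?F) (Ix i a) (Ix j b) =
    entry (assemble (k + l) w u (\<lambda>i. g (i + k) * f i)) (Ix i a) (Ix j b)" .
qed

lemma assemble_add:
  fixes f g :: "int \<Rightarrow> 'a::ring_1 mat"
  assumes f: "bounded_family k v u f" and g: "bounded_family k v u g"
  shows "bounded_family k v u (\<lambda>i. f i + g i)"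
    and "assemble k v u (\<lambda>i. f i + g i) = assemble k v u f + assemble k v u g"
proof -
  obtain N N' where N: "\<And>i. \<bar>i\<bar> > N \<Longrightarrow> f i = 0\<^sub>m (v (i + k)) (u i)"
    "\<And>i. \<bar>i\<bar> > N' \<Longrightarrow> g i = 0\<^sub>m (v (i + k)) (u i)"
    using f g unfolding bounded_family_def by blast
  then have "\<forall>i. \<bar>i\<bar> > max N N' \<longrightarrow> f i + g i = 0\<^sub>m (v (i + k)) (u i)" by auto
  then show sum: "bounded_family k v u (\<lambda>i. f i + g i)"
    unfolding bounded_family_def
    using bounded_family_carrier[OF f] bounded_family_carrier[OF g] by (meson add_carrier_mat)
  have "(f j + g j) $$ (a, b) = f j $$ (a, b) + g j $$ (a, b)" if "a < v (j + k)"
    "b < u j" for a j b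
    using bounded_family_carrier[OF f, of j] bounded_family_carrier[OF g, of j] that by simp
  then show "assemble k v u (\<lambda>i. f i + g i) = assemble k v u f + assemble k v u g"
    by (intro gmat_eqI_Ix) (auto simp: entry_assemble[OF sum] entry_assemble[OF f]
      entry_assemble[OF g])
qed

lemma assemble_uminus:
  fixes f :: "int \<Rightarrow> 'a::ring_1 mat"
  assumes f: "bounded_family k v u f"
  shows "bounded_family k v u (\<lambda>i. - f i)"
    and "assemble k v u (\<lambda>i. - f i) = - assemble k v u f"
proof -
  obtain N where N: "\<And>i. \<bar>i\<bar> > N \<Longrightarrow> f i = 0\<^sub>m (v (i + k)) (u i)"
    using f unfolding bounded_family_def by blast
  then have "\<forall>i. \<bar>i\<bar> > N \<longrightarrow> - f i = 0\<^sub>m (v (i + k)) (u i)" by auto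
  then show neg: "bounded_family k v u (\<lambda>i. - f i)"
    unfolding bounded_family_def using bounded_family_carrier[OF f] by (meson uminus_carrier_mat)
  have "(- f j) $$ (a, b) = - f j $$ (a, b)" if "a < v (j + k)" "b < u j" for a j b
    using bounded_family_carrier[OF f, of j] that by simp
  then show "assemble k v u (\<lambda>i. - f i) = - assemble k v u f"
    by (intro gmat_eqI_Ix) (auto simp: entry_assemble[OF neg] entry_assemble[OF f])
qed

lemma assemble_diff:
  fixes f g :: "int \<Rightarrow> 'a::ring_1 mat"
  assumes f: "bounded_family k v u f" and g: "bounded_family k v u g"
  shows "bounded_family k v u (\<lambda>i. f i - g i)"
    and "assemble k v u (\<lambda>i. f i - g i) = assemble k v u f - assemble k v u g"
proof -
  have diff_eq: "(\<lambda>i. f i - g i) = (\<lambda>i. f i + - g i)"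
    using bounded_family_carrier[OF f] bounded_family_carrier[OF g]
    by (auto simp: fun_eq_iff minus_add_uminus_mat)
  show "bounded_family k v u (\<lambda>i. f i - g i)"
    unfolding diff_eq by (rule assemble_add(1)[OF f assemble_uminus(1)[OF g]])
  show "assemble k v u (\<lambda>i. f i - g i) = assemble k v u f - assemble k v u g"
    unfolding diff_eq assemble_add(2)[OF f assemble_uminus(1)[OF g]] assemble_uminus(2)[OF g] by simp
qed

lemma assemble_surj:
  fixes F :: "'a::ring_1 gmat"
  assumes F: "homog k F" and size: "\<And>i a j b. a \<ge> v i \<or> b \<ge> u j \<Longrightarrow> entry F (Ix i a) (Ix j b) = 0"
  defines "f \<equiv> \<lambda>i. mat (v (i + k)) (u i) (\<lambda>(a, b). entry F (Ix (i + k) a) (Ix i b))"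
  shows "bounded_family k v u f" "assemble k v u f = F"
proof -
  obtain N where "\<And>i a j b. N < \<bar>i\<bar> \<or> N < \<bar>j\<bar> \<Longrightarrow> entry F (Ix i a) (Ix j b) = 0"
    using ex_degree_bound by metis
  then have "f i = 0\<^sub>m (v (i + k)) (u i)" if "\<bar>i\<bar> > N" for i
    unfolding f_def using that by (intro eq_matI) auto
  then show f: "bounded_family k v u f" unfolding bounded_family_def f_def by auto
  show "assemble k v u f = F"
  proof (rule gmat_eqI_Ix)
    fix i a j b
    show "entry (assemble k v u f) (Ix i a) (Ix j b) = entry F (Ix i a) (Ix j b)"
    proof (cases "i = j + k \<and> a < v i \<and> b < u j")
      case True
      then show ?thesis unfolding entry_assemble[OF f] by (auto simp: f_def)
    next
      case False
      then have "entry F (Ix i a) (Ix j b) = 0" using homogD[OF F] size by (meson not_less)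
      then show ?thesis unfolding entry_assemble[OF f] using False by auto
    qed
  qed
qed

subsection \<open>The total complex\<close>

definition csize :: "'a cplx \<Rightarrow> int \<Rightarrow> nat" where "csize X i = fst (cobj X i)"

abbreviation total_map :: "int \<Rightarrow> 'a cplx \<Rightarrow> 'a cplx \<Rightarrow> (int \<Rightarrow> 'a mat) \<Rightarrow> 'a::ring_1 gmat" where
  "total_map k X Y \<equiv> assemble k (csize Y) (csize X)"

definition total :: "'a::ring_1 cplx \<Rightarrow> 'a total_cplx" where
  "total X = (total_map 0 X X (id_cmap X), total_map 1 X X (cdif X))"

lemma total_simps: "ide (total X) = total_map 0 X X (id_cmap X)"
  "dif (total X) = total_map 1 X X (cdif X)"
  unfolding total_def by simp_all

definition component_maps :: "int \<Rightarrow> 'a::ring_1 cplx \<Rightarrow> 'a cplx \<Rightarrow> (int \<Rightarrow> 'a mat) set" where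
  "component_maps k X Y = {f. \<forall>i. f i \<in> phom (cobj X i) (cobj Y (i + k))}"

lemma phom_iff:
  assumes P: "proj_obj P" and Q: "proj_obj Q"
  shows "f \<in> phom P Q \<longleftrightarrow> f \<in> carrier_mat (fst Q) (fst P) \<and> snd Q * f = f \<and> f * snd P = f"
proof
  assume "f \<in> phom P Q"
  then have f: "f \<in> carrier_mat (fst Q) (fst P)" "snd Q * f * snd P = f" unfolding phom_def by auto
  have p: "snd P \<in> carrier_mat (fst P) (fst P)" "snd P * snd P = snd P"
    and q: "snd Q \<in> carrier_mat (fst Q) (fst Q)" "snd Q * snd Q = snd Q"
    using P Q unfolding proj_obj_def by auto
  have qf: "snd Q * f \<in> carrier_mat (fst Q) (fst P)" using q(1) f(1) by simp
  have "snd Q * f = snd Q * (snd Q * f * snd P)" using f(2) by simp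
  also have "\<dots> = snd Q * snd Q * f * snd P"
    by (simp only: assoc_mult_mat[OF q(1) qf p(1)] assoc_mult_mat[OF q(1,1) f(1)])
  also have "\<dots> = f" using q(2) f(2) by simp
  finally have left: "snd Q * f = f" .
  then show "f \<in> carrier_mat (fst Q) (fst P) \<and> snd Q * f = f \<and> f * snd P = f" using f by simp
qed (auto simp: phom_def)

lemma is_complexD:
  assumes "is_complex X"
  shows "proj_obj (cobj X i)" "cdif X i \<in> phom (cobj X i) (cobj X (i + 1))"
    "cdif X (i + 1) * cdif X i = 0\<^sub>m (csize X (i + 2)) (csize X i)"
  using assms unfolding is_complex_def csize_def by auto

lemma component_maps_iff:
  assumes "is_complex X" "is_complex Y"
  shows "f \<in> component_maps k X Y \<longleftrightarrow> (\<forall>i. f i \<in> carrier_mat (csize Y (i + k)) (csize X i) \<and>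
    id_cmap Y (i + k) * f i = f i \<and> f i * id_cmap X i = f i)"
  unfolding component_maps_def id_cmap_def csize_def
  using phom_iff[OF is_complexD(1)[OF assms(1)] is_complexD(1)[OF assms(2)]] by simp

lemma bounded_component_maps:
  assumes X: "is_complex X" and Y: "is_complex Y" and f: "f \<in> component_maps k X Y"
  shows "bounded_family k (csize Y) (csize X) f"
proof -
  note comp = f[unfolded component_maps_iff[OF X Y], rule_format]
  obtain N where N: "\<And>i. \<bar>i\<bar> > int N \<Longrightarrow> id_cmap X i = 0\<^sub>m (csize X i) (csize X i)"
    using X unfolding is_complex_def csize_def id_cmap_def by blast
  have "f i = 0\<^sub>m (csize Y (i + k)) (csize X i)" if "\<bar>i\<bar> > int N" for i
    using comp[of i] N[OF that] by (metis right_mult_zero_mat)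
  then show ?thesis unfolding bounded_family_def using comp by blast
qed

lemma id_cmap_component_maps: "is_complex X \<Longrightarrow> id_cmap X \<in> component_maps 0 X X"
  and cdif_component_maps: "is_complex X \<Longrightarrow> cdif X \<in> component_maps 1 X X"
  unfolding component_maps_def id_cmap_def using is_complexD[of X]
  by (auto simp: phom_def proj_obj_def)

lemma bounded_total:
  assumes "is_complex X"
  shows "bounded_family 0 (csize X) (csize X) (id_cmap X)"
    "bounded_family 1 (csize X) (csize X) (cdif X)"
  using bounded_component_maps[OF assms assms] id_cmap_component_maps[OF assms]
    cdif_component_maps[OF assms]
  by auto

lemma total_complex_total:
  assumes X: "is_complex X" shows "total_complex (total X)"
proof -
  note bounded = bounded_total[OF X]
  note id = id_cmap_component_maps[OF X, unfolded component_maps_iff[OF X X], rule_format]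
  note dif = cdif_component_maps[OF X, unfolded component_maps_iff[OF X X], rule_format]
  have "(\<lambda>i. cdif X (i + 1) * cdif X i) = (\<lambda>i. 0\<^sub>m (csize X (i + (1 + 1))) (csize X i))"
    using is_complexD(3)[OF X] by simp
  then have "total_map (1 + 1) X X (\<lambda>i. cdif X (i + 1) * cdif X i) = 0"
    by (simp only: assemble_zero)
  then show ?thesis
    unfolding total_complex_def total_simps
    using assemble_mult[OF bounded(1,1)] assemble_mult[OF bounded(1,2)]
      assemble_mult[OF bounded(2,1)]
      assemble_mult[OF bounded(2,2)] homog_assemble[OF bounded(1)]
        homog_assemble[OF bounded(2)] id dif
    by simp
qed

lemma is_complexI:
  assumes bounded: "bounded_family 0 (csize X) (csize X) (id_cmap X)"
      "bounded_family 1 (csize X) (csize X) (cdif X)"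
    and X: "total_complex (total X)"
  shows "is_complex X"
proof -
  note eqs = X[unfolded total_complex_def total_simps]
    and mult = assemble_mult[OF bounded(1,1)] assemble_mult[OF bounded(1,2)]
      assemble_mult[OF bounded(2,1)] assemble_mult[OF bounded(2,2)]
    and bounded_mult = bounded_family_mult[OF bounded(1,1), simplified]
      bounded_family_mult[OF bounded(1,2), simplified]
      bounded_family_mult[OF bounded(2,1), simplified] bounded_family_mult[OF bounded(2,2)]
  have id: "id_cmap X i * id_cmap X i = id_cmap X i" "id_cmap X (i + 1) * cdif X i = cdif X i"
    "cdif X i * id_cmap X i = cdif X i" for i
    using eqs mult assemble_eq_iff[OF bounded_mult(1) bounded(1)]
      assemble_eq_iff[OF bounded_mult(2) bounded(2)]
      assemble_eq_iff[OF bounded_mult(3) bounded(2)] by simp_all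
  have dd: "cdif X (i + 1) * cdif X i = 0\<^sub>m (csize X (i + (1 + 1))) (csize X i)" for i
    using eqs mult(4) assemble_eq_iff[OF bounded_mult(4) bounded_family_zero]
    by (simp add: assemble_zero)
  obtain N where "\<And>i. \<bar>i\<bar> > N \<Longrightarrow> id_cmap X i = 0\<^sub>m (csize X i) (csize X i)"
    using bounded(1) unfolding bounded_family_def by auto
  then have "\<forall>i. \<bar>i\<bar> > int (nat N) \<longrightarrow> snd (cobj X i) = 0\<^sub>m (fst (cobj X i)) (fst (cobj X i))"
    unfolding id_cmap_def csize_def by auto
  then have "\<exists>N::nat. \<forall>i. \<bar>i\<bar> > int N \<longrightarrow> snd (cobj X i) = 0\<^sub>m (fst (cobj X i)) (fst (cobj X i))"
    by blast
  then show ?thesis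
    unfolding is_complex_def proj_obj_def phom_def
    using bounded_family_carrier[OF bounded(1)] bounded_family_carrier[OF bounded(2)] id dd
    unfolding id_cmap_def csize_def by auto
qed

lemma component_maps_iff_Hom:
  assumes X: "is_complex X" and Y: "is_complex Y" and f: "bounded_family k (csize Y) (csize X) f"
  shows "f \<in> component_maps k X Y \<longleftrightarrow> total_map k X Y f \<in> Hom k (total X) (total Y)"
proof -
  note left = bounded_total(1)[OF Y] and right = bounded_total(1)[OF X]
  have "total_map k X Y f \<in> Hom k (total X) (total Y) \<longleftrightarrow>
    total_map k X Y (\<lambda>i. id_cmap Y (i + k) * f i) = total_map k X Y f \<and>
    total_map k X Y (\<lambda>i. f i * id_cmap X i) = total_map k X Y f"
    unfolding Hom_def total_simps
    using homog_assemble[OF f] assemble_mult[OF left f] assemble_mult[OF f right]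
    by simp
  also have "\<dots> \<longleftrightarrow> (\<forall>i. id_cmap Y (i + k) * f i = f i) \<and> (\<forall>i. f i * id_cmap X i = f i)"
    using assemble_eq_iff[OF _ f] bounded_family_mult[OF left f] bounded_family_mult[OF f right]
    by simp
  finally show ?thesis
    unfolding component_maps_iff[OF X Y] using bounded_family_carrier[OF f] by auto
qed

lemma total_map_Hom:
  "is_complex X \<Longrightarrow> is_complex Y \<Longrightarrow> f \<in> component_maps k X Y \<Longrightarrow>
    total_map k X Y f \<in> Hom k (total X) (total Y)"
  using component_maps_iff_Hom bounded_component_maps by blast

lemma entry_ide_zero:
  assumes "is_complex X" "a \<ge> csize X i \<or> b \<ge> csize X j"
  shows "entry (ide (total X)) (Ix i a) (Ix j b) = 0"
  using assms(2) unfolding total_simps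
  by (auto simp: entry_assemble[OF bounded_total(1)[OF assms(1)]])

lemma total_map_surj:
  assumes X: "is_complex X" and Y: "is_complex Y" and F: "F \<in> Hom k (total X) (total Y)"
  obtains f where "f \<in> component_maps k X Y" "total_map k X Y f = F"
proof -
  have "entry F (Ix i a) (Ix j b) = 0" if "a \<ge> csize Y i \<or> b \<ge> csize X j" for i a j b
  proof (rule ccontr)
    assume "entry F (Ix i a) (Ix j b) \<noteq> 0"
    then have "entry (ide (total Y) * F) (Ix i a) (Ix j b) \<noteq> 0"
      "entry (F * ide (total X)) (Ix i a) (Ix j b) \<noteq> 0"
      using HomD(2,3)[OF F] by simp_all
    then obtain w w' where "entry (ide (total Y)) (Ix i a) w \<noteq> 0"
      "entry (ide (total X)) w' (Ix j b) \<noteq> 0"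
      using entry_mult_nonzero by metis
    then show False
      using that entry_ide_zero[OF Y, of i a] entry_ide_zero[OF X, of _ _ j b]
      by (cases w; cases w') auto
  qed
  then have "\<exists>f. bounded_family k (csize Y) (csize X) f \<and> total_map k X Y f = F"
    using assemble_surj[of k F "csize Y" "csize X", OF HomD(1)[OF F]] by blast
  then obtain f where f: "bounded_family k (csize Y) (csize X) f" "total_map k X Y f = F" by blast
  show thesis using that[of f] component_maps_iff_Hom[OF X Y f(1)] F f(2) by simp
qed

lemma ex_complex_of_total:
  assumes "total_complex (e, d)" shows "\<exists>X. is_complex X \<and> total X = (e, d :: 'a::ring_1 gmat)"
proof -
  obtain m m' where bound: "\<And>i a j b. m \<le> a \<or> m \<le> b \<Longrightarrow> entry e (Ix i a) (Ix j b) = 0"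
    "\<And>i a j b. m' \<le> a \<or> m' \<le> b \<Longrightarrow> entry d (Ix i a) (Ix j b) = 0"
    using ex_position_bound[of e] ex_position_bound[of d] by metis
  define n where "n = max m m'"
  let ?id = "\<lambda>i. mat n n (\<lambda>(a, b). entry e (Ix (i + 0) a) (Ix i b))"
    and ?dif = "\<lambda>i. mat n n (\<lambda>(a, b). entry d (Ix (i + 1) a) (Ix i b))"
  define X where "X = ((\<lambda>i. (n, ?id i)), ?dif)"
  have X_simps: "csize X = (\<lambda>_. n)" "id_cmap X = ?id" "cdif X = ?dif"
    by (simp_all add: X_def csize_def fun_eq_iff cobj_def id_cmap_def cdif_def)
  have homog: "homog 0 e" "homog 1 d" using assms unfolding total_complex_def by auto
  have id: "bounded_family 0 (\<lambda>_. n) (\<lambda>_. n) ?id" "assemble 0 (\<lambda>_. n) (\<lambda>_. n) ?id = e"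
    by (rule assemble_surj[OF homog(1), of "\<lambda>_. n" "\<lambda>_. n"]; use bound(1) in \<open>auto simp: n_def\<close>)+
  have dif: "bounded_family 1 (\<lambda>_. n) (\<lambda>_. n) ?dif" "assemble 1 (\<lambda>_. n) (\<lambda>_. n) ?dif = d"
    by (rule assemble_surj[OF homog(2), of "\<lambda>_. n" "\<lambda>_. n"]; use bound(2) in \<open>auto simp: n_def\<close>)+
  have "total X = (e, d)" unfolding total_def X_simps id(2) dif(2) ..
  moreover have "is_complex X"
    by (rule is_complexI) (use id(1) dif(1) assms \<open>total X = (e, d)\<close> in \<open>simp_all only: X_simps\<close>)
  ultimately show ?thesis by blast
qed

subsection \<open>Chain maps and homotopies\<close>

lemma shift_simps: "cobj (shift k X) i = cobj X (i + k)"
  "cdif (shift k X) i = (if even k then cdif X (i + k) else - cdif X (i + k))"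
  unfolding shift_def cobj_def cdif_def by auto

lemma shift_0 [simp]: "shift 0 X = X"
  unfolding shift_def cobj_def cdif_def by simp

lemma assemble_shift_cdif_mult:
  assumes Y: "is_complex Y" and f: "bounded_family k (csize Y) u f"
  shows "bounded_family (k + 1) (csize Y) u (\<lambda>i. cdif (shift l Y) (i + k - l) * f i)"
    and "assemble (k + 1) (csize Y) u (\<lambda>i. cdif (shift l Y) (i + k - l) * f i) =
      ksign l (dif (total Y) * assemble k (csize Y) u f)"
proof -
  note dif = bounded_total(2)[OF Y]
  note bounded = bounded_family_mult[OF dif f] and mult = assemble_mult[OF dif f]
  have "- cdif Y (i + k) * f i = - (cdif Y (i + k) * f i)" for i
    using bounded_family_carrier[OF dif, of "i + k"] bounded_family_carrier[OF f, of i]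
    by (intro uminus_mult_left_mat) auto
  then have eq: "(\<lambda>i. cdif (shift l Y) (i + k - l) * f i) =
    (if even l then (\<lambda>i. cdif Y (i + k) * f i) else (\<lambda>i. - (cdif Y (i + k) * f i)))"
    by (simp add: shift_simps)
  show "bounded_family (k + 1) (csize Y) u (\<lambda>i. cdif (shift l Y) (i + k - l) * f i)"
    unfolding eq using bounded assemble_uminus(1)[OF bounded] by simp
  show "assemble (k + 1) (csize Y) u (\<lambda>i. cdif (shift l Y) (i + k - l) * f i) =
      ksign l (dif (total Y) * assemble k (csize Y) u f)"
    unfolding eq total_simps ksign_def mult using assemble_uminus(2)[OF bounded] by simp
qed

lemma chain_map_iff_ZHom:
  assumes X: "is_complex X" and Y: "is_complex Y"
  shows "chain_map X (shift l Y) f \<longleftrightarrow>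
    f \<in> component_maps l X Y \<and> total_map l X Y f \<in> ZHom l (total X) (total Y)"
proof (cases "f \<in> component_maps l X Y")
  case True
  note f = bounded_component_maps[OF X Y True]
  note left = assemble_shift_cdif_mult[OF Y f, of l]
    and right = bounded_family_mult[OF f bounded_total(2)[OF X]]
      assemble_mult[OF f bounded_total(2)[OF X]]
  have "chain_map X (shift l Y) f \<longleftrightarrow> (\<forall>i. cdif (shift l Y) (i + l - l) * f i = f (i + 1) * cdif X i)"
    using True unfolding chain_map_def component_maps_def by (simp add: shift_simps)
  also have "\<dots> \<longleftrightarrow> ksign l (dif (total Y) * total_map l X Y f) = total_map l X Y f * dif (total X)"
    using assemble_eq_iff[OF left(1) right(1)[unfolded add.commute[of 1 l]]] left(2) right(2)
    by (simp add: total_simps add.commute)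
  finally show ?thesis using True total_map_Hom[OF X Y True] unfolding ZHom_def by auto
next
  case False
  then show ?thesis unfolding chain_map_def component_maps_def by (auto simp: shift_simps)
qed

lemma homotopy_iff:
  assumes X: "is_complex X" and Y: "is_complex Y" and f: "bounded_family l (csize Y) (csize X) f"
    and h: "h \<in> component_maps (l - 1) X Y"
  shows "(\<forall>i. f i = cdif (shift l Y) (i - 1) * h i + h (i + 1) * cdif X i) \<longleftrightarrow>
    total_map l X Y f =
      ksign l (dif (total Y) * total_map (l - 1) X Y h) + total_map (l - 1) X Y h * dif (total X)"
proof -
  note bh = bounded_component_maps[OF X Y h]
  note left = assemble_shift_cdif_mult[OF Y bh, of l, simplified]
    and right = bounded_family_mult[OF bh bounded_total(2)[OF X], simplified]
      assemble_mult[OF bh bounded_total(2)[OF X], simplified]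
  note sum = assemble_add[OF left(1) right(1)]
  show ?thesis
    using assemble_eq_iff[OF f sum(1)] sum(2) left(2) right(2) by (simp add: total_simps)
qed

lemma null_homotopic_iff_BHom:
  assumes X: "is_complex X" and Y: "is_complex Y" and f: "bounded_family l (csize Y) (csize X) f"
  shows "null_homotopic X (shift l Y) f \<longleftrightarrow> total_map l X Y f \<in> BHom l (total X) (total Y)"
proof -
  have index: "i - 1 + l = i + (l - 1)" for i :: int by simp
  have "null_homotopic X (shift l Y) f \<longleftrightarrow>
    (\<exists>h\<in>component_maps (l - 1) X Y. \<forall>i. f i
      = cdif (shift l Y) (i - 1) * h i + h (i + 1) * cdif X i)"
    unfolding null_homotopic_def component_maps_def by (simp add: shift_simps(1) index)
  also have "\<dots> \<longleftrightarrow> (\<exists>h\<in>component_maps (l - 1) X Y. total_map l X Y f =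
      ksign l (dif (total Y) * total_map (l - 1) X Y h) + total_map (l - 1) X Y h * dif (total X))"
    using homotopy_iff[OF X Y f] by blast
  also have "\<dots> \<longleftrightarrow> total_map l X Y f \<in> BHom l (total X) (total Y)"
    unfolding BHom_def using total_map_Hom[OF X Y] total_map_surj[OF X Y] by (auto, metis)
  finally show ?thesis .
qed

lemma null_homotopic_inverse_iff:
  assumes X: "is_complex X" and Y: "is_complex Y"
    and f: "f \<in> component_maps 0 X Y" and g: "g \<in> component_maps 0 Y X"
  shows "null_homotopic X X (\<lambda>i. g i * f i - id_cmap X i) \<longleftrightarrow>
    total_map 0 Y X g * total_map 0 X Y f - ide (total X) \<in> BHom 0 (total X) (total X)"
proof -
  note bf = bounded_component_maps[OF X Y f] and bg = bounded_component_maps[OF Y X g]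
  note mult = bounded_family_mult[OF bg bf, simplified] assemble_mult[OF bg bf, simplified]
  note diff = assemble_diff[OF mult(1) bounded_total(1)[OF X]]
  show ?thesis using null_homotopic_iff_BHom[OF X X diff(1)] diff(2) mult(2)
    by (simp add: total_simps)
qed

lemma htpy_equiv_iff_htpy_iso:
  "X \<simeq>\<^sub>K Y \<longleftrightarrow> is_complex X \<and> is_complex Y \<and> htpy_iso (total X) (total Y)"
proof (cases "is_complex X \<and> is_complex Y")
  case True
  then have X: "is_complex X" and Y: "is_complex Y" by auto
  note chain = chain_map_iff_ZHom[OF X Y, of 0, simplified]
    chain_map_iff_ZHom[OF Y X, of 0, simplified]
    and null = null_homotopic_inverse_iff[OF X Y] null_homotopic_inverse_iff[OF Y X]
  show ?thesis
  proof
    assume "X \<simeq>\<^sub>K Y"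
    then obtain f g where "chain_map X Y f" "chain_map Y X g"
      "null_homotopic X X (\<lambda>i. g i * f i - id_cmap X i)"
        "null_homotopic Y Y (\<lambda>i. f i * g i - id_cmap Y i)"
      unfolding htpy_equiv_def by blast
    then show "is_complex X \<and> is_complex Y \<and> htpy_iso (total X) (total Y)"
      unfolding htpy_iso_def chain using null True by blast
  next
    assume "is_complex X \<and> is_complex Y \<and> htpy_iso (total X) (total Y)"
    then obtain F G where FG: "F \<in> ZHom 0 (total X) (total Y)" "G \<in> ZHom 0 (total Y) (total X)"
      "G * F - ide (total X) \<in> BHom 0 (total X) (total X)"
        "F * G - ide (total Y) \<in> BHom 0 (total Y) (total Y)"
      unfolding htpy_iso_def by blast
    obtain f where f: "f \<in> component_maps 0 X Y" "total_map 0 X Y f = F"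
      using total_map_surj[OF X Y ZHomD(1)[OF FG(1)]] .
    obtain g where g: "g \<in> component_maps 0 Y X" "total_map 0 Y X g = G"
      using total_map_surj[OF Y X ZHomD(1)[OF FG(2)]] .
    show "X \<simeq>\<^sub>K Y"
      unfolding htpy_equiv_def chain using True FG f g null(1)[OF f(1) g(1)] null(2)[OF g(1) f(1)]
      by blast
  qed
qed (auto simp: htpy_equiv_def)

lemma presilting_iff_ext_orthogonal:
  "presilting T \<longleftrightarrow> is_complex T \<and> ext_orthogonal (total T) (total T)"
proof -
  have "(\<forall>f. chain_map T (shift l T) f \<longrightarrow> null_homotopic T (shift l T) f) \<longleftrightarrow>
    ZHom l (total T) (total T) \<subseteq> BHom l (total T) (total T)" if T: "is_complex T" for l
  proof
    assume homotopic: "\<forall>f. chain_map T (shift l T) f \<longrightarrow> null_homotopic T (shift l T) f"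
    show "ZHom l (total T) (total T) \<subseteq> BHom l (total T) (total T)"
    proof
      fix F assume F: "F \<in> ZHom l (total T) (total T)"
      obtain f where f: "f \<in> component_maps l T T" "total_map l T T f = F"
        using total_map_surj[OF T T ZHomD(1)[OF F]] .
      then show "F \<in> BHom l (total T) (total T)"
        using homotopic F chain_map_iff_ZHom[OF T T]
          null_homotopic_iff_BHom[OF T T bounded_component_maps[OF T T f(1)]]
        by blast
    qed
  next
    assume "ZHom l (total T) (total T) \<subseteq> BHom l (total T) (total T)"
    then show "\<forall>f. chain_map T (shift l T) f \<longrightarrow> null_homotopic T (shift l T) f"
      using chain_map_iff_ZHom[OF T T]
        null_homotopic_iff_BHom[OF T T bounded_component_maps[OF T T]] by blast
  qed
  then show ?thesis unfolding presilting_def ext_orthogonal_def by blast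
qed

lemma cobj_zero_iff:
  assumes X: "is_complex X"
  shows "snd (cobj X i) = 0\<^sub>m (fst (cobj X i)) (fst (cobj X i)) \<longleftrightarrow>
    (\<forall>a j b. entry (ide (total X)) (Ix i a) (Ix j b) = 0)"
proof -
  have id: "id_cmap X i \<in> carrier_mat (csize X i) (csize X i)"
    using bounded_family_carrier[OF bounded_total(1)[OF X], of i] by simp
  have entry: "entry (ide (total X)) (Ix i a) (Ix j b) =
    (if i = j \<and> a < csize X i \<and> b < csize X j then id_cmap X j $$ (a, b) else 0)" for a j b
    unfolding total_simps by (simp add: entry_assemble[OF bounded_total(1)[OF X]])
  have "id_cmap X i = 0\<^sub>m (csize X i) (csize X i)
    \<longleftrightarrow> (\<forall>a<csize X i. \<forall>b<csize X i. id_cmap X i $$ (a, b) = 0)"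
    using id by auto
  then show ?thesis unfolding entry id_cmap_def[symmetric] csize_def[symmetric] by auto
qed

lemma two_term_iff_total: "two_term X \<longleftrightarrow> is_complex X \<and> two_term_total (total X)"
  unfolding two_term_def two_term_total_def using cobj_zero_iff[of X] by blast

section \<open>The Krull-Schmidt theorem\<close>

text \<open>A category given by hom groups inside a ring of morphisms, an ideal \<open>null\<close> of morphisms to
  be regarded as zero, and units \<open>idt\<close>.\<close>

locale ideal_category =
  fixes ob :: "'o \<Rightarrow> bool" and hom null :: "'o \<Rightarrow> 'o \<Rightarrow> 'm::ring set" and idt :: "'o \<Rightarrow> 'm"
  assumes hom_zero: "0 \<in> hom X Y"
    and hom_add: "f \<in> hom X Y \<Longrightarrow> g \<in> hom X Y \<Longrightarrow> f + g \<in> hom X Y"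
    and hom_uminus: "f \<in> hom X Y \<Longrightarrow> - f \<in> hom X Y"
    and hom_mult: "g \<in> hom Y W \<Longrightarrow> f \<in> hom X Y \<Longrightarrow> g * f \<in> hom X W"
    and idt_hom: "ob X \<Longrightarrow> idt X \<in> hom X X"
    and idt_left: "f \<in> hom X Y \<Longrightarrow> idt Y * f = f"
    and idt_right: "f \<in> hom X Y \<Longrightarrow> f * idt X = f"
    and null_zero: "0 \<in> null X Y"
    and null_add: "f \<in> null X Y \<Longrightarrow> g \<in> null X Y \<Longrightarrow> f + g \<in> null X Y"
    and null_uminus: "f \<in> null X Y \<Longrightarrow> - f \<in> null X Y"
    and null_left: "g \<in> hom Y W \<Longrightarrow> f \<in> null X Y \<Longrightarrow> g * f \<in> null X W"
    and null_right: "g \<in> null Y W \<Longrightarrow> f \<in> hom X Y \<Longrightarrow> g * f \<in> null X W"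
begin

lemma hom_diff: "f \<in> hom X Y \<Longrightarrow> g \<in> hom X Y \<Longrightarrow> f - g \<in> hom X Y"
  using hom_add[of f X Y "- g"] hom_uminus[of g X Y] by simp

lemma null_diff: "f \<in> null X Y \<Longrightarrow> g \<in> null X Y \<Longrightarrow> f - g \<in> null X Y"
  using null_add[of f X Y "- g"] null_uminus[of g X Y] by simp

lemma null_mid: "x \<in> null A B \<Longrightarrow> g \<in> hom B C \<Longrightarrow> f \<in> hom D A \<Longrightarrow> g * x * f \<in> null D C"
  using null_left null_right by blast

lemma null_cong: "f - g \<in> null X Y \<Longrightarrow> g \<in> null X Y \<Longrightarrow> f \<in> null X Y"
  using null_add[of "f - g" X Y g] by simp

lemma null_trans: "f - g \<in> null X Y \<Longrightarrow> g - h \<in> null X Y \<Longrightarrow> f - h \<in> null X Y"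
  using null_add[of "f - g" X Y "g - h"] by simp

lemma null_sym: "f - g \<in> null X Y \<Longrightarrow> g - f \<in> null X Y"
  using null_uminus[of "f - g" X Y] by simp

lemma null_through_zero: "idt Y \<in> null Y Y \<Longrightarrow> i \<in> hom Y X \<Longrightarrow> p \<in> hom W Y \<Longrightarrow> i * p \<in> null W X"
  using null_mid[of "idt Y" Y Y i X p W] idt_right by simp

definition iso :: "'o \<Rightarrow> 'o \<Rightarrow> bool" where
  "iso X Y \<longleftrightarrow> ob X \<and> ob Y \<and>
     (\<exists>f\<in>hom X Y. \<exists>g\<in>hom Y X. g * f - idt X \<in> null X X \<and> f * g - idt Y \<in> null Y Y)"

lemma iso_ob: "iso X Y \<Longrightarrow> ob X" "iso X Y \<Longrightarrow> ob Y"
  unfolding iso_def by auto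

lemma iso_refl: "ob X \<Longrightarrow> iso X X"
  unfolding iso_def using idt_hom[of X] idt_left[of "idt X" X X]
  by (auto intro!: bexI[of _ "idt X"] simp: null_zero)

lemma iso_sym: "iso X Y \<Longrightarrow> iso Y X"
  unfolding iso_def by blast

lemma inverse_comp:
  assumes f: "f \<in> hom X Y" "g \<in> hom Y X" "g * f - idt X \<in> null X X"
    and f': "f' \<in> hom Y W" "g' \<in> hom W Y" "g' * f' - idt Y \<in> null Y Y"
  shows "(g * g') * (f' * f) - idt X \<in> null X X"
proof -
  have "(g * g') * (f' * f) - idt X = g * (g' * f' - idt Y) * f + (g * f - idt X)"
    using idt_left[OF f(1)] by (simp add: algebra_simps)
  also have "\<dots> \<in> null X X" using f f' by (intro null_add null_mid[of _ Y Y])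
  finally show ?thesis .
qed

lemma iso_trans:
  assumes "iso X Y" "iso Y W" shows "iso X W"
proof -
  obtain f g where f: "f \<in> hom X Y" "g \<in> hom Y X" "g * f - idt X \<in> null X X"
    "f * g - idt Y \<in> null Y Y"
    using assms(1) unfolding iso_def by blast
  obtain f' g' where f': "f' \<in> hom Y W" "g' \<in> hom W Y" "g' * f' - idt Y \<in> null Y Y"
    "f' * g' - idt W \<in> null W W"
    using assms(2) unfolding iso_def by blast
  show ?thesis
    unfolding iso_def
    using iso_ob[OF assms(1)] iso_ob[OF assms(2)] hom_mult[OF f'(1) f(1)] hom_mult[OF f(2) f'(2)]
      inverse_comp[OF f(1-3) f'(1-3)] inverse_comp[OF f'(2,1,4) f(2,1,4)] by blast
qed

definition iso_cls :: "'o \<Rightarrow> 'o set" where "iso_cls X = {Y. iso Y X}"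

lemma iso_cls_eq_iff:
  assumes "ob X" shows "iso_cls X = iso_cls Y \<longleftrightarrow> iso X Y"
proof
  assume "iso_cls X = iso_cls Y"
  then show "iso X Y" using iso_refl[OF assms] unfolding iso_cls_def by blast
next
  assume XY: "iso X Y"
  show "iso_cls X = iso_cls Y"
    unfolding iso_cls_def using iso_trans[OF _ XY] iso_trans[OF _ iso_sym[OF XY]] by blast
qed

lemma retraction_idempotent:
  assumes "f \<in> hom Y W" "g \<in> hom W Y" "g * f - idt Y \<in> null Y Y"
  shows "f * g * (f * g) - f * g \<in> null W W"
proof -
  have "f * g * (f * g) - f * g = f * (g * f - idt Y) * g"
    using idt_left[OF assms(2)] by (simp add: algebra_simps)
  then show ?thesis using null_mid[OF assms(3,1,2)] by simp
qed

lemma retraction_comp: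
  assumes f: "f \<in> hom Y W" "g \<in> hom W Y" "g * f - idt Y \<in> null Y Y"
    and eq: "j * q - f * g \<in> null W W"
  shows "g * j * (q * f) - idt Y \<in> null Y Y"
proof -
  have "g * j * (q * f) - idt Y = g * (j * q - f * g) * f + g * f * (g * f - idt Y)
    + (g * f - idt Y)"
    using idt_right[OF f(1)] by (simp add: algebra_simps)
  also have "\<dots> \<in> null Y Y"
    by (intro null_add null_mid[OF eq f(2,1)] null_left[OF hom_mult[OF f(2,1)] f(3)] f(3))
  finally show ?thesis .
qed

lemma iso_of_same_idempotent:
  assumes ob: "ob Y" "ob Y'" and f: "f \<in> hom Y W" "g \<in> hom W Y" "g * f - idt Y \<in> null Y Y"
    and j: "j \<in> hom Y' W" "q \<in> hom W Y'" "q * j - idt Y' \<in> null Y' Y'"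
    and eq: "j * q - f * g \<in> null W W"
  shows "iso Y' Y"
  unfolding iso_def
  using ob hom_mult[OF f(2) j(1)] hom_mult[OF j(2) f(1)]
    retraction_comp[OF f eq] retraction_comp[OF j null_sym[OF eq]] by blast

definition biprod :: "'o \<Rightarrow> 'o \<Rightarrow> 'o \<Rightarrow> 'm \<Rightarrow> 'm \<Rightarrow> 'm \<Rightarrow> 'm \<Rightarrow> bool" where
  "biprod B Y Z i1 i2 p1 p2 \<longleftrightarrow> ob B \<and> ob Y \<and> ob Z \<and>
     i1 \<in> hom Y B \<and> i2 \<in> hom Z B \<and> p1 \<in> hom B Y \<and> p2 \<in> hom B Z \<and>
     p1 * i1 - idt Y \<in> null Y Y \<and> p2 * i2 - idt Z \<in> null Z Z \<and> p1 * i2 \<in> null Z Y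
       \<and> p2 * i1 \<in> null Y Z \<and>
     i1 * p1 + i2 * p2 - idt B \<in> null B B"

lemma biprodD:
  assumes "biprod B Y Z i1 i2 p1 p2"
  shows "ob B" "ob Y" "ob Z" "i1 \<in> hom Y B" "i2 \<in> hom Z B" "p1 \<in> hom B Y" "p2 \<in> hom B Z"
     "p1 * i1 - idt Y \<in> null Y Y" "p2 * i2 - idt Z \<in> null Z Z" "p1 * i2 \<in> null Z Y"
       "p2 * i1 \<in> null Y Z"
     "i1 * p1 + i2 * p2 - idt B \<in> null B B"
  using assms unfolding biprod_def by auto

definition strict_biprod :: "'o \<Rightarrow> 'o \<Rightarrow> 'o \<Rightarrow> 'm \<Rightarrow> 'm \<Rightarrow> 'm \<Rightarrow> 'm \<Rightarrow> bool" where
  "strict_biprod B Y Z i1 i2 p1 p2 \<longleftrightarrow> ob B \<and> ob Y \<and> ob Z \<and>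
     i1 \<in> hom Y B \<and> i2 \<in> hom Z B \<and> p1 \<in> hom B Y \<and> p2 \<in> hom B Z \<and>
     idem_biprod (idt B) (idt Y) (idt Z) i1 i2 p1 p2"

lemma strict_biprodD:
  assumes "strict_biprod B Y Z i1 i2 p1 p2"
  shows "ob B" "ob Y" "ob Z" "i1 \<in> hom Y B" "i2 \<in> hom Z B" "p1 \<in> hom B Y" "p2 \<in> hom B Z"
    "p1 * i1 = idt Y" "p2 * i2 = idt Z" "p1 * i2 = 0" "p2 * i1 = 0" "i1 * p1 + i2 * p2 = idt B"
  using assms unfolding strict_biprod_def idem_biprod_def by auto

lemma biprod_of_strict: "strict_biprod B Y Z i1 i2 p1 p2 \<Longrightarrow> biprod B Y Z i1 i2 p1 p2"
  unfolding biprod_def using strict_biprodD[of B Y Z i1 i2 p1 p2] by (simp add: null_zero)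

lemma biprod_swap: "biprod B Y Z i1 i2 p1 p2 \<Longrightarrow> biprod B Z Y i2 i1 p2 p1"
  unfolding biprod_def by (auto simp: add.commute)

lemma biprod_row_col:
  assumes b: "biprod B Y Z i1 i2 p1 p2"
    and s: "s1 \<in> hom Y C" "s2 \<in> hom Z C" and t: "t1 \<in> hom D Y" "t2 \<in> hom D Z"
  shows "(s1 * p1 + s2 * p2) * (i1 * t1 + i2 * t2) - (s1 * t1 + s2 * t2) \<in> null D C"
proof -
  note b = biprodD[OF b]
  have "(s1 * p1 + s2 * p2) * (i1 * t1 + i2 * t2) - (s1 * t1 + s2 * t2) =
    s1 * (p1 * i1 - idt Y) * t1 + s1 * (p1 * i2) * t2 + s2 * (p2 * i1) * t1
      + s2 * (p2 * i2 - idt Z) * t2"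
    using idt_left[OF t(1)] idt_left[OF t(2)] by (simp add: algebra_simps)
  also have "\<dots> \<in> null D C"
    by (intro null_add null_mid[OF b(8) s(1) t(1)] null_mid[OF b(10) s(1) t(2)]
        null_mid[OF b(11) s(2) t(1)] null_mid[OF b(9) s(2) t(2)])
  finally show ?thesis .
qed

lemma biprod_diagonal:
  assumes b: "biprod B Y Z i1 i2 p1 p2"
    and y: "y - idt Y \<in> null Y Y" and z: "z - idt Z \<in> null Z Z"
  shows "i1 * y * p1 + i2 * z * p2 - idt B \<in> null B B"
proof -
  note b = biprodD[OF b]
  have "i1 * y * p1 + i2 * z * p2 - idt B =
    i1 * (y - idt Y) * p1 + i2 * (z - idt Z) * p2 + (i1 * p1 + i2 * p2 - idt B)"
    using idt_left[OF b(6)] idt_left[OF b(7)] by (simp add: algebra_simps)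
  also have "\<dots> \<in> null B B" by (intro null_add null_mid[OF y b(4,6)] null_mid[OF z b(5,7)] b(12))
  finally show ?thesis .
qed

lemma biprod_map_comp:
  assumes b: "biprod B Y Z i1 i2 p1 p2" and c: "biprod B' Y' Z' j1 j2 q1 q2"
    and a: "a \<in> hom Y Y'" "a' \<in> hom Y' Y" "a' * a - idt Y \<in> null Y Y"
    and d: "d \<in> hom Z Z'" "d' \<in> hom Z' Z" "d' * d - idt Z \<in> null Z Z"
  shows "(i1 * a' * q1 + i2 * d' * q2) * (j1 * (a * p1) + j2 * (d * p2)) - idt B \<in> null B B"
proof -
  note hom = biprodD[OF b]
  have "(i1 * a' * q1 + i2 * d' * q2) * (j1 * (a * p1) + j2 * (d * p2))
      - (i1 * a' * (a * p1) + i2 * d' * (d * p2)) \<in> null B B"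
    by (rule biprod_row_col[OF c]) (use hom a d in \<open>auto intro: hom_mult\<close>)
  moreover have "i1 * a' * (a * p1) + i2 * d' * (d * p2) - idt B \<in> null B B"
    using biprod_diagonal[OF b a(3) d(3)] by (simp add: mult.assoc)
  ultimately show ?thesis by (rule null_trans)
qed

lemma biprod_cong:
  assumes b: "biprod B Y Z i1 i2 p1 p2" and c: "biprod B' Y' Z' j1 j2 q1 q2"
    and "iso Y Y'" "iso Z Z'"
  shows "iso B B'"
proof -
  obtain a a' where a: "a \<in> hom Y Y'" "a' \<in> hom Y' Y" "a' * a - idt Y \<in> null Y Y"
    "a * a' - idt Y' \<in> null Y' Y'"
    using assms(3) unfolding iso_def by blast
  obtain d d' where d: "d \<in> hom Z Z'" "d' \<in> hom Z' Z" "d' * d - idt Z \<in> null Z Z"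
    "d * d' - idt Z' \<in> null Z' Z'"
    using assms(4) unfolding iso_def by blast
  have "j1 * (a * p1) + j2 * (d * p2) \<in> hom B B'" "i1 * (a' * q1) + i2 * (d' * q2) \<in> hom B' B"
    using biprodD[OF b] biprodD[OF c] a d by (auto intro!: hom_add hom_mult)
  then show ?thesis
    unfolding iso_def
    using biprod_map_comp[OF b c a(1-3) d(1-3)] biprod_map_comp[OF c b a(2,1,4) d(2,1,4)]
      biprodD(1)[OF b] biprodD(1)[OF c] by (auto simp: mult.assoc)
qed

lemma biprod_exchange:
  assumes b: "biprod B X W j1 j2 q1 q2" and w: "biprod W Y W' f i g p"
    and v: "biprod V X W' k1 k2 r1 r2"
  shows "biprod B Y V (j2 * f) (j1 * r1 + j2 * (i * r2)) (g * q2) (k1 * q1 + k2 * p * q2)"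
proof -
  note b' = biprodD[OF b] and w' = biprodD[OF w] and v' = biprodD[OF v]
  have yy: "g * q2 * (j2 * f) - idt Y \<in> null Y Y"
    by (rule null_trans[OF _ w'(8)])
       (use biprod_row_col[OF b hom_zero w'(6) hom_zero w'(4)] in \<open>simp add: mult.assoc\<close>)
  have vv: "(k1 * q1 + k2 * p * q2) * (j1 * r1 + j2 * (i * r2)) - idt V \<in> null V V"
    by (rule null_trans[OF biprod_row_col[OF b v'(4) hom_mult[OF v'(5) w'(7)] v'(6)
      hom_mult[OF w'(5) v'(7)]]])
       (use biprod_diagonal[OF v _ w'(9), of "idt X"] idt_left[OF v'(6)] null_zero
         in \<open>simp add: mult.assoc\<close>)
  have "g * q2 * (j1 * r1 + j2 * (i * r2)) - g * (i * r2) \<in> null V Y"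
    using biprod_row_col[OF b hom_zero w'(6) v'(6) hom_mult[OF w'(5) v'(7)]]
    by (simp add: mult.assoc)
  then have vy: "g * q2 * (j1 * r1 + j2 * (i * r2)) \<in> null V Y"
    by (rule null_cong) (use null_right[OF w'(10) v'(7)] in \<open>simp add: mult.assoc\<close>)
  have "(k1 * q1 + k2 * p * q2) * (j2 * f) - k2 * (p * f) \<in> null Y V"
    using biprod_row_col[OF b v'(4) hom_mult[OF v'(5) w'(7)] hom_zero w'(4)]
    by (simp add: mult.assoc)
  then have yv: "(k1 * q1 + k2 * p * q2) * (j2 * f) \<in> null Y V"
    by (rule null_cong) (rule null_left[OF v'(5) w'(11)])
  have "(j1 * r1 + j2 * (i * r2)) * (k1 * q1 + k2 * p * q2) - (j1 * q1 + j2 * i * (p * q2))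
    \<in> null B B"
    using biprod_row_col[OF v b'(4) hom_mult[OF b'(5) w'(5)] b'(6) hom_mult[OF w'(7) b'(7)]]
    by (simp add: mult.assoc)
  moreover have "j1 * q1 + j2 * (f * g + i * p) * q2 - idt B \<in> null B B"
    using biprod_diagonal[OF b _ w'(12), of "idt X"] idt_left[OF b'(6)] null_zero
    by (simp add: mult.assoc)
  ultimately have "(j1 * r1 + j2 * (i * r2)) * (k1 * q1 + k2 * p * q2) - (j1 * q1
    + j2 * i * (p * q2))
      + (j1 * q1 + j2 * (f * g + i * p) * q2 - idt B) \<in> null B B" by (rule null_add)
  then have bb: "j2 * f * (g * q2) + (j1 * r1 + j2 * (i * r2)) * (k1 * q1 + k2 * p * q2) - idt B
    \<in> null B B"
    by (simp add: algebra_simps)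
  show ?thesis
    unfolding biprod_def using yy vv vy yv bb b' w' v' by (auto intro!: hom_add hom_mult)
qed

text \<open>For two decompositions \<open>B = Y \<oplus> Z = X \<oplus> W\<close> such that the component \<open>Y \<rightarrow> X\<close> of the identity
  is invertible with inverse \<open>a\<close>, the Schur complement of that component identifies \<open>Z\<close> and \<open>W\<close>.\<close>

lemma schur_complement_section:
  assumes b: "biprod B Y Z i1 i2 p1 p2" and c: "biprod B X W j1 j2 q1 q2"
    and a: "a \<in> hom X Y" "q1 * i1 * a - idt X \<in> null X X"
  shows "(p2 * j2) * (q2 * i2 - q2 * i1 * a * q1 * i2) - idt Z \<in> null Z Z"
proof -
  note b = biprodD[OF b] and c = biprodD[OF c]
  have "(p2 * j2) * (q2 * i2 - q2 * i1 * a * q1 * i2) - idt Z =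
    (p2 * i2 - idt Z) + p2 * (j1 * q1 + j2 * q2 - idt B) * i2 - (p2 * i1) * (a * q1 * i2)
    - p2 * (j1 * q1 + j2 * q2 - idt B) * (i1 * a * q1 * i2) + (p2 * j1) * (q1 * i1 * a - idt X)
      * (q1 * i2)"
    using idt_left[OF b(5)] idt_left[OF b(4)] idt_left[OF c(6)] idt_left[OF hom_mult[OF c(6) b(5)]]
      idt_left[OF hom_mult[OF b(4) hom_mult[OF a(1) hom_mult[OF c(6) b(5)]]]]
    by (simp add: algebra_simps)
  also have "\<dots> \<in> null Z Z"
    by (intro null_add null_diff b(9) null_mid[OF c(12) b(7,5)]
        null_right[OF b(11) hom_mult[OF hom_mult[OF a(1) c(6)] b(5)]]
        null_mid[OF c(12) b(7) hom_mult[OF hom_mult[OF hom_mult[OF b(4) a(1)] c(6)] b(5)]]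
        null_mid[OF a(2) hom_mult[OF b(7) c(4)] hom_mult[OF c(6) b(5)]])
  finally show ?thesis .
qed

lemma schur_complement_retraction:
  assumes b: "biprod B Y Z i1 i2 p1 p2" and c: "biprod B X W j1 j2 q1 q2"
    and a: "a \<in> hom X Y" "a * (q1 * i1) - idt Y \<in> null Y Y"
  shows "(q2 * i2 - q2 * i1 * a * q1 * i2) * (p2 * j2) - idt W \<in> null W W"
proof -
  note b = biprodD[OF b] and c = biprodD[OF c]
  have "(q2 * i2 - q2 * i1 * a * q1 * i2) * (p2 * j2) - idt W =
    (q2 * j2 - idt W) + q2 * (i1 * p1 + i2 * p2 - idt B) * j2 - (q2 * i1 * a) * (q1 * j2)
    - (q2 * i1 * a * q1) * (i1 * p1 + i2 * p2 - idt B) * j2 + (q2 * i1) * (a * (q1 * i1) - idt Y)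
      * (p1 * j2)"
    using idt_left[OF b(6)] idt_left[OF c(5)] idt_left[OF hom_mult[OF b(6) c(5)]]
    by (simp add: algebra_simps)
  also have "\<dots> \<in> null W W"
    by (intro null_add null_diff c(9) null_mid[OF b(12) c(7,5)]
        null_left[OF hom_mult[OF hom_mult[OF c(7) b(4)] a(1)] c(10)]
        null_mid[OF b(12) hom_mult[OF hom_mult[OF hom_mult[OF c(7) b(4)] a(1)] c(6)] c(5)]
        null_mid[OF a(2) hom_mult[OF c(7) b(4)] hom_mult[OF b(6) c(5)]])
  finally show ?thesis .
qed

lemma biprod_complement_iso:
  assumes b: "biprod B Y Z i1 i2 p1 p2" and c: "biprod B X W j1 j2 q1 q2"
    and a: "a \<in> hom X Y" "a * (q1 * i1) - idt Y \<in> null Y Y" "q1 * i1 * a - idt X \<in> null X X"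
  shows "iso Z W"
proof -
  have "q2 * i2 - q2 * i1 * a * q1 * i2 \<in> hom Z W" "p2 * j2 \<in> hom W Z"
    using biprodD[OF b] biprodD[OF c] a(1) by (auto intro!: hom_diff hom_mult)
  then show ?thesis
    unfolding iso_def
    using schur_complement_section[OF b c a(1,3)] schur_complement_retraction[OF b c a(1,2)]
      biprodD(3)[OF b] biprodD(3)[OF c] by blast
qed

lemma biprod_projection_nonzero:
  assumes b: "biprod B Y Z i1 i2 p1 p2" and Y: "idt Y \<notin> null Y Y"
  shows "i1 * p1 \<notin> null B B"
proof
  assume null: "i1 * p1 \<in> null B B"
  note b = biprodD[OF b]
  have "idt Y = p1 * (i1 * p1) * i1 - (p1 * i1) * (p1 * i1 - idt Y) - (p1 * i1 - idt Y)"
    using idt_right[OF b(4)] by (simp add: algebra_simps)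
  also have "\<dots> \<in> null Y Y"
    by (intro null_diff b(8) null_mid[OF null b(6,4)] null_left[OF hom_mult[OF b(6,4)] b(8)])
  finally show False using Y by blast
qed

lemma biprod_zero:
  assumes b: "biprod B Y Z i1 i2 p1 p2" and "idt B \<in> null B B" shows "idt Y \<in> null Y Y"
  using biprod_projection_nonzero[OF b] null_left[OF _ assms(2)] idt_right biprodD[OF b] hom_mult
  by metis

end

text \<open>The assumption \<open>exchange\<close> says that endomorphism rings modulo \<open>null\<close> are exchange rings;
  \<open>osize\<close> bounds the number of summands.\<close>

locale krull_schmidt_category = ideal_category ob hom null idt
  for ob :: "'o \<Rightarrow> bool" and hom null :: "'o \<Rightarrow> 'o \<Rightarrow> 'm::ring set" and idt :: "'o \<Rightarrow> 'm" +
  fixes osum :: "'o \<Rightarrow> 'o \<Rightarrow> 'o" and ozero :: 'o and osize :: "'o \<Rightarrow> nat"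
  assumes ob_ozero: "ob ozero" and idt_ozero: "idt ozero = 0"
    and biproduct: "ob X \<Longrightarrow> ob Y \<Longrightarrow> \<exists>i1 i2 p1 p2. strict_biprod (osum X Y) X Y i1 i2 p1 p2"
    and exchange: "ob X \<Longrightarrow> f \<in> hom X X \<Longrightarrow> \<exists>e\<in>hom X X. \<exists>u\<in>hom X X. \<exists>v\<in>hom X X. e * e - e \<in> null X X \<and>
      f * u - e \<in> null X X \<and> u * f - e \<in> null X X \<and>
      (idt X - f) * v - (idt X - e) \<in> null X X \<and> v * (idt X - f) - (idt X - e) \<in> null X X"
    and splitting: "ob X \<Longrightarrow> f \<in> hom X X \<Longrightarrow> f * f - f \<in> null X X \<Longrightarrow> \<exists>Y Z i1 i2 p1 p2.
      strict_biprod X Y Z i1 i2 p1 p2 \<and> i1 * p1 - f \<in> null X X \<and>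
      (f \<notin> null X X \<longrightarrow> idt X - f \<notin> null X X \<longrightarrow> osize Y < osize X \<and> osize Z < osize X)"
begin

lemma ob_osum: "ob X \<Longrightarrow> ob Y \<Longrightarrow> ob (osum X Y)"
  using biproduct[of X Y] strict_biprodD(1) by blast

lemma biprod_osum:
  assumes "ob X" "ob Y" obtains i1 i2 p1 p2 where "biprod (osum X Y) X Y i1 i2 p1 p2"
  using biproduct[OF assms] biprod_of_strict by blast

lemma iso_osum_of_biprod: "biprod B Y Z i1 i2 p1 p2 \<Longrightarrow> iso B (osum Y Z)"
  using biprod_osum[of Y Z] biprod_cong iso_refl biprodD(2,3) by metis

lemma osum_cong: "iso X X' \<Longrightarrow> iso Y Y' \<Longrightarrow> iso (osum X Y) (osum X' Y')"
  using biprod_osum[of X Y] biprod_osum[of X' Y'] biprod_cong iso_ob by metis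

lemma osum_commute: "ob X \<Longrightarrow> ob Y \<Longrightarrow> iso (osum X Y) (osum Y X)"
  using biprod_osum[of X Y] biprod_swap iso_osum_of_biprod by metis

lemma biprod_of_iso_osum:
  assumes "iso B (osum Y Z)" "ob Y" "ob Z" obtains i1 i2 p1 p2 where "biprod B Y Z i1 i2 p1 p2"
proof -
  obtain f g where f: "f \<in> hom B (osum Y Z)" "g \<in> hom (osum Y Z) B" "g * f - idt B \<in> null B B"
    "f * g - idt (osum Y Z) \<in> null (osum Y Z) (osum Y Z)" and B: "ob B"
    using assms(1) unfolding iso_def by blast
  obtain j1 j2 q1 q2 where "biprod (osum Y Z) Y Z j1 j2 q1 q2" using biprod_osum[OF assms(2,3)] .
  note c = biprodD[OF this]
  have comp: "q * f * (g * j) - q * j \<in> null A C" if "q \<in> hom (osum Y Z) C"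
    "j \<in> hom A (osum Y Z)" for q j A C
  proof -
    have "q * f * (g * j) - q * j = q * (f * g - idt (osum Y Z)) * j"
      using idt_left[OF that(2)] by (simp add: algebra_simps)
    then show ?thesis using null_mid[OF f(4) that] by simp
  qed
  have "g * j1 * (q1 * f) + g * j2 * (q2 * f) - idt B =
    g * (j1 * q1 + j2 * q2 - idt (osum Y Z)) * f + (g * f - idt B)"
    using idt_left[OF f(1)] by (simp add: algebra_simps)
  also have "\<dots> \<in> null B B" by (intro null_add f(3) null_mid[OF c(12) f(2,1)])
  finally have sum: "g * j1 * (q1 * f) + g * j2 * (q2 * f) - idt B \<in> null B B" .
  have "biprod B Y Z (g * j1) (g * j2) (q1 * f) (q2 * f)"
    unfolding biprod_def
    by (intro conjI B c(2,3) hom_mult[OF f(2) c(4)] hom_mult[OF f(2) c(5)] hom_mult[OF c(6) f(1)]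
        hom_mult[OF c(7) f(1)] null_trans[OF comp[OF c(6,4)] c(8)]
          null_trans[OF comp[OF c(7,5)] c(9)]
        null_cong[OF comp[OF c(6,5)] c(10)] null_cong[OF comp[OF c(7,4)] c(11)] sum)
  then show thesis using that by blast
qed

lemma iso_ozero_iff: "ob X \<Longrightarrow> iso X ozero \<longleftrightarrow> idt X \<in> null X X"
proof
  assume "ob X" "idt X \<in> null X X"
  then show "iso X ozero"
    unfolding iso_def using ob_ozero hom_zero idt_ozero null_uminus null_zero
    by (auto intro!: bexI[of _ 0])
next
  assume "iso X ozero"
  then obtain f g where f: "f \<in> hom X ozero" "g \<in> hom ozero X" "g * f - idt X \<in> null X X"
    unfolding iso_def by blast
  have "f = 0" using idt_left[OF f(1)] idt_ozero by simp
  then show "idt X \<in> null X X" using null_uminus[OF f(3)] by simp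
qed

lemma osum_ozero: assumes "ob X" shows "iso (osum X ozero) X"
proof -
  have "biprod X X ozero (idt X) 0 (idt X) 0"
    unfolding biprod_def
    using assms idt_hom[OF assms] idt_left[OF idt_hom[OF assms]] ob_ozero hom_zero null_zero
      idt_ozero by auto
  then show ?thesis using iso_osum_of_biprod iso_sym by blast
qed

lemma osum_left_commute: "ob X \<Longrightarrow> ob Y \<Longrightarrow> ob Z \<Longrightarrow> iso (osum X (osum Y Z)) (osum Y (osum X Z))"
  using biprod_osum[of X "osum Y Z"] biprod_osum[of Y Z] biprod_osum[of X Z] biprod_exchange
    iso_osum_of_biprod ob_osum by metis

lemma osum_assoc:
  assumes "ob X" "ob Y" "ob Z" shows "iso (osum (osum X Y) Z) (osum X (osum Y Z))"
proof -
  have "iso (osum (osum X Y) Z) (osum Z (osum X Y))" using assms by (intro osum_commute ob_osum)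
  moreover have "iso (osum Z (osum X Y)) (osum X (osum Z Y))"
    using assms by (intro osum_left_commute)
  moreover have "iso (osum X (osum Z Y)) (osum X (osum Y Z))"
    using assms by (intro osum_cong iso_refl osum_commute)
  ultimately show ?thesis using iso_trans by blast
qed

definition indec :: "'o \<Rightarrow> bool" where
  "indec X \<longleftrightarrow> ob X \<and> \<not> iso X ozero \<and>
     (\<forall>Y Z. ob Y \<longrightarrow> ob Z \<longrightarrow> iso X (osum Y Z) \<longrightarrow> iso Y ozero \<or> iso Z ozero)"

lemma indec_ob: "indec X \<Longrightarrow> ob X" and indec_nonzero: "indec X \<Longrightarrow> idt X \<notin> null X X"
  unfolding indec_def using iso_ozero_iff by blast+

lemma indec_local:
  assumes X: "indec X" and f: "f \<in> hom X X"
  shows "(\<exists>u\<in>hom X X. f * u - idt X \<in> null X X \<and> u * f - idt X \<in> null X X) \<or>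
    (\<exists>v\<in>hom X X. (idt X - f) * v - idt X \<in> null X X \<and> v * (idt X - f) - idt X \<in> null X X)"
proof -
  note ob_X = indec_ob[OF X]
  obtain e u v where e: "e \<in> hom X X" "u \<in> hom X X" "v \<in> hom X X" "e * e - e \<in> null X X"
    and u: "f * u - e \<in> null X X" "u * f - e \<in> null X X"
    and v: "(idt X - f) * v - (idt X - e) \<in> null X X" "v * (idt X - f) - (idt X - e) \<in> null X X"
    using exchange[OF ob_X f] by blast
  obtain Y Z i1 i2 p1 p2 where b: "strict_biprod X Y Z i1 i2 p1 p2" and ie: "i1 * p1 - e \<in> null X X"
    using splitting[OF ob_X e(1,4)] by blast
  note b' = strict_biprodD[OF b]
  have "iso X (osum Y Z)" by (rule iso_osum_of_biprod[OF biprod_of_strict[OF b]])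
  then have "iso Y ozero \<or> iso Z ozero" using X b'(2,3) unfolding indec_def by blast
  then show ?thesis
  proof
    assume "iso Y ozero"
    then have "i1 * p1 \<in> null X X" using null_through_zero iso_ozero_iff b' by blast
    then have "e \<in> null X X" using null_diff[OF _ ie] by fastforce
    then have "(idt X - f) * v - idt X \<in> null X X" "v * (idt X - f) - idt X \<in> null X X"
      using null_diff[OF v(1)] null_diff[OF v(2)] by fastforce+
    then show ?thesis using e by blast
  next
    assume "iso Z ozero"
    then have "i2 * p2 \<in> null X X" using null_through_zero iso_ozero_iff b' by blast
    then have "e - idt X \<in> null X X"
      using null_sym[OF ie] b'(12) null_diff[of "e - i1 * p1" X X "i2 * p2"]
      by (simp add: algebra_simps)
    then have "f * u - idt X \<in> null X X" "u * f - idt X \<in> null X X"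
      using null_trans u by blast+
    then show ?thesis using e by blast
  qed
qed

lemma retract_of_indec:
  assumes X: "indec X" and Y: "idt Y \<notin> null Y Y" and f: "f \<in> hom Y X" "g \<in> hom X Y"
    "g * f - idt Y \<in> null Y Y"
  shows "f * g - idt X \<in> null X X"
proof -
  have idem: "f * g * (f * g) - f * g \<in> null X X" by (rule retraction_idempotent[OF f])
  have fg: "f * g \<in> hom X X" using hom_mult f by blast
  from indec_local[OF X fg] show ?thesis
  proof (elim disjE bexE conjE)
    fix u assume u: "u \<in> hom X X" "u * (f * g) - idt X \<in> null X X"
    have "f * g - idt X = - ((u * (f * g) - idt X) * (f * g)) + u * (f * g * (f * g) - f * g)
      + (u * (f * g) - idt X)"
      using idt_left[OF fg] by (simp add: algebra_simps)
    also have "\<dots> \<in> null X X"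
      using u idem fg by (intro null_add null_uminus null_right[OF u(2)] null_left[OF u(1)])
    finally show ?thesis .
  next
    fix v assume v: "v \<in> hom X X" "v * (idt X - f * g) - idt X \<in> null X X"
    have "idt Y = - (g * f - idt Y)
      + (- (g * (v * (idt X - f * g) - idt X) * f) - g * v * f * (g * f - idt Y))"
      using idt_right[OF f(1)] idt_left[OF f(1)] by (simp add: algebra_simps)
    also have "\<dots> \<in> null Y Y"
      by (intro null_add null_uminus null_diff f(3) null_mid[OF v(2) f(2,1)]
          null_left[OF hom_mult[OF hom_mult[OF f(2) v(1)] f(1)] f(3)])
    finally show ?thesis using Y by blast
  qed
qed

lemma retract_biprod:
  assumes f: "f \<in> hom Y W" "g \<in> hom W Y" "g * f - idt Y \<in> null Y Y" and ob: "ob Y" "ob W"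
  obtains W' i p where "biprod W Y W' f i g p"
proof -
  obtain Y' Z i1 i2 p1 p2 where "strict_biprod W Y' Z i1 i2 p1 p2"
    and eq: "i1 * p1 - f * g \<in> null W W"
    using splitting[OF ob(2) hom_mult[OF f(1,2)] retraction_idempotent[OF f]] by blast
  note b = strict_biprodD[OF this(1)]
  have "p2 * f = - (p2 * (i1 * p1 - f * g) * f) - (p2 * f) * (g * f - idt Y) + (p2 * i1) * (p1 * f)"
    using idt_right[OF f(1)] by (simp add: algebra_simps)
  also have "\<dots> \<in> null Y Z"
    unfolding b(11) mult_zero_left
    by (intro null_add null_uminus null_diff null_zero null_mid[OF eq b(7) f(1)]
        null_left[OF hom_mult[OF b(7) f(1)] f(3)])
  finally have p2f: "p2 * f \<in> null Y Z" .
  have "g * i2 = - (g * (i1 * p1 - f * g) * i2) - (g * f - idt Y) * (g * i2) + (g * i1) * (p1 * i2)"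
    using idt_left[OF f(2)] idt_left[OF hom_mult[OF f(2) b(5)]] by (simp add: algebra_simps)
  also have "\<dots> \<in> null Z Y"
    unfolding b(10) mult_zero_right
    by (intro null_add null_uminus null_diff null_zero null_mid[OF eq f(2) b(5)]
        null_right[OF f(3) hom_mult[OF f(2) b(5)]])
  finally have gi2: "g * i2 \<in> null Z Y" .
  have sum: "f * g + i2 * p2 - idt W \<in> null W W"
    using null_sym[OF eq] unfolding b(12)[symmetric] by simp
  have "biprod W Y Z f i2 g p2" unfolding biprod_def using f b ob p2f gi2 sum null_zero by auto
  then show thesis using that by blast
qed

definition osum_list :: "'o list \<Rightarrow> 'o" where "osum_list Xs = foldr osum Xs ozero"

lemma osum_list_simps [simp]: "osum_list [] = ozero" "osum_list (X # Xs) = osum X (osum_list Xs)"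
  unfolding osum_list_def by auto

lemma ob_osum_list: "(\<forall>X\<in>set Xs. ob X) \<Longrightarrow> ob (osum_list Xs)"
  by (induction Xs) (auto simp: ob_ozero ob_osum)

lemma osum_list_remove:
  "\<forall>Y\<in>set (Xs @ X # Ys). ob Y \<Longrightarrow> iso (osum_list (Xs @ X # Ys)) (osum X (osum_list (Xs @ Ys)))"
proof (induction Xs)
  case Nil
  then show ?case using ob_osum_list[of "X # Ys"] by (auto intro!: iso_refl)
next
  case (Cons Z Xs)
  then have "iso (osum_list ((Z # Xs) @ X # Ys)) (osum Z (osum X (osum_list (Xs @ Ys))))"
    by (auto intro!: osum_cong iso_refl)
  moreover have "iso (osum Z (osum X (osum_list (Xs @ Ys))))
    (osum X (osum Z (osum_list (Xs @ Ys))))"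
    using Cons.prems ob_osum_list[of "Xs @ Ys"] by (intro osum_left_commute) auto
  ultimately show ?case using iso_trans by simp
qed

lemma osum_list_append:
  "\<forall>Y\<in>set (Xs @ Ys). ob Y \<Longrightarrow> iso (osum_list (Xs @ Ys)) (osum (osum_list Xs) (osum_list Ys))"
proof (induction Xs)
  case Nil
  then have "ob (osum_list Ys)" using ob_osum_list by auto
  then show ?case using iso_trans[OF iso_sym[OF osum_ozero] osum_commute[OF _ ob_ozero], of
    "osum_list Ys"] by simp
next
  case (Cons X Xs)
  have ob: "ob X" "ob (osum_list Xs)" "ob (osum_list Ys)" using Cons.prems ob_osum_list by auto
  have "iso (osum_list ((X # Xs) @ Ys)) (osum X (osum (osum_list Xs) (osum_list Ys)))"
    using Cons ob by (auto intro!: osum_cong iso_refl)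
  moreover have "iso (osum X (osum (osum_list Xs) (osum_list Ys)))
    (osum (osum_list (X # Xs)) (osum_list Ys))"
    using iso_sym[OF osum_assoc[OF ob]] by simp
  ultimately show ?case by (rule iso_trans)
qed

lemma osum_list_cong:
  "mset (map iso_cls Xs) = mset (map iso_cls Ys) \<Longrightarrow> \<forall>X\<in>set Xs. ob X \<Longrightarrow> \<forall>X\<in>set Ys. ob X \<Longrightarrow>
   iso (osum_list Xs) (osum_list Ys)"
proof (induction Xs arbitrary: Ys)
  case Nil
  then show ?case using iso_refl[OF ob_ozero] by simp
next
  case (Cons X Xs)
  have "iso_cls X \<in># mset (map iso_cls Ys)"
    using Cons.prems(1) by (metis list.simps(9) list.set_intros(1) set_mset_mset)
  then obtain Y where Y: "Y \<in> set Ys" "iso_cls Y = iso_cls X" by auto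
  then obtain Us Vs where Ys: "Ys = Us @ Y # Vs" by (meson split_list)
  have "iso X Y" using Y(2) iso_cls_eq_iff[of X Y] Cons.prems by auto
  have "mset (map iso_cls Xs) = mset (map iso_cls (Us @ Vs))"
    using Cons.prems(1) Y(2) unfolding Ys by simp
  then have "iso (osum_list Xs) (osum_list (Us @ Vs))"
    using Cons.IH[of "Us @ Vs"] Cons.prems Ys by auto
  then have "iso (osum_list (X # Xs)) (osum Y (osum_list (Us @ Vs)))"
    using \<open>iso X Y\<close> by (simp add: osum_cong)
  moreover have "iso (osum Y (osum_list (Us @ Vs))) (osum_list Ys)"
    using osum_list_remove[of Us Y Vs] Cons.prems(3) Ys iso_sym by blast
  ultimately show ?case by (rule iso_trans)
qed

lemma osum_zeroD: "ob Y \<Longrightarrow> ob Z \<Longrightarrow> iso (osum Y Z) ozero \<Longrightarrow> iso Y ozero"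
  using biprod_osum biprod_zero iso_ozero_iff ob_osum by metis

lemma indec_summand_cases:
  assumes Y: "indec Y" and b: "biprod B Y Z i1 i2 p1 p2" and c: "biprod B X W j1 j2 q1 q2"
  shows "(\<exists>u\<in>hom Y Y. u * (p1 * j1 * (q1 * i1)) - idt Y \<in> null Y Y) \<or>
    (\<exists>v\<in>hom Y Y. v * (p1 * j2 * (q2 * i1)) - idt Y \<in> null Y Y)"
proof -
  note b' = biprodD[OF b] and c' = biprodD[OF c]
  let ?f = "p1 * j1 * (q1 * i1)" and ?g = "p1 * j2 * (q2 * i1)"
  have f: "?f \<in> hom Y Y" using b' c' by (intro hom_mult[of _ X] hom_mult[of _ B])
  have "?g - (idt Y - ?f) = p1 * (j1 * q1 + j2 * q2 - idt B) * i1 + (p1 * i1 - idt Y)"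
    using idt_left[OF b'(4)] by (simp add: algebra_simps)
  also have "\<dots> \<in> null Y Y" by (intro null_add b'(8) null_mid[OF c'(12) b'(6,4)])
  finally have g: "?g - (idt Y - ?f) \<in> null Y Y" .
  from indec_local[OF Y f] show ?thesis
  proof (elim disjE bexE conjE)
    fix v assume v: "v \<in> hom Y Y" "v * (idt Y - ?f) - idt Y \<in> null Y Y"
    have "v * ?g - v * (idt Y - ?f) \<in> null Y Y"
      using null_left[OF v(1) g] by (simp add: algebra_simps)
    then have "v * ?g - idt Y \<in> null Y Y" using v(2) null_trans by blast
    then show ?thesis using v(1) by blast
  qed blast
qed

lemma exchange_indec_summand:
  assumes indec: "indec X" "indec Y" and b: "biprod B Y Z i1 i2 p1 p2"
    and c: "biprod B X W j1 j2 q1 q2"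
    and u: "u \<in> hom Y Y" "u * (p1 * j1 * (q1 * i1)) - idt Y \<in> null Y Y"
  shows "iso Y X" "iso Z W"
proof -
  define g where "g = u * (p1 * j1)"
  have g: "g \<in> hom X Y" unfolding g_def using u biprodD[OF b] biprodD[OF c] by (intro hom_mult)
  have f: "q1 * i1 \<in> hom Y X" using biprodD[OF b] biprodD[OF c] by (intro hom_mult)
  have gf: "g * (q1 * i1) - idt Y \<in> null Y Y" using u(2) unfolding g_def by (simp add: mult.assoc)
  have fg: "q1 * i1 * g - idt X \<in> null X X"
    by (rule retract_of_indec[OF indec(1) indec_nonzero[OF indec(2)] f g gf])
  show "iso Z W" by (rule biprod_complement_iso[OF b c g gf fg])
  show "iso Y X" unfolding iso_def using indec indec_ob f g gf fg by blast
qed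

lemma exchange_into_summand:
  assumes b: "biprod B Y Z i1 i2 p1 p2" and c: "biprod B X W j1 j2 q1 q2"
    and v: "v \<in> hom Y Y" "v * (p1 * j2 * (q2 * i1)) - idt Y \<in> null Y Y"
  obtains W' where "ob W'" "iso W (osum Y W')" "iso Z (osum X W')"
proof -
  note b' = biprodD[OF b] and c' = biprodD[OF c]
  define g where "g = v * (p1 * j2)"
  have g: "g \<in> hom W Y" unfolding g_def using v b' c' by (intro hom_mult)
  have f: "q2 * i1 \<in> hom Y W" using b' c' by (intro hom_mult)
  have gf: "g * (q2 * i1) - idt Y \<in> null Y Y" using v(2) unfolding g_def by (simp add: mult.assoc)
  obtain W' i p where w: "biprod W Y W' (q2 * i1) i g p"
    using retract_biprod[OF f g gf b'(2) c'(3)] .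
  note ob_W' = biprodD(3)[OF w]
  obtain k1 k2 r1 r2 where k: "biprod (osum X W') X W' k1 k2 r1 r2"
    using biprod_osum[OF c'(2) ob_W'] .
  have "iso Z (osum X W')"
  proof (rule biprod_complement_iso[OF b biprod_exchange[OF c w k]])
    show "idt Y \<in> hom Y Y" using idt_hom b' by blast
    show "idt Y * (g * q2 * i1) - idt Y \<in> null Y Y" "g * q2 * i1 * idt Y - idt Y \<in> null Y Y"
      using gf idt_left[OF hom_mult[OF g f]] idt_right[OF hom_mult[OF g f]]
      by (simp_all add: mult.assoc)
  qed
  then show thesis using that ob_W' iso_osum_of_biprod[OF w] by blast
qed

lemma indec_exchange:
  "\<forall>X\<in>set Xs. indec X \<Longrightarrow> indec Y \<Longrightarrow> ob Z \<Longrightarrow> iso (osum Y Z) (osum_list Xs) \<Longrightarrow>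
   \<exists>Us X Vs. Xs = Us @ X # Vs \<and> iso Y X \<and> iso Z (osum_list (Us @ Vs))"
proof (induction Xs arbitrary: Z)
  case Nil
  then show ?case using osum_zeroD[of Y Z] unfolding indec_def by auto
next
  case (Cons X Xs)
  have ob: "ob X" "ob (osum_list Xs)" "ob Y" using Cons.prems ob_osum_list[of Xs] indec_ob by auto
  obtain i1 i2 p1 p2 where b: "biprod (osum Y Z) Y Z i1 i2 p1 p2"
    using biprod_osum[OF ob(3) Cons.prems(3)] .
  obtain j1 j2 q1 q2 where c: "biprod (osum Y Z) X (osum_list Xs) j1 j2 q1 q2"
    using biprod_of_iso_osum Cons.prems(4) ob by (metis osum_list_simps(2))
  from indec_summand_cases[OF Cons.prems(2) b c] show ?case
  proof (elim disjE bexE)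
    fix u assume "u \<in> hom Y Y" "u * (p1 * j1 * (q1 * i1)) - idt Y \<in> null Y Y"
    then have "iso Y X" "iso Z (osum_list Xs)"
      using exchange_indec_summand[OF _ Cons.prems(2) b c] Cons.prems(1) by simp_all
    then show ?thesis by (intro exI[of _ "[]"] exI[of _ X] exI[of _ Xs]) simp
  next
    fix v assume "v \<in> hom Y Y" "v * (p1 * j2 * (q2 * i1)) - idt Y \<in> null Y Y"
    then obtain W' where W': "ob W'" "iso (osum_list Xs) (osum Y W')" "iso Z (osum X W')"
      using exchange_into_summand[OF b c] by blast
    then obtain Us X' Vs where IH: "Xs = Us @ X' # Vs" "iso Y X'" "iso W' (osum_list (Us @ Vs))"
      using Cons.IH[of W'] Cons.prems iso_sym by auto
    have "iso (osum X W') (osum_list ((X # Us) @ Vs))"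
      using IH(3) ob by (simp add: osum_cong iso_refl)
    then have "iso Z (osum_list ((X # Us) @ Vs))" using W'(3) iso_trans by blast
    then show ?thesis using IH by (intro exI[of _ "X # Us"] exI[of _ X'] exI[of _ Vs]) simp
  qed
qed

theorem krull_schmidt:
  "\<forall>X\<in>set Xs. indec X \<Longrightarrow> \<forall>X\<in>set Ys. indec X \<Longrightarrow> iso (osum_list Xs) (osum_list Ys) \<Longrightarrow>
   mset (map iso_cls Xs) = mset (map iso_cls Ys)"
proof (induction Xs arbitrary: Ys)
  case Nil
  show ?case
  proof (cases Ys)
    case (Cons Y Ys')
    then have "iso (osum Y (osum_list Ys')) ozero" using Nil iso_sym by auto
    then have "iso Y ozero" using osum_zeroD[of Y "osum_list Ys'"] Nil Cons ob_osum_list[of Ys']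
      indec_ob by auto
    then show ?thesis using Nil Cons unfolding indec_def by auto
  qed simp
next
  case (Cons X Xs)
  have "ob (osum_list Xs)" using Cons.prems ob_osum_list indec_ob by auto
  then obtain Us Y Vs where Y: "Ys = Us @ Y # Vs" "iso X Y"
    "iso (osum_list Xs) (osum_list (Us @ Vs))"
    using indec_exchange[of Ys X "osum_list Xs"] Cons.prems by auto
  have "mset (map iso_cls Xs) = mset (map iso_cls (Us @ Vs))"
    using Cons.IH[of "Us @ Vs"] Cons.prems Y by auto
  moreover have "iso_cls X = iso_cls Y" using Y(2) iso_cls_eq_iff iso_ob by blast
  ultimately show ?case using Y(1) by simp
qed

lemma proper_splitting:
  assumes X: "ob X" "\<not> iso X ozero" "\<not> indec X"
  obtains Y Z where "ob Y" "ob Z" "iso X (osum Y Z)" "osize Y < osize X" "osize Z < osize X"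
proof -
  obtain Y Z where YZ: "ob Y" "ob Z" "iso X (osum Y Z)" "\<not> iso Y ozero" "\<not> iso Z ozero"
    using X unfolding indec_def by blast
  obtain i1 i2 p1 p2 where b: "biprod X Y Z i1 i2 p1 p2" using biprod_of_iso_osum YZ by metis
  note b' = biprodD[OF b]
  have "i1 * p1 \<notin> null X X" "i2 * p2 \<notin> null X X"
    using biprod_projection_nonzero[OF b] biprod_projection_nonzero[OF biprod_swap[OF b]] YZ
      iso_ozero_iff by auto
  moreover have "i2 * p2 \<in> null X X" if "idt X - i1 * p1 \<in> null X X"
    using null_add[OF b'(12) that] by (simp add: algebra_simps)
  ultimately obtain Y' Z' j1 j2 q1 q2 where split: "strict_biprod X Y' Z' j1 j2 q1 q2"
    and size: "osize Y' < osize X" "osize Z' < osize X"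
    using splitting[OF X(1) hom_mult[OF b'(4,6)] retraction_idempotent[OF b'(4,6,8)]] by blast
  show thesis
    by (rule that[OF strict_biprodD(2,3)[OF split] iso_osum_of_biprod[OF biprod_of_strict[OF split]]
      size])
qed

lemma decompose: "ob X \<Longrightarrow> \<exists>Xs. (\<forall>Y\<in>set Xs. indec Y) \<and> iso X (osum_list Xs)"
proof (induction "osize X" arbitrary: X rule: less_induct)
  case less
  consider (zero) "iso X ozero" | (indec) "indec X" | (split) "\<not> iso X ozero" "\<not> indec X" by blast
  then show ?case
  proof cases
    case zero
    then show ?thesis by (intro exI[of _ "[]"]) simp
  next
    case indec
    then show ?thesis using iso_sym[OF osum_ozero[OF less.prems]] by (intro exI[of _ "[X]"]) simp
  next
    case split
    then obtain Y Z where YZ: "ob Y" "ob Z" "iso X (osum Y Z)" "osize Y < osize X"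
      "osize Z < osize X"
      using proper_splitting[OF less.prems] by blast
    then obtain Ys Zs where Ys: "\<forall>Y\<in>set Ys. indec Y" "iso Y (osum_list Ys)"
      and Zs: "\<forall>Y\<in>set Zs. indec Y" "iso Z (osum_list Zs)"
      using less.hyps[OF YZ(4,1)] less.hyps[OF YZ(5,2)] by blast
    have "iso (osum (osum_list Ys) (osum_list Zs)) (osum_list (Ys @ Zs))"
      by (rule iso_sym, rule osum_list_append) (use Ys(1) Zs(1) indec_ob in auto)
    then have "iso X (osum_list (Ys @ Zs))"
      using iso_trans[OF YZ(3) iso_trans[OF osum_cong[OF Ys(2) Zs(2)]]] by blast
    then show ?thesis using Ys(1) Zs(1) by (intro exI[of _ "Ys @ Zs"]) auto
  qed
qed

definition summands :: "'o \<Rightarrow> 'o set multiset" where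
  "summands X = (SOME M. \<exists>Xs. (\<forall>Y\<in>set Xs. indec Y) \<and> iso X (osum_list Xs) \<and>
    M = mset (map iso_cls Xs))"

lemma summands_eqI:
  assumes "\<forall>Y\<in>set Xs. indec Y" "iso X (osum_list Xs)" shows "summands X = mset (map iso_cls Xs)"
proof -
  have "\<exists>M. \<exists>Xs. (\<forall>Y\<in>set Xs. indec Y) \<and> iso X (osum_list Xs) \<and> M = mset (map iso_cls Xs)"
    using assms by blast
  from someI_ex[OF this] obtain Ys where "\<forall>Y\<in>set Ys. indec Y" "iso X (osum_list Ys)"
    "summands X = mset (map iso_cls Ys)"
    unfolding summands_def by blast
  then show ?thesis using krull_schmidt[OF assms(1) _ iso_trans[OF iso_sym[OF assms(2)]], of Ys]
    by simp
qed

lemma summands_decompose: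
  assumes "ob X"
  obtains Xs where "\<forall>Y\<in>set Xs. indec Y" "iso X (osum_list Xs)" "summands X = mset (map iso_cls Xs)"
  using decompose[OF assms] summands_eqI by blast

lemma summands_osum:
  assumes "ob X" "ob Y" shows "summands (osum X Y) = summands X + summands Y"
proof -
  obtain Xs where X: "\<forall>Y\<in>set Xs. indec Y" "iso X (osum_list Xs)"
    "summands X = mset (map iso_cls Xs)"
    using summands_decompose[OF assms(1)] .
  obtain Ys where Y: "\<forall>Y\<in>set Ys. indec Y" "iso Y (osum_list Ys)"
    "summands Y = mset (map iso_cls Ys)"
    using summands_decompose[OF assms(2)] .
  have "iso (osum (osum_list Xs) (osum_list Ys)) (osum_list (Xs @ Ys))"
    by (rule iso_sym, rule osum_list_append) (use X(1) Y(1) indec_ob in auto)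
  from iso_trans[OF osum_cong[OF X(2) Y(2)] this] have "iso (osum X Y) (osum_list (Xs @ Ys))" .
  then show ?thesis using summands_eqI[of "Xs @ Ys"] X Y by auto
qed

lemma summands_iso: "iso X Y \<Longrightarrow> summands X = summands Y"
  using summands_decompose[OF iso_ob(2)] summands_eqI[OF _ iso_trans] by metis

lemma iso_iff_summands: "ob X \<Longrightarrow> ob Y \<Longrightarrow> iso X Y \<longleftrightarrow> summands X = summands Y"
proof
  assume ob: "ob X" "ob Y" and eq: "summands X = summands Y"
  obtain Xs where X: "\<forall>Y\<in>set Xs. indec Y" "iso X (osum_list Xs)"
    "summands X = mset (map iso_cls Xs)"
    using summands_decompose[OF ob(1)] .
  obtain Ys where Y: "\<forall>Y\<in>set Ys. indec Y" "iso Y (osum_list Ys)"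
    "summands Y = mset (map iso_cls Ys)"
    using summands_decompose[OF ob(2)] .
  have "iso (osum_list Xs) (osum_list Ys)" using osum_list_cong[of Xs Ys] X Y eq indec_ob by auto
  then show "iso X Y" by (rule iso_trans[OF X(2) iso_trans[OF _ iso_sym[OF Y(2)]]])
qed (rule summands_iso)

lemma summands_ozero: "summands ozero = {#}"
  using summands_eqI[of "[]" ozero] iso_refl[OF ob_ozero] by simp

lemma summands_indec: "indec X \<Longrightarrow> summands X = {#iso_cls X#}"
  using summands_eqI[of "[X]" X] iso_sym[OF osum_ozero] indec_ob by simp

lemma summands_osum_list_replicate:
  assumes "ob Y" shows "set_mset (summands (osum_list (replicate n Y))) \<subseteq> set_mset (summands Y)"
  by (induction n) (auto simp: assms summands_ozero summands_osum ob_osum_list)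

lemma summands_indec_class:
  assumes "ob X" "c \<in># summands X" shows "\<exists>Y. indec Y \<and> c = iso_cls Y"
proof -
  obtain Xs where "\<forall>Y\<in>set Xs. indec Y" "summands X = mset (map iso_cls Xs)"
    using summands_decompose[OF assms(1)] .
  then show ?thesis using assms(2) by auto
qed

lemma ex_object_of_summands: "(\<forall>c\<in>#M. \<exists>Y. indec Y \<and> c = iso_cls Y) \<Longrightarrow> \<exists>X. ob X \<and> summands X = M"
proof (induction M)
  case empty
  then show ?case using ob_ozero summands_ozero by blast
next
  case (add c M)
  then obtain Y X where "indec Y" "c = iso_cls Y" "ob X" "summands X = M" by auto
  then show ?case
    using summands_osum[of Y X] summands_indec ob_osum indec_ob by (intro exI[of _ "osum Y X"]) auto
qed

lemma summands_empty_iff: "ob X \<Longrightarrow> summands X = {#} \<longleftrightarrow> idt X \<in> null X X"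
  using iso_iff_summands[OF _ ob_ozero] summands_ozero iso_ozero_iff by simp

lemma iso_cls_in_summands_iff:
  assumes "ob X" "indec Y" shows "iso_cls Y \<in># summands X \<longleftrightarrow> (\<exists>Z. ob Z \<and> iso X (osum Y Z))"
proof
  assume "iso_cls Y \<in># summands X"
  have "\<forall>c\<in>#summands X - {#iso_cls Y#}. \<exists>Y. indec Y \<and> c = iso_cls Y"
    using summands_indec_class[OF assms(1)] in_diffD by metis
  from ex_object_of_summands[OF this] obtain Z where Z: "ob Z"
    "summands Z = summands X - {#iso_cls Y#}" by blast
  then have "summands (osum Y Z) = summands X"
    using summands_osum[of Y Z] summands_indec[OF assms(2)] indec_ob[OF assms(2)] \<open>iso_cls Y \<in>#
      summands X\<close> by simp
  then show "\<exists>Z. ob Z \<and> iso X (osum Y Z)"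
    using iso_iff_summands[OF assms(1)] ob_osum indec_ob[OF assms(2)] Z(1) by metis
next
  assume "\<exists>Z. ob Z \<and> iso X (osum Y Z)"
  then obtain Z where "ob Z" "iso X (osum Y Z)" by blast
  then have "summands X = {#iso_cls Y#} + summands Z"
    using summands_iso summands_osum summands_indec assms indec_ob by metis
  then show "iso_cls Y \<in># summands X" by simp
qed

lemma summands_biprod: "biprod B Y Z i1 i2 p1 p2 \<Longrightarrow> summands B = summands Y + summands Z"
  using summands_iso[OF iso_osum_of_biprod] summands_osum[OF biprodD(2,3)] by metis

lemma summands_retract:
  assumes "f \<in> hom Y W" "g \<in> hom W Y" "g * f - idt Y \<in> null Y Y" "ob Y" "ob W"
  shows "summands Y \<subseteq># summands W"
proof -
  obtain W' i p where "biprod W Y W' f i g p" by (rule retract_biprod[OF assms])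
  then show ?thesis using summands_biprod by simp
qed

text \<open>An endomorphism of \<open>X\<close> factoring through an object without common summands is radical: the
  idempotent attached to it by \<open>exchange\<close> has as image a common summand.\<close>

lemma products_factor_through_copies:
  assumes Y: "ob Y" and "x \<in> products (hom Y X) (hom X Y)"
  shows "\<exists>n. \<exists>F\<in>hom X (osum_list (replicate n Y)). \<exists>G\<in>hom (osum_list (replicate n Y)) X. G * F - x
    \<in> null X X"
  using assms(2)
proof (induction rule: products.induct)
  case zero
  show ?case using hom_zero null_zero by (intro exI[of _ 0] bexI[of _ 0]) simp_all
next
  case (add g f x)
  then obtain n F G where FG: "F \<in> hom X (osum_list (replicate n Y))"
    "G \<in> hom (osum_list (replicate n Y)) X"
    "G * F - x \<in> null X X"
    by auto
  obtain i1 i2 p1 p2 where b: "biprod (osum Y (osum_list (replicate n Y))) Y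
    (osum_list (replicate n Y)) i1 i2 p1 p2"
    using biprod_osum[OF Y ob_osum_list[of "replicate n Y"]] Y by (metis in_set_replicate)
  note bD = biprodD[OF b]
  define F' where "F' = i1 * f + i2 * F"
  define G' where "G' = g * p1 + G * p2"
  have "G' * F' - (g * f + G * F) \<in> null X X"
    unfolding F'_def G'_def using add.hyps(1,2) FG by (intro biprod_row_col[OF b])
  moreover have "(g * f + G * F) - (g * f + x) \<in> null X X" using FG(3) by simp
  ultimately have "G' * F' - (g * f + x) \<in> null X X" by (rule null_trans)
  moreover have "F' \<in> hom X (osum_list (replicate (Suc n) Y))"
    "G' \<in> hom (osum_list (replicate (Suc n) Y)) X"
    unfolding F'_def G'_def using add.hyps(1,2) FG bD by (auto intro!: hom_add hom_mult)
  ultimately show ?case by blast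
qed

lemma summands_of_factorisation:
  assumes X: "ob X" and Y: "ob Y" and idt: "idt X \<in> products (hom Y X) (hom X Y)"
  shows "set_mset (summands X) \<subseteq> set_mset (summands Y)"
proof -
  obtain n F G where FG: "F \<in> hom X (osum_list (replicate n Y))"
    "G \<in> hom (osum_list (replicate n Y)) X"
    "G * F - idt X \<in> null X X"
    using products_factor_through_copies[OF Y idt] by blast
  have "summands X \<subseteq># summands (osum_list (replicate n Y))"
    using Y by (intro summands_retract[OF FG X] ob_osum_list) simp
  then show ?thesis using summands_osum_list_replicate[OF Y] set_mset_mono by blast
qed

lemma disjoint_summands_left_inverse:
  assumes X: "ob X" and W: "ob W" and disjoint: "set_mset (summands X) \<inter> set_mset (summands W) = {}"
    and F: "F \<in> hom W X" and G: "G \<in> hom X W"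
  shows "\<exists>v\<in>hom X X. v * (idt X - F * G) - idt X \<in> null X X"
proof -
  obtain e u v where e: "e \<in> hom X X" "u \<in> hom X X" "v \<in> hom X X" "e * e - e \<in> null X X"
    and u: "F * G * u - e \<in> null X X" and v: "v * (idt X - F * G) - (idt X - e) \<in> null X X"
    using exchange[OF X hom_mult[OF F G]] by blast
  obtain Y Z i1 i2 p1 p2 where "strict_biprod X Y Z i1 i2 p1 p2" and ie: "i1 * p1 - e \<in> null X X"
    using splitting[OF X e(1,4)] by blast
  note b = strict_biprodD[OF this(1)]
  have sub_X: "summands Y \<subseteq># summands X"
    using summands_retract[OF b(4,6) _ b(2) X] b(8) null_zero by simp
  have "p1 * (F * G * u - e) * i1 - p1 * (i1 * p1 - e) * i1 \<in> null Y Y"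
    by (intro null_diff null_mid[OF u b(6,4)] null_mid[OF ie b(6,4)])
  moreover have "p1 * (F * G * u - e) * i1 - p1 * (i1 * p1 - e) * i1
      = (p1 * F) * (G * u * i1) - (p1 * i1) * (p1 * i1)"
    by (simp add: algebra_simps)
  moreover have "(p1 * i1) * (p1 * i1) = idt Y" using b(8) idt_left[OF idt_hom[OF b(2)]] by simp
  ultimately have "(p1 * F) * (G * u * i1) - idt Y \<in> null Y Y" by simp
  then have sub_W: "summands Y \<subseteq># summands W"
    using summands_retract[OF hom_mult[OF hom_mult[OF G e(2)] b(4)] hom_mult[OF b(6) F] _ b(2) W]
    by simp
  have "summands Y = {#}"
    using mset_subset_eqD[OF sub_X] mset_subset_eqD[OF sub_W] disjoint
    by (metis IntI empty_iff multiset_nonemptyE)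
  then have "i1 * p1 \<in> null X X" using null_through_zero summands_empty_iff b by blast
  then have "e \<in> null X X" using null_cong[OF null_sym[OF ie]] by simp
  then have "v * (idt X - F * G) - (idt X - e) - e \<in> null X X" by (rule null_diff[OF v])
  then show ?thesis using e(3) by (intro bexI[of _ v]) (simp_all add: algebra_simps)
qed

lemma disjoint_summands_products_left_inverse:
  assumes X: "ob X" and Y: "ob Y" and disjoint: "set_mset (summands X) \<inter> set_mset (summands Y) = {}"
    and x: "x \<in> products (hom Y X) (hom X Y)"
  shows "\<exists>v\<in>hom X X. v * (idt X - x) - idt X \<in> null X X"
proof -
  obtain n F G where FG: "F \<in> hom X (osum_list (replicate n Y))"
    "G \<in> hom (osum_list (replicate n Y)) X"
    "G * F - x \<in> null X X"
    using products_factor_through_copies[OF Y x] by blast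
  have copies: "ob (osum_list (replicate n Y))" using Y by (intro ob_osum_list) simp
  have "set_mset (summands X) \<inter> set_mset (summands (osum_list (replicate n Y))) = {}"
    using disjoint summands_osum_list_replicate[OF Y] by blast
  then obtain v where v: "v \<in> hom X X" "v * (idt X - G * F) - idt X \<in> null X X"
    using disjoint_summands_left_inverse[OF X copies _ FG(2,1)] by blast
  have "v * (idt X - x) - idt X = v * (G * F - x) + (v * (idt X - G * F) - idt X)"
    by (simp add: algebra_simps)
  also have "\<dots> \<in> null X X" by (rule null_add[OF null_left[OF v(1) FG(3)] v(2)])
  finally show ?thesis using v(1) by blast
qed

end

section \<open>Direct sums, extensions, cones and shifts\<close>

subsection \<open>Inclusions and projections of blocks\<close>

definition gtranspose :: "'a::zero gmat \<Rightarrow> 'a gmat" where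
  "gtranspose x = Abs_gmat (\<lambda>u v. entry x v u)"

lemma entry_gtranspose: "entry (gtranspose x) u v = entry x v u"
proof -
  obtain I where "finite I" "supported_on I x" using ex_supported_on by blast
  then have "finite_support (\<lambda>u v. entry x v u)"
    by (intro finite_supportI) (auto simp: supported_onD)
  then show ?thesis unfolding gtranspose_def by (simp add: entry_Abs_gmat)
qed

definition block_incl :: "int \<Rightarrow> (int \<Rightarrow> nat) \<Rightarrow> (int \<Rightarrow> nat) \<Rightarrow> int \<Rightarrow> 'a::ring_1 gmat" where
  "block_incl c m n N = Abs_gmat (\<lambda>x y. if ix_degree y = ix_degree x + c \<and>
     ix_position x = ix_position y + m (ix_degree y) \<and> ix_position y < n (ix_degree y)
       \<and> \<bar>ix_degree y\<bar> \<le> N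
     then 1 else 0)"

definition block_proj :: "int \<Rightarrow> (int \<Rightarrow> nat) \<Rightarrow> (int \<Rightarrow> nat) \<Rightarrow> int \<Rightarrow> 'a::ring_1 gmat" where
  "block_proj c m n N = gtranspose (block_incl c m n N)"

lemma entry_block_incl: "entry (block_incl c m n N :: 'a::ring_1 gmat) (Ix i a) (Ix j b) =
    (if j = i + c \<and> a = b + m j \<and> b < n j \<and> \<bar>j\<bar> \<le> N then 1 else 0)"
proof -
  let ?m = "\<lambda>i. n i + n (i + c) + m i + m (i + c)"
  have "finite_support (\<lambda>x y. if ix_degree y = ix_degree x + c \<and>
     ix_position x = ix_position y + m (ix_degree y) \<and> ix_position y < n (ix_degree y)
       \<and> \<bar>ix_degree y\<bar> \<le> N
     then 1 else (0 :: 'a))"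
  proof (rule finite_supportI[OF finite_index_region[of "\<bar>N\<bar> + \<bar>c\<bar>" ?m]])
    fix x y assume "x \<notin> {w. \<bar>ix_degree w\<bar> \<le> \<bar>N\<bar> + \<bar>c\<bar> \<and> ix_position w < ?m (ix_degree w)} \<or>
      y \<notin> {w. \<bar>ix_degree w\<bar> \<le> \<bar>N\<bar> + \<bar>c\<bar> \<and> ix_position w < ?m (ix_degree w)}"
    then show "(if ix_degree y = ix_degree x + c \<and> ix_position x = ix_position y + m (ix_degree y) \<and>
      ix_position y < n (ix_degree y) \<and> \<bar>ix_degree y\<bar> \<le> N then 1 else (0 :: 'a)) = 0"
      by (cases x; cases y) auto
  qed
  then show ?thesis unfolding block_incl_def by (simp only: entry_Abs_gmat idx.sel)
qed

lemma entry_block_proj: "entry (block_proj c m n N :: 'a::ring_1 gmat) (Ix j b) (Ix i a) =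
    (if j = i + c \<and> a = b + m j \<and> b < n j \<and> \<bar>j\<bar> \<le> N then 1 else 0)"
  unfolding block_proj_def entry_gtranspose by (rule entry_block_incl)

lemma homog_block_incl: "homog (- c) (block_incl c m n N)"
  and homog_block_proj: "homog c (block_proj c m n N)"
  unfolding homog_def entry_block_incl entry_block_proj by (auto split: if_splits)

lemma entry_block_incl_mult: "entry (block_incl c m n N * y) (Ix i a) v =
    (if m (i + c) \<le> a \<and> a < m (i + c) + n (i + c) \<and> \<bar>i + c\<bar> \<le> N
     then entry y (Ix (i + c) (a - m (i + c))) v else 0)"
proof -
  have "entry (block_incl c m n N * y) (Ix i a) v =
    (\<Sum>w\<in>{Ix (i + c) (a - m (i + c))}. entry (block_incl c m n N) (Ix i a) w * entry y w v)"
  proof (rule entry_mult)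
    fix w assume "w \<notin> {Ix (i + c) (a - m (i + c))}"
    then show "entry (block_incl c m n N) (Ix i a) w = 0 \<or> entry y w v = 0"
      by (cases w) (auto simp: entry_block_incl)
  qed simp
  then show ?thesis by (auto simp: entry_block_incl)
qed

lemma entry_mult_block_proj: "entry (y * block_proj c m n N) v (Ix i a) =
    (if m (i + c) \<le> a \<and> a < m (i + c) + n (i + c) \<and> \<bar>i + c\<bar> \<le> N
     then entry y v (Ix (i + c) (a - m (i + c))) else 0)"
proof -
  have "entry (y * block_proj c m n N) v (Ix i a) =
    (\<Sum>w\<in>{Ix (i + c) (a - m (i + c))}. entry y v w * entry (block_proj c m n N) w (Ix i a))"
  proof (rule entry_mult)
    fix w assume "w \<notin> {Ix (i + c) (a - m (i + c))}"
    then show "entry y v w = 0 \<or> entry (block_proj c m n N) w (Ix i a) = 0"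
      by (cases w) (auto simp: entry_block_proj)
  qed simp
  then show ?thesis by (auto simp: entry_block_proj)
qed

definition within_size :: "int \<Rightarrow> (int \<Rightarrow> nat) \<Rightarrow> (int \<Rightarrow> nat) \<Rightarrow> 'a::zero gmat \<Rightarrow> bool" where
  "within_size N v u x \<longleftrightarrow>
     (\<forall>i a j b. \<bar>i\<bar> > N \<or> \<bar>j\<bar> > N \<or> a \<ge> v i \<or> b \<ge> u j \<longrightarrow> entry x (Ix i a) (Ix j b) = 0)"

lemma within_sizeD:
  "within_size N v u x \<Longrightarrow> \<bar>i\<bar> > N \<or> \<bar>j\<bar> > N \<or> a \<ge> v i \<or> b \<ge> u j \<Longrightarrow> entry x (Ix i a) (Ix j b) = 0"
  unfolding within_size_def by blast

lemma within_size_mono: "within_size N v u x \<Longrightarrow> N \<le> M \<Longrightarrow> within_size M v u x"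
  unfolding within_size_def by (meson order_le_less_trans)

lemma within_size_assemble_zero: "within_size N v u (assemble k v u (\<lambda>i. 0\<^sub>m (v (i + k)) (u i)) ::
  'a::ring_1 gmat)"
  unfolding within_size_def assemble_zero by simp

lemma ex_within_size:
  assumes "bounded_family k v u f" shows "\<exists>N. within_size N v u (assemble k v u f)"
proof -
  obtain N where "\<And>i a j b. N < \<bar>i\<bar> \<or> N < \<bar>j\<bar> \<Longrightarrow> entry (assemble k v u f) (Ix i a) (Ix j b) = 0"
    using ex_degree_bound by metis
  moreover have "entry (assemble k v u f) (Ix i a) (Ix j b) = 0" if "a \<ge> v i \<or> b \<ge> u j" for i a j b
    using that by (auto simp: entry_assemble[OF assms])
  ultimately show ?thesis unfolding within_size_def by blast
qed

lemma entry_block_conj: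
  assumes "within_size N v u x"
  shows "entry (block_incl c m v N * x * block_proj c' m' u N) (Ix i a) (Ix j b) =
    (if m (i + c) \<le> a \<and> m' (j + c') \<le> b
     then entry x (Ix (i + c) (a - m (i + c))) (Ix (j + c') (b - m' (j + c'))) else 0)"
  unfolding entry_mult_block_proj entry_block_incl_mult
  using within_sizeD[OF assms, of "i + c" "j + c'" "a - m (i + c)" "b - m' (j + c')"]
  by (cases "m (i + c) \<le> a"; cases "m' (j + c') \<le> b")
    (auto simp: le_diff_conv2 not_less add.commute)

lemma block_proj_incl:
  assumes "within_size N v u x" shows "block_proj c m v N * (block_incl c m v N * x) = x"
proof (rule gmat_eqI_Ix)
  fix i a j b
  have "entry (block_proj c m v N * (block_incl c m v N * x)) (Ix i a) (Ix j b) =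
    (\<Sum>w\<in>{Ix (i - c) (a + m i)}. entry (block_proj c m v N) (Ix i a) w
      * entry (block_incl c m v N * x) w (Ix j b))"
  proof (rule entry_mult)
    fix w assume "w \<notin> {Ix (i - c) (a + m i)}"
    then show "entry (block_proj c m v N) (Ix i a) w = 0 \<or>
      entry (block_incl c m v N * x) w (Ix j b) = 0"
      by (cases w) (auto simp: entry_block_proj)
  qed simp
  then show "entry (block_proj c m v N * (block_incl c m v N * x)) (Ix i a) (Ix j b)
    = entry x (Ix i a) (Ix j b)"
    using within_sizeD[OF assms, of i j a b]
    by (auto simp: entry_block_proj entry_block_incl_mult not_less not_le)
qed

lemma block_proj_incl_orthogonal:
  "block_proj c (\<lambda>_. 0) u N * block_incl 0 (\<lambda>i. u (i + c)) w N = (0 :: 'a::ring_1 gmat)"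
  "block_proj 0 (\<lambda>i. u (i + c)) w N * block_incl c (\<lambda>_. 0) u N = (0 :: 'a::ring_1 gmat)"
proof -
  show "block_proj c (\<lambda>_. 0) u N * block_incl 0 (\<lambda>i. u (i + c)) w N = (0 :: 'a gmat)"
    "block_proj 0 (\<lambda>i. u (i + c)) w N * block_incl c (\<lambda>_. 0) u N = (0 :: 'a gmat)"
    by (rule gmat_mult_zeroI, rename_tac x z y, case_tac z, case_tac x, case_tac y,
        auto simp: entry_block_proj entry_block_incl split: if_splits)+
qed

lemma bounded_family_four_block:
  assumes A: "bounded_family k v1 u1 A" and C: "bounded_family (k - c) v2 u1 C"
    and D: "bounded_family k v2 u2 D"
  shows "bounded_family k (\<lambda>i. v1 (i + c) + v2 i) (\<lambda>i. u1 (i + c) + u2 i)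
    (\<lambda>i. four_block_mat (A (i + c)) (0\<^sub>m (v1 (i + c + k)) (u2 i)) (C (i + c)) (D i))"
proof -
  let ?F = "\<lambda>i. four_block_mat (A (i + c)) (0\<^sub>m (v1 (i + c + k)) (u2 i)) (C (i + c)) (D i)"
  have index: "i + c + k = i + k + c" for i by simp
  have carrier: "?F i \<in> carrier_mat (v1 (i + k + c) + v2 (i + k)) (u1 (i + c) + u2 i)" for i
    using four_block_carrier_mat[OF bounded_family_carrier[OF A, of "i + c"]
      bounded_family_carrier[OF D, of i]]
    by (simp add: index)
  obtain N1 N2 N3 where N: "\<And>i. \<bar>i\<bar> > N1 \<Longrightarrow> A i = 0\<^sub>m (v1 (i + k)) (u1 i)"
    "\<And>i. \<bar>i\<bar> > N2 \<Longrightarrow> C i = 0\<^sub>m (v2 (i + (k - c))) (u1 i)"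
      "\<And>i. \<bar>i\<bar> > N3 \<Longrightarrow> D i = 0\<^sub>m (v2 (i + k)) (u2 i)"
    using A C D unfolding bounded_family_def by meson
  have "?F i = 0\<^sub>m (v1 (i + k + c) + v2 (i + k)) (u1 (i + c) + u2 i)"
    if "\<bar>i\<bar> > \<bar>N1\<bar> + \<bar>N2\<bar> + \<bar>N3\<bar> + \<bar>c\<bar>" for i
  proof -
    have "\<bar>i + c\<bar> > N1" "\<bar>i + c\<bar> > N2" "\<bar>i\<bar> > N3" using that by linarith+
    then show ?thesis using N by (intro eq_matI) (auto simp: algebra_simps)
  qed
  then show ?thesis unfolding bounded_family_def using carrier by blast
qed

lemma assemble_four_block:
  fixes A C D :: "int \<Rightarrow> 'a::ring_1 mat"
  assumes A: "bounded_family k v1 u1 A" and C: "bounded_family (k - c) v2 u1 C"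
    and D: "bounded_family k v2 u2 D"
    and size: "within_size N v1 u1 (assemble k v1 u1 A)"
      "within_size N v2 u1 (assemble (k - c) v2 u1 C)"
      "within_size N v2 u2 (assemble k v2 u2 D)"
  shows "assemble k (\<lambda>i. v1 (i + c) + v2 i) (\<lambda>i. u1 (i + c) + u2 i)
      (\<lambda>i. four_block_mat (A (i + c)) (0\<^sub>m (v1 (i + c + k)) (u2 i)) (C (i + c)) (D i)) =
    block_incl c (\<lambda>_. 0) v1 N * assemble k v1 u1 A * block_proj c (\<lambda>_. 0) u1 N
    + block_incl 0 (\<lambda>i. v1 (i + c)) v2 N * assemble (k - c) v2 u1 C * block_proj c (\<lambda>_. 0) u1 N
    + block_incl 0 (\<lambda>i. v1 (i + c)) v2 N * assemble k v2 u2 D * block_proj 0 (\<lambda>i. u1 (i + c)) u2 N"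
    (is "?L = ?R")
proof (rule gmat_eqI_Ix)
  fix i a j b
  have index: "j + c + k = j + k + c" by simp
  have carrier: "A (j + c) \<in> carrier_mat (v1 (j + k + c)) (u1 (j + c))"
    "C (j + c) \<in> carrier_mat (v2 (j + k)) (u1 (j + c))" "D j \<in> carrier_mat (v2 (j + k)) (u2 j)"
    using bounded_family_carrier[OF A, of "j + c"] bounded_family_carrier[OF C, of "j + c"]
      bounded_family_carrier[OF D, of j] by (simp_all add: algebra_simps)
  note blocks = entry_add entry_block_conj[OF size(1)] entry_block_conj[OF size(2)]
    entry_block_conj[OF size(3)]
    entry_assemble[OF A] entry_assemble[OF C] entry_assemble[OF D]
  show "entry ?L (Ix i a) (Ix j b) = entry ?R (Ix i a) (Ix j b)"
    unfolding blocks entry_assemble[OF bounded_family_four_block[OF A C D]]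
    using carrier by (auto simp: index algebra_simps)
qed

subsection \<open>Gluing\<close>

text \<open>\<open>B\<close> is \<open>X[c] \<oplus> Y\<close> with differential given by \<open>a\<close> on \<open>X\<close>, that of \<open>Y\<close>, and \<open>f\<close> from \<open>X\<close> to
  \<open>Y\<close>.\<close>

definition glued :: "int \<Rightarrow> 'a::ring total_cplx \<Rightarrow> 'a total_cplx \<Rightarrow> 'a total_cplx \<Rightarrow> 'a gmat \<Rightarrow> 'a gmat \<Rightarrow>
    'a gmat \<Rightarrow> 'a gmat \<Rightarrow> 'a gmat \<Rightarrow> 'a gmat \<Rightarrow> bool" where
  "glued c B X Y a f i1 i2 p1 p2 \<longleftrightarrow> homog (- c) i1 \<and> homog c p1 \<and> homog 0 i2 \<and> homog 0 p2 \<and>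
     idem_biprod (ide B) (ide X) (ide Y) i1 i2 p1 p2 \<and>
     dif B = i1 * a * p1 + i2 * f * p1 + i2 * dif Y * p2"

lemma gluedD:
  assumes "glued c B X Y a f i1 i2 p1 p2"
  shows "homog (- c) i1" "homog c p1" "homog 0 i2" "homog 0 p2"
     "i1 * ide X = i1" "ide X * p1 = p1" "i2 * ide Y = i2" "ide Y * p2 = p2"
     "p1 * i1 = ide X" "p2 * i2 = ide Y" "p1 * i2 = 0" "p2 * i1 = 0"
     "ide B = i1 * p1 + i2 * p2" "dif B = i1 * a * p1 + i2 * f * p1 + i2 * dif Y * p2"
  using assms unfolding glued_def idem_biprod_def idem_hom_def by auto

lemma glued_ide:
  assumes "glued c B X Y a f i1 i2 p1 p2"
  shows "ide B * i1 = i1" "ide B * i2 = i2" "p1 * ide B = p1" "p2 * ide B = p2"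
  using assms unfolding glued_def idem_biprod_def idem_hom_def by auto

lemma glued_simps:
  assumes "glued c B X Y a f i1 i2 p1 p2"
  shows "i1 * (ide X * y) = i1 * y" "ide X * (p1 * y) = p1 * y" "i2 * (ide Y * y) = i2 * y"
    "ide Y * (p2 * y) = p2 * y"
     "p1 * (i1 * y) = ide X * y" "p2 * (i2 * y) = ide Y * y" "p1 * (i2 * y) = 0" "p2 * (i1 * y) = 0"
  using gluedD[OF assms] by (simp_all add: mult.assoc[symmetric])

lemma total_complex_glued:
  assumes g: "glued c B X Y a f i1 i2 p1 p2" and X: "total_complex X" and Y: "total_complex Y"
    and a: "homog 1 a" "ide X * a = a" "a * ide X = a" "a * a = 0"
    and f: "homog (1 - c) f" "ide Y * f = f" "f * ide X = f" "dif Y * f + f * a = 0"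
  shows "total_complex B"
proof -
  note gD = gluedD[OF g] and gs = glued_simps[OF g]
  have absorb: "ide X * (ide X * y) = ide X * y" "ide Y * (ide Y * y) = ide Y * y"
    "ide Y * (dif Y * y) = dif Y * y"
    "dif Y * (ide Y * y) = dif Y * y" "dif Y * (dif Y * y) = 0"
    "ide X * (a * y) = a * y" "a * (ide X * y) = a * y" "a * (a * y) = 0"
    "ide Y * (f * y) = f * y" "f * (ide X * y) = f * y" for y
    using X Y a f unfolding total_complex_def by (simp_all add: mult.assoc[symmetric])
  have ff: "dif Y * (f * y) + f * (a * y) = 0" for y
    using f(4) by (simp add: mult.assoc[symmetric] distrib_right[symmetric])
  have "homog 0 (ide B)"
    using homog_mult[OF gD(1,2)] homog_mult[OF gD(3,4)] unfolding gD(13) by (auto intro: homog_add)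
  moreover have "homog 1 (dif B)"
    unfolding gD(14)
    using homog_mult[OF homog_mult[OF gD(1) a(1)] gD(2)]
      homog_mult[OF homog_mult[OF gD(3) f(1)] gD(2)]
      homog_mult[OF homog_mult[OF gD(3), of 1 "dif Y"] gD(4)] Y
    unfolding total_complex_def by (auto intro!: homog_add)
  moreover have "ide B * ide B = ide B" "ide B * dif B = dif B" "dif B * ide B = dif B"
    unfolding gD(13,14) using gD gs absorb by (simp_all add: distrib_left distrib_right mult.assoc)
  moreover have "dif B * dif B = i2 * (dif Y * (f * p1) + f * (a * p1))"
    unfolding gD(14) using gD gs absorb
    by (simp add: distrib_left distrib_right mult.assoc add.commute)
  ultimately show ?thesis unfolding total_complex_def using ff by simp
qed

lemma glued_maps:
  assumes g: "glued c B X Y a f i1 i2 p1 p2" and Y: "total_complex Y"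
    and a: "a \<in> idem_hom (ide X) (ide X)" and f: "f \<in> idem_hom (ide X) (ide Y)"
  shows "i1 \<in> Hom (- c) X B" "p1 \<in> Hom c B X" "i2 \<in> ZHom 0 Y B" "p2 \<in> Hom 0 B Y"
    "dif B * i1 = i1 * a + i2 * f" "p1 * dif B = a * p1" "p2 * dif B = f * p1 + dif Y * p2"
proof -
  note gD = gluedD[OF g] and gs = glued_simps[OF g] and aD = idem_homD[OF a]
    and fD = idem_homD[OF f]
  have absorb: "ide X * (a * y) = a * y" "a * (ide X * y) = a * y" "ide Y * (f * y) = f * y"
    "ide Y * (dif Y * y) = dif Y * y" "dif Y * (ide Y * y) = dif Y * y"
    "ide Y * dif Y = dif Y" "dif Y * ide Y = dif Y" for y
    using Y aD fD unfolding total_complex_def by (simp_all add: mult.assoc[symmetric])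
  show "i1 \<in> Hom (- c) X B" "p1 \<in> Hom c B X" "i2 \<in> ZHom 0 Y B" "p2 \<in> Hom 0 B Y"
    "dif B * i1 = i1 * a + i2 * f" "p1 * dif B = a * p1" "p2 * dif B = f * p1 + dif Y * p2"
    unfolding ZHom_def Hom_def using gD gs absorb aD fD glued_ide[OF g]
    by (simp_all add: distrib_left distrib_right mult.assoc)
qed

lemma glued_extension_maps:
  assumes g: "glued 0 B X Y (dif X) f i1 i2 p1 p2" and X: "total_complex X" and Y: "total_complex Y"
    and f: "f \<in> Hom 1 X Y"
  shows "i1 \<in> Hom 0 X B" "p2 \<in> Hom 0 B Y" "i2 \<in> ZHom 0 Y B" "p1 \<in> ZHom 0 B X"
    "dif B * i1 = i1 * dif X + i2 * f" "p2 * dif B = f * p1 + dif Y * p2"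
  using glued_maps[OF g Y Hom_idem_hom[OF dif_Hom[OF X]] Hom_idem_hom[OF f]]
  unfolding ZHom_def by simp_all

lemma glued_biproduct:
  assumes g: "glued 0 B X Y (dif X) 0 i1 i2 p1 p2" and X: "total_complex X" and Y: "total_complex Y"
  shows "i1 \<in> ZHom 0 X B" "i2 \<in> ZHom 0 Y B" "p1 \<in> ZHom 0 B X" "p2 \<in> ZHom 0 B Y"
  using glued_extension_maps[OF g X Y Hom_zero] unfolding ZHom_def by simp_all

lemma glued_of_blocks:
  assumes X: "total_complex X" and Y: "total_complex Y" and a: "ide X * a = a" "a * ide X = a"
    and f: "ide Y * f = f" "f * ide X = f"
    and homog: "homog (- c) s1" "homog c t1" "homog 0 s2" "homog 0 t2"
    and ts: "t1 * (s1 * ide X) = ide X" "t2 * (s2 * ide Y) = ide Y" "t1 * s2 = 0" "t2 * s1 = 0"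
    and B: "ide B = s1 * ide X * t1 + s2 * ide Y * t2"
      "dif B = s1 * a * t1 + s2 * f * t1 + s2 * dif Y * t2"
  shows "glued c B X Y a f (s1 * ide X) (s2 * ide Y) (ide X * t1) (ide Y * t2)"
proof -
  have orthogonal: "t1 * (s2 * y) = 0" "t2 * (s1 * y) = 0" for y
    using ts(3,4) by (simp_all add: mult.assoc[symmetric])
  have absorb: "ide X * (ide X * y) = ide X * y" "ide Y * (ide Y * y) = ide Y * y"
    "ide X * (a * y) = a * y" "a * (ide X * y) = a * y" "ide Y * (f * y) = f * y"
      "f * (ide X * y) = f * y"
    "ide Y * (dif Y * y) = dif Y * y" "dif Y * (ide Y * y) = dif Y * y" for y
    using X Y a f unfolding total_complex_def by (simp_all add: mult.assoc[symmetric])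
  have ee: "ide X * ide X = ide X" "ide Y * ide Y = ide Y" "homog 0 (ide X)" "homog 0 (ide Y)"
    using X Y unfolding total_complex_def by auto
  have "idem_biprod (ide B) (ide X) (ide Y) (s1 * ide X) (s2 * ide Y) (ide X * t1) (ide Y * t2)"
    by (rule idem_biprodI) (use ee ts orthogonal absorb B(1) in \<open>simp_all add: mult.assoc\<close>)
  then show ?thesis
    unfolding glued_def B(2) using homog ee absorb
    by (auto intro: homog_mult_0_left homog_mult_0_right simp: mult.assoc)
qed

lemma four_block_cplx_simps:
  fixes X Y B :: "'a::ring_1 cplx"
  assumes "\<And>i. cobj B i = pobj_sum (cobj X (i + c)) (cobj Y i)"
    and "\<And>i. cdif B i = four_block_mat (A (i + c)) (0\<^sub>m (csize X (i + c + 1)) (csize Y i))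
      (C (i + c)) (cdif Y i)"
  shows "csize B = (\<lambda>i. csize X (i + c) + csize Y i)"
    and "id_cmap B = (\<lambda>i. four_block_mat (id_cmap X (i + c)) (0\<^sub>m (csize X (i + c + 0)) (csize Y i))
      (0\<^sub>m (csize Y (i + c + (0 - c))) (csize X (i + c))) (id_cmap Y i))"
    and "cdif B = (\<lambda>i. four_block_mat (A (i + c)) (0\<^sub>m (csize X (i + c + 1)) (csize Y i))
      (C (i + c)) (cdif Y i))"
  by (simp_all add: fun_eq_iff csize_def id_cmap_def assms pobj_sum_def)

lemma total_four_block:
  fixes X Y B :: "'a::ring_1 cplx"
  assumes X: "is_complex X" and Y: "is_complex Y"
    and A: "bounded_family 1 (csize X) (csize X) A"
    and C: "bounded_family (1 - c) (csize Y) (csize X) C"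
  defines "a \<equiv> total_map 1 X X A" and "f \<equiv> total_map (1 - c) X Y C"
  assumes B: "\<And>i. cobj B i = pobj_sum (cobj X (i + c)) (cobj Y i)"
      "\<And>i. cdif B i = four_block_mat (A (i + c)) (0\<^sub>m (csize X (i + c + 1)) (csize Y i))
        (C (i + c)) (cdif Y i)"
  obtains N where "within_size N (csize X) (csize X) (ide (total X))"
    "within_size N (csize Y) (csize Y) (ide (total Y))"
    "ide (total B) = block_incl c (\<lambda>_. 0) (csize X) N * ide (total X)
      * block_proj c (\<lambda>_. 0) (csize X) N
      + block_incl 0 (\<lambda>i. csize X (i + c)) (csize Y) N * ide (total Y)
        * block_proj 0 (\<lambda>i. csize X (i + c)) (csize Y) N"
    "dif (total B) = block_incl c (\<lambda>_. 0) (csize X) N * a * block_proj c (\<lambda>_. 0) (csize X) N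
      + block_incl 0 (\<lambda>i. csize X (i + c)) (csize Y) N * f * block_proj c (\<lambda>_. 0) (csize X) N
      + block_incl 0 (\<lambda>i. csize X (i + c)) (csize Y) N * dif (total Y)
        * block_proj 0 (\<lambda>i. csize X (i + c)) (csize Y) N"
proof -
  note bX = bounded_total[OF X] and bY = bounded_total[OF Y]
  obtain N1 N2 N3 N4 N5 where "within_size N1 (csize X) (csize X) (ide (total X))"
    "within_size N2 (csize Y) (csize Y) (ide (total Y))" "within_size N3 (csize X) (csize X) a"
    "within_size N4 (csize Y) (csize X) f" "within_size N5 (csize Y) (csize Y) (dif (total Y))"
    using ex_within_size[OF bX(1)] ex_within_size[OF bY(1)] ex_within_size[OF A]
      ex_within_size[OF C]
      ex_within_size[OF bY(2)]
    unfolding a_def f_def total_simps by blast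
  note sizes = this[THEN within_size_mono]
  define N where "N = max (max N1 N2) (max N3 (max N4 N5))"
  have size: "within_size N (csize X) (csize X) (ide (total X))"
    "within_size N (csize Y) (csize Y) (ide (total Y))"
    "within_size N (csize X) (csize X) a" "within_size N (csize Y) (csize X) f"
    "within_size N (csize Y) (csize Y) (dif (total Y))"
    using sizes unfolding N_def by auto
  show thesis
    by (rule that[OF size(1,2)])
       (unfold total_simps four_block_cplx_simps[OF B] a_def f_def,
        use assemble_four_block[OF bX(1) bounded_family_zero bY(1) size(1)[unfolded total_simps]
            within_size_assemble_zero size(2)[unfolded total_simps]]
          assemble_four_block[OF A C bY(2) size(3,4,5)[unfolded total_simps a_def f_def]]
        in \<open>simp_all only: assemble_zero mult_zero_left mult_zero_right add_0_right\<close>)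
qed

lemma glued_four_block:
  fixes X Y B :: "'a::ring_1 cplx"
  assumes X: "is_complex X" and Y: "is_complex Y"
    and A: "bounded_family 1 (csize X) (csize X) A"
    and C: "bounded_family (1 - c) (csize Y) (csize X) C"
  defines "a \<equiv> total_map 1 X X A" and "f \<equiv> total_map (1 - c) X Y C"
  assumes a: "ide (total X) * a = a" "a * ide (total X) = a" "a * a = 0"
    and f: "ide (total Y) * f = f" "f * ide (total X) = f" "dif (total Y) * f + f * a = 0"
    and B: "\<And>i. cobj B i = pobj_sum (cobj X (i + c)) (cobj Y i)"
      "\<And>i. cdif B i = four_block_mat (A (i + c)) (0\<^sub>m (csize X (i + c + 1)) (csize Y i))
        (C (i + c)) (cdif Y i)"
  shows "is_complex B" "\<exists>i1 i2 p1 p2. glued c (total B) (total X) (total Y) a f i1 i2 p1 p2"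
proof -
  note bX = bounded_total[OF X] and bY = bounded_total[OF Y]
  obtain N where size: "within_size N (csize X) (csize X) (ide (total X))"
      "within_size N (csize Y) (csize Y) (ide (total Y))"
    and total_B: "ide (total B)
      = block_incl c (\<lambda>_. 0) (csize X) N * ide (total X) * block_proj c (\<lambda>_. 0) (csize X) N
      + block_incl 0 (\<lambda>i. csize X (i + c)) (csize Y) N * ide (total Y)
        * block_proj 0 (\<lambda>i. csize X (i + c)) (csize Y) N"
    "dif (total B) = block_incl c (\<lambda>_. 0) (csize X) N * a * block_proj c (\<lambda>_. 0) (csize X) N
      + block_incl 0 (\<lambda>i. csize X (i + c)) (csize Y) N * f * block_proj c (\<lambda>_. 0) (csize X) N
      + block_incl 0 (\<lambda>i. csize X (i + c)) (csize Y) N * dif (total Y)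
        * block_proj 0 (\<lambda>i. csize X (i + c)) (csize Y) N"
    using total_four_block[OF X Y A C B, folded a_def f_def] .
  have glued: "\<exists>i1 i2 p1 p2. glued c (total B) (total X) (total Y) a f i1 i2 p1 p2"
    by (intro exI, rule glued_of_blocks[OF total_complex_total[OF X] total_complex_total[OF Y]
      a(1,2) f(1,2)
          homog_block_incl homog_block_proj _ _ _ _ block_proj_incl_orthogonal total_B])
       (use homog_block_incl[of 0] homog_block_proj[of 0] block_proj_incl[OF size(1)]
         block_proj_incl[OF size(2)]
        in simp_all)
  then show "\<exists>i1 i2 p1 p2. glued c (total B) (total X) (total Y) a f i1 i2 p1 p2" .
  have bounded: "bounded_family 0 (csize B) (csize B) (id_cmap B)"
    "bounded_family 1 (csize B) (csize B) (cdif B)"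
    unfolding four_block_cplx_simps[OF B]
    using bounded_family_four_block[OF bX(1) bounded_family_zero bY(1)]
      bounded_family_four_block[OF A C bY(2)]
    by simp_all
  have "total_complex (total B)"
    using glued total_complex_glued[OF _ total_complex_total[OF X]
      total_complex_total[OF Y] _ a _ f]
      homog_assemble[OF A] homog_assemble[OF C] unfolding a_def f_def by blast
  then show "is_complex B" by (rule is_complexI[OF bounded])
qed

subsection \<open>Extensions and direct sums\<close>

definition extension_cplx :: "'a::ring_1 cplx \<Rightarrow> 'a cplx \<Rightarrow> (int \<Rightarrow> 'a mat) \<Rightarrow> 'a cplx" where
  "extension_cplx X Y C = ((\<lambda>i. pobj_sum (cobj X i) (cobj Y i)),
     (\<lambda>i. four_block_mat (cdif X i) (0\<^sub>m (csize X (i + 1)) (csize Y i)) (C i) (cdif Y i)))"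

lemma extension_glued:
  fixes X Y :: "'a::ring_1 cplx"
  assumes X: "is_complex X" and Y: "is_complex Y" and C: "bounded_family 1 (csize Y) (csize X) C"
    and F: "total_map 1 X Y C \<in> ZHom 1 (total X) (total Y)"
  shows "is_complex (extension_cplx X Y C)"
    "\<exists>i1 i2 p1 p2. glued 0 (total (extension_cplx X Y C)) (total X) (total Y) (dif (total X))
      (total_map 1 X Y C) i1 i2 p1 p2"
proof -
  note tX = total_complex_total[OF X, unfolded total_complex_def] and Fh = HomD[OF ZHomD(1)[OF F]]
  have F2: "dif (total Y) * total_map 1 X Y C + total_map 1 X Y C * dif (total X) = 0"
    using ZHomD(2)[OF F] by (simp add: add_eq_0_iff)
  have cplx: "cobj (extension_cplx X Y C) i = pobj_sum (cobj X (i + 0)) (cobj Y i)"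
    "cdif (extension_cplx X Y C) i
      = four_block_mat (cdif X (i + 0)) (0\<^sub>m (csize X (i + 0 + 1)) (csize Y i)) (C (i + 0))
        (cdif Y i)" for i
    by (simp_all add: extension_cplx_def cobj_def cdif_def)
  have C': "bounded_family (1 - 0) (csize Y) (csize X) C" using C by simp
  note block = glued_four_block[OF X Y bounded_total(2)[OF X] C' _ _ _ _ _ _ cplx, folded
    total_simps(2), unfolded diff_zero]
  show "is_complex (extension_cplx X Y C)" by (rule block(1)) (use tX Fh F2 in simp_all)
  show "\<exists>i1 i2 p1 p2. glued 0 (total (extension_cplx X Y C)) (total X) (total Y) (dif (total X))
    (total_map 1 X Y C) i1 i2 p1 p2"
    by (rule block(2)) (use tX Fh F2 in simp_all)
qed

lemma two_term_extension:
  assumes "two_term X" "two_term Y" "is_complex (extension_cplx X Y C)"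
  shows "two_term (extension_cplx X Y C)"
  unfolding two_term_def
proof (intro conjI allI impI assms(3))
  fix i :: int assume i: "i \<noteq> - 1 \<and> i \<noteq> 0"
  have "snd (cobj X i) = 0\<^sub>m (csize X i) (csize X i)" "snd (cobj Y i) = 0\<^sub>m (csize Y i) (csize Y i)"
    using assms(1,2) i unfolding two_term_def csize_def by blast+
  moreover have "cobj (extension_cplx X Y C) i = pobj_sum (cobj X i) (cobj Y i)"
    by (simp add: extension_cplx_def cobj_def)
  ultimately show "snd (cobj (extension_cplx X Y C) i) =
      0\<^sub>m (fst (cobj (extension_cplx X Y C) i)) (fst (cobj (extension_cplx X Y C) i))"
    unfolding pobj_sum_def by (intro eq_matI) (auto simp: csize_def)
qed

lemma ex_extension:
  assumes X: "is_complex X" and Y: "is_complex Y" and F: "F \<in> ZHom 1 (total X) (total Y)"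
  obtains U i1 i2 p1 p2 where "is_complex U"
    "glued 0 (total U) (total X) (total Y) (dif (total X)) F i1 i2 p1 p2"
    "two_term X \<Longrightarrow> two_term Y \<Longrightarrow> two_term U"
proof -
  obtain C where C: "C \<in> component_maps 1 X Y" "total_map 1 X Y C = F"
    using total_map_surj[OF X Y ZHomD(1)[OF F]] .
  note ext = extension_glued[OF X Y bounded_component_maps[OF X Y C(1)], unfolded C(2), OF F]
  show thesis using that ext two_term_extension[OF _ _ ext(1)] by blast
qed

lemma dsum_eq_extension: "X \<oplus>\<^sub>K Y = extension_cplx X Y (\<lambda>i. 0\<^sub>m (csize Y (i + 1)) (csize X i))"
  unfolding dsum_def extension_cplx_def csize_def ..

lemma dsum_glued:
  fixes X Y :: "'a::ring_1 cplx"
  assumes X: "is_complex X" and Y: "is_complex Y"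
  shows "is_complex (X \<oplus>\<^sub>K Y)"
    "\<exists>i1 i2 p1 p2. glued 0 (total (X \<oplus>\<^sub>K Y)) (total X) (total Y) (dif (total X)) 0 i1 i2 p1 p2"
  unfolding dsum_eq_extension
  using extension_glued[OF X Y bounded_family_zero] by (simp_all add: assemble_zero)

lemma two_term_dsum: "two_term X \<Longrightarrow> two_term Y \<Longrightarrow> two_term (X \<oplus>\<^sub>K Y)"
  using two_term_extension[of X Y] dsum_glued(1)[of X Y] unfolding dsum_eq_extension two_term_def
  by blast

lemma zero_cplx_simps: "csize (zero_cplx :: 'a::ring_1 cplx) = (\<lambda>_. 0)"
  "id_cmap (zero_cplx :: 'a cplx) = (\<lambda>i. 0\<^sub>m ((\<lambda>_. 0) (i + 0)) ((\<lambda>_. 0) i))"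
  "cdif (zero_cplx :: 'a cplx) = (\<lambda>i. 0\<^sub>m ((\<lambda>_. 0) (i + 1)) ((\<lambda>_. 0) i))"
  by (simp_all add: fun_eq_iff zero_cplx_def csize_def cobj_def id_cmap_def cdif_def)

lemma total_zero_cplx: "total (zero_cplx :: 'a::ring_1 cplx) = (0, 0)"
  using assemble_zero[of 0 "\<lambda>_. 0" "\<lambda>_. 0"] assemble_zero[of 1 "\<lambda>_. 0" "\<lambda>_. 0"]
  by (simp add: total_def zero_cplx_simps)

lemma is_complex_zero_cplx: "is_complex (zero_cplx :: 'a::ring_1 cplx)"
  unfolding is_complex_def zero_cplx_def proj_obj_def phom_def cobj_def cdif_def by auto

lemma two_term_zero_cplx: "two_term (zero_cplx :: 'a::ring_1 cplx)"
  unfolding two_term_def using is_complex_zero_cplx by (simp add: zero_cplx_def cobj_def)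

subsection \<open>Cones and shifts\<close>

lemma cone_glued:
  assumes X: "is_complex X" and Y: "is_complex Y" and f: "chain_map X Y f"
  shows "is_complex (cone X Y f)"
    "\<exists>i1 i2 p1 p2. glued 1 (total (cone X Y f)) (total X) (total Y) (- dif (total X))
      (total_map 0 X Y f) i1 i2 p1 p2"
proof -
  have f': "f \<in> component_maps 0 X Y" "total_map 0 X Y f \<in> ZHom 0 (total X) (total Y)"
    using chain_map_iff_ZHom[OF X Y, of 0 f] f by auto
  note F = ZHomD[OF f'(2)] and Fh = HomD[OF ZHomD(1)[OF f'(2)]]
  note A = assemble_uminus[OF bounded_total(2)[OF X]]
  have C: "bounded_family (1 - 1) (csize Y) (csize X) f"
    using bounded_component_maps[OF X Y f'(1)] by simp
  note tX = total_complex_total[OF X, unfolded total_complex_def]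
  have index: "i + 1 + 1 = i + 2" for i :: int by simp
  have cplx: "cobj (cone X Y f) i = pobj_sum (cobj X (i + 1)) (cobj Y i)"
    "cdif (cone X Y f) i = four_block_mat (- cdif X (i + 1)) (0\<^sub>m (csize X (i + 1 + 1)) (csize Y i))
      (f (i + 1)) (cdif Y i)" for i
    unfolding index by (simp_all add: cone_def cobj_def cdif_def csize_def)
  note block = glued_four_block[OF X Y A(1) C _ _ _ _ _ _ cplx, unfolded A(2), folded
    total_simps(2), unfolded diff_self]
  show "is_complex (cone X Y f)" by (rule block(1)) (use tX F(2) Fh in simp_all)
  show "\<exists>i1 i2 p1 p2. glued 1 (total (cone X Y f)) (total X) (total Y) (- dif (total X))
    (total_map 0 X Y f) i1 i2 p1 p2"
    by (rule block(2)) (use tX F(2) Fh in simp_all)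
qed

lemma assemble_shift:
  fixes F :: "int \<Rightarrow> 'a::ring_1 mat"
  assumes F: "bounded_family k v u F" and size: "within_size N v u (assemble k v u F)"
  shows "bounded_family k (\<lambda>i. v (i + c)) (\<lambda>i. u (i + c)) (\<lambda>i. F (i + c))"
    "assemble k (\<lambda>i. v (i + c)) (\<lambda>i. u (i + c)) (\<lambda>i. F (i + c)) =
      block_incl c (\<lambda>_. 0) v N * assemble k v u F * block_proj c (\<lambda>_. 0) u N"
proof -
  have index: "i + k + c = i + c + k" for i by simp
  obtain N0 where N0: "\<And>i. \<bar>i\<bar> > N0 \<Longrightarrow> F i = 0\<^sub>m (v (i + k)) (u i)"
    using F unfolding bounded_family_def by blast
  have "F (i + c) = 0\<^sub>m (v (i + k + c)) (u (i + c))" if "\<bar>i\<bar> > N0 + \<bar>c\<bar>" for i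
    unfolding index by (rule N0) (use that in linarith)
  then show shift: "bounded_family k (\<lambda>i. v (i + c)) (\<lambda>i. u (i + c)) (\<lambda>i. F (i + c))"
    unfolding bounded_family_def using bounded_family_carrier[OF F] by (metis index)
  show "assemble k (\<lambda>i. v (i + c)) (\<lambda>i. u (i + c)) (\<lambda>i. F (i + c)) =
      block_incl c (\<lambda>_. 0) v N * assemble k v u F * block_proj c (\<lambda>_. 0) u N"
    by (rule gmat_eqI_Ix, unfold entry_block_conj[OF size] entry_assemble[OF shift])
       (auto simp: entry_assemble[OF F] index)
qed

definition shifted :: "int \<Rightarrow> 'a::ring total_cplx \<Rightarrow> 'a total_cplx \<Rightarrow> 'a gmat \<Rightarrow> 'a gmat \<Rightarrow> bool" where
  "shifted c B X i p \<longleftrightarrow> homog (- c) i \<and> homog c p \<and> i * ide X = i \<and> ide X * p = p \<and> p * i = ide X \<and>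
     ide B = i * p \<and> dif B = ksign c (i * dif X * p)"

lemma shiftedD:
  assumes "shifted c B X i p"
  shows "homog (- c) i" "homog c p" "i * ide X = i" "ide X * p = p" "p * i = ide X"
    "ide B = i * p" "dif B = ksign c (i * dif X * p)"
  using assms unfolding shifted_def by auto

lemma shifted_idem_iso:
  assumes "shifted c B X i p" shows "idem_iso (ide X) (ide B) i p"
  unfolding idem_iso_def using shiftedD[OF assms]
  by (auto intro!: idem_homI simp: mult.assoc) (simp add: mult.assoc[symmetric])

lemma shifted_maps:
  assumes s: "shifted c B X i p" and X: "total_complex X"
  shows "i \<in> Hom (- c) X B" "p \<in> Hom c B X" "dif B * i = ksign c (i * dif X)"
    "p * dif B = ksign c (dif X * p)"
proof -
  note sD = shiftedD[OF s] and iso = idem_isoD[OF shifted_idem_iso[OF s]]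
  show "i \<in> Hom (- c) X B" "p \<in> Hom c B X"
    unfolding Hom_def using sD(1,2) idem_homD[OF iso(1)] idem_homD[OF iso(2)] by simp_all
  have "dif B * i = ksign c (i * (dif X * (p * i)))" "p * dif B = ksign c ((p * i) * (dif X * p))"
    unfolding sD(7) by (simp_all add: ksign_mult_left ksign_mult_right mult.assoc)
  moreover have "dif X * ide X = dif X" "ide X * (dif X * y) = dif X * y" for y
    using X unfolding total_complex_def by (simp_all add: mult.assoc[symmetric])
  ultimately show "dif B * i = ksign c (i * dif X)" "p * dif B = ksign c (dif X * p)"
    unfolding sD(5) by simp_all
qed

lemma total_complex_shifted:
  assumes s: "shifted c B X i p" and X: "total_complex X" shows "total_complex B"
proof -
  note sD = shiftedD[OF s] and tX = X[unfolded total_complex_def]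
  have absorb: "p * (i * y) = ide X * y" "ide X * (p * y) = p * y" "i * (ide X * y) = i * y"
    "ide X * (dif X * y) = dif X * y" "dif X * (dif X * y) = 0"
      "dif X * (ide X * y) = dif X * y" for y
    using sD tX by (simp_all add: mult.assoc[symmetric])
  have "homog 0 (i * p)" "homog 1 (i * dif X * p)"
    using homog_mult[of "- c" i c p] homog_mult[OF homog_mult[of "- c" i 1 "dif X"], of c p] sD tX
    by auto
  then show ?thesis
    unfolding total_complex_def using sD tX absorb
    by (simp add: ksign_mult_left ksign_mult_right homog_ksign mult.assoc)
qed

lemma total_shift:
  fixes X :: "'a::ring_1 cplx"
  assumes X: "is_complex X"
    and size: "within_size N (csize X) (csize X) (ide (total X))"
      "within_size N (csize X) (csize X) (dif (total X))"
  shows "bounded_family 0 (csize (shift c X)) (csize (shift c X)) (id_cmap (shift c X))"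
    "bounded_family 1 (csize (shift c X)) (csize (shift c X)) (cdif (shift c X))"
    "total (shift c X) =
      (block_incl c (\<lambda>_. 0) (csize X) N * ide (total X) * block_proj c (\<lambda>_. 0) (csize X) N,
       ksign c (block_incl c (\<lambda>_. 0) (csize X) N * dif (total X)
         * block_proj c (\<lambda>_. 0) (csize X) N))"
proof -
  have simps: "csize (shift c X) = (\<lambda>i. csize X (i + c))"
    "id_cmap (shift c X) = (\<lambda>i. id_cmap X (i + c))"
    "cdif (shift c X) = (if even c then (\<lambda>i. cdif X (i + c)) else (\<lambda>i. - cdif X (i + c)))"
    by (simp_all add: fun_eq_iff csize_def id_cmap_def shift_simps)
  note id = assemble_shift[OF bounded_total(1)[OF X], folded total_simps(1), OF size(1), of c]
    and dif = assemble_shift[OF bounded_total(2)[OF X], folded total_simps(2), OF size(2), of c]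
  note neg = assemble_uminus[OF dif(1)]
  show "bounded_family 0 (csize (shift c X)) (csize (shift c X)) (id_cmap (shift c X))"
    "bounded_family 1 (csize (shift c X)) (csize (shift c X)) (cdif (shift c X))"
    unfolding simps using id(1) dif(1) neg(1) by simp_all
  show "total (shift c X) =
      (block_incl c (\<lambda>_. 0) (csize X) N * ide (total X) * block_proj c (\<lambda>_. 0) (csize X) N,
       ksign c (block_incl c (\<lambda>_. 0) (csize X) N * dif (total X)
         * block_proj c (\<lambda>_. 0) (csize X) N))"
    unfolding total_def[of "shift c X"] simps id(2) ksign_def using dif(2) neg(2) by simp
qed

lemma shift_shifted:
  fixes X :: "'a::ring_1 cplx"
  assumes X: "is_complex X"
  shows "is_complex (shift c X)" "\<exists>i p. shifted c (total (shift c X)) (total X) i p"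
proof -
  note tX = total_complex_total[OF X, unfolded total_complex_def]
  obtain N1 N2 where "within_size N1 (csize X) (csize X) (ide (total X))"
    "within_size N2 (csize X) (csize X) (dif (total X))"
    using ex_within_size[OF bounded_total(1)[OF X]] ex_within_size[OF bounded_total(2)[OF X]]
    unfolding total_simps by blast
  note sizes = this[THEN within_size_mono]
  define N where "N = max N1 N2"
  have size: "within_size N (csize X) (csize X) (ide (total X))"
    "within_size N (csize X) (csize X) (dif (total X))"
    using sizes unfolding N_def by auto
  note shift = total_shift[OF X size, of c]
  define s where "s = (block_incl c (\<lambda>_. 0) (csize X) N :: 'a gmat)"
  define t where "t = (block_proj c (\<lambda>_. 0) (csize X) N :: 'a gmat)"
  have ts: "t * (s * ide (total X)) = ide (total X)"
    unfolding s_def t_def using block_proj_incl[OF size(1)] by auto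
  have absorb: "ide (total X) * (ide (total X) * y) = ide (total X) * y"
    "ide (total X) * (dif (total X) * y) = dif (total X) * y"
    "dif (total X) * (ide (total X) * y) = dif (total X) * y" for y
    using tX by (simp_all add: mult.assoc[symmetric])
  have "homog (- c) (s * ide (total X))" "homog c (ide (total X) * t)"
    using tX homog_block_incl[of c "\<lambda>_. 0" "csize X" N] homog_block_proj[of c "\<lambda>_. 0" "csize X" N]
    unfolding s_def t_def by (auto intro: homog_mult_0_left homog_mult_0_right)
  then have "shifted c (total (shift c X)) (total X) (s * ide (total X)) (ide (total X) * t)"
    unfolding shifted_def shift(3) s_def[symmetric] t_def[symmetric] using tX ts absorb
    by (simp add: mult.assoc)
  then show shifted: "\<exists>i p. shifted c (total (shift c X)) (total X) i p" by blast
  show "is_complex (shift c X)"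
    using is_complexI[OF shift(1,2)] total_complex_shifted[OF _ total_complex_total[OF X]] shifted
    by blast
qed

lemma shift_shift: "shift (- t) (shift t X) = X"
proof -
  have "- (- A) = A" for A :: "'b::ring_1 mat" by (rule eq_matI) auto
  then show ?thesis unfolding shift_def cobj_def cdif_def by (cases X) (auto simp: fun_eq_iff)
qed

section \<open>Krull-Schmidt for complexes\<close>

context finite_dim_algebra
begin

lemma subspace_ZHom: "vs.subspace (ZHom k X Y)"
proof (rule vs.subspaceI)
  fix c f assume f: "f \<in> ZHom k X Y"
  have "ksign k (gscale c x) = gscale c (ksign k x)" for x unfolding ksign_def by simp
  then show "gscale c f \<in> ZHom k X Y"
    using f unfolding ZHom_def Hom_def
    by (simp add: gscale_mult_left gscale_mult_right homog_gscale)
qed (auto intro: ZHom_add)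

lemma dim_idem_hom_less:
  assumes "e * g = g" "g * e = g" "e * e = e" "g \<noteq> e"
  shows "vs.dim (idem_hom g g) < vs.dim (idem_hom e e)"
proof -
  obtain B where B: "finite B" "idem_hom e e \<subseteq> vs.span B" using finite_span_idem_hom by blast
  have "idem_hom g g \<subseteq> idem_hom e e"
  proof
    fix x assume "x \<in> idem_hom g g"
    then show "x \<in> idem_hom e e" using assms(1,2) unfolding idem_hom_def by (simp, metis mult.assoc)
  qed
  moreover have "e \<in> idem_hom e e" "e \<notin> idem_hom g g" using assms unfolding idem_hom_def by auto
  ultimately show ?thesis using vs.dim_strict_mono[OF subspace_idem_hom _ B(2,1), of g g] by blast
qed

lemma fitting_ZHom:
  fixes X :: "'a total_cplx"
  assumes X: "total_complex X" and f: "f \<in> ZHom 0 X X"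
  obtains g u v where "g \<in> ZHom 0 X X" "u \<in> ZHom 0 X X" "v \<in> ZHom 0 X X" "g * g = g"
    "f * u = g" "u * f = g"
    "(ide X - f) * v = ide X - g" "v * (ide X - f) = ide X - g"
proof (rule fitting_idempotent[of "ide X" f "ZHom 0 X X"])
  show "ide X * ide X = ide X" using X unfolding total_complex_def by blast
  show "f \<in> idem_hom (ide X) (ide X)" using f ZHomD(1) Hom_idem_hom by blast
  show "x * y \<in> ZHom 0 X X" if "x \<in> ZHom 0 X X" "y \<in> ZHom 0 X X" for x y
    using ZHom_mult[OF that] by simp
  show "ide X \<in> ZHom 0 X X" by (rule ide_ZHom[OF X])
qed (use subspace_ZHom f that in auto)

text \<open>The Fitting idempotent of \<open>f\<close> differs from \<open>f\<close> by \<open>(f\<^sup>2 - f) v - (f\<^sup>2 - f) u\<close>.\<close>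

lemma idempotent_lift:
  fixes X :: "'a total_cplx"
  assumes X: "total_complex X" and f: "f \<in> ZHom 0 X X" "f * f - f \<in> BHom 0 X X"
  obtains g where "g \<in> ZHom 0 X X" "g * g = g" "g - f \<in> BHom 0 X X"
proof -
  obtain g u v where g: "g \<in> ZHom 0 X X" "u \<in> ZHom 0 X X" "v \<in> ZHom 0 X X" "g * g = g"
    "f * u = g" "u * f = g"
    "(ide X - f) * v = ide X - g"
    using fitting_ZHom[OF X f(1)] .
  have f_ide: "f * ide X = f" using HomD(3)[OF ZHomD(1)[OF f(1)]] .
  have "f * (ide X - g) = f * (ide X - f) * v" using g(7) by (simp add: mult.assoc)
  also have "\<dots> = - ((f * f - f) * v)" using f_ide by (simp add: algebra_simps)
  finally have "g - f = (f * f - f) * v - (f * f - f) * u"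
    using f_ide g(5) by (simp add: algebra_simps)
  moreover have "(f * f - f) * v \<in> BHom 0 X X" "(f * f - f) * u \<in> BHom 0 X X"
    using BHom_mult_right[OF f(2) g(3)] BHom_mult_right[OF f(2) g(2)] by auto
  ultimately have "g - f \<in> BHom 0 X X" using BHom_diff by simp
  then show thesis using that g by blast
qed

lemma ex_image_complex:
  assumes X: "is_complex X" and g: "g \<in> ZHom 0 (total X) (total X)" "g * g = g"
  obtains Y where "is_complex Y" "ide (total Y) = g"
    "g \<in> ZHom 0 (total Y) (total X)" "g \<in> ZHom 0 (total X) (total Y)"
proof -
  note tX = total_complex_total[OF X, unfolded total_complex_def]
    and gD = HomD[OF ZHomD(1)[OF g(1)]]
  have commute: "dif (total X) * g = g * dif (total X)" using ZHomD(2)[OF g(1)] by simp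
  have absorb: "dif (total X) * (g * y) = g * (dif (total X) * y)" "g * (g * y) = g * y"
    "dif (total X) * (dif (total X) * y) = 0" for y
    using commute g(2) tX by (simp_all add: mult.assoc[symmetric])
  have "homog 1 (g * dif (total X))" using homog_mult[OF gD(1), of 1 "dif (total X)"] tX by simp
  then have "total_complex (g, g * dif (total X))"
    unfolding total_complex_def using gD tX commute absorb g(2) by (simp add: mult.assoc)
  then obtain Y where Y: "is_complex Y" "total Y = (g, g * dif (total X))"
    using ex_complex_of_total by blast
  have "g \<in> ZHom 0 (total Y) (total X)" "g \<in> ZHom 0 (total X) (total Y)"
    unfolding ZHom_def Hom_def Y(2) using gD tX commute absorb g(2) by (simp_all add: mult.assoc)
  then show thesis using that Y by simp
qed

definition end_dim :: "'a cplx \<Rightarrow> nat" where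
  "end_dim X = vs.dim (idem_hom (ide (total X)) (ide (total X)))"

sublocale ks: ideal_category "is_complex :: 'a cplx \<Rightarrow> bool" "\<lambda>X Y. ZHom 0 (total X) (total Y)"
  "\<lambda>X Y. BHom 0 (total X) (total Y)"
  "\<lambda>X. ide (total X)"
proof
  fix X Y W :: "'a cplx" and f g :: "'a gmat"
  show "0 \<in> ZHom 0 (total X) (total Y)" "0 \<in> BHom 0 (total X) (total Y)" by auto
  show "f + g \<in> ZHom 0 (total X) (total Y)" if "f \<in> ZHom 0 (total X) (total Y)"
    "g \<in> ZHom 0 (total X) (total Y)"
    using that by (rule ZHom_add)
  show "- f \<in> ZHom 0 (total X) (total Y)" if "f \<in> ZHom 0 (total X) (total Y)"
    using that by (rule ZHom_uminus)
  show "g * f \<in> ZHom 0 (total X) (total W)" if "g \<in> ZHom 0 (total Y) (total W)"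
    "f \<in> ZHom 0 (total X) (total Y)"
    using ZHom_mult[OF that] by simp
  show "ide (total X) \<in> ZHom 0 (total X) (total X)" if "is_complex X"
    using ide_ZHom total_complex_total that by blast
  show "ide (total Y) * f = f" "f * ide (total X) = f" if "f \<in> ZHom 0 (total X) (total Y)"
    using HomD[OF ZHomD(1)[OF that]] by auto
  show "f + g \<in> BHom 0 (total X) (total Y)" if "f \<in> BHom 0 (total X) (total Y)"
    "g \<in> BHom 0 (total X) (total Y)"
    using that by (rule BHom_add)
  show "- f \<in> BHom 0 (total X) (total Y)" if "f \<in> BHom 0 (total X) (total Y)"
    using that by (rule BHom_uminus)
  show "g * f \<in> BHom 0 (total X) (total W)" if "g \<in> ZHom 0 (total Y) (total W)"
    "f \<in> BHom 0 (total X) (total Y)"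
    using BHom_mult_left[OF that] by simp
  show "g * f \<in> BHom 0 (total X) (total W)" if "g \<in> BHom 0 (total Y) (total W)"
    "f \<in> ZHom 0 (total X) (total Y)"
    using BHom_mult_right[OF that] by simp
qed

lemma strict_biprod_dsum:
  assumes X: "is_complex X" and Y: "is_complex Y"
  shows "\<exists>i1 i2 p1 p2. ks.strict_biprod (X \<oplus>\<^sub>K Y) X Y i1 i2 p1 p2"
proof -
  obtain i1 i2 p1 p2 where g: "glued 0 (total (X \<oplus>\<^sub>K Y)) (total X) (total Y) (dif (total X)) 0
    i1 i2 p1 p2"
    using dsum_glued(2)[OF X Y] by blast
  then have "ks.strict_biprod (X \<oplus>\<^sub>K Y) X Y i1 i2 p1 p2"
    using glued_biproduct[OF g total_complex_total[OF X] total_complex_total[OF Y]] X Y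
      dsum_glued(1)[OF X Y]
    unfolding ks.strict_biprod_def glued_def by blast
  then show ?thesis by blast
qed

lemma homotopy_idempotent_splitting:
  assumes X: "is_complex X" and f: "f \<in> ZHom 0 (total X) (total X)"
    "f * f - f \<in> BHom 0 (total X) (total X)"
  shows "\<exists>Y Z i1 i2 p1 p2. ks.strict_biprod X Y Z i1 i2 p1 p2
    \<and> i1 * p1 - f \<in> BHom 0 (total X) (total X) \<and>
    (f \<notin> BHom 0 (total X) (total X) \<longrightarrow> ide (total X) - f \<notin> BHom 0 (total X) (total X) \<longrightarrow>
      end_dim Y < end_dim X \<and> end_dim Z < end_dim X)"
proof -
  let ?e = "ide (total X)"
  obtain g where g: "g \<in> ZHom 0 (total X) (total X)" "g * g = g"
    "g - f \<in> BHom 0 (total X) (total X)"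
    using idempotent_lift[OF total_complex_total[OF X] f] .
  have e: "?e * ?e = ?e" "?e * g = g" "g * ?e = g"
    using ks.idt_left ks.idt_right ks.idt_hom[OF X] g(1) by auto
  have complement: "?e - g \<in> ZHom 0 (total X) (total X)" "(?e - g) * (?e - g) = ?e - g"
    using ks.hom_diff[OF ks.idt_hom[OF X] g(1)] e g(2) by (auto simp: algebra_simps)
  obtain Y where Y: "is_complex Y" "ide (total Y) = g" "g \<in> ZHom 0 (total Y) (total X)"
    "g \<in> ZHom 0 (total X) (total Y)"
    using ex_image_complex[OF X g(1,2)] .
  obtain Z where Z: "is_complex Z" "ide (total Z) = ?e - g" "?e - g \<in> ZHom 0 (total Z) (total X)"
      "?e - g \<in> ZHom 0 (total X) (total Z)"
    using ex_image_complex[OF X complement] .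
  have "ks.strict_biprod X Y Z g (?e - g) g (?e - g)"
    unfolding ks.strict_biprod_def Y(2) Z(2) using X Y Z idem_biprod_complement[OF e(1) g(2) e(2,3)]
    by blast
  moreover have "end_dim Y < end_dim X \<and> end_dim Z < end_dim X"
    if f: "f \<notin> BHom 0 (total X) (total X)" "?e - f \<notin> BHom 0 (total X) (total X)"
  proof -
    have "g \<noteq> 0" "g \<noteq> ?e" using g(3) f BHom_uminus[of "g - f" 0 "total X" "total X"] by auto
    then show ?thesis
      unfolding end_dim_def Y(2) Z(2)
      using dim_idem_hom_less[of ?e g] dim_idem_hom_less[of ?e "?e - g"] e
      by (auto simp: left_diff_distrib right_diff_distrib)
  qed
  ultimately show ?thesis
    using g(2,3) by (intro exI[of _ Y] exI[of _ Z] exI[of _ g] exI[of _ "?e - g"]) simp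
qed

sublocale ks: krull_schmidt_category is_complex "\<lambda>X Y. ZHom 0 (total X) (total Y)"
  "\<lambda>X Y. BHom 0 (total X) (total Y)"
  "\<lambda>X. ide (total X)" "(\<oplus>\<^sub>K)" zero_cplx end_dim
proof
  fix X :: "'a cplx" and f :: "'a gmat" assume X: "is_complex X"
    and f: "f \<in> ZHom 0 (total X) (total X)"
  obtain g u v where "g \<in> ZHom 0 (total X) (total X)" "u \<in> ZHom 0 (total X) (total X)"
    "v \<in> ZHom 0 (total X) (total X)"
    "g * g = g" "f * u = g" "u * f = g"
    "(ide (total X) - f) * v = ide (total X) - g" "v * (ide (total X) - f) = ide (total X) - g"
    using fitting_ZHom[OF total_complex_total[OF X] f] .
  then show "\<exists>e\<in>ZHom 0 (total X) (total X). \<exists>u\<in>ZHom 0 (total X) (total X).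
    \<exists>v\<in>ZHom 0 (total X) (total X).
      e * e - e \<in> BHom 0 (total X) (total X) \<and>
      f * u - e \<in> BHom 0 (total X) (total X) \<and> u * f - e \<in> BHom 0 (total X) (total X) \<and>
      (ide (total X) - f) * v - (ide (total X) - e) \<in> BHom 0 (total X) (total X) \<and>
      v * (ide (total X) - f) - (ide (total X) - e) \<in> BHom 0 (total X) (total X)"
    by (intro bexI[of _ g] bexI[of _ u] bexI[of _ v]) simp_all
qed (use is_complex_zero_cplx strict_biprod_dsum homotopy_idempotent_splitting
  in \<open>simp_all add: total_zero_cplx\<close>)

lemma htpy_equiv_iff_iso: "X \<simeq>\<^sub>K Y \<longleftrightarrow> ks.iso X Y"
  unfolding htpy_equiv_iff_htpy_iso htpy_iso_def ks.iso_def ..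

lemma iso_class_eq_iso_cls: "iso_class X = ks.iso_cls X"
  unfolding iso_class_def ks.iso_cls_def htpy_equiv_iff_iso ..

lemma indec_iff_ks_indec: "indec X \<longleftrightarrow> ks.indec X"
  unfolding indec_def ks.indec_def htpy_equiv_iff_iso ..

lemma dsum_list_eq_osum_list: "dsum_list Xs = ks.osum_list Xs"
  by (induction Xs) auto

lemma num_summands_eq_card:
  assumes X: "is_complex X" shows "num_summands X = card (set_mset (ks.summands X))"
proof -
  have "iso_class ` {Y. indec Y \<and> (\<exists>Z. is_complex Z \<and> X \<simeq>\<^sub>K Y \<oplus>\<^sub>K Z)} =
      ks.iso_cls ` {Y. ks.indec Y \<and> ks.iso_cls Y \<in># ks.summands X}"
    unfolding indec_iff_ks_indec htpy_equiv_iff_iso iso_class_eq_iso_cls[abs_def]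
    by (rule arg_cong[where f = "(`) ks.iso_cls"], rule Collect_cong)
      (metis ks.iso_cls_in_summands_iff[OF X])
  also have "\<dots> = set_mset (ks.summands X)" using ks.summands_indec_class[OF X] by auto
  finally show ?thesis unfolding num_summands_def by simp
qed

lemma distinct_iso_cls_iff:
  assumes "\<forall>Y\<in>set Ts. is_complex Y"
  shows "distinct (map ks.iso_cls Ts) \<longleftrightarrow> (\<forall>i j. i < j \<longrightarrow> j < length Ts \<longrightarrow> \<not> Ts ! i \<simeq>\<^sub>K Ts ! j)"
proof -
  have "distinct (map ks.iso_cls Ts) \<longleftrightarrow> sorted_wrt (\<noteq>) (map ks.iso_cls Ts)" by (induction Ts) auto
  also have "\<dots> \<longleftrightarrow> (\<forall>i j. i < j \<longrightarrow> j < length Ts \<longrightarrow> ks.iso_cls (Ts ! i) \<noteq> ks.iso_cls (Ts ! j))"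
    unfolding sorted_wrt_iff_nth_less by auto
  also have "\<dots> \<longleftrightarrow> (\<forall>i j. i < j \<longrightarrow> j < length Ts \<longrightarrow> \<not> Ts ! i \<simeq>\<^sub>K Ts ! j)"
    using assms by (intro all_cong1 imp_cong refl) (simp add: ks.iso_cls_eq_iff htpy_equiv_iff_iso)
  finally show ?thesis .
qed

lemma basic_iff_summands: "basic X \<longleftrightarrow> is_complex X \<and> (\<forall>c. count (ks.summands X) c \<le> 1)"
proof -
  have distinct_iff: "distinct xs \<longleftrightarrow> (\<forall>c. count (mset xs) c \<le> 1)" for xs :: "'a cplx set list"
    by (induction xs) (auto simp: count_eq_zero_iff[symmetric] le_Suc_eq split: if_splits)
  have "basic X \<longleftrightarrow> (\<exists>Ts. ks.iso X (ks.osum_list Ts) \<and> (\<forall>Y\<in>set Ts. ks.indec Y)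
    \<and> distinct (map ks.iso_cls Ts))"
    unfolding basic_def indec_iff_ks_indec dsum_list_eq_osum_list htpy_equiv_iff_iso
    by (intro ex_cong1 conj_cong refl)
      (simp add: distinct_iso_cls_iff htpy_equiv_iff_iso ks.indec_ob)
  also have "\<dots> \<longleftrightarrow> is_complex X \<and> (\<forall>c. count (ks.summands X) c \<le> 1)"
  proof
    assume "\<exists>Ts. ks.iso X (ks.osum_list Ts) \<and> (\<forall>Y\<in>set Ts. ks.indec Y)
      \<and> distinct (map ks.iso_cls Ts)"
    then obtain Ts where "ks.iso X (ks.osum_list Ts)" "\<forall>Y\<in>set Ts. ks.indec Y"
      "distinct (map ks.iso_cls Ts)"
      by blast
    then show "is_complex X \<and> (\<forall>c. count (ks.summands X) c \<le> 1)"
      unfolding distinct_iff using ks.summands_eqI ks.iso_ob(1) by metis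
  next
    assume "is_complex X \<and> (\<forall>c. count (ks.summands X) c \<le> 1)"
    then show "\<exists>Ts. ks.iso X (ks.osum_list Ts) \<and> (\<forall>Y\<in>set Ts. ks.indec Y)
      \<and> distinct (map ks.iso_cls Ts)"
      unfolding distinct_iff using ks.summands_decompose[of X] by metis
  qed
  finally show ?thesis .
qed

end

section \<open>Two-term complexes and the Bongartz completion\<close>

subsection \<open>Degrees\<close>

lemma entry_Hom_nonzero:
  assumes f: "f \<in> Hom k X Y" and nz: "entry f u v \<noteq> 0"
  shows "\<exists>w. entry (ide Y) u w \<noteq> 0" "\<exists>w. entry (ide X) w v \<noteq> 0"
  using nz entry_mult_nonzero[of "ide Y" f u v] entry_mult_nonzero[of f "ide X" u v] HomD(2,3)[OF f]
  by auto

definition degrees :: "'a::ring total_cplx \<Rightarrow> int set" where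
  "degrees X = {i. \<exists>a v. entry (ide X) (Ix i a) v \<noteq> 0}"

lemma two_term_total_iff_degrees: "two_term_total X \<longleftrightarrow> degrees X \<subseteq> {-1, 0}"
  unfolding two_term_total_def degrees_def by (auto, metis idx.exhaust)

lemma degrees_Hom:
  assumes X: "total_complex X" and f: "f \<in> Hom k X Y" and nz: "entry f (Ix i a) (Ix j b) \<noteq> 0"
  shows "i \<in> degrees Y" "j \<in> degrees X" "i = j + k"
proof -
  show "i \<in> degrees Y" using entry_Hom_nonzero(1)[OF f nz] unfolding degrees_def by blast
  show "i = j + k" using homogD[OF HomD(1)[OF f]] nz by blast
  obtain j' b' where nz': "entry (ide X) (Ix j' b') (Ix j b) \<noteq> 0"
    using entry_Hom_nonzero(2)[OF f nz] by (metis idx.exhaust)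
  moreover have "j' = j" using homogD[of 0 "ide X" j' j] nz' X unfolding total_complex_def by auto
  ultimately show "j \<in> degrees X" unfolding degrees_def by blast
qed

lemma Hom_zero_of_degrees:
  assumes "total_complex X" "f \<in> Hom k X Y" "\<And>j. j \<in> degrees X \<Longrightarrow> j + k \<notin> degrees Y"
  shows "f = 0"
proof (rule gmat_eqI_Ix)
  fix i a j b
  show "entry f (Ix i a) (Ix j b) = entry 0 (Ix i a) (Ix j b)"
    using degrees_Hom[OF assms(1,2)] assms(3) by (metis entry_zero)
qed

lemma two_termD:
  assumes "two_term X"
  shows "is_complex X" "total_complex (total X)" "degrees (total X) \<subseteq> {-1, 0}"
  using assms total_complex_total[of X] unfolding two_term_iff_total two_term_total_iff_degrees
  by auto

lemma degrees_retract:
  assumes f: "f \<in> Hom 0 X Y" and g: "g \<in> Hom 0 Y X" and eq: "g * f = ide X"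
  shows "degrees X \<subseteq> degrees Y"
proof
  fix i assume "i \<in> degrees X"
  then obtain a v where "entry (g * f) (Ix i a) v \<noteq> 0" unfolding degrees_def eq by blast
  then obtain w where w: "entry g (Ix i a) w \<noteq> 0" "entry f w v \<noteq> 0"
    using entry_mult_nonzero by blast
  obtain j b where j: "w = Ix j b" by (cases w)
  have "i = j" using homogD[OF HomD(1)[OF g]] w(1) unfolding j by force
  then show "i \<in> degrees Y" using entry_Hom_nonzero(1)[OF f w(2)] unfolding j degrees_def by blast
qed

lemma total_alg_cplx:
  "is_complex (alg_cplx :: 'a::ring_1 cplx)"
    "total (alg_cplx :: 'a cplx) = (elem_gmat (Ix 0 0) (Ix 0 0) 1, 0)"
proof -
  show alg: "is_complex (alg_cplx :: 'a cplx)"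
    unfolding is_complex_def alg_cplx_def proj_obj_def phom_def cobj_def cdif_def
    by (auto intro!: exI[of _ 0])
  have size: "csize (alg_cplx :: 'a cplx) i = (if i = 0 then 1 else 0)" for i
    by (simp add: csize_def alg_cplx_def cobj_def)
  have "ide (total (alg_cplx :: 'a cplx)) = elem_gmat (Ix 0 0) (Ix 0 0) 1"
    unfolding total_simps
    by (rule gmat_eqI_Ix, unfold entry_assemble[OF bounded_total(1)[OF alg]] size entry_elem_gmat)
       (auto simp: id_cmap_def alg_cplx_def cobj_def)
  moreover have "dif (total (alg_cplx :: 'a cplx)) = 0"
    unfolding total_simps
    by (rule gmat_eqI_Ix) (auto simp: entry_assemble[OF bounded_total(2)[OF alg]] size)
  ultimately show "total (alg_cplx :: 'a cplx) = (elem_gmat (Ix 0 0) (Ix 0 0) 1, 0)"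
    by (simp add: prod_eq_iff)
qed

lemma degrees_alg_cplx: "degrees (total (alg_cplx :: 'a::ring_1 cplx)) \<subseteq> {0}"
  unfolding degrees_def total_alg_cplx(2) by (auto simp: entry_elem_gmat split: if_splits)

lemma two_term_alg_cplx: "two_term (alg_cplx :: 'a::ring_1 cplx)"
  unfolding two_term_iff_total two_term_total_iff_degrees using total_alg_cplx(1) degrees_alg_cplx
  by blast

subsection \<open>Vanishing of extensions\<close>

lemma ext_orthogonalI:
  "(\<And>l f. l > 0 \<Longrightarrow> f \<in> ZHom (int l) X Y \<Longrightarrow> f \<in> BHom (int l) X Y) \<Longrightarrow> ext_orthogonal X Y"
  unfolding ext_orthogonal_def by blast

lemma ext_orthogonalD: "ext_orthogonal X Y \<Longrightarrow> l > 0 \<Longrightarrow> f \<in> ZHom (int l) X Y \<Longrightarrow> f \<in> BHom (int l) X Y"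
  unfolding ext_orthogonal_def by blast

lemma ext_orthogonal_of_degrees:
  assumes "total_complex X" "\<And>i j. i \<in> degrees X \<Longrightarrow> j \<in> degrees Y \<Longrightarrow> j \<le> i"
  shows "ext_orthogonal X Y"
proof (rule ext_orthogonalI)
  fix l :: nat and f assume "l > 0" "f \<in> ZHom (int l) X Y"
  then have "f = 0" using assms by (intro Hom_zero_of_degrees[OF assms(1) ZHomD(1)]) force+
  then show "f \<in> BHom (int l) X Y" by simp
qed

lemma ext_orthogonal_retract:
  assumes f: "f \<in> ZHom 0 X X'" "g \<in> ZHom 0 X' X" "f * g - ide X' \<in> BHom 0 X' X'"
    and a: "a \<in> ZHom 0 Y Y'" "b \<in> ZHom 0 Y' Y" "a * b - ide Y' \<in> BHom 0 Y' Y'"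
    and orth: "ext_orthogonal X Y"
  shows "ext_orthogonal X' Y'"
proof (rule ext_orthogonalI)
  fix l :: nat and F assume l: "l > 0" and F: "F \<in> ZHom (int l) X' Y'"
  have "b * F * f \<in> ZHom (int l) X Y" using ZHom_mult[OF ZHom_mult[OF a(2) F] f(1)] by simp
  then have "b * F * f \<in> BHom (int l) X Y" by (rule ext_orthogonalD[OF orth l])
  then have "a * (b * F * f) * g \<in> BHom (int l) X' Y'"
    using BHom_mult_right[OF BHom_mult_left[OF a(1)] f(2)] by simp
  moreover have "(a * b - ide Y') * (F * (f * g)) \<in> BHom (int l) X' Y'"
    using BHom_mult_right[OF a(3) ZHom_mult[OF F ZHom_mult[OF f(1,2)]]] by simp
  moreover have "F * (f * g - ide X') \<in> BHom (int l) X' Y'" using BHom_mult_left[OF F f(3)] by simp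
  moreover have "F = a * (b * F * f) * g - (a * b - ide Y') * (F * (f * g)) - F * (f * g - ide X')"
  proof -
    have "ide Y' * (F * (f * g)) = F * (f * g)"
      using HomD(2)[OF ZHomD(1)[OF F]] by (simp add: mult.assoc[symmetric])
    moreover have "F * ide X' = F" using HomD(3)[OF ZHomD(1)[OF F]] .
    ultimately show ?thesis by (simp add: left_diff_distrib right_diff_distrib mult.assoc)
  qed
  ultimately show "F \<in> BHom (int l) X' Y'" using BHom_diff by metis
qed

text \<open>A cocycle on an extension is corrected by a coboundary so as to vanish on the subcomplex;
  dually for cocycles with values in an extension.\<close>

lemma ext_orthogonal_glued_left:
  assumes g: "glued 0 U X Y (dif X) F i1 i2 p1 p2" and F: "F \<in> Hom 1 X Y"
    and tc: "total_complex X" "total_complex Y" "total_complex U" "total_complex Z"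
    and orth: "ext_orthogonal X Z" "ext_orthogonal Y Z"
  shows "ext_orthogonal U Z"
proof (rule ext_orthogonalI)
  fix l :: nat and G assume l: "l > 0" and G: "G \<in> ZHom (int l) U Z"
  note maps = glued_extension_maps[OF g tc(1,2) F] and gD = gluedD[OF g]
  have "G * i2 \<in> BHom (int l) Y Z"
    using ext_orthogonalD[OF orth(2) l] ZHom_mult[OF G maps(3)] by simp
  then obtain h where h: "h \<in> Hom (int l - 1) Y Z" "G * i2 = ksign l (dif Z * h) + h * dif Y"
    unfolding BHom_def by auto
  define b where "b = ksign l (dif Z * (h * p2)) + (h * p2) * dif U"
  have b: "b \<in> BHom (int l) U Z"
    unfolding b_def using Hom_mult[OF h(1) maps(2)] by (intro BHomI) simp
  define G' where "G' = G - b"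
  have G': "G' \<in> ZHom (int l) U Z"
    unfolding G'_def using G b BHom_subset_ZHom[OF tc(3,4)] by (intro ZHom_diff) auto
  have "p2 * (dif U * i2) = dif Y"
    using maps(6) glued_simps[OF g] gD(8,10,11) tc(2) unfolding total_complex_def
    by (simp add: mult.assoc[symmetric] distrib_right) (simp add: mult.assoc)
  then have "b * i2 = G * i2"
    unfolding b_def h(2) using gD(10) HomD(3)[OF h(1)]
    by (simp add: distrib_right ksign_mult_left mult.assoc)
  then have vanish: "G' * i2 = 0" unfolding G'_def by (simp add: left_diff_distrib)
  have "ksign l (dif Z * (G' * i1)) = G' * (dif U * i1)"
    using arg_cong[OF ZHomD(2)[OF G'], of "\<lambda>x. x * i1"] by (simp add: ksign_mult_left mult.assoc)
  also have "\<dots> = G' * i1 * dif X"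
    unfolding maps(5) using vanish by (simp add: distrib_left mult.assoc[symmetric])
  finally have "G' * i1 \<in> ZHom (int l) X Z"
    unfolding ZHom_def using Hom_mult[OF ZHomD(1)[OF G'] maps(1)] by simp
  then have "G' * i1 * p1 \<in> BHom (int l) U Z"
    using BHom_mult_right[OF ext_orthogonalD[OF orth(1) l] maps(4)] by simp
  moreover have "G' = G' * i1 * p1 + G' * i2 * p2"
    using HomD(3)[OF ZHomD(1)[OF G']] unfolding gD(13) by (simp add: distrib_left mult.assoc)
  ultimately have "G' \<in> BHom (int l) U Z" using vanish by simp
  then show "G \<in> BHom (int l) U Z" using BHom_add[OF _ b] unfolding G'_def by fastforce
qed

lemma glued_connecting_BHom:
  assumes g: "glued 0 U X Y (dif X) F i1 i2 p1 p2" and F: "F \<in> Hom 1 X Y"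
    and tc: "total_complex X" "total_complex Y" and c: "c \<in> ZHom (k - 1) Z X"
  shows "i2 * (F * c) \<in> BHom k Z U"
proof -
  note maps = glued_extension_maps[OF g tc F]
  have "dif U * (i1 * c) = i1 * (dif X * c) + i2 * (F * c)"
    using maps(5) by (simp add: mult.assoc[symmetric] distrib_right)
  moreover have "dif X * c = - ksign k (c * dif Z)"
    unfolding ZHomD(2)[OF c, symmetric] by (simp add: ksign_def)
  ultimately have "i2 * (F * c) = ksign k (dif U * ksign k (i1 * c)) + ksign k (i1 * c) * dif Z"
    by (simp add: ksign_def mult.assoc)
  also have "\<dots> \<in> BHom k Z U"
    using Hom_ksign[OF Hom_mult[OF maps(1) ZHomD(1)[OF c]]] by (intro BHomI) simp
  finally show ?thesis .
qed

lemma glued_ZHom_into_right: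
  assumes g: "glued 0 U X Y (dif X) F i1 i2 p1 p2" and F: "F \<in> ZHom 1 X Y"
    and tc: "total_complex X" "total_complex Y"
    and G: "G \<in> ZHom k Z U" and vanish: "p1 * G = 0"
  shows "p2 * G \<in> ZHom k Z Y" "i2 * (p2 * G) = G"
proof -
  note maps = glued_extension_maps[OF g tc ZHomD(1)[OF F]]
  have "p2 * (dif U * G) = dif Y * (p2 * G)"
    using maps(6) vanish by (simp add: mult.assoc[symmetric] distrib_right) (simp add: mult.assoc)
  then have "ksign k (dif Y * (p2 * G)) = p2 * G * dif Z"
    using arg_cong[OF ZHomD(2)[OF G], of "(*) p2"] by (simp add: ksign_mult_right mult.assoc)
  then show "p2 * G \<in> ZHom k Z Y"
    unfolding ZHom_def using Hom_mult[OF maps(2) ZHomD(1)[OF G]] by simp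
  show "i2 * (p2 * G) = G"
    using HomD(2)[OF ZHomD(1)[OF G]] vanish unfolding gluedD(13)[OF g]
    by (simp add: distrib_right mult.assoc)
qed

lemma ext_orthogonal_glued_right:
  assumes g: "glued 0 U X Y (dif X) F i1 i2 p1 p2" and F: "F \<in> ZHom 1 X Y"
    and tc: "total_complex X" "total_complex Y" "total_complex U" "total_complex Z"
    and orth: "ext_orthogonal Z X"
    and factor: "\<And>l G. l > 0 \<Longrightarrow> G \<in> ZHom (int l) Z Y \<Longrightarrow> \<exists>c\<in>ZHom (int l - 1) Z X. G - F * c
      \<in> BHom (int l) Z Y"
  shows "ext_orthogonal Z U"
proof (rule ext_orthogonalI)
  fix l :: nat and G assume l: "l > 0" and G: "G \<in> ZHom (int l) Z U"
  note maps = glued_extension_maps[OF g tc(1,2) ZHomD(1)[OF F]] and gD = gluedD[OF g]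
  have "p1 * G \<in> BHom (int l) Z X" using ext_orthogonalD[OF orth l] ZHom_mult[OF maps(4) G] by simp
  then obtain h where h: "h \<in> Hom (int l - 1) Z X" "p1 * G = ksign l (dif X * h) + h * dif Z"
    unfolding BHom_def by auto
  define b where "b = ksign l (dif U * (i1 * h)) + (i1 * h) * dif Z"
  have b: "b \<in> BHom (int l) Z U"
    unfolding b_def using Hom_mult[OF maps(1) h(1)] by (intro BHomI) simp
  define G' where "G' = G - b"
  have G': "G' \<in> ZHom (int l) Z U"
    unfolding G'_def using G b BHom_subset_ZHom[OF tc(4,3)] by (intro ZHom_diff) auto
  have absorb: "p1 * (i1 * y) = ide X * y" for y using gD(9) by (simp add: mult.assoc[symmetric])
  have "p1 * (dif U * (i1 * h)) = dif X * (p1 * (i1 * h))"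
    using ZHomD(2)[OF maps(4)] by (simp add: mult.assoc[symmetric])
  then have "p1 * (dif U * (i1 * h)) = dif X * h" "p1 * (i1 * (h * dif Z)) = h * dif Z"
    using HomD(2)[OF h(1)] by (simp_all add: absorb) (simp add: mult.assoc[symmetric])
  then have "p1 * b = p1 * G"
    unfolding b_def h(2) by (simp add: distrib_left ksign_mult_right mult.assoc)
  then have vanish: "p1 * G' = 0" unfolding G'_def by (simp add: right_diff_distrib)
  note lift = glued_ZHom_into_right[OF g F tc(1,2) G' vanish]
  from factor[OF l lift(1)] obtain c where c: "c \<in> ZHom (int l - 1) Z X"
    "p2 * G' - F * c \<in> BHom (int l) Z Y" by blast
  have "i2 * (F * c) \<in> BHom (int l) Z U"
    by (rule glued_connecting_BHom[OF g ZHomD(1)[OF F] tc(1,2) c(1)])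
  moreover have "i2 * (p2 * G' - F * c) \<in> BHom (int l) Z U"
    using BHom_mult_left[OF maps(3) c(2)] by simp
  ultimately have "i2 * (p2 * G' - F * c) + i2 * (F * c) \<in> BHom (int l) Z U" by (intro BHom_add)
  then have "G' \<in> BHom (int l) Z U" by (simp add: right_diff_distrib lift(2))
  then show "G \<in> BHom (int l) Z U" using BHom_add[OF _ b] unfolding G'_def by fastforce
qed

lemma ext_orthogonal_dsum:
  assumes X: "is_complex X" and Y: "is_complex Y" and Z: "total_complex Z"
  shows "ext_orthogonal (total (X \<oplus>\<^sub>K Y)) Z \<longleftrightarrow> ext_orthogonal (total X) Z
    \<and> ext_orthogonal (total Y) Z"
    and "ext_orthogonal Z (total (X \<oplus>\<^sub>K Y)) \<longleftrightarrow> ext_orthogonal Z (total X)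
      \<and> ext_orthogonal Z (total Y)"
proof -
  obtain i1 i2 p1 p2 where g: "glued 0 (total (X \<oplus>\<^sub>K Y)) (total X) (total Y) (dif (total X)) 0
    i1 i2 p1 p2"
    using dsum_glued(2)[OF X Y] by blast
  note tc = total_complex_total[OF X] total_complex_total[OF Y]
    total_complex_total[OF dsum_glued(1)[OF X Y]] Z
  note maps = glued_biproduct[OF g tc(1,2)]
  have ide_Z: "ide Z \<in> ZHom 0 Z Z" "ide Z * ide Z - ide Z \<in> BHom 0 Z Z"
    using ide_ZHom[OF Z] Z unfolding total_complex_def by auto
  have retract: "p1 * i1 - ide (total X) \<in> BHom 0 (total X) (total X)"
    "p2 * i2 - ide (total Y) \<in> BHom 0 (total Y) (total Y)"
    using gluedD(9,10)[OF g] by simp_all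
  show "ext_orthogonal (total (X \<oplus>\<^sub>K Y)) Z \<longleftrightarrow> ext_orthogonal (total X) Z
    \<and> ext_orthogonal (total Y) Z"
    using ext_orthogonal_retract[OF maps(3,1) retract(1) ide_Z(1,1,2)]
      ext_orthogonal_retract[OF maps(4,2) retract(2) ide_Z(1,1,2)]
      ext_orthogonal_glued_left[OF g Hom_zero tc] by blast
  have "ext_orthogonal Z (total (X \<oplus>\<^sub>K Y))" if "ext_orthogonal Z (total X)"
    "ext_orthogonal Z (total Y)"
    using ext_orthogonalD[OF that(2)]
    by (intro ext_orthogonal_glued_right[OF g ZHom_zero tc that(1)] bexI[of _ 0]) simp_all
  then show "ext_orthogonal Z (total (X \<oplus>\<^sub>K Y)) \<longleftrightarrow> ext_orthogonal Z (total X)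
    \<and> ext_orthogonal Z (total Y)"
    using ext_orthogonal_retract[OF ide_Z(1,1,2) maps(3,1) retract(1)]
      ext_orthogonal_retract[OF ide_Z(1,1,2) maps(4,2) retract(2)] by blast
qed

lemma ext_orthogonal_zero_cplx:
  "total_complex Z \<Longrightarrow> ext_orthogonal (total (zero_cplx :: 'a::ring_1 cplx)) Z"
  "total_complex Z \<Longrightarrow> ext_orthogonal Z (total (zero_cplx :: 'a cplx))"
  using total_complex_total[OF is_complex_zero_cplx]
  by (intro ext_orthogonal_of_degrees; simp add: degrees_def total_zero_cplx)+

context finite_dim_algebra
begin

lemma ext_orthogonal_osum_list:
  assumes Z: "total_complex Z"
  shows "\<forall>X\<in>set Xs. is_complex X \<Longrightarrow>
      ext_orthogonal (total (ks.osum_list Xs)) Z \<longleftrightarrow> (\<forall>X\<in>set Xs. ext_orthogonal (total X) Z)"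
    and "\<forall>X\<in>set Xs. is_complex X \<Longrightarrow>
      ext_orthogonal Z (total (ks.osum_list Xs)) \<longleftrightarrow> (\<forall>X\<in>set Xs. ext_orthogonal Z (total X))"
  by (induction Xs) (simp_all add: ext_orthogonal_zero_cplx ext_orthogonal_dsum ks.ob_osum_list Z)

lemma ext_orthogonal_iso:
  assumes "ks.iso X X'" "ks.iso Y Y'" "ext_orthogonal (total X) (total Y)"
  shows "ext_orthogonal (total X') (total Y')"
proof -
  obtain f g a b where f: "f \<in> ZHom 0 (total X) (total X')" "g \<in> ZHom 0 (total X') (total X)"
      "f * g - ide (total X') \<in> BHom 0 (total X') (total X')"
    and a: "a \<in> ZHom 0 (total Y) (total Y')" "b \<in> ZHom 0 (total Y') (total Y)"
      "a * b - ide (total Y') \<in> BHom 0 (total Y') (total Y')"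
    using assms(1,2) unfolding ks.iso_def by blast
  show ?thesis by (rule ext_orthogonal_retract[OF f a assms(3)])
qed

definition orthogonal_classes :: "'a cplx set \<Rightarrow> 'a cplx set \<Rightarrow> bool" where
  "orthogonal_classes c d \<longleftrightarrow> (\<exists>X\<in>c. \<exists>Y\<in>d. ext_orthogonal (total X) (total Y))"

lemma orthogonal_classes_iso_cls:
  assumes "is_complex X" "is_complex Y"
  shows "orthogonal_classes (ks.iso_cls X) (ks.iso_cls Y) \<longleftrightarrow> ext_orthogonal (total X) (total Y)"
  unfolding orthogonal_classes_def ks.iso_cls_def
  using ext_orthogonal_iso ks.iso_refl[OF assms(1)] ks.iso_refl[OF assms(2)] by blast

lemma ext_orthogonal_iff_summands:
  assumes X: "is_complex X" and Y: "is_complex Y"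
  shows "ext_orthogonal (total X) (total Y)
    \<longleftrightarrow> (\<forall>c\<in>#ks.summands X. \<forall>d\<in>#ks.summands Y. orthogonal_classes c d)"
proof -
  obtain Xs where Xs: "\<forall>Y\<in>set Xs. ks.indec Y" "ks.iso X (ks.osum_list Xs)"
    "ks.summands X = mset (map ks.iso_cls Xs)"
    using ks.summands_decompose[OF X] .
  obtain Ys where Ys: "\<forall>Y\<in>set Ys. ks.indec Y" "ks.iso Y (ks.osum_list Ys)"
    "ks.summands Y = mset (map ks.iso_cls Ys)"
    using ks.summands_decompose[OF Y] .
  have ob: "\<forall>X\<in>set Xs. is_complex X" "\<forall>X\<in>set Ys. is_complex X"
    using Xs(1) Ys(1) ks.indec_ob by blast+
  have "ext_orthogonal (total X) (total Y)
    \<longleftrightarrow> ext_orthogonal (total (ks.osum_list Xs)) (total (ks.osum_list Ys))"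
    using ext_orthogonal_iso[OF Xs(2) Ys(2)]
      ext_orthogonal_iso[OF ks.iso_sym[OF Xs(2)] ks.iso_sym[OF Ys(2)]] by blast
  also have "\<dots> \<longleftrightarrow> (\<forall>X\<in>set Xs. ext_orthogonal (total X) (total (ks.osum_list Ys)))"
    by (rule ext_orthogonal_osum_list(1)[OF total_complex_total[OF ks.ob_osum_list[OF ob(2)]]
      ob(1)])
  also have "\<dots> \<longleftrightarrow> (\<forall>X\<in>set Xs. \<forall>Y\<in>set Ys. ext_orthogonal (total X) (total Y))"
    by (rule ball_cong[OF refl]) (use ext_orthogonal_osum_list(2)[OF total_complex_total ob(2)]
      ob(1) in blast)
  also have "\<dots> \<longleftrightarrow> (\<forall>X\<in>set Xs. \<forall>Y\<in>set Ys. orthogonal_classes (ks.iso_cls X) (ks.iso_cls Y))"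
    by (intro ball_cong refl) (use orthogonal_classes_iso_cls ob in blast)
  also have "\<dots> \<longleftrightarrow> (\<forall>c\<in>#ks.summands X. \<forall>d\<in>#ks.summands Y. orthogonal_classes c d)"
    unfolding Xs(3) Ys(3) by simp
  finally show ?thesis .
qed

subsection \<open>Two-term summands\<close>

definition two_term_class :: "'a cplx set \<Rightarrow> bool" where "two_term_class c \<longleftrightarrow> (\<exists>X\<in>c. two_term X)"

lemma two_term_summand:
  assumes T: "two_term T" and b: "ks.biprod T Y Z i1 i2 p1 p2"
  shows "two_term_class (ks.iso_cls Y)"
proof -
  note retract = ks.biprodD(4,6,8)[OF b]
  obtain Y' Z' j1 j2 q1 q2 where s: "ks.strict_biprod T Y' Z' j1 j2 q1 q2"
    and eq: "j1 * q1 - i1 * p1 \<in> BHom 0 (total T) (total T)"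
    using ks.splitting[OF two_termD(1)[OF T] ks.hom_mult[OF retract(1,2)]
      ks.retraction_idempotent[OF retract]]
    by blast
  note sD = ks.strict_biprodD[OF s]
  have "degrees (total Y') \<subseteq> degrees (total T)"
    by (rule degrees_retract[OF ZHomD(1)[OF sD(4)] ZHomD(1)[OF sD(6)] sD(8)])
  then have "two_term Y'"
    unfolding two_term_iff_total two_term_total_iff_degrees using sD(2) two_termD(3)[OF T] by blast
  moreover have "ks.iso Y' Y"
    by (rule ks.iso_of_same_idempotent[OF ks.biprodD(2)[OF b] sD(2) retract sD(4,6) _ eq])
      (simp add: sD(8))
  ultimately show ?thesis unfolding two_term_class_def ks.iso_cls_def by blast
qed

lemma two_term_osum_list: "\<forall>X\<in>set Xs. two_term X \<Longrightarrow> two_term (ks.osum_list Xs)"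
  by (induction Xs) (auto simp: two_term_zero_cplx two_term_dsum)

lemma two_term_class_osum_list:
  "\<forall>Y\<in>set Xs. two_term_class (ks.iso_cls Y) \<Longrightarrow> two_term_class (ks.iso_cls (ks.osum_list Xs))"
proof (induction Xs)
  case Nil
  then show ?case
    unfolding two_term_class_def ks.iso_cls_def using two_term_zero_cplx ks.iso_refl[OF ks.ob_ozero]
    by (intro bexI[of _ zero_cplx]) simp_all
next
  case (Cons Y Ys)
  then obtain T T' where "two_term T" "ks.iso T (ks.osum_list Ys)" "two_term T'" "ks.iso T' Y"
    unfolding two_term_class_def ks.iso_cls_def by auto
  then have "two_term (T' \<oplus>\<^sub>K T)" "ks.iso (T' \<oplus>\<^sub>K T) (ks.osum_list (Y # Ys))"
    using two_term_dsum ks.osum_cong by simp_all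
  then show ?case unfolding two_term_class_def ks.iso_cls_def by blast
qed

lemma two_term_class_iff_summands:
  assumes X: "is_complex X"
  shows "two_term_class (ks.iso_cls X) \<longleftrightarrow> (\<forall>c\<in>#ks.summands X. two_term_class c)"
proof
  assume "two_term_class (ks.iso_cls X)"
  then obtain T where T: "ks.iso T X" "two_term T"
    unfolding two_term_class_def ks.iso_cls_def by blast
  show "\<forall>c\<in>#ks.summands X. two_term_class c"
  proof
    fix c assume c: "c \<in># ks.summands X"
    obtain Y where Y: "ks.indec Y" "c = ks.iso_cls Y" using ks.summands_indec_class[OF X c] by blast
    obtain Z where Z: "is_complex Z" "ks.iso X (Y \<oplus>\<^sub>K Z)"
      using ks.iso_cls_in_summands_iff[OF X Y(1)] c Y(2) by blast
    obtain i1 i2 p1 p2 where "ks.biprod T Y Z i1 i2 p1 p2"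
      using ks.biprod_of_iso_osum[OF ks.iso_trans[OF T(1) Z(2)] ks.indec_ob[OF Y(1)] Z(1)] .
    then show "two_term_class c" unfolding Y(2) by (rule two_term_summand[OF T(2)])
  qed
next
  assume two_term: "\<forall>c\<in>#ks.summands X. two_term_class c"
  obtain Xs where Xs: "ks.iso X (ks.osum_list Xs)" "ks.summands X = mset (map ks.iso_cls Xs)"
    using ks.summands_decompose[OF X] by blast
  then have "ks.iso_cls X = ks.iso_cls (ks.osum_list Xs)" using ks.iso_cls_eq_iff[OF X] by blast
  then show "two_term_class (ks.iso_cls X)"
    using two_term_class_osum_list[of Xs] two_term Xs(2) by simp
qed

subsection \<open>The Bongartz completion\<close>

lemma ex_factoring_cocycle:
  assumes T: "is_complex T"
  shows "set L \<subseteq> ZHom k (total T) (total A) \<Longrightarrow>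
    \<exists>F\<in>ZHom k (total (ks.osum_list (replicate (length L) T))) (total A). \<forall>G\<in>set L.
      \<exists>c\<in>ZHom 0 (total T) (total (ks.osum_list (replicate (length L) T))). G = F * c"
proof (induction L)
  case Nil
  show ?case by (rule bexI[of _ 0]) simp_all
next
  case (Cons G L)
  let ?S = "ks.osum_list (replicate (length L) T)"
  have S: "is_complex ?S" using T by (intro ks.ob_osum_list) simp
  from Cons obtain F where F: "F \<in> ZHom k (total ?S) (total A)"
    "\<And>G. G \<in> set L \<Longrightarrow> \<exists>c\<in>ZHom 0 (total T) (total ?S). G = F * c" by auto
  obtain i1 i2 p1 p2 where b: "ks.strict_biprod (T \<oplus>\<^sub>K ?S) T ?S i1 i2 p1 p2"
    using strict_biprod_dsum[OF T S] by blast
  note bD = ks.strict_biprodD[OF b]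
  have G: "G \<in> ZHom k (total T) (total A)" using Cons.prems by simp
  define F' where "F' = G * p1 + F * p2"
  have F': "F' \<in> ZHom k (total (T \<oplus>\<^sub>K ?S)) (total A)"
    unfolding F'_def using ZHom_add[OF ZHom_mult[OF G bD(6)] ZHom_mult[OF F(1) bD(7)]] by simp
  have "G = F' * i1"
    unfolding F'_def using bD(8,11) HomD(3)[OF ZHomD(1)[OF G]]
    by (simp add: distrib_right mult.assoc)
  moreover have "\<exists>c\<in>ZHom 0 (total T) (total (T \<oplus>\<^sub>K ?S)). G' = F' * c" if G': "G' \<in> set L" for G'
  proof -
    obtain c where c: "c \<in> ZHom 0 (total T) (total ?S)" "G' = F * c" using F(2)[OF G'] by blast
    have "F' * i2 = F"
      unfolding F'_def using bD(9,10) HomD(3)[OF ZHomD(1)[OF F(1)]]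
      by (simp add: distrib_right mult.assoc)
    then have "F' * (i2 * c) = G'" unfolding c(2) by (simp add: mult.assoc[symmetric])
    then show ?thesis using ks.hom_mult[OF bD(5) c(1)] by (intro bexI[of _ "i2 * c"]) simp_all
  qed
  ultimately show ?case using F' bD(4) by (intro bexI[of _ F']) auto
qed

lemma ex_universal_cocycle:
  assumes T: "is_complex T"
  obtains r F where "F \<in> ZHom k (total (ks.osum_list (replicate r T))) (total A)"
    "\<And>G. G \<in> ZHom k (total T) (total A) \<Longrightarrow>
      \<exists>c\<in>ZHom 0 (total T) (total (ks.osum_list (replicate r T))). G = F * c"
proof -
  let ?V = "ZHom k (total T) (total A)"
  obtain B where B: "finite B" "idem_hom (ide (total T)) (ide (total A)) \<subseteq> vs.span B"
    using finite_span_idem_hom by blast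
  obtain C where C: "C \<subseteq> ?V" "vs.independent C" "?V \<subseteq> vs.span C" by (rule vs.basis_exists[of ?V])
  have "finite C"
    using vs.independent_span_bound[OF B(1) C(2)] C(1) B(2) ZHomD(1) Hom_idem_hom by blast
  then obtain L where L: "set L = C" using finite_list by blast
  define S where "S = ks.osum_list (replicate (length L) T)"
  obtain F where F: "F \<in> ZHom k (total S) (total A)"
    "\<And>G. G \<in> set L \<Longrightarrow> \<exists>c\<in>ZHom 0 (total T) (total S). G = F * c"
    using ex_factoring_cocycle[OF T, of L] C(1) L unfolding S_def by blast
  have "\<exists>c\<in>ZHom 0 (total T) (total S). G = F * c" if "G \<in> vs.span C" for G
    using that
  proof (induction rule: vs.span_induct_alt)
    case base
    then show ?case by (intro bexI[of _ 0]) auto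
  next
    case (step c x y)
    then obtain a b where "a \<in> ZHom 0 (total T) (total S)" "x = F * a"
      "b \<in> ZHom 0 (total T) (total S)" "y = F * b"
      using F(2) L by blast
    then show ?case using vs.subspace_add[OF subspace_ZHom vs.subspace_scale[OF subspace_ZHom]]
      by (intro bexI[of _ "gscale c a + b"]) (auto simp: distrib_left gscale_mult_right)
  qed
  then show thesis using that F(1) C(3) unfolding S_def by blast
qed

lemma ext_orthogonal_extension_by_alg:
  assumes g: "glued 0 (total U) (total S) (total (alg_cplx :: 'a cplx)) (dif (total S)) F
    i1 i2 p1 p2"
    and F: "F \<in> ZHom 1 (total S) (total alg_cplx)" and two_term: "two_term S" "two_term U"
      "two_term Z"
  shows "ext_orthogonal (total S) (total Z) \<Longrightarrow> ext_orthogonal (total U) (total Z)"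
    and "ext_orthogonal (total Z) (total S) \<Longrightarrow> (\<And>G. G \<in> ZHom 1 (total Z) (total alg_cplx) \<Longrightarrow>
      \<exists>c\<in>ZHom 0 (total Z) (total S). G = F * c) \<Longrightarrow> ext_orthogonal (total Z) (total U)"
proof -
  note tc = two_termD(2)[OF two_term(1)] two_termD(2)[OF two_term_alg_cplx]
    two_termD(2)[OF two_term(2)]
    two_termD(2)[OF two_term(3)]
  have "ext_orthogonal (total (alg_cplx :: 'a cplx)) (total Z)"
    using degrees_alg_cplx two_termD(3)[OF two_term(3)]
    by (intro ext_orthogonal_of_degrees[OF tc(2)]) force
  then show "ext_orthogonal (total U) (total Z)" if "ext_orthogonal (total S) (total Z)"
    by (rule ext_orthogonal_glued_left[OF g ZHomD(1)[OF F] tc that])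
  show "ext_orthogonal (total Z) (total U)" if "ext_orthogonal (total Z) (total S)"
    and universal: "\<And>G. G \<in> ZHom 1 (total Z) (total alg_cplx) \<Longrightarrow>
      \<exists>c\<in>ZHom 0 (total Z) (total S). G = F * c"
  proof (rule ext_orthogonal_glued_right[OF g F tc that(1)])
    fix l :: nat and G assume l: "l > 0" and G: "G \<in> ZHom (int l) (total Z) (total alg_cplx)"
    show "\<exists>c\<in>ZHom (int l - 1) (total Z) (total S). G - F * c
      \<in> BHom (int l) (total Z) (total alg_cplx)"
    proof (cases "l = 1")
      case True
      then show ?thesis using universal G by force
    next
      case False
      then have "G = 0"
        using two_termD(3)[OF two_term(3)] degrees_alg_cplx l
        by (intro Hom_zero_of_degrees[OF tc(4) ZHomD(1)[OF G]]) force
      then show ?thesis by (intro bexI[of _ 0]) simp_all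
    qed
  qed
qed

theorem bongartz_completion:
  assumes T: "two_term T" "presilting T"
  obtains U r F i1 i2 p1 p2 where "two_term U" "presilting (T \<oplus>\<^sub>K U)"
    "glued 0 (total U) (total (ks.osum_list (replicate r T))) (total alg_cplx)
      (dif (total (ks.osum_list (replicate r T)))) F i1 i2 p1 p2"
    "F \<in> ZHom 1 (total (ks.osum_list (replicate r T))) (total alg_cplx)"
proof -
  note T' = two_termD[OF T(1)] and alg = two_termD[OF two_term_alg_cplx]
  obtain r F where F: "F \<in> ZHom 1 (total (ks.osum_list (replicate r T))) (total alg_cplx)"
    and universal: "\<And>G. G \<in> ZHom 1 (total T) (total alg_cplx) \<Longrightarrow>
      \<exists>c\<in>ZHom 0 (total T) (total (ks.osum_list (replicate r T))). G = F * c"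
    using ex_universal_cocycle[OF T'(1)] by metis
  define S where "S = ks.osum_list (replicate r T)"
  have S: "two_term S" unfolding S_def using T(1) by (intro two_term_osum_list) simp
  note S' = two_termD[OF S]
  obtain U i1 i2 p1 p2 where U: "is_complex U"
    "two_term S \<Longrightarrow> two_term (alg_cplx :: 'a cplx) \<Longrightarrow> two_term U"
    and g: "glued 0 (total U) (total S) (total alg_cplx) (dif (total S)) F i1 i2 p1 p2"
    using ex_extension[OF S'(1) alg(1)] F unfolding S_def by metis
  have two_term_U: "two_term U" by (rule U(2)[OF S two_term_alg_cplx])
  note U' = two_termD[OF two_term_U]
  note extension = ext_orthogonal_extension_by_alg[OF g F[folded S_def] S two_term_U]
  have orth_TT: "ext_orthogonal (total T) (total T)"
    using T(2) unfolding presilting_iff_ext_orthogonal by blast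
  have orth_SZ: "ext_orthogonal (total S) Z" if "total_complex Z" "ext_orthogonal (total T) Z" for Z
    unfolding S_def using ext_orthogonal_osum_list(1)[OF that(1), of "replicate r T"] T'(1) that(2)
    by auto
  have orth_TS: "ext_orthogonal (total T) (total S)"
    unfolding S_def using ext_orthogonal_osum_list(2)[OF T'(2), of "replicate r T"] T'(1) orth_TT
    by auto
  have orth_TU: "ext_orthogonal (total T) (total U)"
    using extension(2)[OF T(1) orth_TS] universal unfolding S_def by blast
  have "ext_orthogonal (total U) (total T)" "ext_orthogonal (total U) (total U)"
    using extension(1)[OF T(1) orth_SZ[OF T'(2) orth_TT]]
      extension(1)[OF two_term_U orth_SZ[OF U'(2) orth_TU]] .
  moreover have TU: "is_complex (T \<oplus>\<^sub>K U)" by (rule dsum_glued(1)[OF T'(1) U'(1)])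
  ultimately have "presilting (T \<oplus>\<^sub>K U)"
    unfolding presilting_iff_ext_orthogonal
      ext_orthogonal_dsum(1)[OF T'(1) U'(1) total_complex_total[OF TU]]
    using orth_TT orth_TU ext_orthogonal_dsum(2)[OF T'(1) U'(1)] T'(2) U'(2) by blast
  then show thesis using that[OF two_term_U] g F unfolding S_def by blast
qed

end

section \<open>Stalk complexes\<close>

subsection \<open>Blocks and degree parts\<close>

definition block_at :: "int \<Rightarrow> int \<Rightarrow> 'a::zero gmat \<Rightarrow> bool" where
  "block_at s t x \<longleftrightarrow> (\<forall>i a j b. entry x (Ix i a) (Ix j b) \<noteq> 0 \<longrightarrow> i = s \<and> j = t)"

lemma block_at_homog: "block_at s t x \<Longrightarrow> homog (s - t) x"
  unfolding block_at_def homog_def by force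

lemma block_at_add: "block_at s t x \<Longrightarrow> block_at s t y \<Longrightarrow> block_at s t (x + y :: 'a::ring gmat)"
  unfolding block_at_def by (metis add_0 entry_add)

lemma block_at_mult:
  "block_at s t x \<Longrightarrow> block_at t' r y \<Longrightarrow> block_at s r (x * y :: 'a::ring gmat)"
  unfolding block_at_def using entry_mult_nonzero by (metis idx.exhaust)

lemma block_at_mult_zero:
  "block_at s t x \<Longrightarrow> block_at t' r y \<Longrightarrow> t \<noteq> t' \<Longrightarrow> x * y = (0 :: 'a::ring gmat)"
  by (rule gmat_mult_zeroI) (metis block_at_def idx.exhaust)

lemma block_at_idem_hom:
  "block_at s s P \<Longrightarrow> block_at t t Q \<Longrightarrow> x \<in> idem_hom P Q \<Longrightarrow> block_at t s (x :: 'a::ring gmat)"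
  using block_at_mult[of t t Q _ _ x] block_at_mult[of _ _ x s s P] idem_homD[of x P Q]
  unfolding block_at_def by (metis entry_mult_nonzero idx.exhaust)

lemma block_at_homog_left:
  assumes "homog k x" "block_at s t y" shows "block_at (s + k) t (x * y :: 'a::ring gmat)"
  unfolding block_at_def
proof (intro allI impI)
  fix i a j b assume "entry (x * y) (Ix i a) (Ix j b) \<noteq> 0"
  then obtain w where "entry x (Ix i a) w \<noteq> 0" "entry y w (Ix j b) \<noteq> 0"
    using entry_mult_nonzero by blast
  then show "i = s + k \<and> j = t" using assms unfolding homog_def block_at_def by (cases w) blast
qed

lemma block_at_homog_right:
  assumes "block_at s t y" "homog k x" shows "block_at s (t - k) (y * x :: 'a::ring gmat)"
  unfolding block_at_def
proof (intro allI impI)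
  fix i a j b assume "entry (y * x) (Ix i a) (Ix j b) \<noteq> 0"
  then obtain w where w: "entry y (Ix i a) w \<noteq> 0" "entry x w (Ix j b) \<noteq> 0"
    using entry_mult_nonzero by blast
  obtain i' a' where "w = Ix i' a'" by (cases w)
  then have "i = s \<and> i' = t" "i' = j + k" using w assms unfolding homog_def block_at_def by blast+
  then show "i = s \<and> j = t - k" by simp
qed

lemma block_at_homog_zero:
  assumes p: "block_at s s p" and q: "block_at t t q" and f: "homog k f" and "s \<noteq> t + k"
  shows "p * f * q = (0 :: 'a::ring gmat)"
proof -
  have "p * (f * q) = 0" by (rule block_at_mult_zero[OF p block_at_homog_left[OF f q] assms(4)])
  then show ?thesis by (simp add: mult.assoc)
qed

definition degree_part :: "int \<Rightarrow> 'a::zero gmat \<Rightarrow> 'a gmat" where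
  "degree_part t x = Abs_gmat (\<lambda>u v. if ix_degree u = t then entry x u v else 0)"

lemma entry_degree_part:
  "entry (degree_part t x) u v = (if ix_degree u = t then entry x u v else 0)"
proof -
  obtain I where "finite I" "supported_on I x" using ex_supported_on by blast
  then have "finite_support (\<lambda>u v. if ix_degree u = t then entry x u v else 0)"
    by (intro finite_supportI[of I]) (auto simp: supported_onD)
  then show ?thesis unfolding degree_part_def by (simp add: entry_Abs_gmat)
qed

lemma degree_part_idem: "degree_part t (degree_part t x) = degree_part t x"
  by (rule gmat_eqI) (simp add: entry_degree_part)

lemma degree_part_zero: "degree_part t 0 = (0 :: 'a::ring gmat)"
  and degree_part_add: "degree_part t (x + y)
    = degree_part t x + degree_part t (y :: 'a::ring gmat)"
  by (rule gmat_eqI, simp add: entry_degree_part)+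

lemma degree_part_mult_left: "degree_part t x * y = degree_part t (x * y :: 'a::ring gmat)"
proof (rule gmat_eqI)
  fix u v
  obtain I where I: "finite I" "supported_on I x" using ex_supported_on by blast
  then have "entry (degree_part t x * y) u v = (\<Sum>w\<in>I. entry (degree_part t x) u w * entry y w v)"
    by (intro entry_mult) (auto simp: entry_degree_part supported_onD)
  then show "entry (degree_part t x * y) u v = entry (degree_part t (x * y)) u v"
    unfolding entry_degree_part entry_mult_supported[OF I] by simp
qed

lemma degree_part_mult_right:
  assumes x: "homog k x" shows "x * degree_part t y = degree_part (t + k) (x * y :: 'a::ring gmat)"
proof (rule gmat_eqI)
  fix u v
  obtain I where I: "finite I" "supported_on I x" using ex_supported_on by blast
  have "entry x u w = 0" if "ix_degree u \<noteq> ix_degree w + k" for w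
    using homogD[OF x that, of "ix_position u" "ix_position w"] by simp
  then show "entry (x * degree_part t y) u v = entry (degree_part (t + k) (x * y)) u v"
    unfolding entry_degree_part entry_mult_supported[OF I] by (force intro!: sum.cong sum.neutral)
qed

lemma degree_part_mult:
  "homog 0 x \<Longrightarrow> degree_part t x * degree_part t y = degree_part t (x * y :: 'a::ring gmat)"
  by (simp add: degree_part_mult_left degree_part_mult_right degree_part_idem)

lemma block_at_degree_part: "homog k x \<Longrightarrow> block_at t (t - k) (degree_part t x)"
  unfolding block_at_def homog_def by (auto simp: entry_degree_part split: if_splits) force

lemma degree_part_idempotent:
  assumes "homog 0 e" "e * e = (e :: 'a::ring gmat)"
  shows "degree_part t e * degree_part t e = degree_part t e"
    "e * degree_part t e = degree_part t e"
    "degree_part t e * e = degree_part t e" "block_at t t (degree_part t e)"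
  using block_at_degree_part[OF assms(1), of t] assms(2) degree_part_mult_right[OF assms(1), of t e]
  by (simp_all add: degree_part_mult_left degree_part_idem)

subsection \<open>Complexes concentrated in one degree\<close>

definition stalk :: "'a::ring_1 cplx \<Rightarrow> int \<Rightarrow> 'a gmat \<Rightarrow> bool" where
  "stalk X t P \<longleftrightarrow> is_complex X \<and> total X = (P, 0) \<and> block_at t t P"

lemma stalkD:
  assumes "stalk X t P" shows "is_complex X" "total X = (P, 0)" "block_at t t P" "P * P = P"
  using assms total_complex_total[of X] unfolding stalk_def total_complex_def by auto

lemma ex_stalk:
  assumes "block_at t t P" "P * P = (P :: 'a::ring_1 gmat)" obtains X where "stalk X t P"
  using ex_complex_of_total[OF total_complex_zero_dif[of P]] block_at_homog[OF assms(1)] assms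
  unfolding stalk_def by auto

lemma stalk_ZHom: "stalk X t P \<Longrightarrow> stalk Y t Q \<Longrightarrow> ZHom 0 (total X) (total Y) = idem_hom P Q"
  using block_at_homog[OF block_at_idem_hom[of t P t Q]]
  unfolding stalk_def ZHom_def Hom_def idem_hom_def by auto

lemma stalk_BHom: "stalk X s P \<Longrightarrow> stalk Y t Q \<Longrightarrow> BHom k (total X) (total Y) = {0}"
  unfolding stalk_def BHom_def by (auto intro!: exI[of _ 0])

lemma stalk_alg_cplx: "stalk (alg_cplx :: 'a::ring_1 cplx) 0 (elem_gmat (Ix 0 0) (Ix 0 0) 1)"
  unfolding stalk_def using total_alg_cplx
  by (auto simp: block_at_def entry_elem_gmat split: if_splits)

lemma stalk_shift:
  assumes X: "stalk X t P" shows "\<exists>Q i p. stalk (shift t X) 0 Q \<and> idem_iso P Q i p"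
proof -
  note XD = stalkD[OF X]
  obtain i p where s: "shifted t (total (shift t X)) (total X) i p"
    using shift_shifted(2)[OF XD(1)] by blast
  note sD = shiftedD[OF s, unfolded XD(2) fst_conv snd_conv]
  have "total (shift t X) = (i * p, 0)" using sD(6,7) by (simp add: prod_eq_iff)
  moreover have "block_at 0 0 (i * p)"
    using block_at_mult[OF block_at_homog_left[OF sD(1) XD(3)] block_at_homog_right[OF XD(3) sD(2)]]
      sD(3,4) by simp
  moreover have "idem_iso P (i * p) i p" using shifted_idem_iso[OF s] unfolding XD(2) sD(6) by simp
  ultimately show ?thesis unfolding stalk_def using shift_shifted(1)[OF XD(1)] by blast
qed

context finite_dim_algebra
begin

lemma stalk_iso_iff:
  assumes V: "stalk V t v" and W: "stalk W t w" shows "ks.iso V W \<longleftrightarrow> (\<exists>u u'. idem_iso v w u u')"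
  unfolding ks.iso_def stalk_BHom[OF V V] stalk_BHom[OF W W] stalk_ZHom[OF V W] stalk_ZHom[OF W V]
    idem_iso_def
  using stalkD(1,2)[OF V] stalkD(1,2)[OF W] by auto

lemma stalk_summands_eq_iff:
  assumes V: "stalk V t v" and W: "stalk W t w"
  shows "ks.summands V = ks.summands W \<longleftrightarrow> (\<exists>u u'. idem_iso v w u u')"
  using stalk_iso_iff[OF V W] ks.iso_iff_summands[OF stalkD(1)[OF V] stalkD(1)[OF W]] by simp

lemma stalk_summands_biprod:
  assumes R: "stalk R t b" and V: "stalk V t v" and W: "stalk W t w"
    and b: "idem_biprod b v w i1 i2 p1 p2"
  shows "ks.summands R = ks.summands V + ks.summands W"
proof -
  have "ks.strict_biprod R V W i1 i2 p1 p2"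
    unfolding ks.strict_biprod_def stalk_ZHom[OF V R] stalk_ZHom[OF W R] stalk_ZHom[OF R V]
      stalk_ZHom[OF R W]
    using stalkD(1,2)[OF R] stalkD(1,2)[OF V] stalkD(1,2)[OF W] b idem_biprodD(1-4)[OF b] by simp
  then show ?thesis using ks.summands_biprod ks.biprod_of_strict by blast
qed

lemma stalk_dsum:
  assumes V: "stalk V t v" and W: "stalk W t w"
  shows "\<exists>b i1 i2 p1 p2. stalk (V \<oplus>\<^sub>K W) t b \<and> idem_biprod b v w i1 i2 p1 p2"
proof -
  note VD = stalkD[OF V] and WD = stalkD[OF W]
  let ?B = "total (V \<oplus>\<^sub>K W)"
  obtain i1 i2 p1 p2 where g: "glued 0 ?B (total V) (total W) (dif (total V)) 0 i1 i2 p1 p2"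
    using dsum_glued(2)[OF VD(1) WD(1)] by blast
  note gD = gluedD[OF g, unfolded VD(2) WD(2) fst_conv snd_conv]
  have "block_at t t i1" "block_at t t i2" "block_at t t p1" "block_at t t p2"
    using block_at_homog_left[OF gD(1) VD(3)] block_at_homog_left[OF gD(3) WD(3)]
      block_at_homog_right[OF VD(3) gD(2)] block_at_homog_right[OF WD(3) gD(4)] gD(5-8) by simp_all
  then have "block_at t t (ide ?B)" unfolding gD(13) by (intro block_at_add block_at_mult)
  moreover have "?B = (ide ?B, 0)" using gD(14) by (simp add: prod_eq_iff)
  ultimately have "stalk (V \<oplus>\<^sub>K W) t (ide ?B)"
    unfolding stalk_def using dsum_glued(1)[OF VD(1) WD(1)] by blast
  moreover have "idem_biprod (ide ?B) v w i1 i2 p1 p2"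
    using g unfolding glued_def VD(2) WD(2) by simp
  ultimately show ?thesis by blast
qed

text \<open>The columns of an idempotent matrix exhibit its image as a direct summand of a free module.\<close>

lemma stalk_summands_alg:
  assumes X: "stalk X 0 P" shows "set_mset (ks.summands X) \<subseteq> set_mset (ks.summands alg_cplx)"
proof -
  note XD = stalkD[OF X]
  obtain I where I: "finite I" "supported_on I P" using ex_supported_on by blast
  define J where "J = {u \<in> I. ix_degree u = 0}"
  have rows: "entry P u v = 0" if "u \<notin> J" for u v
    using that I(2) XD(3) unfolding J_def supported_on_def block_at_def
    by (metis (mono_tags, lifting) idx.exhaust idx.sel(1) mem_Collect_eq)
  define f where "f u = elem_gmat (Ix 0 0) u 1 * P" for u
  define g where "g u = P * elem_gmat u (Ix 0 0) 1" for u
  have fg: "f u \<in> ZHom 0 (total X) (total alg_cplx)" "g u \<in> ZHom 0 (total alg_cplx) (total X)" for u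
    unfolding stalk_ZHom[OF X stalk_alg_cplx] stalk_ZHom[OF stalk_alg_cplx X] f_def g_def
    using XD(4) by (auto intro!: idem_homI simp: mult.assoc elem_gmat_mult)
      (simp_all add: mult.assoc[symmetric] elem_gmat_mult)
  have "g u * f u = P * (elem_gmat u u 1 * P)" for u
  proof -
    have "g u * f u = P * ((elem_gmat u (Ix 0 0) 1 * elem_gmat (Ix 0 0) u 1) * P)"
      unfolding f_def g_def by (simp add: mult.assoc)
    then show ?thesis by (simp add: elem_gmat_mult)
  qed
  then have "(\<Sum>u\<in>J. g u * f u) = P * (\<Sum>u\<in>J. elem_gmat u u 1 * P)" by (simp add: sum_distrib_left)
  also have "\<dots> = ide (total X)"
    using sum_elem_gmat_mult[of J P] rows I(1) XD(2,4) unfolding J_def by simp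
  finally have "ide (total X) = (\<Sum>u\<in>J. g u * f u)" ..
  moreover have "(\<Sum>u\<in>J. g u * f u)
    \<in> products (ZHom 0 (total alg_cplx) (total X)) (ZHom 0 (total X) (total alg_cplx))"
    by (intro products_sum fg)
  ultimately show ?thesis by (intro ks.summands_of_factorisation[OF XD(1) total_alg_cplx(1)]) simp
qed

end

section \<open>Thick subcategories\<close>

lemma glued_comparison:
  assumes g: "glued c B X Y a f i1 i2 p1 p2" and g': "glued c B' X Y a f j1 j2 q1 q2"
    and Y: "total_complex Y"
    and a: "a \<in> idem_hom (ide X) (ide X)" and f: "f \<in> idem_hom (ide X) (ide Y)"
  shows "j1 * p1 + j2 * p2 \<in> ZHom 0 B B'"
proof -
  note maps = glued_maps[OF g Y a f] and maps' = glued_maps[OF g' Y a f]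
  have "j1 * p1 + j2 * p2 \<in> Hom 0 B B'"
    using Hom_add[OF Hom_mult[OF maps'(1) maps(2)]] Hom_mult[OF ZHomD(1)[OF maps'(3)] maps(4)]
    by simp
  moreover have "dif B' * (j1 * p1 + j2 * p2) = (dif B' * j1) * p1 + (dif B' * j2) * p2"
    by (simp add: distrib_left mult.assoc)
  then have "dif B' * (j1 * p1 + j2 * p2) = (j1 * a + j2 * f) * p1 + j2 * dif Y * p2"
    using ZHomD(2)[OF maps'(3)] unfolding maps'(5) by simp
  moreover have "(j1 * p1 + j2 * p2) * dif B = j1 * (p1 * dif B) + j2 * (p2 * dif B)"
    by (simp add: distrib_right mult.assoc)
  ultimately show ?thesis
    unfolding ZHom_def maps(6,7) by (simp add: distrib_left distrib_right mult.assoc)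
qed

lemma glued_unique:
  assumes g: "glued c B X Y a f i1 i2 p1 p2" and g': "glued c B' X Y a f j1 j2 q1 q2"
    and Y: "total_complex Y"
    and a: "a \<in> idem_hom (ide X) (ide X)" and f: "f \<in> idem_hom (ide X) (ide Y)"
  shows "htpy_iso B B'"
proof -
  have "idem_iso (ide B) (ide B') (j1 * p1 + j2 * p2) (i1 * q1 + i2 * q2)"
    using idem_biprod_unique g g' unfolding glued_def by blast
  from idem_isoD(3,4)[OF this] show ?thesis
    unfolding htpy_iso_def using glued_comparison[OF g g' Y a f] glued_comparison[OF g' g Y a f]
    by (intro bexI[of _ "j1 * p1 + j2 * p2"] bexI[of _ "i1 * q1 + i2 * q2"]) simp_all
qed

lemma glued_shift_cone:
  assumes g: "glued 1 C sX Y (- dif sX) (F * p) i1 i2 p1 p2" and s: "shifted (-1) sX X i p"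
  shows "glued 0 C X Y (dif X) F (i1 * i) i2 (p * p1) p2"
proof -
  note gD = gluedD[OF g] and sD = shiftedD[OF s]
  have "homog 0 (i1 * i)" "homog 0 (p * p1)"
    using homog_mult[OF gD(1) sD(1)] homog_mult[OF sD(2) gD(2)] by simp_all
  moreover have "idem_biprod (ide C) (ide X) (ide Y) (i1 * i) i2 (p * p1) p2"
    using g idem_biprod_iso_left[OF _ shifted_idem_iso[OF s]] unfolding glued_def by blast
  moreover have "dif C = (i1 * i) * dif X * (p * p1) + i2 * F * (p * p1) + i2 * dif Y * p2"
    unfolding gD(14) sD(7) by (simp add: ksign_def mult.assoc)
  ultimately show ?thesis unfolding glued_def using gD(3,4) by simp
qed

text \<open>For an extension \<open>U\<close> of \<open>X\<close> by \<open>Y\<close>, the shift of \<open>Y\<close> is homotopy equivalent to the cone of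
  \<open>U \<rightarrow> X\<close>; being a retract of it is enough here.\<close>

lemma shifted_retract_of_cone:
  assumes g: "glued 0 U X Y (dif X) F i1 i2 p1 p2" and C: "glued 1 C U X (- dif U) p1 j1 j2 q1 q2"
    and s: "shifted 1 sY Y s t" and tc: "total_complex X" "total_complex Y" "total_complex U"
    and F: "F \<in> ZHom 1 X Y"
  shows "\<exists>f\<in>ZHom 0 sY C. \<exists>r\<in>ZHom 0 C sY. r * f = ide sY"
proof (intro bexI)
  note maps = glued_extension_maps[OF g tc(1,2) ZHomD(1)[OF F]]
  have "- dif U \<in> idem_hom (ide U) (ide U)"
    using tc(3) unfolding total_complex_def idem_hom_def by simp
  note cmaps = glued_maps[OF C tc(1) this Hom_idem_hom[OF ZHomD(1)[OF maps(4)]]]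
  note smaps = shifted_maps[OF s tc(2)]
  note gD = gluedD[OF g] and CD = gluedD[OF C] and sD = shiftedD[OF s]
  have move: "dif sY * (s * y) = - (s * (dif Y * y))" "q1 * (dif C * y) = - (dif U * (q1 * y))"
    "q2 * (dif C * y) = p1 * (q1 * y) + dif X * (q2 * y)"
      "dif C * (j1 * y) = - (j1 * (dif U * y)) + j2 * (p1 * y)"
    "p2 * (dif U * y) = F * (p1 * y) + dif Y * (p2 * y)" "dif U * (i2 * y) = i2 * (dif Y * y)"
    "F * (dif X * y) = - (dif Y * (F * y))" "p1 * (i2 * y) = 0" for y
    using smaps(3) cmaps(5,6,7) maps(6) ZHomD(2)[OF maps(3)] ZHomD(2)[OF F, symmetric] gD(11)
    by (simp_all add: mult.assoc[symmetric] distrib_right left_diff_distrib)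
  have simps: "t * dif sY = - (dif Y * t)" "q1 * dif C = - (dif U * q1)"
    "q2 * dif C = p1 * q1 + dif X * q2"
    using smaps(4) cmaps(6,7) by simp_all
  have "s * (p2 * q1 + F * q2) \<in> Hom 0 C sY"
    using Hom_mult[OF smaps(1) Hom_add[OF Hom_mult[OF maps(2) cmaps(2)]]]
      Hom_mult[OF ZHomD(1)[OF F] cmaps(4)] by simp
  then show "s * (p2 * q1 + F * q2) \<in> ZHom 0 C sY"
    unfolding ZHom_def by (simp add: distrib_left distrib_right right_diff_distrib
      mult.assoc move simps)
  have "j1 * (i2 * t) \<in> Hom 0 sY C"
    using Hom_mult[OF cmaps(1) Hom_mult[OF ZHomD(1)[OF maps(3)] smaps(2)]] by simp
  then show "j1 * (i2 * t) \<in> ZHom 0 sY C"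
    unfolding ZHom_def by (simp add: mult.assoc move simps)
  have "s * (p2 * q1 + F * q2) * (j1 * (i2 * t))
    = s * (p2 * ((q1 * j1) * i2) * t) + s * (F * (q2 * j1) * (i2 * t))"
    by (simp add: distrib_left distrib_right mult.assoc)
  also have "\<dots> = s * ((p2 * i2) * t)" using CD(9,12) glued_ide(2)[OF g] by (simp add: mult.assoc)
  finally show "s * (p2 * q1 + F * q2) * (j1 * (i2 * t)) = ide sY" using gD(10) sD(4,6) by simp
qed

lemma thick_complex: "X \<in> thick S \<Longrightarrow> is_complex X"
proof (induction rule: thick.induct)
  case (iso X Y)
  then show ?case unfolding htpy_equiv_def by blast
qed (auto intro: is_complex_zero_cplx shift_shifted(1) cone_glued(1))

lemma thick_cone:
  assumes X: "X \<in> thick S" and Y: "Y \<in> thick S" and \<phi>: "\<phi> \<in> ZHom 0 (total X) (total Y)"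
  obtains C i1 i2 p1 p2 where "C \<in> thick S"
    "glued 1 (total C) (total X) (total Y) (- dif (total X)) \<phi> i1 i2 p1 p2"
proof -
  note ob = thick_complex[OF X] thick_complex[OF Y]
  obtain f where f: "f \<in> component_maps 0 X Y" "total_map 0 X Y f = \<phi>"
    using total_map_surj[OF ob ZHomD(1)[OF \<phi>]] .
  have chain: "chain_map X Y f" using chain_map_iff_ZHom[OF ob, of 0 f] f \<phi> by simp
  show thesis using that[OF thick.cne[OF X Y chain]] cone_glued(2)[OF ob chain]
    unfolding f(2) by blast
qed

lemma thick_extension:
  assumes X: "X \<in> thick S" and Y: "Y \<in> thick S" and U: "is_complex U"
    and F: "F \<in> ZHom 1 (total X) (total Y)"
    and g: "glued 0 (total U) (total X) (total Y) (dif (total X)) F i1 i2 p1 p2"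
  shows "U \<in> thick S"
proof -
  note tc = total_complex_total[OF thick_complex[OF X]] total_complex_total[OF thick_complex[OF Y]]
  obtain i p where s: "shifted (-1) (total (shift (-1) X)) (total X) i p"
    using shift_shifted(2)[OF thick_complex[OF X]] by blast
  note smaps = shifted_maps[OF s tc(1)]
  have "dif (total Y) * (F * p) = F * p * dif (total (shift (-1) X))"
    using arg_cong[OF ZHomD(2)[OF F], of "\<lambda>x. - (x * p)"] smaps(4)
    by (simp add: ksign_def mult.assoc)
  then have "F * p \<in> ZHom 0 (total (shift (-1) X)) (total Y)"
    unfolding ZHom_def using Hom_mult[OF ZHomD(1)[OF F] smaps(2)] by simp
  then obtain C j1 j2 q1 q2 where C: "C \<in> thick S"
    "glued 1 (total C) (total (shift (-1) X)) (total Y) (- dif (total (shift (-1) X))) (F * p)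
      j1 j2 q1 q2"
    using thick_cone[OF thick.shft[OF X] Y] by blast
  have "htpy_iso (total C) (total U)"
    by (rule glued_unique[OF glued_shift_cone[OF C(2) s] g tc(2)
      Hom_idem_hom[OF dif_Hom[OF tc(1)]]
          Hom_idem_hom[OF ZHomD(1)[OF F]]])
  then have "C \<simeq>\<^sub>K U" unfolding htpy_equiv_iff_htpy_iso using thick_complex[OF C(1)] U by blast
  then show ?thesis by (rule thick.iso[OF C(1)])
qed

context finite_dim_algebra
begin

lemma thick_osum_list: "set Xs \<subseteq> thick S \<Longrightarrow> ks.osum_list Xs \<in> thick S"
proof (induction Xs)
  case Nil
  then show ?case by (simp add: thick.zero)
next
  case (Cons X Xs)
  then have X: "X \<in> thick S" "ks.osum_list Xs \<in> thick S" by auto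
  obtain i1 i2 p1 p2 where
    g: "glued 0 (total (X \<oplus>\<^sub>K ks.osum_list Xs)) (total X) (total (ks.osum_list Xs)) (dif (total X))
      0 i1 i2 p1 p2"
    using dsum_glued(2)[OF thick_complex[OF X(1)] thick_complex[OF X(2)]] by blast
  show ?case
    using thick_extension[OF X dsum_glued(1)[OF thick_complex[OF X(1)] thick_complex[OF X(2)]]
      ZHom_zero g] by simp
qed

lemma thick_summands:
  assumes B: "B \<in> thick S" and X: "is_complex X"
    "set_mset (ks.summands X) \<subseteq> set_mset (ks.summands B)"
  shows "X \<in> thick S"
proof -
  obtain Xs where Xs: "\<forall>Y\<in>set Xs. ks.indec Y" "ks.iso X (ks.osum_list Xs)"
    "ks.summands X = mset (map ks.iso_cls Xs)"
    using ks.summands_decompose[OF X(1)] .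
  have "Y \<in> thick S" if "Y \<in> set Xs" for Y
  proof -
    have Y: "ks.indec Y" "ks.iso_cls Y \<in># ks.summands B" using that Xs(1,3) X(2) by auto
    then obtain Z where Z: "is_complex Z" "B \<simeq>\<^sub>K Y \<oplus>\<^sub>K Z"
      unfolding htpy_equiv_iff_iso using ks.iso_cls_in_summands_iff[OF thick_complex[OF B] Y(1)]
      by blast
    show ?thesis by (rule thick.summand[OF thick.iso[OF B Z(2)] ks.indec_ob[OF Y(1)] Z(1)])
  qed
  then have "ks.osum_list Xs \<in> thick S" by (intro thick_osum_list) blast
  moreover have "ks.osum_list Xs \<simeq>\<^sub>K X" unfolding htpy_equiv_iff_iso by (rule ks.iso_sym[OF Xs(2)])
  ultimately show ?thesis by (rule thick.iso)
qed

lemma thick_extension_kernel: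
  fixes Y :: "'a cplx"
  assumes U: "U \<in> thick S" and X: "X \<in> thick S" and Y: "is_complex Y"
    and F: "F \<in> ZHom 1 (total X) (total Y)"
    and g: "glued 0 (total U) (total X) (total Y) (dif (total X)) F i1 i2 p1 p2"
  shows "Y \<in> thick S"
proof -
  note tc = total_complex_total[OF thick_complex[OF X]] total_complex_total[OF Y]
    total_complex_total[OF thick_complex[OF U]]
  have "p1 \<in> ZHom 0 (total U) (total X)"
    by (rule glued_extension_maps(4)[OF g tc(1,2) ZHomD(1)[OF F]])
  then obtain C j1 j2 q1 q2 where C: "C \<in> thick S"
    "glued 1 (total C) (total U) (total X) (- dif (total U)) p1 j1 j2 q1 q2"
    using thick_cone[OF U X] by blast
  obtain s t where s: "shifted 1 (total (shift 1 Y)) (total Y) s t"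
    using shift_shifted(2)[OF Y] by blast
  obtain f r where "f \<in> ZHom 0 (total (shift 1 Y)) (total C)"
    "r \<in> ZHom 0 (total C) (total (shift 1 Y))"
    "r * f = ide (total (shift 1 Y))"
    using shifted_retract_of_cone[OF g C(2) s tc F] by blast
  then have "ks.summands (shift 1 Y) \<subseteq># ks.summands C"
    using shift_shifted(1)[OF Y] thick_complex[OF C(1)]
    by (intro ks.summands_retract[of f _ _ r]) simp_all
  then have "shift 1 Y \<in> thick S"
    by (intro thick_summands[OF C(1) shift_shifted(1)[OF Y]] set_mset_mono)
  from thick.shft[OF this, of "-1"] show ?thesis by (simp add: shift_shift)
qed

lemma thick_stalk:
  assumes A: "(alg_cplx :: 'a cplx) \<in> thick S" and X: "stalk X t P" shows "X \<in> thick S"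
proof -
  obtain Q where "stalk (shift t X) 0 Q" using stalk_shift[OF X] by blast
  then have "shift t X \<in> thick S" using thick_summands[OF A] stalk_summands_alg stalkD(1) by blast
  from thick.shft[OF this, of "- t"] show ?thesis by (simp add: shift_shift)
qed

end

lemma dif_mult_top_degree_part:
  assumes tc: "total_complex X" and top: "degrees X \<subseteq> {..t}"
  shows "dif X * degree_part t (ide X) = 0"
proof -
  note tX = tc[unfolded total_complex_def]
  have "t + 1 \<notin> degrees X" using top by auto
  then have "entry (degree_part (t + 1) (dif X)) (Ix i a) (Ix j b) = 0" for i a j b
    using degrees_Hom(1)[OF tc dif_Hom[OF tc], of i a j b] by (auto simp: entry_degree_part)
  then have "degree_part (t + 1) (dif X) = 0" by (intro gmat_eqI_Ix) simp
  then show ?thesis using degree_part_mult_right[of 1 "dif X" t "ide X"] tX by simp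
qed

lemma ex_top_degree_extension:
  fixes X :: "'a::ring_1 cplx"
  assumes X: "is_complex X" and top: "degrees (total X) \<subseteq> {..t}"
  obtains Y Z P F i1 i2 p1 p2 where "is_complex Y" "degrees (total Y) \<subseteq> degrees (total X) - {t}"
    "stalk Z t P"
    "F \<in> ZHom 1 (total Y) (total Z)"
      "glued 0 (total X) (total Y) (total Z) (dif (total Y)) F i1 i2 p1 p2"
proof -
  define e where "e = ide (total X)"
  define d where "d = dif (total X)"
  note tX = total_complex_total[OF X, unfolded total_complex_def, folded e_def d_def]
  define g where "g = degree_part t e"
  have g: "g * g = g" "e * g = g" "g * e = g" "block_at t t g"
    unfolding g_def using degree_part_idempotent tX by blast+
  have dg: "d * g = 0"
    unfolding g_def e_def d_def by (rule dif_mult_top_degree_part[OF total_complex_total[OF X] top])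
  have f: "(e - g) * (e - g) = e - g" "homog 0 (e - g)" "homog 0 g" "d * (e - g) = d"
    using g dg tX block_at_homog[OF g(4)]
    by (auto simp: left_diff_distrib right_diff_distrib homog_diff)
  have absorb: "(e - g) * ((e - g) * y) = (e - g) * y" "d * ((e - g) * y) = d * y" "d * (d * y) = 0"
    "g * ((e - g) * y) = 0" "g * (g * y) = g * y" for y
    using f g tX by (simp_all add: mult.assoc[symmetric] right_diff_distrib)
  have "total_complex (e - g, (e - g) * d)"
    unfolding total_complex_def using f absorb tX homog_mult[OF f(2), of 1 d]
    by (simp add: mult.assoc)
  then obtain Y where Y: "is_complex Y" "total Y = (e - g, (e - g) * d)"
    using ex_complex_of_total by blast
  obtain Z where Z: "stalk Z t g" using ex_stalk[OF g(4,1)] .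
  note ZD = stalkD[OF Z]
  have "degrees (total Y) \<subseteq> degrees (total X) - {t}"
    unfolding degrees_def Y(2) g_def e_def[symmetric]
    by (auto simp: entry_degree_part split: if_splits)
  moreover have "g * d \<in> ZHom 1 (total Y) (total Z)"
    unfolding ZHom_def Hom_def Y(2) ZD(2) using f absorb tX homog_mult[OF f(3), of 1 d]
    by (simp add: mult.assoc)
  moreover have "d = (e - g) * d + g * d" using tX by (simp add: left_diff_distrib)
  then have "glued 0 (total X) (total Y) (total Z) (dif (total Y)) (g * d) (e - g) g (e - g) g"
    unfolding glued_def Y(2) ZD(2) e_def[symmetric] d_def[symmetric]
    using idem_biprod_swap[OF idem_biprod_complement[OF _ g(1-3)]] tX f absorb
    by (simp add: mult.assoc)
  ultimately show thesis using that[OF Y(1) _ Z] by blast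
qed

context finite_dim_algebra
begin

lemma thick_of_bounded_degrees:
  assumes A: "(alg_cplx :: 'a cplx) \<in> thick S"
  shows "is_complex X \<Longrightarrow> degrees (total X) \<subseteq> {b..<b + int k} \<Longrightarrow> X \<in> thick S"
proof (induction k arbitrary: X)
  case 0
  then have "ide (total X) = 0"
    unfolding degrees_def by (intro gmat_eqI_Ix) auto
  then have "ks.summands X = {#}" using ks.summands_empty_iff[OF 0(1)] by simp
  then show ?case using thick_summands[OF thick.zero 0(1)] by simp
next
  case (Suc k)
  have top: "degrees (total X) \<subseteq> {..b + int k}" using Suc.prems(2) by force
  obtain Y Z P F i1 i2 p1 p2 where Y: "is_complex Y"
    "degrees (total Y) \<subseteq> degrees (total X) - {b + int k}"
    and Z: "stalk Z (b + int k) P" and F: "F \<in> ZHom 1 (total Y) (total Z)"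
      "glued 0 (total X) (total Y) (total Z) (dif (total Y)) F i1 i2 p1 p2"
    using ex_top_degree_extension[OF Suc.prems(1) top] .
  have "degrees (total Y) \<subseteq> {b..<b + int k}" using Y(2) Suc.prems(2) by force
  then have "Y \<in> thick S" by (rule Suc.IH[OF Y(1)])
  then show ?case by (rule thick_extension[OF _ thick_stalk[OF A Z] Suc.prems(1) F])
qed

lemma thick_of_alg_cplx:
  assumes A: "(alg_cplx :: 'a cplx) \<in> thick S" and X: "is_complex X" shows "X \<in> thick S"
proof -
  obtain N where N: "\<And>i a j b. N < \<bar>i\<bar> \<or> N < \<bar>j\<bar> \<Longrightarrow> entry (ide (total X)) (Ix i a) (Ix j b) = 0"
    using ex_degree_bound by metis
  have "degrees (total X) \<subseteq> {- \<bar>N\<bar>..<- \<bar>N\<bar> + int (nat (2 * \<bar>N\<bar> + 1))}"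
  proof
    fix i assume "i \<in> degrees (total X)"
    then obtain a v where "entry (ide (total X)) (Ix i a) v \<noteq> 0" unfolding degrees_def by blast
    then have "\<bar>i\<bar> \<le> N" using N by (cases v) (meson not_less)
    then show "i \<in> {- \<bar>N\<bar>..<- \<bar>N\<bar> + int (nat (2 * \<bar>N\<bar> + 1))}" by auto
  qed
  then show ?thesis by (rule thick_of_bounded_degrees[OF A X])
qed

end

section \<open>Faces\<close>

context finite_dim_algebra
begin

definition indec_class :: "'a cplx set \<Rightarrow> bool" where
  "indec_class c \<longleftrightarrow> (\<exists>Y. ks.indec Y \<and> c = ks.iso_cls Y)"

text \<open>The finite compatible sets are the faces of \<open>\<Delta>(A)\<close>.\<close>

definition compatible :: "'a cplx set set \<Rightarrow> bool" where
  "compatible C \<longleftrightarrow> (\<forall>c\<in>C. indec_class c \<and> two_term_class c \<and> (\<forall>d\<in>C. orthogonal_classes c d))"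

lemma compatible_summands:
  assumes T: "two_term T" "presilting T" shows "compatible (set_mset (ks.summands T))"
proof -
  note oT = two_termD(1)[OF T(1)]
  have "two_term_class (ks.iso_cls T)"
    unfolding two_term_class_def ks.iso_cls_def using T(1) ks.iso_refl[OF oT] by blast
  then show ?thesis
    using two_term_class_iff_summands[OF oT] ks.summands_indec_class[OF oT] T(2)
      ext_orthogonal_iff_summands[OF oT oT]
    unfolding compatible_def indec_class_def presilting_iff_ext_orthogonal by simp
qed

lemma ex_presilting_of_compatible:
  assumes M: "compatible (set_mset M)" obtains T where "two_term T" "presilting T"
    "ks.summands T = M"
proof -
  obtain X where X: "is_complex X" "ks.summands X = M"
    using ks.ex_object_of_summands[of M] M unfolding compatible_def indec_class_def by blast
  have "two_term_class (ks.iso_cls X)"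
    using two_term_class_iff_summands[OF X(1)] X(2) M unfolding compatible_def by simp
  then obtain T where T: "ks.iso T X" "two_term T"
    unfolding two_term_class_def ks.iso_cls_def by blast
  note oT = ks.iso_ob(1)[OF T(1)] and summands_T = ks.summands_iso[OF T(1), unfolded X(2)]
  have "presilting T"
    unfolding presilting_iff_ext_orthogonal
    using oT ext_orthogonal_iff_summands[OF oT oT] summands_T M
    unfolding compatible_def by simp
  then show thesis using that T(2) summands_T by blast
qed

lemma compatible_subset: "compatible C \<Longrightarrow> D \<subseteq> C \<Longrightarrow> compatible D"
  unfolding compatible_def by (meson subset_iff)

lemma ex_silting_completion:
  assumes T: "two_term T" "presilting T"
  obtains S where "two_term S" "silting S" "basic S"
    "set_mset (ks.summands T) \<subseteq> set_mset (ks.summands S)"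
proof -
  obtain U r F i1 i2 p1 p2 where U: "two_term U" "presilting (T \<oplus>\<^sub>K U)"
    and F: "F \<in> ZHom 1 (total (ks.osum_list (replicate r T))) (total alg_cplx)"
    and g: "glued 0 (total U) (total (ks.osum_list (replicate r T))) (total alg_cplx)
      (dif (total (ks.osum_list (replicate r T)))) F i1 i2 p1 p2"
    using bongartz_completion[OF T] .
  note oT = two_termD(1)[OF T(1)] and oU = two_termD(1)[OF U(1)]
  let ?K = "set_mset (ks.summands (T \<oplus>\<^sub>K U))"
  have K: "?K = set_mset (ks.summands T) \<union> set_mset (ks.summands U)"
    using ks.summands_osum[OF oT oU] by simp
  have "compatible ?K" by (rule compatible_summands[OF two_term_dsum[OF T(1) U(1)] U(2)])
  then obtain S where S: "two_term S" "presilting S" "ks.summands S = mset_set ?K"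
    using ex_presilting_of_compatible[of "mset_set ?K"] by auto
  note oS = two_termD(1)[OF S(1)]
  have basic: "basic S" unfolding basic_iff_summands using oS S(3) by (auto simp: count_mset_set')
  have thick_S: "X \<in> thick {S}" if "is_complex X" "set_mset (ks.summands X) \<subseteq> ?K" for X
    using thick_summands[OF thick.base[of S "{S}"] that(1)] oS S(3) that(2) by simp
  have "U \<in> thick {S}" using thick_S[OF oU] K by blast
  moreover have "ks.osum_list (replicate r T) \<in> thick {S}"
    using thick_S[OF ks.ob_osum_list[of "replicate r T"]] oT K
      ks.summands_osum_list_replicate[OF oT, of r] by auto
  ultimately have "(alg_cplx :: 'a cplx) \<in> thick {S}"
    by (rule thick_extension_kernel[OF _ _ total_alg_cplx(1) F g])
  then have "silting S" unfolding silting_def using S(2) thick_of_alg_cplx by blast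
  then show thesis using that[OF S(1) _ basic] S(3) K by simp
qed

definition vertices :: "'a cplx set set" where "vertices = {c. compatible {c}}"

lemma finite_vertices:
  assumes "g_finite TYPE('a)" shows "finite vertices"
proof -
  let ?classes = "iso_class ` {T :: 'a cplx. two_term T \<and> silting T \<and> basic T}"
  define f where "f = (\<lambda>C. \<Union>X\<in>C :: 'a cplx set. set_mset (ks.summands X))"
  have f: "f (iso_class S) = set_mset (ks.summands S)" if "is_complex S" for S
  proof -
    have "f (iso_class S) = (\<Union>X\<in>iso_class S. set_mset (ks.summands S))"
      unfolding f_def iso_class_eq_iso_cls ks.iso_cls_def using ks.summands_iso
      by (intro SUP_cong) auto
    also have "\<dots> = set_mset (ks.summands S)"
      unfolding iso_class_eq_iso_cls ks.iso_cls_def using ks.iso_refl[OF that] by blast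
    finally show ?thesis .
  qed
  have "vertices \<subseteq> \<Union> (f ` ?classes)"
  proof
    fix c assume "c \<in> vertices"
    then have "compatible (set_mset {#c#})" unfolding vertices_def by simp
    then obtain T where T: "two_term T" "presilting T" "ks.summands T = {#c#}"
      using ex_presilting_of_compatible by blast
    obtain S where S: "two_term S" "silting S" "basic S"
      "set_mset (ks.summands T) \<subseteq> set_mset (ks.summands S)"
      using ex_silting_completion[OF T(1,2)] .
    then have "c \<in> f (iso_class S)" using f[OF two_termD(1)[OF S(1)]] T(3) by simp
    then show "c \<in> \<Union> (f ` ?classes)" using S(1-3) by blast
  qed
  moreover have "finite (\<Union> (f ` ?classes))"
  proof (rule finite_Union)
    show "finite (f ` ?classes)" using assms unfolding g_finite_def by (rule finite_imageI)
    show "finite A" if "A \<in> f ` ?classes" for A using that f[OF two_termD(1)] by (elim imageE) simp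
  qed
  ultimately show ?thesis by (rule finite_subset)
qed

end

section \<open>Complexes with the same terms\<close>

subsection \<open>Nakayama's lemma\<close>

locale left_submodule =
  fixes Z N :: "'a::ring set"
  assumes scalar_zero: "0 \<in> Z" and scalar_add: "x \<in> Z \<Longrightarrow> y \<in> Z \<Longrightarrow> x + y \<in> Z"
    and scalar_mult: "x \<in> Z \<Longrightarrow> y \<in> Z \<Longrightarrow> x * y \<in> Z"
    and submodule_zero: "0 \<in> N" and submodule_add: "m \<in> N \<Longrightarrow> n \<in> N \<Longrightarrow> m + n \<in> N"
    and submodule_mult: "z \<in> Z \<Longrightarrow> n \<in> N \<Longrightarrow> z * n \<in> N"
begin

primrec submodule_plus :: "'a list \<Rightarrow> 'a set" where
  "submodule_plus [] = N"
| "submodule_plus (s # L) = {m + z * s | m z. m \<in> submodule_plus L \<and> z \<in> Z}"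

lemma submodule_plus_Cons: "m \<in> submodule_plus L \<Longrightarrow> m \<in> submodule_plus (s # L)"
  using scalar_zero by force

lemma submodule_subset_plus: "N \<subseteq> submodule_plus L"
  by (induction L) (use submodule_plus_Cons in auto)

lemma submodule_plus_add: "x \<in> submodule_plus L \<Longrightarrow> y \<in> submodule_plus L \<Longrightarrow> x + y \<in> submodule_plus L"
proof (induction L arbitrary: x y)
  case (Cons s L)
  then obtain m z m' z' where "x = m + z * s" "y = m' + z' * s" "m \<in> submodule_plus L"
    "m' \<in> submodule_plus L"
    "z \<in> Z" "z' \<in> Z" by auto
  then have "x + y = (m + m') + (z + z') * s" "m + m' \<in> submodule_plus L" "z + z' \<in> Z"
    using Cons.IH scalar_add by (auto simp: distrib_right algebra_simps)
  then show ?case by auto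
qed (simp add: submodule_add)

lemma submodule_plus_mult: "z \<in> Z \<Longrightarrow> x \<in> submodule_plus L \<Longrightarrow> z * x \<in> submodule_plus L"
proof (induction L arbitrary: x)
  case (Cons s L)
  then obtain m y where m: "x = m + y * s" "m \<in> submodule_plus L" "y \<in> Z" by auto
  then have "z * x = z * m + (z * y) * s" by (simp add: distrib_left mult.assoc)
  then show ?case using Cons.IH[OF Cons.prems(1) m(2)] scalar_mult[OF Cons.prems(1) m(3)] by auto
qed (simp add: submodule_mult)

lemma submodule_plus_generator: "s \<in> set L \<Longrightarrow> z \<in> Z \<Longrightarrow> z * s \<in> submodule_plus L"
proof (induction L)
  case (Cons t L)
  show ?case
  proof (cases "s = t")
    case True
    have "0 \<in> submodule_plus L" using submodule_subset_plus submodule_zero by blast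
    then show ?thesis using True Cons.prems(2) by (simp, metis add_0)
  next
    case False
    then show ?thesis using Cons submodule_plus_Cons by simp
  qed
qed simp

text \<open>With \<open>s = n + y\<close> and \<open>y \<in> I M \<subseteq> submodule_plus L + I s\<close>, some \<open>s - a s\<close> lies in
  \<open>submodule_plus L\<close>.\<close>

lemma nakayama_step:
  assumes I: "I \<subseteq> Z" "0 \<in> I" "\<And>x y. x \<in> I \<Longrightarrow> y \<in> I \<Longrightarrow> x + y \<in> I" "\<And>a z. a \<in> I \<Longrightarrow> z \<in> Z \<Longrightarrow> a * z \<in> I"
    and M: "M \<subseteq> submodule_plus (s # L)" and s: "s = n + y" "n \<in> N" "y \<in> products I M"
    and inverse: "\<And>a. a \<in> I \<Longrightarrow> \<exists>v\<in>Z. s - v * (s - a * s) \<in> N"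
  shows "M \<subseteq> submodule_plus L"
proof -
  have "\<exists>m\<in>submodule_plus L. \<exists>a\<in>I. y = m + a * s"
    using s(3)
  proof (induction rule: products.induct)
    case zero
    then show ?case using submodule_subset_plus[of L] submodule_zero I(2)
      by (intro bexI[of _ 0]) auto
  next
    case (add p q y)
    obtain m a where ma: "m \<in> submodule_plus L" "a \<in> I" "y = m + a * s" using add.IH by blast
    obtain m' z where mz: "m' \<in> submodule_plus L" "z \<in> Z" "q = m' + z * s"
      using M add.hyps(2) by auto
    have "p * q + y = (p * m' + m) + (p * z + a) * s"
      unfolding ma(3) mz(3) by (simp add: distrib_left distrib_right mult.assoc add.assoc
        add.left_commute)
    moreover have "p * m' + m \<in> submodule_plus L" "p * z + a \<in> I"
      using submodule_plus_add submodule_plus_mult I add.hyps(1) ma mz by (meson subsetD)+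
    ultimately show ?case by blast
  qed
  then obtain m a where ma: "m \<in> submodule_plus L" "a \<in> I" "y = m + a * s" by blast
  then have "s - a * s \<in> submodule_plus L"
    using s submodule_plus_add submodule_subset_plus[of L]
    by (metis add_diff_cancel_right' add.assoc subsetD)
  moreover obtain v where v: "v \<in> Z" "s - v * (s - a * s) \<in> N" using inverse[OF ma(2)] by blast
  ultimately have "v * (s - a * s) + (s - v * (s - a * s)) \<in> submodule_plus L"
    using submodule_plus_add submodule_plus_mult submodule_subset_plus[of L] by blast
  then have s_mem: "s \<in> submodule_plus L" by simp
  show ?thesis using M submodule_plus_add submodule_plus_mult[OF _ s_mem] by auto
qed

theorem nakayama:
  assumes I: "I \<subseteq> Z" "0 \<in> I" "\<And>x y. x \<in> I \<Longrightarrow> y \<in> I \<Longrightarrow> x + y \<in> I" "\<And>a z. a \<in> I \<Longrightarrow> z \<in> Z \<Longrightarrow> a * z \<in> I"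
    and generated: "\<And>s. s \<in> M \<Longrightarrow> \<exists>n\<in>N. \<exists>y\<in>products I M. s = n + y"
    and inverse: "\<And>a s. a \<in> I \<Longrightarrow> s \<in> M \<Longrightarrow> \<exists>v\<in>Z. s - v * (s - a * s) \<in> N"
  shows "set L \<subseteq> M \<Longrightarrow> M \<subseteq> submodule_plus L \<Longrightarrow> M \<subseteq> N"
proof (induction L)
  case (Cons s L)
  then obtain n y where "s = n + y" "n \<in> N" "y \<in> products I M" using generated[of s] by auto
  then have "M \<subseteq> submodule_plus L"
    using nakayama_step[OF I Cons.prems(2)] inverse Cons.prems(1) by auto
  then show ?case using Cons by simp
qed simp

end

subsection \<open>Traces\<close>

context finite_dim_algebra
begin

definition maps_decompose :: "'a gmat \<Rightarrow> 'a gmat \<Rightarrow> 'a gmat \<Rightarrow> 'a gmat \<Rightarrow> bool" where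
  "maps_decompose P Q d d' \<longleftrightarrow>
     (\<forall>b\<in>idem_hom P Q. \<exists>h\<in>idem_hom P P. \<exists>h'\<in>idem_hom Q Q. b = h' * d + d' * h)"

text \<open>Degree zero components of chain maps from \<open>d : P \<rightarrow> Q\<close> to \<open>d' : P \<rightarrow> Q\<close>.\<close>

definition target_maps :: "'a gmat \<Rightarrow> 'a gmat \<Rightarrow> 'a gmat \<Rightarrow> 'a gmat \<Rightarrow> 'a gmat set" where
  "target_maps P Q d d' = {\<phi>\<in>idem_hom Q Q. \<exists>\<rho>\<in>idem_hom P P. \<phi> * d = d' * \<rho>}"

lemma target_mapsD:
  "\<phi> \<in> target_maps P Q d d' \<Longrightarrow> \<phi> \<in> idem_hom Q Q"
  "\<phi> \<in> target_maps P Q d d' \<Longrightarrow> \<exists>\<rho>\<in>idem_hom P P. \<phi> * d = d' * \<rho>"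
  unfolding target_maps_def by auto

lemma target_maps_mult:
  assumes "\<psi> \<in> target_maps P Q d2 d3" "\<phi> \<in> target_maps P Q d1 d2"
  shows "\<psi> * \<phi> \<in> target_maps P Q d1 d3"
proof -
  obtain r s where r: "r \<in> idem_hom P P" "\<phi> * d1 = d2 * r" and s: "s \<in> idem_hom P P"
    "\<psi> * d2 = d3 * s"
    using assms target_mapsD(2) by blast
  have "\<psi> * \<phi> * d1 = d3 * (s * r)" using r s by (metis mult.assoc)
  then show ?thesis
    unfolding target_maps_def
    using idem_hom_mult[OF target_mapsD(1)[OF assms(1)] target_mapsD(1)[OF assms(2)]]
      idem_hom_mult[OF s(1) r(1)]
    by blast
qed

lemma subspace_target_maps: "vs.subspace (target_maps P Q d d')"
proof (rule vs.subspaceI)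
  show "0 \<in> target_maps P Q d d'"
    unfolding target_maps_def using idem_hom_zero by (auto intro!: bexI[of _ 0])
next
  fix x y assume "x \<in> target_maps P Q d d'" "y \<in> target_maps P Q d d'"
  then obtain r s where "x \<in> idem_hom Q Q" "y \<in> idem_hom Q Q" "r \<in> idem_hom P P" "s \<in> idem_hom P P"
    "x * d = d' * r" "y * d = d' * s"
    unfolding target_maps_def by blast
  then show "x + y \<in> target_maps P Q d d'"
    unfolding target_maps_def
    by (auto simp: idem_hom_add distrib_right distrib_left intro!: bexI[of _ "r + s"])
next
  fix c x assume "x \<in> target_maps P Q d d'"
  then obtain r where r: "x \<in> idem_hom Q Q" "r \<in> idem_hom P P" "x * d = d' * r"
    unfolding target_maps_def by blast
  have "gscale c x \<in> idem_hom Q Q" "gscale c r \<in> idem_hom P P"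
    using r vs.subspace_scale[OF subspace_idem_hom] by auto
  then show "gscale c x \<in> target_maps P Q d d'"
    unfolding target_maps_def using r
    by (auto simp: gscale_mult_left gscale_mult_right intro!: bexI[of _ "gscale c r"])
qed

lemma subspace_products: "vs.subspace B \<Longrightarrow> vs.subspace (products A B)"
proof (rule vs.subspaceI)
  fix c x assume B: "vs.subspace B" and "x \<in> products A B"
  from this(2) show "gscale c x \<in> products A B"
  proof (induction rule: products.induct)
    case (add a b x)
    have "gscale c (a * b + x) = a * gscale c b + gscale c x"
      by (simp add: vs.scale_right_distrib gscale_mult_right)
    then show ?case using add vs.subspace_scale[OF B] by (simp add: products.add)
  qed (simp add: products.zero)
qed (auto intro: products.zero products_add)

lemma products_subset_subspace:
  "vs.subspace V \<Longrightarrow> (\<And>a b. a \<in> A \<Longrightarrow> b \<in> B \<Longrightarrow> a * b \<in> V) \<Longrightarrow> products A B \<subseteq> V"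
  using products_subset vs.subspace_0 vs.subspace_add by metis

definition trace_module :: "'a gmat \<Rightarrow> 'a gmat \<Rightarrow> 'a gmat \<Rightarrow> 'a gmat set \<Rightarrow> 'a gmat \<Rightarrow> 'a gmat set" where
  "trace_module P Q d J U = {d * c + x | c x. c \<in> idem_hom U P \<and> x \<in> products J (idem_hom U Q)}"

lemma trace_moduleI: "c \<in> idem_hom U P \<Longrightarrow> x \<in> products J (idem_hom U Q) \<Longrightarrow>
  d * c + x \<in> trace_module P Q d J U"
  unfolding trace_module_def by blast

lemma subspace_trace_module: "vs.subspace (trace_module P Q d J U)"
proof (rule vs.subspaceI)
  show "0 \<in> trace_module P Q d J U" using trace_moduleI[OF idem_hom_zero products.zero] by fastforce
next
  fix a b assume "a \<in> trace_module P Q d J U" "b \<in> trace_module P Q d J U"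
  then obtain c x c' x' where "a = d * c + x" "b = d * c' + x'" "c \<in> idem_hom U P"
    "c' \<in> idem_hom U P"
    "x \<in> products J (idem_hom U Q)" "x' \<in> products J (idem_hom U Q)"
    unfolding trace_module_def by blast
  then have "a + b = d * (c + c') + (x + x')" "c + c' \<in> idem_hom U P"
    "x + x' \<in> products J (idem_hom U Q)"
    by (auto simp: distrib_left idem_hom_add products_add)
  then show "a + b \<in> trace_module P Q d J U" by (simp add: trace_moduleI)
next
  fix k a assume "a \<in> trace_module P Q d J U"
  then obtain c x where "a = d * c + x" "c \<in> idem_hom U P" "x \<in> products J (idem_hom U Q)"
    unfolding trace_module_def by blast
  then have "gscale k a = d * gscale k c + gscale k x" "gscale k c \<in> idem_hom U P"
    "gscale k x \<in> products J (idem_hom U Q)"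
    using vs.subspace_scale[OF subspace_idem_hom]
      vs.subspace_scale[OF subspace_products[OF subspace_idem_hom]]
    by (auto simp: vs.scale_right_distrib gscale_mult_right)
  then show "gscale k a \<in> trace_module P Q d J U" by (simp add: trace_moduleI)
qed

lemma trace_module_mult:
  assumes x: "x \<in> trace_module P Q d J U" and y: "y \<in> idem_hom V U"
  shows "x * y \<in> trace_module P Q d J V"
proof -
  obtain c z where cz: "x = d * c + z" "c \<in> idem_hom U P" "z \<in> products J (idem_hom U Q)"
    using x unfolding trace_module_def by blast
  have "z * y \<in> products J (idem_hom V Q)"
    by (rule products_mult_right[OF cz(3) idem_hom_mult[OF _ y]])
  then show ?thesis
    unfolding cz(1) using idem_hom_mult[OF cz(2) y]
    by (simp add: distrib_right mult.assoc trace_moduleI)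
qed

lemma trace_module_subset:
  assumes d: "d \<in> idem_hom P Q" and J: "J \<subseteq> idem_hom Q Q"
  shows "trace_module P Q d J U \<subseteq> idem_hom U Q"
proof -
  have "products J (idem_hom U Q) \<subseteq> idem_hom U Q"
    using J by (intro products_subset_subspace subspace_idem_hom) (blast intro: idem_hom_mult)
  then show ?thesis unfolding trace_module_def using idem_hom_mult[OF d] idem_hom_add by blast
qed

lemma products_target_maps_decompose:
  assumes decompose: "maps_decompose P Q d' d'"
    and z: "z \<in> products (target_maps P Q d' d) (idem_hom P Q)"
  shows "\<exists>r\<in>idem_hom P P. \<exists>w\<in>products (target_maps P Q d' d) (idem_hom Q Q). z = d * r + w * d'"
  using z
proof (induction rule: products.induct)
  case zero
  then show ?case using idem_hom_zero products.zero by (intro bexI[of _ 0]) auto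
next
  case (add a b z)
  obtain r w where rw: "r \<in> idem_hom P P" "w \<in> products (target_maps P Q d' d) (idem_hom Q Q)"
    "z = d * r + w * d'"
    using add.IH by blast
  obtain h h' where h: "h \<in> idem_hom P P" "h' \<in> idem_hom Q Q" "b = h' * d' + d' * h"
    using decompose add.hyps(2) unfolding maps_decompose_def by blast
  obtain s where s: "s \<in> idem_hom P P" "a * d' = d * s"
    using target_mapsD(2)[OF add.hyps(1)] by blast
  have "a * b = a * h' * d' + a * d' * h" by (simp add: h(3) distrib_left mult.assoc)
  then have "a * b + z = d * (s * h + r) + (a * h' + w) * d'"
    using rw(3) s(2) by (simp add: distrib_left distrib_right mult.assoc add.assoc add.left_commute)
  then show ?case
    using idem_hom_add[OF idem_hom_mult[OF s(1) h(1)] rw(1)] products.add[OF add.hyps(1) h(2) rw(2)]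
    by blast
qed

lemma trace_module_cancel:
  assumes Q: "Q * Q = Q" and decompose: "maps_decompose P Q d' d'"
    and x: "x \<in> idem_hom Q Q" "x * d' \<in> trace_module P Q d (target_maps P Q d' d) P"
  shows "x \<in> trace_module P Q d (target_maps P Q d' d) Q"
proof -
  let ?J = "target_maps P Q d' d"
  obtain r z where rz: "x * d' = d * r + z" "r \<in> idem_hom P P" "z \<in> products ?J (idem_hom P Q)"
    using x(2) unfolding trace_module_def by blast
  obtain s w where sw: "s \<in> idem_hom P P" "w \<in> products ?J (idem_hom Q Q)" "z = d * s + w * d'"
    using products_target_maps_decompose[OF decompose rz(3)] by blast
  have QQ: "Q \<in> idem_hom Q Q" by (rule idem_homI[OF Q Q])
  have "products ?J (idem_hom Q Q) \<subseteq> idem_hom Q Q"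
    by (intro products_subset_subspace subspace_idem_hom)
      (blast intro: idem_hom_mult target_mapsD(1))
  then have w: "w \<in> idem_hom Q Q" using sw(2) by blast
  have "(x - w) * d' = d * (r + s)" using rz(1) sw(3) by (simp add: left_diff_distrib distrib_left)
  then have xw: "x - w \<in> ?J"
    unfolding target_maps_def using idem_hom_diff[OF x(1) w] idem_hom_add[OF rz(2) sw(1)] by blast
  have "x = d * 0 + ((x - w) * Q + w)" using idem_homD(2)[OF target_mapsD(1)[OF xw]] by simp
  then show ?thesis using trace_moduleI[OF idem_hom_zero products.add[OF xw QQ sw(2)]] by metis
qed

text \<open>Modulo the traces, multiplication by \<open>d\<close> from \<open>End Q\<close> to \<open>Hom P Q\<close> is surjective and
  multiplication by \<open>d'\<close> is injective; by dimensions the former is injective as well, and it kills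
  the identity.\<close>

lemma idem_in_trace_module:
  assumes P: "P * P = P" and Q: "Q * Q = Q" and d: "d \<in> idem_hom P Q" "d' \<in> idem_hom P Q"
    and decompose: "maps_decompose P Q d d" "maps_decompose P Q d' d'"
  shows "Q \<in> trace_module P Q d (target_maps P Q d' d) Q"
proof -
  let ?J = "target_maps P Q d' d"
  obtain B where B: "finite B" "idem_hom Q Q \<subseteq> vs.span B" using finite_span_idem_hom by blast
  have J: "?J \<subseteq> idem_hom Q Q" using target_mapsD(1) by blast
  show ?thesis
  proof (rule vs.quotient_surj_inj[where ?V1.0 = "idem_hom Q Q" and ?V2.0 = "idem_hom P Q"
        and ?W2.0 = "trace_module P Q d ?J P" and f = "\<lambda>x. x * d" and g = "\<lambda>x. x * d'"])
    show "trace_module P Q d ?J Q \<subseteq> idem_hom Q Q" by (rule trace_module_subset[OF d(1) J])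
    show "x * d \<in> trace_module P Q d ?J P" if "x \<in> trace_module P Q d ?J Q" for x
      by (rule trace_module_mult[OF that d(1)])
    show "x * d' \<in> idem_hom P Q" if "x \<in> idem_hom Q Q" for x by (rule idem_hom_mult[OF that d(2)])
    show "\<exists>x\<in>idem_hom Q Q. y - x * d \<in> trace_module P Q d ?J P" if y: "y \<in> idem_hom P Q" for y
    proof -
      obtain h h' where h: "h \<in> idem_hom P P" "h' \<in> idem_hom Q Q" "y = h' * d + d * h"
        using decompose(1) y unfolding maps_decompose_def by blast
      have "y - h' * d \<in> trace_module P Q d ?J P"
        using trace_moduleI[OF h(1) products.zero] unfolding h(3) by simp
      then show ?thesis using h(2) by blast
    qed
    show "x \<in> trace_module P Q d ?J Q" if "x \<in> idem_hom Q Q"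
      "x * d' \<in> trace_module P Q d ?J P" for x
      by (rule trace_module_cancel[OF Q decompose(2) that])
    show "Q \<in> idem_hom Q Q" by (rule idem_homI[OF Q Q])
    show "Q * d \<in> trace_module P Q d ?J P"
      using trace_moduleI[OF idem_homI[OF P P] products.zero, of d] idem_homD[OF d(1)] by simp
  qed (use B subspace_idem_hom subspace_trace_module module_hom_mult_right in auto)
qed

lemma trace_module_products:
  assumes J: "J \<subseteq> target_maps P Q d' d" and M: "idem_hom Q Q \<subseteq> trace_module P Q d' J' Q"
    and x: "x \<in> products J (idem_hom Q Q)"
  shows "x \<in> trace_module P Q d (products J J') Q"
  using x
proof (induction rule: products.induct)
  case zero
  show ?case by (rule vs.subspace_0[OF subspace_trace_module])
next
  case (add p q y)
  obtain c z where cz: "q = d' * c + z" "c \<in> idem_hom Q P" "z \<in> products J' (idem_hom Q Q)"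
    using M add.hyps(2) unfolding trace_module_def by blast
  obtain \<rho> where \<rho>: "\<rho> \<in> idem_hom P P" "p * d' = d * \<rho>" using target_mapsD(2) J add.hyps(1) by blast
  have "p * q = (p * d') * c + p * z" unfolding cz(1) by (simp add: distrib_left mult.assoc)
  then have "p * q = d * (\<rho> * c) + p * z" unfolding \<rho>(2) by (simp add: mult.assoc)
  moreover have "p * z \<in> products (products J J') (idem_hom Q Q)"
    by (rule products_mult_left[OF cz(3) productsI[OF add.hyps(1)]])
  ultimately have "p * q \<in> trace_module P Q d (products J J') Q"
    using trace_moduleI[OF idem_hom_mult[OF \<rho>(1) cz(2)]] by simp
  then show ?case by (rule vs.subspace_add[OF subspace_trace_module _ add.IH])
qed

lemma idem_hom_subset_trace_module:
  assumes P: "P * P = P" and Q: "Q * Q = Q" and d: "d \<in> idem_hom P Q" "d' \<in> idem_hom P Q"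
    and decompose: "maps_decompose P Q d d" "maps_decompose P Q d' d'"
  shows "idem_hom Q Q \<subseteq> trace_module P Q d
    (products (target_maps P Q d' d) (target_maps P Q d d')) Q"
proof
  let ?J = "target_maps P Q d' d" and ?J' = "target_maps P Q d d'"
  have in_trace: "s \<in> trace_module P Q d ?J Q" "s \<in> trace_module P Q d' ?J' Q"
    if "s \<in> idem_hom Q Q" for s
    using trace_module_mult[OF idem_in_trace_module[OF P Q d decompose] that]
      trace_module_mult[OF idem_in_trace_module[OF P Q d(2,1) decompose(2,1)] that]
        idem_homD(1)[OF that] by simp_all
  fix s assume "s \<in> idem_hom Q Q"
  then obtain c x where cx: "s = d * c + x" "c \<in> idem_hom Q P" "x \<in> products ?J (idem_hom Q Q)"
    using in_trace(1) unfolding trace_module_def by blast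
  have "x \<in> trace_module P Q d (products ?J ?J') Q"
    using in_trace(2) by (intro trace_module_products[OF subset_refl _ cx(3)]) blast
  moreover have "d * c \<in> trace_module P Q d (products ?J ?J') Q"
    using trace_moduleI[OF cx(2) products.zero] by fastforce
  ultimately show "s \<in> trace_module P Q d (products ?J ?J') Q"
    unfolding cx(1) by (intro vs.subspace_add[OF subspace_trace_module])
qed

lemma left_submodule_target_maps:
  "left_submodule (target_maps P Q d d) ((*) d ` idem_hom Q P)"
proof
  fix z n assume "z \<in> target_maps P Q d d" "n \<in> (*) d ` idem_hom Q P"
  then obtain r c where r: "r \<in> idem_hom P P" "z * d = d * r" "c \<in> idem_hom Q P" "n = d * c"
    using target_mapsD(2) by blast
  then have "z * n = d * (r * c)" by (metis mult.assoc)
  then show "z * n \<in> (*) d ` idem_hom Q P" using idem_hom_mult[OF r(1,3)] by blast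
next
  fix m n assume "m \<in> (*) d ` idem_hom Q P" "n \<in> (*) d ` idem_hom Q P"
  then show "m + n \<in> (*) d ` idem_hom Q P"
    by (auto simp: distrib_left[symmetric] intro: idem_hom_add)
qed (use vs.subspace_0[OF subspace_target_maps] vs.subspace_add[OF subspace_target_maps]
  target_maps_mult
    idem_hom_zero in \<open>auto simp: image_iff intro!: bexI[of _ 0]\<close>)

lemma span_subset_submodule_plus:
  assumes "left_submodule Z N" and scalars: "\<And>k s. s \<in> set L \<Longrightarrow> \<exists>z\<in>Z. gscale k s = z * s"
  shows "vs.span (set L) \<subseteq> left_submodule.submodule_plus Z N L"
proof
  interpret left_submodule Z N by (rule assms(1))
  fix x assume "x \<in> vs.span (set L)"
  then show "x \<in> submodule_plus L"
  proof (induction rule: vs.span_induct_alt)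
    case base
    then show ?case using submodule_subset_plus submodule_zero by blast
  next
    case (step c x y)
    then show ?case using scalars submodule_plus_add submodule_plus_generator by metis
  qed
qed

theorem split_of_radical_trace:
  assumes P: "P * P = P" and Q: "Q * Q = Q" and d: "d \<in> idem_hom P Q" "d' \<in> idem_hom P Q"
    and decompose: "maps_decompose P Q d d" "maps_decompose P Q d' d'"
    and inverse: "\<And>a. a \<in> products (target_maps P Q d' d) (target_maps P Q d d') \<Longrightarrow>
      \<exists>v\<in>target_maps P Q d d. \<exists>c\<in>idem_hom Q P. v * (Q - a) - Q = d * c"
  shows "\<exists>c\<in>idem_hom Q P. Q = d * c"
proof -
  let ?Z = "target_maps P Q d d" and ?N = "(*) d ` idem_hom Q P"
  let ?I = "products (target_maps P Q d' d) (target_maps P Q d d')"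
  interpret left_submodule ?Z ?N by (rule left_submodule_target_maps)
  obtain B where B: "finite B" "idem_hom Q Q \<subseteq> vs.span B" using finite_span_idem_hom by blast
  obtain C where C: "C \<subseteq> idem_hom Q Q" "vs.independent C" "idem_hom Q Q \<subseteq> vs.span C"
    by (rule vs.basis_exists[of "idem_hom Q Q"])
  have "finite C" using vs.independent_span_bound[OF B(1) C(2)] C(1) B(2) by blast
  then obtain L where L: "set L = C" using finite_list by blast
  have QZ: "Q \<in> ?Z"
    unfolding target_maps_def using idem_homD[OF d(1)] P Q by (auto intro!: bexI[of _ P] idem_homI)
  have "\<exists>z\<in>?Z. gscale k s = z * s" if "s \<in> idem_hom Q Q" for k s
    using vs.subspace_scale[OF subspace_target_maps QZ, of k] idem_homD(1)[OF that]
    by (intro bexI[of _ "gscale k Q"]) (simp_all add: gscale_mult_left)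
  then have generators: "idem_hom Q Q \<subseteq> submodule_plus L"
    using span_subset_submodule_plus[OF left_submodule_axioms, of L] C(1,3) L by blast
  have "idem_hom Q Q \<subseteq> ?N"
  proof (rule nakayama[where I = ?I])
    show "?I \<subseteq> ?Z" by (intro products_subset_subspace subspace_target_maps target_maps_mult)
    show "a * z \<in> ?I" if "a \<in> ?I" "z \<in> ?Z" for a z
      by (rule products_mult_right[OF that(1) target_maps_mult[OF _ that(2)]])
    show "\<exists>n\<in>?N. \<exists>y\<in>products ?I (idem_hom Q Q). s = n + y" if "s \<in> idem_hom Q Q" for s
      using idem_hom_subset_trace_module[OF P Q d decompose] that
      unfolding trace_module_def by blast
    show "\<exists>v\<in>?Z. s - v * (s - a * s) \<in> ?N" if a: "a \<in> ?I" and s: "s \<in> idem_hom Q Q" for a s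
    proof -
      obtain v c where v: "v \<in> ?Z" "c \<in> idem_hom Q P" "v * (Q - a) - Q = d * c"
        using inverse[OF a] by blast
      have "s - v * (s - a * s) = - ((v * (Q - a) - Q) * s)"
        using idem_homD(1)[OF s] by (simp add: left_diff_distrib right_diff_distrib mult.assoc)
      also have "\<dots> = d * (- (c * s))" unfolding v(3) by (simp add: mult.assoc)
      finally show ?thesis using v(1) idem_hom_uminus[OF idem_hom_mult[OF v(2) s]] by blast
    qed
  qed (use generators L C(1) in \<open>auto intro: products.zero products_add\<close>)
  then show ?thesis using idem_homI[OF Q Q] by blast
qed

end

subsection \<open>Two-term complexes as maps\<close>

definition term_pair :: "'a::ring gmat \<Rightarrow> 'a gmat \<Rightarrow> bool" where
  "term_pair P Q \<longleftrightarrow> block_at (-1) (-1) P \<and> block_at 0 0 Q \<and> P * P = P \<and> Q * Q = Q"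

lemma term_pairD:
  assumes "term_pair P Q"
  shows "block_at (-1) (-1) P" "block_at 0 0 Q" "P * P = P" "Q * Q = Q"
  using assms unfolding term_pair_def by auto

lemma term_pair_orthogonal:
  assumes "term_pair P Q" "term_pair P' Q'" shows "P * Q' = 0" "Q * P' = 0"
  using block_at_mult_zero[OF term_pairD(1)[OF assms(1)] term_pairD(2)[OF assms(2)]]
    block_at_mult_zero[OF term_pairD(2)[OF assms(1)] term_pairD(1)[OF assms(2)]] by simp_all

lemma term_pair_self: "term_pair P Q \<Longrightarrow> P \<in> idem_hom P P" "term_pair P Q \<Longrightarrow> Q \<in> idem_hom Q Q"
  unfolding term_pair_def by (auto intro: idem_homI)

lemma term_pair_sum_mult:
  assumes t: "term_pair P Q"
  shows "x \<in> idem_hom A P \<Longrightarrow> (P + Q) * x = x" "x \<in> idem_hom A Q \<Longrightarrow> (P + Q) * x = x"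
    "x \<in> idem_hom P A \<Longrightarrow> x * (P + Q) = x" "x \<in> idem_hom Q A \<Longrightarrow> x * (P + Q) = x"
  using idem_hom_orthogonal[OF term_pair_self(1)[OF t] _ term_pair_orthogonal(1)[OF t t], of x]
    idem_hom_orthogonal[OF term_pair_self(2)[OF t] _ term_pair_orthogonal(2)[OF t t], of x]
    idem_hom_orthogonal[OF _ term_pair_self(1)[OF t] term_pair_orthogonal(2)[OF t t], of x]
    idem_hom_orthogonal[OF _ term_pair_self(2)[OF t] term_pair_orthogonal(1)[OF t t], of x]
  by (auto simp: distrib_left distrib_right dest: idem_homD)

lemma total_complex_term_pair:
  assumes t: "term_pair P Q" and d: "d \<in> idem_hom P Q" shows "total_complex (P + Q, d)"
proof -
  note tD = term_pairD[OF t]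
  have "homog 0 (P + Q)"
    using block_at_homog[OF tD(1)] block_at_homog[OF tD(2)] by (simp add: homog_add)
  moreover have "homog 1 d" using block_at_homog[OF block_at_idem_hom[OF tD(1,2) d]] by simp
  moreover have "d * d = 0" by (rule idem_hom_orthogonal[OF d d term_pair_orthogonal(1)[OF t t]])
  moreover have "(P + Q) * (P + Q) = P + Q"
    using term_pair_sum_mult(1,2)[OF t] term_pair_self[OF t] by (simp add: distrib_left)
  ultimately show ?thesis unfolding total_complex_def using term_pair_sum_mult(2,3)[OF t d] by simp
qed

lemma term_pair_map_decompose:
  assumes "f \<in> Hom k (P + Q, d) (P' + Q', d')"
  shows "f = P' * f * P + P' * f * Q + Q' * f * P + Q' * f * Q"
proof -
  have "f = (P' + Q') * f * (P + Q)" using HomD(2,3)[OF assms] by simp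
  then show ?thesis by (simp add: distrib_left distrib_right add_ac)
qed

lemma term_pair_Hom:
  assumes t: "term_pair P Q" and t': "term_pair P' Q'"
  shows "Hom 0 (P + Q, d) (P' + Q', d') = {\<phi> + \<rho> | \<phi> \<rho>. \<phi> \<in> idem_hom Q Q' \<and> \<rho> \<in> idem_hom P P'}"
    and "Hom 1 (P + Q, d) (P' + Q', d') = idem_hom P Q'"
    and "Hom (-1) (P + Q, d) (P' + Q', d') = idem_hom Q P'"
proof -
  note tD = term_pairD[OF t] and tD' = term_pairD[OF t']
  have split: "f = P' * f * P + P' * f * Q + Q' * f * P + Q' * f * Q" "homog k f"
    if "f \<in> Hom k (P + Q, d) (P' + Q', d')" for k f
    using term_pair_map_decompose[OF that] HomD(1)[OF that] .
  note zero = block_at_homog_zero[OF tD'(1) tD(1)] block_at_homog_zero[OF tD'(1) tD(2)]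
    block_at_homog_zero[OF tD'(2) tD(1)] block_at_homog_zero[OF tD'(2) tD(2)]
  have homog: "x \<in> idem_hom Q Q' \<Longrightarrow> homog 0 x" "x \<in> idem_hom P P' \<Longrightarrow> homog 0 x"
    "x \<in> idem_hom P Q' \<Longrightarrow> homog 1 x" "x \<in> idem_hom Q P' \<Longrightarrow> homog (-1) x" for x
    using block_at_homog[OF block_at_idem_hom[OF tD(2) tD'(2)]]
      block_at_homog[OF block_at_idem_hom[OF tD(1) tD'(1)]]
      block_at_homog[OF block_at_idem_hom[OF tD(1) tD'(2)]]
        block_at_homog[OF block_at_idem_hom[OF tD(2) tD'(1)]]
    by fastforce+
  show "Hom 0 (P + Q, d) (P' + Q', d') = {\<phi> + \<rho> | \<phi> \<rho>. \<phi> \<in> idem_hom Q Q' \<and> \<rho> \<in> idem_hom P P'}"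
  proof (intro equalityI subsetI)
    fix f assume f: "f \<in> Hom 0 (P + Q, d) (P' + Q', d')"
    then have "f = Q' * f * Q + P' * f * P"
      using split[OF f] zero[of 0 f] by (simp add: add.commute)
    then show "f \<in> {\<phi> + \<rho> | \<phi> \<rho>. \<phi> \<in> idem_hom Q Q' \<and> \<rho> \<in> idem_hom P P'}"
      using idem_hom_block[OF tD'(4) tD(4)] idem_hom_block[OF tD'(3) tD(3)] by blast
  qed (auto simp: Hom_def homog homog_add term_pair_sum_mult[OF t] term_pair_sum_mult[OF t']
      distrib_left[of "P' + Q'"] distrib_right[of _ _ "P + Q"])
  show "Hom 1 (P + Q, d) (P' + Q', d') = idem_hom P Q'"
  proof (intro equalityI subsetI)
    fix f assume f: "f \<in> Hom 1 (P + Q, d) (P' + Q', d')"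
    then have "f = Q' * f * P" using split[OF f] zero[of 1 f] by simp
    then show "f \<in> idem_hom P Q'" using idem_hom_block[OF tD'(4) tD(3)] by metis
  qed (simp add: Hom_def homog term_pair_sum_mult[OF t] term_pair_sum_mult[OF t'])
  show "Hom (-1) (P + Q, d) (P' + Q', d') = idem_hom Q P'"
  proof (intro equalityI subsetI)
    fix f assume f: "f \<in> Hom (-1) (P + Q, d) (P' + Q', d')"
    then have "f = P' * f * Q" using split[OF f] zero[of "-1" f] by simp
    then show "f \<in> idem_hom Q P'" using idem_hom_block[OF tD'(3) tD(4)] by metis
  qed (simp add: Hom_def homog term_pair_sum_mult[OF t] term_pair_sum_mult[OF t'])
qed

lemma term_pair_components_eq:
  assumes t': "term_pair P' Q'" and \<phi>: "\<phi> \<in> idem_hom Q Q'" "\<phi>' \<in> idem_hom Q Q'"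
    and \<rho>: "\<rho> \<in> idem_hom P P'" "\<rho>' \<in> idem_hom P P'" and eq: "\<phi> + \<rho> = \<phi>' + \<rho>'"
  shows "\<phi> = \<phi>'"
proof -
  have "Q' * \<rho> = 0" "Q' * \<rho>' = 0"
    using idem_hom_orthogonal[OF term_pair_self(2)[OF t'] _ term_pair_orthogonal(2)[OF t' t']] \<rho>
    by blast+
  then show ?thesis
    using arg_cong[OF eq, of "(*) Q'"] idem_homD(1)[OF \<phi>(1)] idem_homD(1)[OF \<phi>(2)]
    by (simp add: distrib_left)
qed

lemma term_pair_dif_mult:
  assumes "term_pair P Q" "term_pair P' Q'" and d: "d \<in> idem_hom P Q" "d' \<in> idem_hom P' Q'"
    and \<phi>: "\<phi> \<in> idem_hom Q Q'" and \<rho>: "\<rho> \<in> idem_hom P P'"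
  shows "d' * (\<phi> + \<rho>) = d' * \<rho>" "(\<phi> + \<rho>) * d = \<phi> * d"
  using idem_hom_orthogonal[OF d(2) \<phi> term_pair_orthogonal(1)[OF assms(2,2)]]
    idem_hom_orthogonal[OF \<rho> d(1) term_pair_orthogonal(1)[OF assms(1,1)]]
  by (simp_all add: distrib_left distrib_right)

lemma term_pair_ZHom_0:
  assumes t: "term_pair P Q" "term_pair P' Q'" and d: "d \<in> idem_hom P Q" "d' \<in> idem_hom P' Q'"
  shows "ZHom 0 (P + Q, d) (P' + Q', d') =
    {\<phi> + \<rho> | \<phi> \<rho>. \<phi> \<in> idem_hom Q Q' \<and> \<rho> \<in> idem_hom P P' \<and> \<phi> * d = d' * \<rho>}"
  unfolding ZHom_def term_pair_Hom[OF t] using term_pair_dif_mult[OF t d] by fastforce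

lemma term_pair_BHom_0:
  assumes t: "term_pair P Q" "term_pair P' Q'"
  shows "BHom 0 (P + Q, d) (P' + Q', d') = {d' * c + c * d | c. c \<in> idem_hom Q P'}"
  unfolding BHom_def using term_pair_Hom(3)[OF t] by simp

lemma term_pair_BHom_1:
  assumes t: "term_pair P Q" "term_pair P' Q'" and d: "d \<in> idem_hom P Q" "d' \<in> idem_hom P' Q'"
    and f: "f \<in> BHom 1 (P + Q, d) (P' + Q', d')"
  shows "\<exists>\<phi>\<in>idem_hom Q Q'. \<exists>\<rho>\<in>idem_hom P P'. f = \<phi> * d - d' * \<rho>"
proof -
  obtain \<phi> \<rho> where h: "\<phi> \<in> idem_hom Q Q'" "\<rho> \<in> idem_hom P P'" "f = - (d' * (\<phi> + \<rho>)) + (\<phi> + \<rho>) * d"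
    using f unfolding BHom_def diff_self term_pair_Hom(1)[OF t] by auto
  have "f = \<phi> * d - d' * \<rho>" unfolding h(3) term_pair_dif_mult[OF t d h(1,2)] by simp
  then show ?thesis using h(1,2) by blast
qed

lemma term_pair_add_contractible:
  assumes t: "term_pair P Q" "term_pair P' Q'" and d: "d \<in> idem_hom P Q"
    and P: "idem_biprod P' P R k1 k2 r1 r2" and Q: "idem_biprod Q' Q R i1 i2 p1 p2"
  shows "i1 * d * r1 + i2 * r2 \<in> idem_hom P' Q'"
    "htpy_iso (P + Q, d) (P' + Q', i1 * d * r1 + i2 * r2)"
proof -
  define D where "D = i1 * d * r1 + i2 * r2"
  note PD = idem_biprodD[OF P] and QD = idem_biprodD[OF Q]
  show D: "i1 * d * r1 + i2 * r2 \<in> idem_hom P' Q'"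
    by (intro idem_hom_add idem_hom_mult[OF QD(2) PD(4)]
      idem_hom_mult[OF idem_hom_mult[OF QD(1) d] PD(3)])
  have "D * k1 = i1 * (d * (r1 * k1)) + i2 * (r2 * k1)"
    "p1 * D = (p1 * i1) * d * r1 + (p1 * i2) * r2"
    unfolding D_def by (simp_all add: distrib_left distrib_right mult.assoc)
  then have "i1 * d = D * k1" "p1 * D = d * r1" using PD(5,8) QD(5,7) idem_homD[OF d] by simp_all
  then have maps: "i1 + k1 \<in> ZHom 0 (P + Q, d) (P' + Q', D)"
    "p1 + r1 \<in> ZHom 0 (P' + Q', D) (P + Q, d)"
    unfolding term_pair_ZHom_0[OF t d D[folded D_def]] term_pair_ZHom_0[OF t(2,1) D[folded D_def] d]
    using PD(1,3) QD(1,3) by blast+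
  have cross: "p1 * k1 = 0" "r1 * i1 = 0" "i1 * r1 = 0" "k1 * p1 = 0"
    using idem_hom_orthogonal[OF QD(3) PD(1)] idem_hom_orthogonal[OF PD(3) QD(1)]
      idem_hom_orthogonal[OF QD(1) PD(3)] idem_hom_orthogonal[OF PD(1) QD(3)]
      term_pair_orthogonal[OF t(1,1)] term_pair_orthogonal[OF t(2,2)] by simp_all
  have "(p1 + r1) * (i1 + k1) - (P + Q) = 0"
    using PD(5) QD(5) cross by (simp add: distrib_left distrib_right add.commute)
  moreover have "(i1 + k1) * (p1 + r1) - (P' + Q') \<in> BHom 0 (P' + Q', D) (P' + Q', D)"
  proof -
    have "(i1 + k1) * (p1 + r1) - (P' + Q') = - (i2 * p2) - k2 * r2"
      unfolding PD(9)[symmetric] QD(9)[symmetric] using cross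
      by (simp add: distrib_left distrib_right)
    moreover have "D * (k2 * p2) = i1 * d * (r1 * k2) * p2 + i2 * ((r2 * k2) * p2)"
      "(k2 * p2) * D = k2 * (p2 * i1) * d * r1 + k2 * ((p2 * i2) * r2)"
      unfolding D_def by (simp_all add: distrib_left distrib_right mult.assoc)
    then have "D * (k2 * p2) = i2 * p2" "(k2 * p2) * D = k2 * r2"
      using PD(6,7,8) QD(6,7,8) idem_homD[OF PD(4)] idem_homD[OF QD(4)] by simp_all
    ultimately have "(i1 + k1) * (p1 + r1) - (P' + Q') = D * (- (k2 * p2)) + (- (k2 * p2)) * D"
      by simp
    then show ?thesis
      unfolding term_pair_BHom_0[OF t(2,2)] using idem_hom_uminus[OF idem_hom_mult[OF PD(2) QD(4)]]
      by blast
  qed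
  ultimately show "htpy_iso (P + Q, d) (P' + Q', i1 * d * r1 + i2 * r2)"
    unfolding htpy_iso_def D_def[symmetric] using maps
    by (intro bexI[of _ "i1 + k1"] bexI[of _ "p1 + r1"]) simp_all
qed

context finite_dim_algebra
begin

lemma maps_decompose_of_ext_orthogonal:
  assumes t: "term_pair P Q" and d: "d \<in> idem_hom P Q" "d' \<in> idem_hom P Q"
    and orth: "ext_orthogonal (P + Q, d) (P + Q, d')"
  shows "maps_decompose P Q d d'"
  unfolding maps_decompose_def
proof
  fix b assume b: "b \<in> idem_hom P Q"
  have "d' * b = 0" "b * d = 0"
    using idem_hom_orthogonal[OF d(2) b term_pair_orthogonal(1)[OF t t]]
      idem_hom_orthogonal[OF b d(1) term_pair_orthogonal(1)[OF t t]] .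
  then have "b \<in> ZHom (int 1) (P + Q, d) (P + Q, d')"
    unfolding ZHom_def using term_pair_Hom(2)[OF t t] b by simp
  then have "b \<in> BHom 1 (P + Q, d) (P + Q, d')" using ext_orthogonalD[OF orth, of 1] by simp
  then obtain \<phi> \<rho> where "\<phi> \<in> idem_hom Q Q" "\<rho> \<in> idem_hom P P" "b = \<phi> * d - d' * \<rho>"
    using term_pair_BHom_1[OF t t d] by blast
  then show "\<exists>h\<in>idem_hom P P. \<exists>h'\<in>idem_hom Q Q. b = h' * d + d' * h"
    by (intro bexI[of _ "- \<rho>"] bexI[of _ \<phi>]) (simp_all add: idem_hom_uminus)
qed

lemma target_maps_iff_ZHom:
  assumes t: "term_pair P Q" and d: "d \<in> idem_hom P Q" "d' \<in> idem_hom P Q"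
  shows "\<phi> \<in> target_maps P Q d d' \<longleftrightarrow>
    \<phi> \<in> idem_hom Q Q \<and> (\<exists>\<rho>\<in>idem_hom P P. \<phi> + \<rho> \<in> ZHom 0 (P + Q, d) (P + Q, d'))"
proof -
  have "\<phi> * d = d' * \<rho>" if \<phi>\<rho>: "\<phi> \<in> idem_hom Q Q" "\<rho> \<in> idem_hom P P"
    "\<phi> + \<rho> \<in> ZHom 0 (P + Q, d) (P + Q, d')" for \<rho>
    using ZHomD(2)[OF \<phi>\<rho>(3)] term_pair_dif_mult[OF t t d \<phi>\<rho>(1,2)] by simp
  then show ?thesis unfolding target_maps_def term_pair_ZHom_0[OF t t d] by blast
qed

lemma target_maps_products_ZHom:
  assumes t: "term_pair P Q" and d: "d \<in> idem_hom P Q" "d' \<in> idem_hom P Q"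
    and a: "a \<in> products (target_maps P Q d' d) (target_maps P Q d d')"
  shows "\<exists>\<rho>\<in>idem_hom P P. a + \<rho>
    \<in> products (ZHom 0 (P + Q, d') (P + Q, d)) (ZHom 0 (P + Q, d) (P + Q, d'))"
  using a
proof (induction rule: products.induct)
  case zero
  then show ?case using idem_hom_zero products.zero by (intro bexI[of _ 0]) auto
next
  case (add p q a)
  obtain r s \<rho> where r: "p \<in> idem_hom Q Q" "r \<in> idem_hom P P"
    "p + r \<in> ZHom 0 (P + Q, d') (P + Q, d)"
    and s: "q \<in> idem_hom Q Q" "s \<in> idem_hom P P" "q + s \<in> ZHom 0 (P + Q, d) (P + Q, d')"
    and \<rho>: "\<rho> \<in> idem_hom P P"
      "a + \<rho> \<in> products (ZHom 0 (P + Q, d') (P + Q, d)) (ZHom 0 (P + Q, d) (P + Q, d'))"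
    using add target_maps_iff_ZHom[OF t d] target_maps_iff_ZHom[OF t d(2,1)] by blast
  have "p * s = 0" "r * q = 0"
    using idem_hom_orthogonal[OF r(1) s(2) term_pair_orthogonal(2)[OF t t]]
      idem_hom_orthogonal[OF r(2) s(1) term_pair_orthogonal(1)[OF t t]] .
  then have "(p * q + a) + (r * s + \<rho>) = (p + r) * (q + s) + (a + \<rho>)"
    by (simp add: distrib_left distrib_right add_ac)
  also have "\<dots> \<in> products (ZHom 0 (P + Q, d') (P + Q, d)) (ZHom 0 (P + Q, d) (P + Q, d'))"
    by (rule products.add[OF r(3) s(3) \<rho>(2)])
  finally show ?case using idem_hom_add[OF idem_hom_mult[OF r(2) s(2)] \<rho>(1)] by blast
qed

lemma target_maps_products_left_inverse:
  assumes t: "term_pair P Q" and d: "d \<in> idem_hom P Q" "d' \<in> idem_hom P Q"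
    and X: "is_complex X" "total X = (P + Q, d)" and Y: "is_complex Y" "total Y = (P + Q, d')"
    and disjoint: "set_mset (ks.summands X) \<inter> set_mset (ks.summands Y) = {}"
    and a: "a \<in> products (target_maps P Q d' d) (target_maps P Q d d')"
  shows "\<exists>v\<in>target_maps P Q d d. \<exists>c\<in>idem_hom Q P. v * (Q - a) - Q = d * c"
proof -
  note self = term_pair_self[OF t]
  obtain \<rho> where \<rho>: "\<rho> \<in> idem_hom P P"
    "a + \<rho> \<in> products (ZHom 0 (total Y) (total X)) (ZHom 0 (total X) (total Y))"
    using target_maps_products_ZHom[OF t d a] unfolding X(2) Y(2) by blast
  obtain f where f: "f \<in> ZHom 0 (P + Q, d) (P + Q, d)"
    "f * (P + Q - (a + \<rho>)) - (P + Q) \<in> BHom 0 (P + Q, d) (P + Q, d)"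
    using ks.disjoint_summands_products_left_inverse[OF X(1) Y(1) disjoint \<rho>(2)]
    unfolding X(2) by auto
  obtain v r where v: "f = v + r" "v \<in> idem_hom Q Q" "r \<in> idem_hom P P" "v * d = d * r"
    using f(1) unfolding term_pair_ZHom_0[OF t t d(1,1)] by blast
  obtain c where c: "c \<in> idem_hom Q P" "f * (P + Q - (a + \<rho>)) - (P + Q) = d * c + c * d"
    using f(2) unfolding term_pair_BHom_0[OF t t] by blast
  have "products (target_maps P Q d' d) (target_maps P Q d d') \<subseteq> idem_hom Q Q"
    by (intro products_subset_subspace subspace_idem_hom)
      (blast intro: idem_hom_mult target_mapsD(1))
  then have aQ: "Q - a \<in> idem_hom Q Q" and \<rho>P: "P - \<rho> \<in> idem_hom P P"
    using a self \<rho>(1) idem_hom_diff by blast+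
  have "v * (P - \<rho>) = 0" "r * (Q - a) = 0"
    using idem_hom_orthogonal[OF v(2) \<rho>P term_pair_orthogonal(2)[OF t t]]
      idem_hom_orthogonal[OF v(3) aQ term_pair_orthogonal(1)[OF t t]] .
  then have "f * (P + Q - (a + \<rho>)) - (P + Q) = (v * (Q - a) - Q) + (r * (P - \<rho>) - P)"
    unfolding v(1) by (simp add: algebra_simps)
  then have "(v * (Q - a) - Q) + (r * (P - \<rho>) - P) = d * c + c * d" using c(2) by simp
  then have "v * (Q - a) - Q = d * c"
    by (rule term_pair_components_eq[OF t idem_hom_diff[OF idem_hom_mult[OF v(2) aQ] self(2)]
      idem_hom_mult[OF d(1) c(1)]
          idem_hom_diff[OF idem_hom_mult[OF v(3) \<rho>P] self(1)] idem_hom_mult[OF c(1) d(1)]])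
  then show ?thesis using c(1) v unfolding target_maps_def by blast
qed

lemma split_surjection_summands:
  assumes t: "term_pair P Q" and d: "d \<in> idem_hom P Q" and c: "c \<in> idem_hom Q P" "Q = d * c"
    and X: "is_complex X" "total X = (P + Q, d)" and S: "stalk S (-1) P"
  shows "\<exists>V v. stalk V (-1) v \<and> idem_iso v Q d c \<and> ks.summands S = ks.summands X + ks.summands V"
proof -
  note tD = term_pairD[OF t] and dD = idem_homD[OF d] and cD = idem_homD[OF c(1)]
  define v where "v = c * d"
  have v: "v * v = v" "P * v = v" "v * P = v" "d * v = d" "v * c = c"
    unfolding v_def using dD cD c(2) by (metis mult.assoc)+
  define w where "w = P - v"
  have w: "w * w = w" "P * w = w" "w * P = w" "d * w = 0" "w * c = 0"
    unfolding w_def using v tD(3) cD dD by (simp_all add: left_diff_distrib right_diff_distrib)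
  have block: "block_at (-1) (-1) v" "block_at (-1) (-1) w"
    using block_at_idem_hom[OF tD(1,1)] idem_homI v(2,3) w(2,3) by blast+
  obtain V where V: "stalk V (-1) v" using ex_stalk[OF block(1) v(1)] .
  obtain W where W: "stalk W (-1) w" using ex_stalk[OF block(2) w(1)] .
  have "idem_biprod P w v w v w v"
    using idem_biprod_swap[OF idem_biprod_complement[OF tD(3) v(1,2,3)]] unfolding w_def .
  then have "ks.summands S = ks.summands W + ks.summands V"
    by (rule stalk_summands_biprod[OF S W V])
  moreover have "term_pair w 0"
    unfolding term_pair_def using block(2) w(1) by (simp add: block_at_def[of _ _ 0])
  from term_pair_add_contractible(2)[OF this t, of 0 Q w c w d 0 Q 0 Q]
  have "htpy_iso (total W) (total X)"
    unfolding X(2) stalkD(2)[OF W] using v w dD cD tD(4) c(2)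
    by (simp add: idem_biprod_def idem_hom_def w_def v_def)
  then have "ks.iso W X"
    using X(1) stalkD(1)[OF W]
    unfolding htpy_equiv_iff_iso[symmetric] htpy_equiv_iff_htpy_iso by blast
  then have "ks.summands W = ks.summands X" by (rule ks.summands_iso)
  ultimately have "ks.summands S = ks.summands X + ks.summands V" by simp
  moreover have "idem_iso v Q d c"
    unfolding idem_iso_def idem_hom_def using v dD cD c(2) v_def by simp
  ultimately show ?thesis using V by blast
qed

lemma same_terms_disjoint_summands_eq:
  assumes t: "term_pair P Q" and d: "d \<in> idem_hom P Q" "d' \<in> idem_hom P Q"
    and X: "is_complex X" "total X = (P + Q, d)" and Y: "is_complex Y" "total Y = (P + Q, d')"
    and orth: "ext_orthogonal (total X) (total X)" "ext_orthogonal (total Y) (total Y)"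
    and disjoint: "set_mset (ks.summands X) \<inter> set_mset (ks.summands Y) = {}"
  shows "ks.summands X = ks.summands Y"
proof -
  note tD = term_pairD[OF t]
  have decompose: "maps_decompose P Q d d" "maps_decompose P Q d' d'"
    using maps_decompose_of_ext_orthogonal[OF t] d orth unfolding X(2) Y(2) by blast+
  have disjoint': "set_mset (ks.summands Y) \<inter> set_mset (ks.summands X) = {}" using disjoint by blast
  obtain c where c: "c \<in> idem_hom Q P" "Q = d * c"
    using split_of_radical_trace[OF tD(3,4) d decompose
      target_maps_products_left_inverse[OF t d X Y disjoint]] by blast
  obtain c' where c': "c' \<in> idem_hom Q P" "Q = d' * c'"
    using split_of_radical_trace[OF tD(3,4) d(2,1) decompose(2,1)
        target_maps_products_left_inverse[OF t d(2,1) Y X disjoint']] by blast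
  obtain S where S: "stalk S (-1) P" using ex_stalk[OF tD(1,3)] .
  obtain V v where V: "stalk V (-1) v" "idem_iso v Q d c"
    "ks.summands S = ks.summands X + ks.summands V"
    using split_surjection_summands[OF t d(1) c X S] by blast
  obtain V' v' where V': "stalk V' (-1) v'" "idem_iso v' Q d' c'"
    "ks.summands S = ks.summands Y + ks.summands V'"
    using split_surjection_summands[OF t d(2) c' Y S] by blast
  have "ks.summands V = ks.summands V'"
    using stalk_summands_eq_iff[OF V(1) V'(1)] idem_iso_trans[OF V(2) idem_iso_sym[OF V'(2)]]
    by blast
  then show ?thesis using V(3) V'(3) by simp
qed

end

section \<open>g-vectors\<close>

subsection \<open>The summands of a term\<close>

lemma degree_part_idem_biprod:
  assumes "idem_biprod B Y Z i1 i2 p1 p2" and "homog 0 B" "homog 0 Y" "homog 0 Z"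
    and "homog 0 i1" "homog 0 i2" "homog 0 p1" "homog 0 p2"
  shows "idem_biprod (degree_part t B) (degree_part t Y) (degree_part t Z)
    (degree_part t i1) (degree_part t i2) (degree_part t p1) (degree_part t p2)"
  using assms unfolding idem_biprod_def idem_hom_def
  by (simp add: degree_part_mult degree_part_zero degree_part_add[symmetric])

lemma two_term_term_pair:
  assumes X: "two_term X"
  defines "P \<equiv> degree_part (-1) (ide (total X))" and "Q \<equiv> degree_part 0 (ide (total X))"
  shows "term_pair P Q" "dif (total X) \<in> idem_hom P Q" "total X = (P + Q, dif (total X))"
proof -
  note XD = two_termD[OF X]
  define e where "e = ide (total X)"
  define d where "d = dif (total X)"
  note tX = XD(2)[unfolded total_complex_def, folded e_def d_def]
  show "term_pair P Q"
    unfolding term_pair_def P_def Q_def e_def[symmetric] using degree_part_idempotent tX by blast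
  have "degree_part 0 d = d"
  proof (rule gmat_eqI_Ix)
    fix i a j b
    show "entry (degree_part 0 d) (Ix i a) (Ix j b) = entry d (Ix i a) (Ix j b)"
      using degrees_Hom[OF XD(2) dif_Hom[OF XD(2)], folded d_def, of i a j b] XD(3)
      by (cases "entry d (Ix i a) (Ix j b) = 0")
        (auto simp: entry_degree_part dest!: subsetD[OF XD(3)])
  qed
  moreover have "d * degree_part (-1) e = degree_part 0 (d * e)"
    using degree_part_mult_right[of 1 d "-1" e] tX by simp
  ultimately show "dif (total X) \<in> idem_hom P Q"
    unfolding P_def Q_def e_def[symmetric] d_def[symmetric]
    using tX by (intro idem_homI) (simp_all add: degree_part_mult_left)
  have "e = P + Q"
  proof (rule gmat_eqI_Ix)
    fix i a j b
    show "entry e (Ix i a) (Ix j b) = entry (P + Q) (Ix i a) (Ix j b)"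
      using XD(3) unfolding degrees_def P_def Q_def e_def[symmetric]
      by (fastforce simp: entry_degree_part)
  qed
  then show "total X = (P + Q, dif (total X))" unfolding e_def by (simp add: prod_eq_iff)
qed

context finite_dim_algebra
begin

text \<open>The projective \<open>P\<close>, placed in an arbitrary degree, becomes a complex with summands \<open>A\<close> when
  moved to degree 0.\<close>

definition projective_summands :: "'a gmat \<Rightarrow> 'a cplx set multiset \<Rightarrow> bool" where
  "projective_summands P A \<longleftrightarrow> (\<exists>R b u u'. stalk R 0 b \<and> ks.summands R = A \<and> idem_iso P b u u')"

lemma projective_summands_zero: "projective_summands 0 {#}"
proof -
  have "stalk (zero_cplx :: 'a cplx) 0 0"
    unfolding stalk_def by (simp add: is_complex_zero_cplx total_zero_cplx block_at_def)
  moreover have "idem_iso 0 0 0 (0 :: 'a gmat)" unfolding idem_iso_def idem_hom_def by simp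
  ultimately show ?thesis unfolding projective_summands_def using ks.summands_ozero by blast
qed

lemma projective_summands_ex_sum:
  assumes "projective_summands P A" "projective_summands Q B"
  shows "\<exists>R b i1 i2 p1 p2. stalk R 0 b \<and> ks.summands R = A + B \<and> idem_biprod b P Q i1 i2 p1 p2"
proof -
  obtain R b u u' where R: "stalk R 0 b" "ks.summands R = A" "idem_iso P b u u'"
    using assms(1) unfolding projective_summands_def by blast
  obtain S c v v' where S: "stalk S 0 c" "ks.summands S = B" "idem_iso Q c v v'"
    using assms(2) unfolding projective_summands_def by blast
  obtain a i1 i2 p1 p2 where a: "stalk (R \<oplus>\<^sub>K S) 0 a" "idem_biprod a b c i1 i2 p1 p2"
    using stalk_dsum[OF R(1) S(1)] by blast
  have "idem_biprod a P Q (i1 * u) (i2 * v) (u' * p1) (v' * p2)"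
    using idem_biprod_swap[OF
      idem_biprod_iso_left[OF idem_biprod_swap[OF idem_biprod_iso_left[OF a(2) R(3)]] S(3)]] .
  moreover have "ks.summands (R \<oplus>\<^sub>K S) = A + B"
    using ks.summands_osum[OF stalkD(1)[OF R(1)] stalkD(1)[OF S(1)]] R(2) S(2) by simp
  ultimately show ?thesis using a(1) by blast
qed

lemma projective_summands_sum:
  assumes "idem_biprod B P Q i1 i2 p1 p2" "projective_summands P M" "projective_summands Q N"
  shows "projective_summands B (M + N)"
  using projective_summands_ex_sum[OF assms(2,3)] idem_biprod_unique[OF assms(1)]
  unfolding projective_summands_def by blast

lemma ex_projective_summands:
  assumes P: "block_at t t P" "P * P = P"
  shows "\<exists>A. projective_summands P A \<and> set_mset A \<subseteq> set_mset (ks.summands alg_cplx)"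
proof -
  obtain S where "stalk S t P" using ex_stalk[OF P] .
  from stalk_shift[OF this] show ?thesis unfolding projective_summands_def
    using stalk_summands_alg by blast
qed

text \<open>The difference of \<open>A\<close> and \<open>B\<close>, the summands in degrees 0 and -1, is the g-vector of \<open>X\<close>.\<close>

definition g_vector :: "'a cplx \<Rightarrow> 'a cplx set multiset \<Rightarrow> 'a cplx set multiset \<Rightarrow> bool" where
  "g_vector X A B \<longleftrightarrow> two_term X \<and>
     projective_summands (degree_part 0 (ide (total X))) A \<and>
     projective_summands (degree_part (-1) (ide (total X))) B"

lemma g_vectorD:
  assumes "g_vector X A B"
  shows "is_complex X" "two_term X" "projective_summands (degree_part 0 (ide (total X))) A"
    "projective_summands (degree_part (-1) (ide (total X))) B"
  using assms two_termD(1)[of X] unfolding g_vector_def by auto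

lemma g_vector_zero: "g_vector zero_cplx {#} {#}"
  unfolding g_vector_def by (simp add: two_term_zero_cplx total_zero_cplx degree_part_zero
    projective_summands_zero)

lemma g_vector_dsum:
  assumes X: "g_vector X A B" and Y: "g_vector Y A' B'" shows "g_vector (X \<oplus>\<^sub>K Y) (A + A') (B + B')"
proof -
  note two_term = g_vectorD(2)[OF X] g_vectorD(2)[OF Y]
  note XD = two_termD[OF two_term(1)] and YD = two_termD[OF two_term(2)]
    and SD = two_termD[OF two_term_dsum[OF two_term]]
  obtain i1 i2 p1 p2 where g: "glued 0 (total (X \<oplus>\<^sub>K Y)) (total X) (total Y) (dif (total X)) 0
    i1 i2 p1 p2"
    using dsum_glued(2)[OF XD(1) YD(1)] by blast
  have "idem_biprod (degree_part t (ide (total (X \<oplus>\<^sub>K Y)))) (degree_part t (ide (total X)))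
    (degree_part t (ide (total Y)))
      (degree_part t i1) (degree_part t i2) (degree_part t p1) (degree_part t p2)" for t
    using g XD(2) YD(2) SD(2) unfolding glued_def total_complex_def
    by (intro degree_part_idem_biprod) simp_all
  then show ?thesis
    using X Y two_term_dsum[OF two_term] projective_summands_sum unfolding g_vector_def by blast
qed

lemma ex_g_vector:
  assumes "two_term X"
  shows "\<exists>A B. g_vector X A B \<and>
    set_mset A \<subseteq> set_mset (ks.summands alg_cplx) \<and> set_mset B \<subseteq> set_mset (ks.summands alg_cplx)"
  using assms ex_projective_summands term_pairD[OF two_term_term_pair(1)[OF assms]]
  unfolding g_vector_def by blast

lemma g_vector_multiset:
  assumes "\<And>c. c \<in> C \<Longrightarrow> ks.summands (T c) = {#c#} \<and> g_vector (T c) (A c) (B c)"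
  shows "set_mset M \<subseteq> C \<Longrightarrow> \<exists>X. ks.summands X = M \<and> g_vector X (\<Sum>c\<in>#M. A c) (\<Sum>c\<in>#M. B c)"
proof (induction M)
  case empty
  show ?case using ks.summands_ozero g_vector_zero by (intro exI[of _ zero_cplx]) simp
next
  case (add c M)
  then obtain X where X: "ks.summands X = M" "g_vector X (\<Sum>c\<in>#M. A c) (\<Sum>c\<in>#M. B c)" by auto
  have c: "ks.summands (T c) = {#c#}" "g_vector (T c) (A c) (B c)"
    using assms[of c] add.prems by auto
  then have "ks.summands (T c \<oplus>\<^sub>K X) = {#c#} + M"
    using ks.summands_osum[OF g_vectorD(1)[OF c(2)] g_vectorD(1)[OF X(2)]] X(1) by simp
  then show ?case using g_vector_dsum[OF c(2) X(2)] by (intro exI[of _ "T c \<oplus>\<^sub>K X"]) simp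
qed

subsection \<open>Disjoint complexes with the same g-vector\<close>

lemma ex_common_terms:
  assumes X: "g_vector X A B" and Y: "g_vector Y A' B'" and eq: "A + B' = A' + B"
  obtains P Q d d' where "term_pair P Q" "d \<in> idem_hom P Q" "d' \<in> idem_hom P Q"
    "htpy_iso (total X) (P + Q, d)" "htpy_iso (total Y) (P + Q, d')"
proof -
  define P Q P' Q' where "P = degree_part (-1) (ide (total X))"
    and "Q = degree_part 0 (ide (total X))"
    and "P' = degree_part (-1) (ide (total Y))" and "Q' = degree_part 0 (ide (total Y))"
  note tX = two_term_term_pair[OF g_vectorD(2)[OF X], folded P_def Q_def]
    and tY = two_term_term_pair[OF g_vectorD(2)[OF Y], folded P'_def Q'_def]
  note summands = g_vectorD(3,4)[OF X, folded P_def Q_def]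
    g_vectorD(3,4)[OF Y, folded P'_def Q'_def]
  obtain R q i1 i2 p1 p2 where R: "stalk R 0 q" "ks.summands R = A + B'"
    "idem_biprod q Q P' i1 i2 p1 p2"
    using projective_summands_ex_sum[OF summands(1,4)] by blast
  obtain R' q' j1 j2 s1 s2 where R': "stalk R' 0 q'" "ks.summands R' = A' + B"
    "idem_biprod q' Q' P j1 j2 s1 s2"
    using projective_summands_ex_sum[OF summands(3,2)] by blast
  obtain u u' where u: "idem_iso q' q u u'"
    using stalk_summands_eq_iff[OF R'(1) R(1)] R(2) R'(2) eq by auto
  obtain S where S: "stalk S (-1) P" using ex_stalk term_pairD(1,3)[OF tX(1)] by blast
  obtain S' where S': "stalk S' (-1) P'" using ex_stalk term_pairD(1,3)[OF tY(1)] by blast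
  obtain p k1 k2 r1 r2 where p: "stalk (S \<oplus>\<^sub>K S') (-1) p" "idem_biprod p P P' k1 k2 r1 r2"
    using stalk_dsum[OF S S'] by blast
  have t: "term_pair p q"
    unfolding term_pair_def using stalkD(3,4)[OF p(1)] stalkD(3,4)[OF R(1)] by blast
  note X' = term_pair_add_contractible[OF tX(1) t tX(2) p(2) R(3), folded tX(3)]
    and Y' = term_pair_add_contractible[OF tY(1) t tY(2) idem_biprod_swap[OF p(2)]
      idem_biprod_iso_sum[OF R'(3) u],
      folded tY(3)]
  show thesis by (rule that[OF t X'(1) Y'(1) X'(2) Y'(2)])
qed

text \<open>If the terms of \<open>X\<close> and \<open>Y\<close> agree in the Grothendieck group, contractible summands can be
  added so that both complexes become maps between the same two projectives; the vanishing of
  extensions then makes both maps split surjections, and cancellation identifies the two kernels.\<close>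

theorem equal_g_vectors_disjoint:
  assumes X: "g_vector X A B" and Y: "g_vector Y A' B'" and eq: "A + B' = A' + B"
    and orth: "ext_orthogonal (total X) (total X)" "ext_orthogonal (total Y) (total Y)"
    and disjoint: "set_mset (ks.summands X) \<inter> set_mset (ks.summands Y) = {}"
  shows "ks.summands X = {#}" "ks.summands Y = {#}"
proof -
  obtain P Q d d' where t: "term_pair P Q" and d: "d \<in> idem_hom P Q" "d' \<in> idem_hom P Q"
    and iso: "htpy_iso (total X) (P + Q, d)" "htpy_iso (total Y) (P + Q, d')"
    using ex_common_terms[OF X Y eq] .
  obtain V W where V: "is_complex V" "total V = (P + Q, d)"
    and W: "is_complex W" "total W = (P + Q, d')"
    using ex_complex_of_total total_complex_term_pair[OF t] d by meson
  have iso': "ks.iso X V" "ks.iso Y W"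
    using iso g_vectorD(1)[OF X] g_vectorD(1)[OF Y] V W
    unfolding htpy_equiv_iff_iso[symmetric] htpy_equiv_iff_htpy_iso by simp_all
  note summands = ks.summands_iso[OF iso'(1)] ks.summands_iso[OF iso'(2)]
  have "ks.summands V = ks.summands W"
    by (rule same_terms_disjoint_summands_eq[OF t d V W ext_orthogonal_iso[OF iso'(1,1) orth(1)]
          ext_orthogonal_iso[OF iso'(2,2) orth(2)] disjoint[unfolded summands]])
  then show "ks.summands X = {#}" "ks.summands Y = {#}" using disjoint summands by auto
qed

end

subsection \<open>Multisets with the same weighted sum\<close>

lemma integer_relation:
  fixes v :: "'c \<Rightarrow> 's \<Rightarrow> int"
  assumes "finite S" "finite C" "card S < card C"
  shows "\<exists>a. (\<exists>c\<in>C. a c \<noteq> 0) \<and> (\<forall>s\<in>S. (\<Sum>c\<in>C. a c * v c s) = 0)"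
  using assms
proof (induction S arbitrary: C v rule: finite_induct)
  case empty
  then have "C \<noteq> {}" by auto
  then show ?case by (intro exI[of _ "\<lambda>_. 1"]) auto
next
  case (insert s S)
  show ?case
  proof (cases "\<forall>c\<in>C. v c s = 0")
    case True
    then show ?thesis using insert.IH[OF insert.prems(1), of v] insert.prems insert.hyps by auto
  next
    case False
    then obtain c0 where c0: "c0 \<in> C" "v c0 s \<noteq> 0" by blast
    define D where "D = C - {c0}"
    have D: "C = insert c0 D" "finite D" "c0 \<notin> D" unfolding D_def using c0 insert.prems(1) by auto
    define w where "w = (\<lambda>c t. v c0 s * v c t - v c s * v c0 t)"
    have "card S < card D" using insert.prems insert.hyps D by simp
    from insert.IH[OF D(2) this, of w] obtain a where
      a: "\<exists>c\<in>D. a c \<noteq> 0" "\<forall>t\<in>S. (\<Sum>c\<in>D. a c * w c t) = 0" by blast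
    define b where "b = (\<lambda>c. if c = c0 then - (\<Sum>c\<in>D. a c * v c s) else v c0 s * a c)"
    have "(\<Sum>c\<in>C. b c * v c t) = (\<Sum>c\<in>D. a c * w c t)" for t
    proof -
      have "(\<Sum>c\<in>D. b c * v c t) = (\<Sum>c\<in>D. v c0 s * a c * v c t)"
        using D(3) by (intro sum.cong) (auto simp: b_def)
      then have "(\<Sum>c\<in>C. b c * v c t)
        = - (\<Sum>c\<in>D. a c * v c s) * v c0 t + (\<Sum>c\<in>D. v c0 s * a c * v c t)"
        unfolding D(1) using D(2,3) by (simp add: b_def)
      then show ?thesis unfolding w_def by (simp add: sum_distrib_left sum_subtractf algebra_simps)
    qed
    moreover have "\<exists>c\<in>C. b c \<noteq> 0" using a(1) c0(2) D(1,3) unfolding b_def by auto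
    moreover have "w c s = 0" for c unfolding w_def by (simp add: mult.commute)
    ultimately show ?thesis using a(2) by (intro exI[of _ b]) simp
  qed
qed

lemma count_sum_mset_image:
  assumes "finite C" shows "set_mset K \<subseteq> C \<Longrightarrow> count (\<Sum>c\<in>#K. f c) s
    = (\<Sum>c\<in>C. count K c * count (f c) s)"
proof (induction K)
  case (add x K)
  have "(\<Sum>c\<in>C. count (add_mset x K) c * count (f c) s) =
      (\<Sum>c\<in>C. (if c = x then count (f x) s else 0) + count K c * count (f c) s)"
    by (intro sum.cong) auto
  also have "\<dots> = count (f x) s + (\<Sum>c\<in>C. count K c * count (f c) s)"
    using add.prems assms by (simp add: sum.distrib)
  finally show ?case using add by simp
qed simp

lemma ex_multisets_of_integer_weights:
  assumes C: "finite C"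
  obtains M N where "set_mset M \<subseteq> C" "set_mset N \<subseteq> C" "set_mset M \<inter> set_mset N = {}"
    "\<And>c. c \<in> C \<Longrightarrow> int (count M c) - int (count N c) = a c"
proof -
  define M N where "M = (\<Sum>c\<in>C. replicate_mset (nat (a c)) c)"
    and "N = (\<Sum>c\<in>C. replicate_mset (nat (- a c)) c)"
  have count: "count M c = (if c \<in> C then nat (a c) else 0)"
    "count N c = (if c \<in> C then nat (- a c) else 0)" for c
    unfolding M_def N_def count_sum using C by auto
  have "set_mset M \<subseteq> C" "set_mset N \<subseteq> C" "set_mset M \<inter> set_mset N = {}"
    by (auto simp: set_mset_def count split: if_splits)
  then show thesis using that[of M N] by (simp add: count)
qed

lemma ex_multiset_relation:
  fixes A B :: "'c \<Rightarrow> 's multiset"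
  assumes S: "finite S" and C: "finite C" "card S < card C"
    and AB: "\<And>c. c \<in> C \<Longrightarrow> set_mset (A c) \<subseteq> S \<and> set_mset (B c) \<subseteq> S"
  obtains M N where "set_mset M \<subseteq> C" "set_mset N \<subseteq> C" "set_mset M \<inter> set_mset N = {}"
    "M \<noteq> {#} \<or> N \<noteq> {#}"
    "(\<Sum>c\<in>#M. A c) + (\<Sum>c\<in>#N. B c) = (\<Sum>c\<in>#N. A c) + (\<Sum>c\<in>#M. B c)"
proof -
  obtain a where a: "\<exists>c\<in>C. a c \<noteq> 0"
    "\<forall>s\<in>S. (\<Sum>c\<in>C. a c * (int (count (A c) s) - int (count (B c) s))) = 0"
    using integer_relation[OF S C, of "\<lambda>c s. int (count (A c) s) - int (count (B c) s)"] by blast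
  obtain M N where MN: "set_mset M \<subseteq> C" "set_mset N \<subseteq> C" "set_mset M \<inter> set_mset N = {}"
    and diff: "\<And>c. c \<in> C \<Longrightarrow> int (count M c) - int (count N c) = a c"
    using ex_multisets_of_integer_weights[OF C(1)] by metis
  note counts = count_sum_mset_image[OF C(1) MN(1)] count_sum_mset_image[OF C(1) MN(2)]
  have "count ((\<Sum>c\<in>#M. A c) + (\<Sum>c\<in>#N. B c)) s = count ((\<Sum>c\<in>#N. A c) + (\<Sum>c\<in>#M. B c)) s" for s
  proof (cases "s \<in> S")
    case True
    have "int (count ((\<Sum>c\<in>#M. A c) + (\<Sum>c\<in>#N. B c)) s) - int (count ((\<Sum>c\<in>#N. A c) + (\<Sum>c\<in>#M. B c)) s)
        = (\<Sum>c\<in>C. (int (count M c) - int (count N c)) * (int (count (A c) s) - int (count (B c) s)))"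
      by (simp add: counts sum.distrib[symmetric] sum_subtractf[symmetric] algebra_simps)
    also have "\<dots> = 0" using a(2) True by (simp add: diff)
    finally show ?thesis by simp
  next
    case False
    then have "count (A c) s = 0" "count (B c) s = 0" if "c \<in> C" for c
      using AB[OF that] by (meson count_inI subset_iff)+
    then show ?thesis by (simp add: counts)
  qed
  then have "(\<Sum>c\<in>#M. A c) + (\<Sum>c\<in>#N. B c) = (\<Sum>c\<in>#N. A c) + (\<Sum>c\<in>#M. B c)" by (rule multiset_eqI)
  moreover have "M \<noteq> {#} \<or> N \<noteq> {#}" using a(1) diff by fastforce
  ultimately show thesis using that MN by blast
qed

subsection \<open>The dimension of the faces\<close>

context finite_dim_algebra
begin

lemma ex_vertex_g_vector:
  assumes "indec_class c" "two_term_class c"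
  shows "\<exists>T A B. ks.summands T = {#c#} \<and> g_vector T A B \<and>
    set_mset A \<subseteq> set_mset (ks.summands alg_cplx) \<and> set_mset B \<subseteq> set_mset (ks.summands alg_cplx)"
proof -
  obtain Y where Y: "ks.indec Y" "c = ks.iso_cls Y"
    using assms(1) unfolding indec_class_def by blast
  obtain T where T: "ks.iso T Y" "two_term T"
    using assms(2) unfolding two_term_class_def Y(2) ks.iso_cls_def by blast
  have "ks.summands T = {#c#}"
    using ks.summands_iso[OF T(1)] ks.summands_indec[OF Y(1)] Y(2) by simp
  then show ?thesis using ex_g_vector[OF T(2)] by blast
qed

theorem card_compatible_le:
  assumes compatible: "compatible C" and C: "finite C"
  shows "card C \<le> num_summands (alg_cplx :: 'a cplx)"
proof (rule ccontr)
  let ?S = "set_mset (ks.summands alg_cplx)"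
  assume "\<not> card C \<le> num_summands (alg_cplx :: 'a cplx)"
  then have less: "card ?S < card C" using num_summands_eq_card[OF total_alg_cplx(1)] by simp
  define R where "R c T A B \<longleftrightarrow> ks.summands T = {#c#} \<and> g_vector T A B \<and> set_mset A \<subseteq> ?S
    \<and> set_mset B \<subseteq> ?S"
    for c T A B
  have "\<forall>c\<in>C. \<exists>T A B. R c T A B"
    unfolding R_def using compatible ex_vertex_g_vector unfolding compatible_def by blast
  then obtain T A B where "\<And>c. c \<in> C \<Longrightarrow> R c (T c) (A c) (B c)" by metis
  then have TAB: "\<And>c. c \<in> C \<Longrightarrow> ks.summands (T c) = {#c#} \<and> g_vector (T c) (A c) (B c)"
    and S: "\<And>c. c \<in> C \<Longrightarrow> set_mset (A c) \<subseteq> ?S \<and> set_mset (B c) \<subseteq> ?S"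
    unfolding R_def by blast+
  obtain M N where MN: "set_mset M \<subseteq> C" "set_mset N \<subseteq> C" "set_mset M \<inter> set_mset N = {}"
    "M \<noteq> {#} \<or> N \<noteq> {#}"
    and eq: "(\<Sum>c\<in>#M. A c) + (\<Sum>c\<in>#N. B c) = (\<Sum>c\<in>#N. A c) + (\<Sum>c\<in>#M. B c)"
    using ex_multiset_relation[OF finite_set_mset C less S] .
  obtain X where X: "ks.summands X = M" "g_vector X (\<Sum>c\<in>#M. A c) (\<Sum>c\<in>#M. B c)"
    using g_vector_multiset[OF TAB MN(1)] by blast
  obtain Y where Y: "ks.summands Y = N" "g_vector Y (\<Sum>c\<in>#N. A c) (\<Sum>c\<in>#N. B c)"
    using g_vector_multiset[OF TAB MN(2)] by blast
  note ob = g_vectorD(1)[OF X(2)] g_vectorD(1)[OF Y(2)]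
  have "ext_orthogonal (total X) (total X)" "ext_orthogonal (total Y) (total Y)"
    unfolding ext_orthogonal_iff_summands[OF ob(1,1)] ext_orthogonal_iff_summands[OF ob(2,2)] X(1)
      Y(1)
    using compatible MN unfolding compatible_def by blast+
  from equal_g_vectors_disjoint[OF X(2) Y(2) eq this] show False using MN(3,4) X(1) Y(1) by auto
qed

end

section \<open>Counting\<close>

lemma card_image_cong:
  assumes "\<And>x y. x \<in> S \<Longrightarrow> y \<in> S \<Longrightarrow> f x = f y \<longleftrightarrow> g x = g y"
  shows "card (f ` S) = card (g ` S)"
proof -
  define h where "h c = g (SOME x. x \<in> S \<and> f x = c)" for c
  have h: "h (f x) = g x" if "x \<in> S" for x
  proof -
    have "\<exists>y. y \<in> S \<and> f y = f x" using that by blast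
    from someI_ex[OF this] show ?thesis unfolding h_def using assms that by blast
  qed
  have "inj_on h (f ` S)" using assms h by (auto intro!: inj_onI)
  moreover have "h ` f ` S = g ` S" using h by (auto simp: image_image)
  ultimately show ?thesis using card_image by metis
qed

subsection \<open>Multisets with prescribed support\<close>

lemma multisets_of_support_Suc:
  assumes s: "s \<in> S"
  shows "{M. set_mset M = S \<and> size M \<le> Suc l} =
    add_mset s ` ({M. set_mset M = S \<and> size M \<le> l} \<union> {M. set_mset M = S - {s} \<and> size M \<le> l})"
    (is "?L = add_mset s ` ?K")
proof (intro equalityI subsetI)
  fix M assume M: "M \<in> ?L"
  then have "s \<in># M" using s by simp
  then obtain K where K: "M = add_mset s K" by (rule mset_add)
  then have "insert s (set_mset K) = S" "size K \<le> l" using M by simp_all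
  then have "K \<in> ?K" by blast
  then show "M \<in> add_mset s ` ?K" using K by simp
next
  fix M assume "M \<in> add_mset s ` ?K"
  then obtain K where K: "M = add_mset s K" "set_mset K = S \<or> set_mset K = S - {s}" "size K \<le> l"
    by blast
  then have "insert s (set_mset K) = S" using s by blast
  then show "M \<in> ?L" using K(1,3) by simp
qed

lemma multisets_of_support:
  "finite S \<Longrightarrow> finite {M. set_mset M = S \<and> size M \<le> l} \<and>
    card {M. set_mset M = S \<and> size M \<le> l} = l choose card S"
proof (induction l arbitrary: S)
  case 0
  have "{M. set_mset M = S \<and> size M \<le> 0} = (if S = {} then {{#}} else {})" by auto
  then show ?case using 0 by (auto simp: card_gt_0_iff)
next
  case (Suc l)
  show ?case
  proof (cases "S = {}")
    case True
    then have "{M. set_mset M = S \<and> size M \<le> Suc l} = {{#}}" by auto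
    then show ?thesis using True by simp
  next
    case False
    then obtain s where s: "s \<in> S" by blast
    let ?U = "{M. set_mset M = S \<and> size M \<le> l}" and ?V = "{M. set_mset M = S - {s} \<and> size M \<le> l}"
    have "finite ?U" "card ?U = l choose card S" "finite ?V" "card ?V = l choose card (S - {s})"
      using Suc.IH[OF Suc.prems] Suc.IH[of "S - {s}"] Suc.prems by blast+
    moreover have "?U \<inter> ?V = {}" using s by blast
    ultimately have "finite (?U \<union> ?V)"
      "card (?U \<union> ?V) = (l choose card S) + (l choose card (S - {s}))"
      by (simp_all only: finite_Un card_Un_disjoint)
    moreover have "card (add_mset s ` (?U \<union> ?V)) = card (?U \<union> ?V)"
      by (intro card_image inj_onI) simp
    moreover have "card S = Suc (card (S - {s}))" by (rule card.remove[OF Suc.prems s])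
    ultimately show ?thesis unfolding multisets_of_support_Suc[OF s] by simp
  qed
qed

subsection \<open>From the f-vector to the h-vector\<close>

lemma alternating_binomial_Suc:
  fixes g :: "nat \<Rightarrow> int"
  shows "(\<Sum>k\<le>Suc m. (-1) ^ k * int (Suc m choose k) * g k) =
    (\<Sum>k\<le>m. (-1) ^ k * int (m choose k) * (g k - g (Suc k)))"
proof -
  have "(\<Sum>k\<le>m. (-1) ^ k * int (m choose k) * g k) = (\<Sum>k\<le>Suc m. (-1) ^ k * int (m choose k) * g k)"
    by simp
  also have "\<dots> = g 0 + (\<Sum>k\<le>m. (-1) ^ Suc k * int (m choose Suc k) * g (Suc k))"
    by (subst sum.atMost_Suc_shift) simp
  finally have shift: "(\<Sum>k\<le>m. (-1) ^ k * int (m choose k) * g k) =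
    g 0 + (\<Sum>k\<le>m. (-1) ^ Suc k * int (m choose Suc k) * g (Suc k))" .
  have "(\<Sum>k\<le>Suc m. (-1) ^ k * int (Suc m choose k) * g k) =
    g 0 + (\<Sum>k\<le>m. (-1) ^ Suc k * int (Suc m choose Suc k) * g (Suc k))"
    by (subst sum.atMost_Suc_shift) simp
  also have "(\<Sum>k\<le>m. (-1) ^ Suc k * int (Suc m choose Suc k) * g (Suc k)) =
    (\<Sum>k\<le>m. (-1) ^ Suc k * int (m choose Suc k) * g (Suc k)
      - (-1) ^ k * int (m choose k) * g (Suc k))"
    by (intro sum.cong) (auto simp: algebra_simps)
  also have "g 0 + \<dots> = (\<Sum>k\<le>m. (-1) ^ k * int (m choose k) * g k)
    - (\<Sum>k\<le>m. (-1) ^ k * int (m choose k) * g (Suc k))"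
    unfolding shift sum_subtractf by simp
  also have "\<dots> = (\<Sum>k\<le>m. (-1) ^ k * int (m choose k) * (g k - g (Suc k)))"
    by (simp add: sum_subtractf[symmetric] right_diff_distrib)
  finally show ?thesis .
qed

lemma alternating_binomial_sum:
  "(\<Sum>k\<le>m. (-1) ^ k * int (m choose k) * int ((N + m - k) choose (r + m))) = int (N choose r)"
proof (induction m)
  case (Suc m)
  have "(\<Sum>k\<le>Suc m. (-1) ^ k * int (Suc m choose k) * int ((N + Suc m - k) choose (r + Suc m))) =
    (\<Sum>k\<le>m. (-1) ^ k * int (m choose k) *
      (int ((N + Suc m - k) choose (r + Suc m)) - int ((N + Suc m - Suc k) choose (r + Suc m))))"
    by (rule alternating_binomial_Suc)
  also have "\<dots> = (\<Sum>k\<le>m. (-1) ^ k * int (m choose k) * int ((N + m - k) choose (r + m)))"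
    by (intro sum.cong) (auto simp: Suc_diff_le)
  finally show ?case using Suc by simp
qed simp

lemma h_vector_transform:
  fixes f :: "nat \<Rightarrow> int"
  shows "(\<Sum>j = 0..n. int ((n + l - j) choose n) *
      (\<Sum>i = 0..j. (-1) ^ (j - i) * int ((n - i) choose (j - i)) * f i))
        = (\<Sum>i = 0..n. int (l choose i) * f i)"
proof -
  let ?t = "\<lambda>j i. int ((n + l - j) choose n)
    * ((-1) ^ (j - i) * int ((n - i) choose (j - i)) * f i)"
  have "(\<Sum>j = 0..n. int ((n + l - j) choose n)
    * (\<Sum>i = 0..j. (-1) ^ (j - i) * int ((n - i) choose (j - i)) * f i)) =
      (\<Sum>j = 0..n. \<Sum>i | i \<in> {0..n} \<and> i \<le> j. ?t j i)"
    unfolding sum_distrib_left by (intro sum.cong) auto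
  also have "\<dots> = (\<Sum>i = 0..n. \<Sum>j | j \<in> {0..n} \<and> i \<le> j. ?t j i)" by (rule sum.swap_restrict) simp_all
  also have "\<dots> = (\<Sum>i = 0..n. int (l choose i) * f i)"
  proof (intro sum.cong refl)
    fix i assume "i \<in> {0..n}"
    then obtain m where m: "n = i + m" using le_Suc_ex by auto
    have "{j. j \<in> {0..n} \<and> i \<le> j} = {0 + i..m + i}" using m by auto
    then have "(\<Sum>j | j \<in> {0..n} \<and> i \<le> j. ?t j i) = (\<Sum>k = 0..m. ?t (k + i) i)"
      by (simp only: sum.shift_bounds_cl_nat_ivl)
    also have "\<dots> = (\<Sum>k\<le>m. (-1) ^ k * int (m choose k) * int ((l + m - k) choose (i + m))) * f i"
      unfolding sum_distrib_right atMost_atLeast0 by (intro sum.cong) (auto simp: m algebra_simps)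
    also have "\<dots> = int (l choose i) * f i" by (simp only: alternating_binomial_sum)
    finally show "(\<Sum>j | j \<in> {0..n} \<and> i \<le> j. ?t j i) = int (l choose i) * f i" .
  qed
  finally show ?thesis .
qed

subsection \<open>Presilting complexes as multisets\<close>

context finite_dim_algebra
begin

lemma card_iso_classes:
  assumes "\<And>X. X \<in> S \<Longrightarrow> is_complex X" shows "card (iso_class ` S) = card (ks.summands ` S)"
  by (rule card_image_cong)
    (use assms in \<open>simp add: iso_class_eq_iso_cls ks.iso_cls_eq_iff ks.iso_iff_summands\<close>)

lemma summands_presilting:
  "ks.summands ` {T. two_term T \<and> presilting T \<and> R (ks.summands T)}
    = {M. compatible (set_mset M) \<and> R M}"
proof (intro equalityI subsetI)
  fix M assume "M \<in> ks.summands ` {T. two_term T \<and> presilting T \<and> R (ks.summands T)}"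
  then show "M \<in> {M. compatible (set_mset M) \<and> R M}"
    by (elim imageE) (simp add: compatible_summands)
next
  fix M assume M: "M \<in> {M. compatible (set_mset M) \<and> R M}"
  then obtain T where "two_term T" "presilting T" "ks.summands T = M"
    using ex_presilting_of_compatible[of M] by blast
  then show "M \<in> ks.summands ` {T. two_term T \<and> presilting T \<and> R (ks.summands T)}" using M by blast
qed

lemma psilt_count_eq: "psilt_count TYPE('a) j = card {C. compatible C \<and> finite C \<and> card C = j}"
proof -
  let ?G = "{C. compatible C \<and> finite C \<and> card C = j}"
  let ?R = "\<lambda>M :: 'a cplx set multiset. (\<forall>c. count M c \<le> 1) \<and> card (set_mset M) = j"
  have "{T :: 'a cplx. two_term T \<and> presilting T \<and> basic T \<and> num_summands T = j} =
      {T. two_term T \<and> presilting T \<and> ?R (ks.summands T)}"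
    using two_termD(1) num_summands_eq_card by (auto simp: basic_iff_summands)
  then have "psilt_count TYPE('a) j = card {M. compatible (set_mset M) \<and> ?R M}"
    unfolding psilt_count_def using summands_presilting[of ?R] two_termD(1)
    by (subst card_iso_classes) auto
  also have "{M. compatible (set_mset M) \<and> ?R M} = mset_set ` ?G"
  proof (intro equalityI subsetI)
    fix M assume M: "M \<in> {M. compatible (set_mset M) \<and> ?R M}"
    have "M = mset_set (set_mset M)"
    proof (rule multiset_eqI)
      fix c
      have "count M c \<le> 1" using M by simp
      then show "count M c = count (mset_set (set_mset M)) c"
        using count_greater_zero_iff[of M c] by (cases "count M c") (auto simp: count_mset_set')
    qed
    then show "M \<in> mset_set ` ?G" using M by (intro image_eqI[of _ _ "set_mset M"]) simp_all
  qed (auto simp: count_mset_set')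
  also have "card (mset_set ` ?G) = card ?G"
    by (intro card_image inj_on_inverseI[of _ set_mset]) simp
  finally show ?thesis .
qed

lemma psilt_oplus_le_count_eq:
  "psilt_oplus_le_count TYPE('a) l = card {M. compatible (set_mset M) \<and> size M \<le> l}"
proof -
  have "(\<exists>Ts. length Ts \<le> l \<and> (\<forall>Y\<in>set Ts. indec Y) \<and> T \<simeq>\<^sub>K dsum_list Ts) \<longleftrightarrow> size (ks.summands T) \<le> l"
    if T: "is_complex T" for T
  proof
    assume "\<exists>Ts. length Ts \<le> l \<and> (\<forall>Y\<in>set Ts. indec Y) \<and> T \<simeq>\<^sub>K dsum_list Ts"
    then obtain Ts where Ts: "length Ts \<le> l" "\<forall>Y\<in>set Ts. ks.indec Y" "ks.iso T (ks.osum_list Ts)"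
      unfolding indec_iff_ks_indec htpy_equiv_iff_iso dsum_list_eq_osum_list by blast
    then show "size (ks.summands T) \<le> l" using ks.summands_eqI[OF Ts(2,3)] by simp
  next
    assume size: "size (ks.summands T) \<le> l"
    obtain Ts where Ts: "\<forall>Y\<in>set Ts. ks.indec Y" "ks.iso T (ks.osum_list Ts)"
      "ks.summands T = mset (map ks.iso_cls Ts)"
      using ks.summands_decompose[OF T] .
    then have "length Ts \<le> l" using size by simp
    then show "\<exists>Ts. length Ts \<le> l \<and> (\<forall>Y\<in>set Ts. indec Y) \<and> T \<simeq>\<^sub>K dsum_list Ts"
      unfolding indec_iff_ks_indec htpy_equiv_iff_iso dsum_list_eq_osum_list using Ts(1,2) by blast
  qed
  then have "{T :: 'a cplx. two_term T \<and> presilting T \<and>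
      (\<exists>Ts. length Ts \<le> l \<and> (\<forall>Y\<in>set Ts. indec Y) \<and> T \<simeq>\<^sub>K dsum_list Ts)} =
      {T. two_term T \<and> presilting T \<and> size (ks.summands T) \<le> l}"
    using two_termD(1) by blast
  then show ?thesis
    unfolding psilt_oplus_le_count_def using summands_presilting[of "\<lambda>M. size M \<le> l"] two_termD(1)
    by (subst card_iso_classes) auto
qed

lemma fvec_eq_psilt_count: "fvec TYPE('a) i = int (psilt_count TYPE('a) i)"
proof -
  have "{C. compatible C \<and> finite C \<and> card C = 0} = {{}}"
    unfolding compatible_def by (auto simp: card_eq_0_iff)
  then show ?thesis unfolding fvec_def using psilt_count_eq[of 0] by simp
qed

theorem psilt_oplus_le_count_binomial:
  assumes "g_finite TYPE('a)"
  shows "int (psilt_oplus_le_count TYPE('a) l) =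
    (\<Sum>i = 0..num_summands (alg_cplx :: 'a cplx). int (l choose i) * fvec TYPE('a) i)"
proof -
  let ?n = "num_summands (alg_cplx :: 'a cplx)"
  let ?G = "{C. compatible C \<and> finite C}"
    and ?F = "\<lambda>C :: 'a cplx set set. {M. set_mset M = C \<and> size M \<le> l}"
  have "C \<subseteq> vertices" if "compatible C" for C
    unfolding vertices_def using compatible_subset[OF that] by blast
  then have faces: "finite ?G"
    using finite_subset[of ?G "Pow vertices"] finite_vertices[OF assms] by blast
  have "{M. compatible (set_mset M) \<and> size M \<le> l} = (\<Union>C\<in>?G. ?F C)" by auto
  then have "psilt_oplus_le_count TYPE('a) l = (\<Sum>C\<in>?G. card (?F C))"
    unfolding psilt_oplus_le_count_eq
    by (simp add: faces card_UN_disjoint multisets_of_support disjoint_iff)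
  also have "\<dots> = (\<Sum>C\<in>?G. l choose card C)" by (intro sum.cong) (auto simp: multisets_of_support)
  also have "\<dots> = (\<Sum>i = 0..?n. \<Sum>C\<in>{C \<in> ?G. card C = i}. l choose card C)"
    using card_compatible_le by (intro sum.group[symmetric] faces) auto
  also have "\<dots> = (\<Sum>i = 0..?n. (l choose i) * psilt_count TYPE('a) i)"
    unfolding psilt_count_eq by (intro sum.cong) (auto simp: conj_assoc)
  finally show ?thesis unfolding fvec_eq_psilt_count by simp
qed

end

theorem theorem5p5:
  fixes scale :: "'k::field \<Rightarrow> 'a::ring_1 \<Rightarrow> 'a"
  assumes "fd_algebra scale"
    and "g_finite TYPE('a)"
  shows "\<forall>l::nat. int (psilt_oplus_le_count TYPE('a) l) =
           (\<Sum>j = 0..num_summands (alg_cplx :: 'a cplx).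
              int ((num_summands (alg_cplx :: 'a cplx) + l - j) choose
                   (num_summands (alg_cplx :: 'a cplx)))
              * hvec TYPE('a) (num_summands (alg_cplx :: 'a cplx)) j)"
proof -
  interpret finite_dim_algebra scale by unfold_locales (rule assms(1))
  show ?thesis
    unfolding hvec_def h_vector_transform using psilt_oplus_le_count_binomial[OF assms(2)] by blast
qed

end
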